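(* Let $f:\Omega\times\mathbb{R}\to\mathbb{R}$ satisfy hypothesis $(\mathbf{H}_0)$ stated in the context, and let $(\underline{u},\overline{u})$ be a sub-supersolution pair of the problem $$(-\Delta_g)^s u=f(x,u)\ \text{ in }\Omega,\qquad u=0\ \text{ in }\Omega^c .$$ Then there exists $u\in S(\underline{u},\overline{u})$, i.e. there exists a weak solution $u\in W^{s,G}_0(\Omega)$ of the problem with $\underline{u}\le u\le\overline{u}$ a.e.
   Context: Let $n\ge1$, $s\in(0,1)$, $\Omega\subset\mathbb{R}^n$ a smooth bounded domain, $\Omega^c=\mathbb{R}^n\setminus\Omega$. N-functions: $G:[0,\infty)\to[0,\infty)$ is an N-function if $G(t)=\int_0^t g(\tau)\,d\tau$ with $g$ right-continuous on $[0,\infty)$, positive on $(0,\infty)$, non-decreasing, $g(0)=0$, $\lim_{t\to\infty}g(t)=\infty$. $G$ is extended to $\mathbb{R}$ as an even function and $g=G'$ as an odd function (same convention for every N-function). Standing assumptions on $G$: there are constants $1<p^-\le p^+<\infty$ with $p^-\le \frac{t g(t)}{G(t)}\le p^+$ for all $t>0$; $g$ is differentiable and $g'$ is non-decreasing on $(0,\infty)$; $\int_M^\infty (t/G(t))^{s/(n-s)}dt=\infty$ for some $M>0$ and $\int_0^\delta (t/G(t))^{s/(n-s)}dt<\infty$ for some $\delta>0$. The Orlicz-Sobolev conjugate is $G_{n/s}=G\circ H^{-1}$ with $H(t)=\big(\int_0^t(\tau/G(\tau))^{s/(n-s)}d\tau\big)^{(n-s)/n}$. For N-functions $A,B$, write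 $A\ll B$ if $\lim_{t\to\infty}A(ct)/B(t)=0$ for every $c>0$. Spaces: $d\mu=\frac{dx\,dy}{|x-y|^n}$; $\rho_G(u)=\int_{\mathbb{R}^n}G(|u|)\,dx$, $\rho_{s,G}(u)=\iint_{\mathbb{R}^{2n}}G\big(\frac{|u(x)-u(y)|}{|x-y|^s}\big)d\mu$; $W^{s,G}(\mathbb{R}^n)$ is the set of measurable $u$ with $\rho_G(u)<\infty$, $\rho_{s,G}(u)<\infty$, with norm $\|u\|_{s,G}=\inf\{\lambda>0:\rho_G(u/\lambda)\le1\}+\inf\{\lambda>0:\rho_{s,G}(u/\lambda)\le1\}$. $W^{s,G}_0(\Omega)=\{u\in W^{s,G}(\mathbb{R}^n):u=0\text{ in }\Omega^c\}$. $E$ is the closure of $C_c^\infty(\Omega)$ in $W^{s,G}(\mathbb{R}^n)$, and $E_+=\{v\in E: v\ge0\}$. All (in)equalities between functions are a.e. Operator: for $u,v\in W^{s,G}(\mathbb{R}^n)$, $\langle(-\Delta_g)^su,v\rangle=\iint_{\mathbb{R}^{2n}}g\big(\frac{u(x)-u(y)}{|x-y|^s}\big)\frac{v(x)-v(y)}{|x-y|^s}\,d\mu$. $(\mathbf{H}_0)$: $f$ is a Carathéodory function and $|f(x,t)|\le c_0(1+|b(t)|)$ for a.e. $x\in\Omega$ and all $t\in\mathbb{R}$, where $c_0>0$ and $b=B'$ with $B$ an N-function such that $p_B^-\le \frac{t b(t)}{B(t)}\le p_B^+$ for all $t>0$ for some constants $1<p_B^-\le p_B^+<\infty$, and $G\ll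 B\ll G_{n/s}$. Solutions: $u\in W^{s,G}(\mathbb{R}^n)$ is a supersolution of the problem if $\langle(-\Delta_g)^su,v\rangle\ge\int_\Omega f(x,u)v\,dx$ for all $v\in E_+$ and $u\ge0$ in $\Omega^c$; it is a subsolution if $\langle(-\Delta_g)^su,v\rangle\le\int_\Omega f(x,u)v\,dx$ for all $v\in E_+$ and $u\le0$ in $\Omega^c$. $(\underline{u},\overline{u})\in W^{s,G}(\mathbb{R}^n)^2$ is a sub-supersolution pair if $\underline{u}$ is a subsolution, $\overline{u}$ is a supersolution and $\underline{u}\le\overline{u}$ in $\Omega$. $u\in W_0^{s,G}(\Omega)$ is a (weak) solution if $\langle(-\Delta_g)^su,v\rangle=\int_\Omega f(x,u)v\,dx$ for all $v\in E$. $S(\underline{u},\overline{u})=\{u\in W_0^{s,G}(\Omega): u\text{ is a solution},\ \underline{u}\le u\le\overline{u}\}$. *)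

theory Defs
  imports "HOL-Analysis.Analysis"
begin

primrec Ck_on :: "nat \<Rightarrow> 'a::euclidean_space set \<Rightarrow> ('a \<Rightarrow> real) \<Rightarrow> bool" where
  "Ck_on 0 S f \<longleftrightarrow> continuous_on S f"
| "Ck_on (Suc k) S f \<longleftrightarrow> (\<forall>x\<in>S. f differentiable (at x)) \<and>
     (\<forall>v. Ck_on k S (\<lambda>x. frechet_derivative f (at x) v))"

text \<open>Only used for open sets \<open>S\<close>.\<close>

definition smooth_on :: "'a::euclidean_space set \<Rightarrow> ('a \<Rightarrow> real) \<Rightarrow> bool" where
  "smooth_on S f \<longleftrightarrow> (\<forall>k. Ck_on k S f)"

text \<open>The boundary is smooth if the domain is, near each of its boundary points, the strict
  sublevel set of a smooth function without critical points. In particular the domain lies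
  locally on one side of its boundary, which is a smooth hypersurface.\<close>

definition smooth_boundary :: "'a::euclidean_space set \<Rightarrow> bool" where
  "smooth_boundary \<Omega> \<longleftrightarrow>
     (\<forall>x0 \<in> frontier \<Omega>. \<exists>U \<phi>. open U \<and> x0 \<in> U \<and> smooth_on U \<phi> \<and>
        (\<forall>x\<in>U. \<exists>v. frechet_derivative \<phi> (at x) v \<noteq> 0) \<and>
        \<Omega> \<inter> U = {x \<in> U. \<phi> x < 0})"

definition smooth_bounded_domain :: "'a::euclidean_space set \<Rightarrow> bool" where
  "smooth_bounded_domain \<Omega> \<longleftrightarrow>
     \<Omega> \<noteq> {} \<and> open \<Omega> \<and> connected \<Omega> \<and> bounded \<Omega> \<and> smooth_boundary \<Omega>"

definition test_functions :: "'a::euclidean_space set \<Rightarrow> ('a \<Rightarrow> real) set" where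
  "test_functions \<Omega> = {\<phi>. smooth_on UNIV \<phi> \<and>
     compact (closure {x. \<phi> x \<noteq> 0}) \<and> closure {x. \<phi> x \<noteq> 0} \<subseteq> \<Omega>}"

text \<open>An N-function \<open>A\<close> comes with its right-continuous density \<open>a\<close>. Both are functions on the
  whole line: \<open>A\<close> is extended evenly and \<open>a\<close> oddly.\<close>

definition N_function :: "(real \<Rightarrow> real) \<Rightarrow> (real \<Rightarrow> real) \<Rightarrow> bool" where
  "N_function A a \<longleftrightarrow>
     (\<forall>t\<ge>0. continuous (at_right t) a) \<and>
     (\<forall>t>0. a t > 0) \<and> mono_on {0..} a \<and> a 0 = 0 \<and> filterlim a at_top at_top \<and>
     (\<forall>t\<ge>0. A t = (LINT \<tau>:{0..t}|lborel. a \<tau>)) \<and>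
     (\<forall>t. A (- t) = A t) \<and> (\<forall>t. a (- t) = - a t)"

definition growth_condition :: "(real \<Rightarrow> real) \<Rightarrow> (real \<Rightarrow> real) \<Rightarrow> bool" where
  "growth_condition A a \<longleftrightarrow>
     (\<exists>pm pp. 1 < pm \<and> pm \<le> pp \<and> (\<forall>t>0. pm \<le> t * a t / A t \<and> t * a t / A t \<le> pp))"

definition ess_smaller :: "(real \<Rightarrow> real) \<Rightarrow> (real \<Rightarrow> real) \<Rightarrow> bool" where
  "ess_smaller A B \<longleftrightarrow> (\<forall>c>0. ((\<lambda>t. A (c * t) / B t) \<longlongrightarrow> 0) at_top)"

text \<open>In the next three definitions \<open>n\<close> is the dimension of the underlying space, as a real.\<close>

definition standing_assumptions ::
    "real \<Rightarrow> real \<Rightarrow> (real \<Rightarrow> real) \<Rightarrow> (real \<Rightarrow> real) \<Rightarrow> bool" where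
  "standing_assumptions n s G g \<longleftrightarrow>
     N_function G g \<and> growth_condition G g \<and>
     (\<forall>t>0. g differentiable (at t)) \<and> mono_on {0<..} (deriv g) \<and>
     (\<exists>M>0. (\<integral>\<^sup>+ t\<in>{M..}. ennreal ((t / G t) powr (s / (n - s))) \<partial>lborel) = \<infinity>) \<and>
     (\<exists>\<delta>>0. (\<integral>\<^sup>+ t\<in>{0..\<delta>}. ennreal ((t / G t) powr (s / (n - s))) \<partial>lborel) < \<infinity>)"

definition conj_H :: "real \<Rightarrow> real \<Rightarrow> (real \<Rightarrow> real) \<Rightarrow> real \<Rightarrow> real" where
  "conj_H n s G t =
     (LINT \<tau>:{0..t}|lborel. (\<tau> / G \<tau>) powr (s / (n - s))) powr ((n - s) / n)"

text \<open>Under the standing assumptions \<open>conj_H n s G\<close> is a bijection of \<open>{0..}\<close> onto itself.\<close>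

definition sobolev_conjugate :: "real \<Rightarrow> real \<Rightarrow> (real \<Rightarrow> real) \<Rightarrow> real \<Rightarrow> real" where
  "sobolev_conjugate n s G t = G (the_inv_into {0..} (conj_H n s G) \<bar>t\<bar>)"

text \<open>The diagonal is a null set for \<open>dx dy\<close>, so the convention \<open>1 / 0 = 0\<close> used there, and in the
  difference quotients below, is immaterial.\<close>

definition mu :: "('a::euclidean_space \<times> 'a) measure" where
  "mu = density (lebesgue \<Otimes>\<^sub>M lebesgue) (\<lambda>(x, y). ennreal (1 / norm (x - y) ^ DIM('a)))"

definition diff_quot :: "real \<Rightarrow> ('a::euclidean_space \<Rightarrow> real) \<Rightarrow> 'a \<Rightarrow> 'a \<Rightarrow> real" where
  "diff_quot s u x y = (u x - u y) / norm (x - y) powr s"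

definition rho :: "(real \<Rightarrow> real) \<Rightarrow> ('a::euclidean_space \<Rightarrow> real) \<Rightarrow> ennreal" where
  "rho G u = (\<integral>\<^sup>+ x. ennreal (G \<bar>u x\<bar>) \<partial>lebesgue)"

definition rho_s :: "real \<Rightarrow> (real \<Rightarrow> real) \<Rightarrow> ('a::euclidean_space \<Rightarrow> real) \<Rightarrow> ennreal" where
  "rho_s s G u = (\<integral>\<^sup>+ (x, y). ennreal (G \<bar>diff_quot s u x y\<bar>) \<partial>mu)"

definition W :: "real \<Rightarrow> (real \<Rightarrow> real) \<Rightarrow> ('a::euclidean_space \<Rightarrow> real) set" where
  "W s G = {u. u \<in> borel_measurable lebesgue \<and> rho G u < \<infinity> \<and> rho_s s G u < \<infinity>}"

definition W_norm :: "real \<Rightarrow> (real \<Rightarrow> real) \<Rightarrow> ('a::euclidean_space \<Rightarrow> real) \<Rightarrow> real" where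
  "W_norm s G u = Inf {r. 0 < r \<and> rho G (\<lambda>x. u x / r) \<le> 1} +
                  Inf {r. 0 < r \<and> rho_s s G (\<lambda>x. u x / r) \<le> 1}"

definition W0 :: "real \<Rightarrow> (real \<Rightarrow> real) \<Rightarrow> 'a::euclidean_space set \<Rightarrow> ('a \<Rightarrow> real) set" where
  "W0 s G \<Omega> = {u \<in> W s G. AE x in lebesgue. x \<notin> \<Omega> \<longrightarrow> u x = 0}"

definition E :: "real \<Rightarrow> (real \<Rightarrow> real) \<Rightarrow> 'a::euclidean_space set \<Rightarrow> ('a \<Rightarrow> real) set" where
  "E s G \<Omega> = {u \<in> W s G. \<forall>\<epsilon>>0. \<exists>\<phi> \<in> test_functions \<Omega>. W_norm s G (\<lambda>x. u x - \<phi> x) < \<epsilon>}"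

definition E_plus :: "real \<Rightarrow> (real \<Rightarrow> real) \<Rightarrow> 'a::euclidean_space set \<Rightarrow> ('a \<Rightarrow> real) set" where
  "E_plus s G \<Omega> = {v \<in> E s G \<Omega>. AE x in lebesgue. v x \<ge> 0}"

definition frac_g_laplacian ::
    "real \<Rightarrow> (real \<Rightarrow> real) \<Rightarrow> ('a::euclidean_space \<Rightarrow> real) \<Rightarrow> ('a \<Rightarrow> real) \<Rightarrow> real" where
  "frac_g_laplacian s g u v = (\<integral> (x, y). g (diff_quot s u x y) * diff_quot s v x y \<partial>mu)"

definition rhs ::
    "'a::euclidean_space set \<Rightarrow> ('a \<Rightarrow> real \<Rightarrow> real) \<Rightarrow> ('a \<Rightarrow> real) \<Rightarrow> ('a \<Rightarrow> real) \<Rightarrow> real" where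
  "rhs \<Omega> f u v = (LINT x:\<Omega>|lebesgue. f x (u x) * v x)"

definition caratheodory :: "'a::euclidean_space set \<Rightarrow> ('a \<Rightarrow> real \<Rightarrow> real) \<Rightarrow> bool" where
  "caratheodory \<Omega> f \<longleftrightarrow>
     (\<forall>t. (\<lambda>x. f x t) \<in> borel_measurable (lebesgue_on \<Omega>)) \<and>
     (AE x in lebesgue. x \<in> \<Omega> \<longrightarrow> continuous_on UNIV (f x))"

definition H0 ::
    "real \<Rightarrow> (real \<Rightarrow> real) \<Rightarrow> 'a::euclidean_space set \<Rightarrow> ('a \<Rightarrow> real \<Rightarrow> real) \<Rightarrow> bool" where
  "H0 s G \<Omega> f \<longleftrightarrow>
     caratheodory \<Omega> f \<and>
     (\<exists>c0 B b. c0 > 0 \<and> N_function B b \<and> growth_condition B b \<and>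
        ess_smaller G B \<and> ess_smaller B (sobolev_conjugate (real DIM('a)) s G) \<and>
        (AE x in lebesgue. x \<in> \<Omega> \<longrightarrow> (\<forall>t. \<bar>f x t\<bar> \<le> c0 * (1 + \<bar>b t\<bar>))))"

definition supersolution ::
    "real \<Rightarrow> (real \<Rightarrow> real) \<Rightarrow> (real \<Rightarrow> real) \<Rightarrow> 'a::euclidean_space set \<Rightarrow>
     ('a \<Rightarrow> real \<Rightarrow> real) \<Rightarrow> ('a \<Rightarrow> real) \<Rightarrow> bool" where
  "supersolution s G g \<Omega> f u \<longleftrightarrow> u \<in> W s G \<and>
     (\<forall>v \<in> E_plus s G \<Omega>. frac_g_laplacian s g u v \<ge> rhs \<Omega> f u v) \<and>
     (AE x in lebesgue. x \<notin> \<Omega> \<longrightarrow> u x \<ge> 0)"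

definition subsolution ::
    "real \<Rightarrow> (real \<Rightarrow> real) \<Rightarrow> (real \<Rightarrow> real) \<Rightarrow> 'a::euclidean_space set \<Rightarrow>
     ('a \<Rightarrow> real \<Rightarrow> real) \<Rightarrow> ('a \<Rightarrow> real) \<Rightarrow> bool" where
  "subsolution s G g \<Omega> f u \<longleftrightarrow> u \<in> W s G \<and>
     (\<forall>v \<in> E_plus s G \<Omega>. frac_g_laplacian s g u v \<le> rhs \<Omega> f u v) \<and>
     (AE x in lebesgue. x \<notin> \<Omega> \<longrightarrow> u x \<le> 0)"

definition sub_super_pair ::
    "real \<Rightarrow> (real \<Rightarrow> real) \<Rightarrow> (real \<Rightarrow> real) \<Rightarrow> 'a::euclidean_space set \<Rightarrow>
     ('a \<Rightarrow> real \<Rightarrow> real) \<Rightarrow> ('a \<Rightarrow> real) \<Rightarrow> ('a \<Rightarrow> real) \<Rightarrow> bool" where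
  "sub_super_pair s G g \<Omega> f u_lo u_up \<longleftrightarrow>
     subsolution s G g \<Omega> f u_lo \<and> supersolution s G g \<Omega> f u_up \<and>
     (AE x in lebesgue. x \<in> \<Omega> \<longrightarrow> u_lo x \<le> u_up x)"

definition weak_solution ::
    "real \<Rightarrow> (real \<Rightarrow> real) \<Rightarrow> (real \<Rightarrow> real) \<Rightarrow> 'a::euclidean_space set \<Rightarrow>
     ('a \<Rightarrow> real \<Rightarrow> real) \<Rightarrow> ('a \<Rightarrow> real) \<Rightarrow> bool" where
  "weak_solution s G g \<Omega> f u \<longleftrightarrow> u \<in> W0 s G \<Omega> \<and>
     (\<forall>v \<in> E s G \<Omega>. frac_g_laplacian s g u v = rhs \<Omega> f u v)"

definition solution_set ::
    "real \<Rightarrow> (real \<Rightarrow> real) \<Rightarrow> (real \<Rightarrow> real) \<Rightarrow> 'a::euclidean_space set \<Rightarrow>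
     ('a \<Rightarrow> real \<Rightarrow> real) \<Rightarrow> ('a \<Rightarrow> real) \<Rightarrow> ('a \<Rightarrow> real) \<Rightarrow> ('a \<Rightarrow> real) set" where
  "solution_set s G g \<Omega> f u_lo u_up =
     {u. weak_solution s G g \<Omega> f u \<and> (AE x in lebesgue. u_lo x \<le> u x \<and> u x \<le> u_up x)}"

end

(* The energy is the difference of the modular of the difference quotients and of the integral of the
   primitive of f(x, .) truncated between the sub- and the supersolution. It is minimised only over the
   functions that lie between the two; there the lower order term is dominated, so compactness and Fatou
   suffice. Since g is monotone and u_lo, u_up are a sub- and a supersolution, clipping a competitor at
   them does not increase the energy. Hence the minimiser minimises over all of W0, and the
   Euler-Lagrange equation, in which the truncation is inactive, is the weak formulation.

   The growth of f is controlled by the fractional Orlicz-Sobolev embedding, which follows from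
   superadditivity of G over slices of |u| between levels of halving measure and a discrete Hardy
   inequality. The sub- and supersolution inequalities are only given for limits of test functions; they
   pass to nonnegative functions of W0 because shifted mollifications of localised pieces are test
   functions (the boundary is smooth) whose modular stays bounded by Jensen's inequality. *)

theory Submission
  imports Defs
begin

text \<open>The sub- and supersolution are tested only with limits of test functions, whereas
  clipping produces functions such as \<open>max (z - u_up) 0\<close>, which are merely in
  \<open>W0\<close>. The gap is closed without density in norm: the pairing is continuous along
  sequences that converge almost everywhere with bounded modulars (\<open>pairing_tendsto\<close>).
  This rests on \<open>g (c * t) \<le> c * g t\<close> for \<open>0 < c \<le> 1\<close>, which is
  how the monotonicity of the derivative of \<open>g\<close> enters. Conversely, functions in
  \<open>E\<close> vanish outside the domain, so the Euler-Lagrange inequality for \<open>v\<close>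
  and \<open>- v\<close> in \<open>W0\<close> yields the weak formulation.

  Mollification near the boundary would spread the support out of the domain. The kernel is
  therefore centred away from 0, which moves the function inwards while smoothing it.

  The embedding serves one purpose: \<open>B\<close> of a function in \<open>W\<close> is integrable
  over the domain, and therefore the majorant \<open>h\<close> of the truncated nonlinearity is
  integrable against every function in \<open>W\<close>.\<close>

section \<open>N-functions\<close>

locale nfun =
  fixes A a :: "real \<Rightarrow> real"
  assumes N: "N_function A a"
begin

lemma odd: "a (- t) = - a t" and even: "A (- t) = A t" and a0 [simp]: "a 0 = 0"
  using N unfolding N_function_def by auto

lemma even_abs [simp]: "A \<bar>t\<bar> = A t"
  by (cases "t \<ge> 0") (auto simp: even)

lemma a_pos: "t > 0 \<Longrightarrow> a t > 0"
  using N unfolding N_function_def by auto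

lemma a_nonneg: "t \<ge> 0 \<Longrightarrow> a t \<ge> 0"
  using a_pos[of t] by (cases "t = 0") auto

lemma a_mono: "x \<le> y \<Longrightarrow> a x \<le> a y"
proof -
  assume xy: "x \<le> y"
  have m: "mono_on {0..} a" using N unfolding N_function_def by auto
  consider "x \<ge> 0" | "x < 0" "y \<ge> 0" | "x < 0" "y < 0" by linarith
  then show ?thesis
  proof cases
    case 1 then show ?thesis using m xy by (auto simp: mono_on_def)
  next
    case 2 then show ?thesis using a_nonneg[of "-x"] a_nonneg[of y] odd[of x] by auto
  next
    case 3
    then have "a (-y) \<le> a (-x)" using m xy by (auto simp: mono_on_def)
    then show ?thesis by (simp add: odd)
  qed
qed

lemma a_abs: "\<bar>a t\<bar> = a \<bar>t\<bar>"
  using a_nonneg[of t] a_nonneg[of "-t"] odd[of t] by (cases "t \<ge> 0") auto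

lemma a_measurable [measurable]: "a \<in> borel_measurable borel"
  by (rule borel_measurable_mono) (auto simp: mono_def a_mono)

lemma a_integrable: "set_integrable lborel {x..y} a"
proof -
  have "\<bar>a t\<bar> \<le> a (\<bar>x\<bar> + \<bar>y\<bar>)" if "t \<in> {x..y}" for t
    unfolding a_abs using that by (intro a_mono) auto
  then have b: "AE t in lborel. norm (indicator {x..y} t *\<^sub>R a t) \<le> norm (indicator {x..y} t * a (\<bar>x\<bar> + \<bar>y\<bar>))"
    by (intro AE_I2) (auto split: split_indicator intro: order.trans[OF _ abs_ge_self])
  show ?thesis unfolding set_integrable_def
    by (rule Bochner_Integration.integrable_bound[OF _ _ b])
       (auto intro!: integrable_mult_left integrable_real_indicator simp: emeasure_lborel_Icc_eq)
qed

lemma A_diff: assumes "0 \<le> x" "x \<le> y"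
  shows "(y - x) * a x \<le> A y - A x" "A y - A x \<le> (y - x) * a y"
proof -
  have A: "A t = (LINT \<tau>:{0..t}|lborel. a \<tau>)" if "t \<ge> 0" for t
    using that N unfolding N_function_def by auto
  have "{0..y} = {0..x} \<union> {x<..y}" using assms by auto
  then have "A y = A x + (LINT \<tau>:{x<..y}|lborel. a \<tau>)"
    using assms A a_integrable[of 0 x] set_integrable_subset[OF a_integrable[of x y], of "{x<..y}"]
    by (simp add: set_integral_Un greaterThanAtMost_subseteq_atLeastAtMost_iff disjoint_iff)
  moreover have i: "set_integrable lborel {x<..y} a"
    by (rule set_integrable_subset[OF a_integrable[of x y]]) auto
  moreover have c: "set_integrable lborel {x<..y} (\<lambda>_. c::real)" for c
    unfolding set_integrable_def using assms(2) by (auto intro!: integrable_real_indicator)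
  moreover have "(LINT \<tau>:{x<..y}|lborel. c) = (y - x) * c" for c :: real
    using assms unfolding set_lebesgue_integral_def by simp
  ultimately show "(y - x) * a x \<le> A y - A x" "A y - A x \<le> (y - x) * a y"
    using set_integral_mono[OF c[of "a x"] i] set_integral_mono[OF i c[of "a y"]] a_mono[of x] a_mono[of _ y]
    by (simp_all add: greaterThanAtMost_iff)
qed

text \<open>The convexity arguments below rest on this subgradient inequality, so jumps of
  \<open>a\<close> do no harm. For \<open>p < 0 \<le> q\<close>, replacing \<open>p\<close> by
  \<open>- p\<close> keeps \<open>A p\<close> and enlarges the right-hand side; negative
  \<open>q\<close> follows by reflecting both arguments.\<close>

lemma tangent: "A p - A q \<ge> a q * (p - q)"
proof -
  have *: "A p - A q \<ge> a q * (p - q)" if "p \<ge> 0" "q \<ge> 0" for p q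
    using A_diff[of q p] A_diff[of p q] that by (cases "q \<le> p") (auto simp: algebra_simps)
  have **: "A p - A q \<ge> a q * (p - q)" if "q \<ge> 0" for p q
  proof (cases "p \<ge> 0")
    case False
    have "A (-p) - A q \<ge> a q * (- p - q)" using * False that by auto
    moreover have "a q * (- p - q) \<ge> a q * (p - q)"
      using False a_nonneg[OF that] by (intro mult_left_mono) auto
    ultimately show ?thesis by (simp add: even)
  qed (use * that in auto)
  show ?thesis
  proof (cases "q \<ge> 0")
    case False
    then show ?thesis using **[of "-q" "-p"] by (simp add: even odd algebra_simps)
  qed (use ** in auto)
qed

lemma A_zero [simp]: "A 0 = 0"
proof -
  have "A 0 = (LINT \<tau>:{0..0}|lborel. a \<tau>)" using N unfolding N_function_def by blast
  also have "\<dots> = 0" unfolding set_lebesgue_integral_def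
    by (rule integral_eq_zero_AE) (use AE_lborel_singleton[of 0] in \<open>auto split: split_indicator\<close>)
  finally show ?thesis .
qed

lemma A_nonneg [simp]: "A t \<ge> 0"
  using tangent[of 0 t] A_diff[of 0 "\<bar>t\<bar>"] by simp

lemma A_mono: "\<bar>x\<bar> \<le> \<bar>y\<bar> \<Longrightarrow> A x \<le> A y"
proof -
  assume xy: "\<bar>x\<bar> \<le> \<bar>y\<bar>"
  then have "0 \<le> (\<bar>y\<bar> - \<bar>x\<bar>) * a \<bar>x\<bar>" using a_nonneg[of "\<bar>x\<bar>"] by (intro mult_nonneg_nonneg) auto
  also have "\<dots> \<le> A \<bar>y\<bar> - A \<bar>x\<bar>" using xy by (intro A_diff) auto
  finally show ?thesis by simp
qed

lemma A_pos: "t \<noteq> 0 \<Longrightarrow> A t > 0"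
proof -
  assume "t \<noteq> 0"
  then have "0 < (\<bar>t\<bar>/2) * a (\<bar>t\<bar>/2)" using a_pos by simp
  also have "\<dots> \<le> A \<bar>t\<bar> - A (\<bar>t\<bar>/2)" using A_diff(1)[of "\<bar>t\<bar>/2" "\<bar>t\<bar>"] by simp
  finally show ?thesis using A_nonneg[of "\<bar>t\<bar>/2"] even_abs[of t] by linarith
qed

text \<open>Take the tangent at \<open>c * x\<close> and evaluate it at \<open>x\<close> with weight
  \<open>c\<close> and at 0 with weight \<open>1 - c\<close>: the linear terms cancel.\<close>

lemma A_scale: "0 \<le> c \<Longrightarrow> c \<le> 1 \<Longrightarrow> A (c * x) \<le> c * A x"
proof -
  assume c: "0 \<le> c" "c \<le> 1"
  have "c * (a (c*x) * (x - c*x)) \<le> c * (A x - A (c*x))"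
    using c tangent[of "c*x" x] by (intro mult_left_mono) auto
  moreover have "(1-c) * (a (c*x) * (0 - c*x)) \<le> (1-c) * (A 0 - A (c*x))"
    using c tangent[of "c*x" 0] by (intro mult_left_mono) auto
  ultimately show ?thesis by (simp add: algebra_simps)
qed

text \<open>Both summands are fractions of \<open>x + y\<close>, so \<open>A_scale\<close> bounds
  them by the same fractions of \<open>A (x + y)\<close>. This is what later allows the modulars of
  the slices of a function to be added.\<close>

lemma A_superadd: assumes "0 \<le> x" "0 \<le> y" shows "A x + A y \<le> A (x + y)"
proof (cases "x + y = 0")
  case False
  then have p: "x + y > 0" using assms by linarith
  have "A x \<le> x/(x+y) * A (x+y)" using A_scale[of "x/(x+y)" "x+y"] p assms by simp
  moreover have "A y \<le> y/(x+y) * A (x+y)" using A_scale[of "y/(x+y)" "x+y"] p assms by simp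
  moreover have "x/(x+y) * A (x+y) + y/(x+y) * A (x+y) = ((x+y)/(x+y)) * A (x+y)"
    by (simp only: add_divide_distrib distrib_right)
  ultimately show ?thesis using p by simp
next
  case True
  then have "x = 0" "y = 0" using assms by auto
  then show ?thesis by simp
qed

lemma A_superadd_sum:
  assumes "finite I" "\<And>i. i \<in> I \<Longrightarrow> 0 \<le> x i"
  shows "(\<Sum>i\<in>I. A (x i)) \<le> A (\<Sum>i\<in>I. x i)"
  using assms
proof (induction I rule: finite_induct)
  case (insert i I)
  then show ?case using A_superadd[of "x i" "sum x I"] by (auto simp: sum_nonneg intro: order_trans)
qed simp

lemma A_convex: "convex_on UNIV A"
proof (rule convex_onI)
  fix t x y :: real assume t: "0 < t" "t < 1"
  define m where "m = (1 - t) * x + t * y"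
  have "(1-t) * (a m * (x - m)) \<le> (1-t) * (A x - A m)" "t * (a m * (y - m)) \<le> t * (A y - A m)"
    using t tangent[of m] by (auto intro!: mult_left_mono)
  moreover have "(1-t) * (a m * (x - m)) + t * (a m * (y - m)) = a m * ((1 - t) * x + t * y - m)"
    by (simp add: algebra_simps)
  ultimately show "A ((1 - t) *\<^sub>R x + t *\<^sub>R y) \<le> (1 - t) * A x + t * A y"
    by (simp add: m_def algebra_simps)
qed auto

lemma A_continuous: "continuous_on UNIV A"
  using convex_on_continuous[OF _ A_convex] by auto

lemma A_isCont: "isCont A x"
  using A_continuous by (simp add: continuous_on_eq_continuous_at)

lemma A_tendsto: "(f \<longlongrightarrow> l) F \<Longrightarrow> ((\<lambda>x. A (f x)) \<longlongrightarrow> A l) F"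
  by (rule isCont_tendsto_compose[OF A_isCont])

lemma A_measurable [measurable]: "A \<in> borel_measurable borel"
  using A_continuous by (rule borel_measurable_continuous_onI)

lemma ratio_mono: assumes "0 < x" "x \<le> y" shows "A x / x \<le> A y / y"
proof -
  have "A (x/y * y) \<le> x/y * A y" using assms by (intro A_scale) auto
  then show ?thesis using assms by (simp add: field_simps)
qed

text \<open>Beyond 1 the quotient \<open>A t / t\<close> is at least \<open>A 1\<close>. On sets of
  finite measure this turns a modular bound into an L1 bound.\<close>

lemma linear_le: "\<bar>t\<bar> \<le> 1 + A t / A 1"
proof (cases "\<bar>t\<bar> \<le> 1")
  case False
  then have "A 1 \<le> A \<bar>t\<bar> / \<bar>t\<bar>" using ratio_mono[of 1 "\<bar>t\<bar>"] by auto
  then have "\<bar>t\<bar> * A 1 \<le> A t" using False by (simp add: field_simps)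
  then have "\<bar>t\<bar> \<le> A t / A 1" using A_pos[of 1] by (simp add: field_simps)
  then show ?thesis by simp
qed (use A_nonneg[of t] A_nonneg[of 1] in \<open>simp add: add_increasing2\<close>)

lemma slope: "a t * t \<ge> A t"
  using tangent[of t 0] by simp

end

section \<open>The doubling condition\<close>

locale nfun_growth = nfun +
  fixes pp :: real
  assumes pp: "\<And>t. t > 0 \<Longrightarrow> t * a t \<le> pp * A t"
begin

lemma growth: "t * a t \<le> pp * A t"
  using pp[of t] pp[of "-t"] by (cases "t > 0"; cases "t = 0") (auto simp: odd even)

lemma pp_ge1: "pp \<ge> 1"
proof -
  have "1 * A 1 \<le> pp * A 1" using pp[of 1] slope[of 1] by simp
  then show ?thesis using A_pos[of 1] by (simp only: mult_le_cancel_right)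
qed

text \<open>Takes the place of Young's inequality with the conjugate function: the product is at
  most \<open>a t * t\<close>, where \<open>t\<close> is the larger of the two absolute
  values.\<close>

lemma abs_growth: "a \<bar>x\<bar> * \<bar>y\<bar> \<le> pp * A x + pp * A y"
proof -
  have "a \<bar>x\<bar> * \<bar>y\<bar> \<le> a \<bar>x\<bar> * \<bar>x\<bar> \<or> a \<bar>x\<bar> * \<bar>y\<bar> \<le> a \<bar>y\<bar> * \<bar>y\<bar>"
    by (cases "\<bar>x\<bar> \<le> \<bar>y\<bar>") (auto intro!: mult_right_mono mult_left_mono a_mono a_nonneg)
  moreover have "a \<bar>x\<bar> * \<bar>x\<bar> \<le> pp * A x" "a \<bar>y\<bar> * \<bar>y\<bar> \<le> pp * A y"
    using growth[of "\<bar>x\<bar>"] growth[of "\<bar>y\<bar>"] by (simp_all add: mult.commute)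
  moreover have "0 \<le> pp * A x" "0 \<le> pp * A y" using pp_ge1 by simp_all
  ultimately show ?thesis by linarith
qed

text \<open>The upper growth exponent controls the dilation by a factor \<open>e\<close> slightly
  above 1; iteration reaches \<open>2 ^ k\<close>.\<close>

lemma Delta2_power: "\<exists>C\<ge>1. \<forall>t. A (2 ^ k * t) \<le> C * A t"
proof -
  \<comment> \<open>With this choice \<open>(1 - 1/e) * pp \<le> 1/2\<close>, so the increment of
    \<open>A\<close> from \<open>t\<close> to \<open>e * t\<close> is at most half of
    \<open>A (e * t)\<close>.\<close>
  define e where "e = 1 + 1 / (2 * pp)"
  have e: "e > 1" using pp_ge1 by (simp add: e_def)
  have step: "A (e * t) \<le> 2 * A t" if "t \<ge> 0" for t
  proof -
    have "A (e*t) - A t \<le> (e*t - t) * a (e*t)" using A_diff(2)[of t "e*t"] e that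
      by (simp add: mult_le_cancel_right1)
    also have "\<dots> = (1 - 1/e) * (e*t * a (e*t))" using e by (simp add: field_simps)
    also have "\<dots> \<le> (1 - 1/e) * (pp * A (e*t))" using e growth by (intro mult_left_mono) auto
    also have "\<dots> = ((1 - 1/e) * pp) * A (e*t)" by simp
    also have "\<dots> \<le> (1/2) * A (e*t)"
    proof (rule mult_right_mono)
      show "(1 - 1/e) * pp \<le> 1/2" using pp_ge1 by (simp add: e_def field_simps)
    qed simp
    finally show ?thesis by simp
  qed
  have pw: "A (e ^ m * t) \<le> 2 ^ m * A t" if "t \<ge> 0" for m t
  proof (induction m)
    case (Suc m)
    have "A (e ^ Suc m * t) \<le> 2 * A (e ^ m * t)" using step[of "e^m*t"] that e by (simp add: mult.assoc)
    also have "\<dots> \<le> 2 ^ Suc m * A t" using Suc by simp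
    finally show ?case .
  qed simp
  obtain m where m: "2 ^ k < e ^ m" using real_arch_pow[OF e] by blast
  have "A (2^k*t) \<le> 2 ^ m * A t" for t
  proof -
    have "A (2^k*t) \<le> A (e^m*\<bar>t\<bar>)" using m e by (intro A_mono) (auto simp: abs_mult intro!: mult_right_mono)
    then show ?thesis using pw[of "\<bar>t\<bar>" m] by simp
  qed
  then show ?thesis by (intro exI[of _ "2^m"]) auto
qed

lemma Delta2_mult: "\<exists>C\<ge>1. \<forall>t. A (c * t) \<le> C * A t"
proof -
  obtain k where k: "\<bar>c\<bar> < 2 ^ k" using real_arch_pow[of 2] by auto
  obtain C where C: "C \<ge> 1" "\<And>t. A (2 ^ k * t) \<le> C * A t" using Delta2_power by blast
  have "A (c * t) \<le> A (2 ^ k * t)" for t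
    using k by (intro A_mono) (auto simp: abs_mult intro!: mult_right_mono)
  then show ?thesis using C by (meson order.trans)
qed

definition D2 where "D2 = (SOME C. C \<ge> 1 \<and> (\<forall>t. A (2 * t) \<le> C * A t))"

lemma D2: "D2 \<ge> 1" "A (2 * t) \<le> D2 * A t"
  using someI_ex[of "\<lambda>C. C \<ge> 1 \<and> (\<forall>t. A (2 * t) \<le> C * A t)"] Delta2_mult[of 2]
  unfolding D2_def by auto

text \<open>Takes the place of the triangle inequality: in absolute value \<open>x + y\<close> is at
  most twice the larger of the two.\<close>

lemma A_add: "A (x + y) \<le> D2 * A x + D2 * A y"
proof -
  have "A (x + y) \<le> A (2 * x) \<or> A (x + y) \<le> A (2 * y)"
    by (cases "\<bar>x\<bar> \<le> \<bar>y\<bar>") (auto intro!: A_mono)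
  moreover have "0 \<le> D2 * A x" "0 \<le> D2 * A y" using D2(1) by simp_all
  ultimately show ?thesis using D2(2)[of x] D2(2)[of y] by linarith
qed

lemma A_diff_le: "A (x - y) \<le> D2 * A x + D2 * A y"
  using A_add[of x "-y"] by (simp add: even)

end

section \<open>Difference quotients and the modular spaces\<close>

text \<open>Uncurried, so that integrals against \<open>mu\<close> run over a single
  variable.\<close>

definition dq :: "real \<Rightarrow> ('a::euclidean_space \<Rightarrow> real) \<Rightarrow> 'a \<times> 'a \<Rightarrow> real" where
  "dq s u p = diff_quot s u (fst p) (snd p)"

lemma dq_Pair: "dq s u (x, y) = (u x - u y) / norm (x - y) powr s"
  by (simp add: dq_def diff_quot_def)

lemma dq_add: "dq s (\<lambda>x. u x + v x) p = dq s u p + dq s v p"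
  and dq_diff: "dq s (\<lambda>x. u x - v x) p = dq s u p - dq s v p"
  and dq_cmult: "dq s (\<lambda>x. c * u x) p = c * dq s u p"
  and dq_minus: "dq s (\<lambda>x. - u x) p = - dq s u p"
  by (simp_all add: dq_def diff_quot_def add_divide_distrib diff_divide_distrib field_simps)

lemma abs_dq_le: assumes "\<bar>u x - u y\<bar> \<le> \<bar>v x - v y\<bar>" shows "\<bar>dq s u (x, y)\<bar> \<le> \<bar>dq s v (x, y)\<bar>"
  using assms by (simp add: dq_Pair divide_right_mono)

lemma sigma_finite_lebesgue: "sigma_finite_measure (lebesgue :: 'a::euclidean_space measure)"
proof
  obtain A :: "'a set set" where A: "countable A" "A \<subseteq> sets lborel" "\<Union>A = space lborel"
      "\<forall>a\<in>A. emeasure lborel a \<noteq> \<infinity>"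
    using lborel.sigma_finite_countable by blast
  then show "\<exists>A. countable A \<and> A \<subseteq> sets (lebesgue :: 'a measure) \<and> \<Union> A = space lebesgue \<and>
      (\<forall>a\<in>A. emeasure lebesgue a \<noteq> \<infinity>)"
    by (intro exI[of _ A]) auto
qed

interpretation lebesgue: sigma_finite_measure "lebesgue :: 'a::euclidean_space measure"
  by (rule sigma_finite_lebesgue)

interpretation lebesgue_pair: pair_sigma_finite "lebesgue :: 'a::euclidean_space measure"
    "lebesgue :: 'a::euclidean_space measure"
  by unfold_locales

lemma id_measurable_lebesgue [measurable]: "(\<lambda>x. x) \<in> measurable lebesgue borel"
  by (simp add: measurable_completion)

lemma sets_mu [measurable_cong]: "sets mu = sets (lebesgue \<Otimes>\<^sub>M lebesgue)"
  by (simp add: mu_def)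

lemma space_mu [simp]: "space mu = UNIV"
  by (simp add: mu_def space_pair_measure)

lemma
  fixes u :: "'a::euclidean_space \<Rightarrow> 'b::topological_space"
  assumes u: "u \<in> borel_measurable lebesgue"
  shows measurable_fst_comp: "(\<lambda>p. u (fst p)) \<in> borel_measurable (lebesgue \<Otimes>\<^sub>M (lebesgue :: 'a measure))"
    and measurable_snd_comp: "(\<lambda>p. u (snd p)) \<in> borel_measurable ((lebesgue :: 'a measure) \<Otimes>\<^sub>M lebesgue)"
  by (rule measurable_compose[OF measurable_fst u], rule measurable_compose[OF measurable_snd u])

lemma measurable_norm_diff:
  "(\<lambda>p. norm (fst p - snd p)) \<in> borel_measurable ((lebesgue :: 'a::euclidean_space measure) \<Otimes>\<^sub>M lebesgue)"
  by (intro measurable_compose[OF _ borel_measurable_norm] borel_measurable_diff measurable_fst_comp measurable_snd_comp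
      id_measurable_lebesgue)

lemma dq_measurable [measurable]:
  assumes u: "u \<in> borel_measurable lebesgue"
  shows "dq s u \<in> borel_measurable mu"
proof -
  have "dq s u = (\<lambda>p. (u (fst p) - u (snd p)) / norm (fst p - snd p) powr s)"
    by (auto simp: dq_def diff_quot_def)
  moreover have "(\<lambda>p::'a\<times>'a. (u (fst p) - u (snd p)) / norm (fst p - snd p) powr s)
      \<in> borel_measurable (lebesgue \<Otimes>\<^sub>M lebesgue)"
    by (intro borel_measurable_divide borel_measurable_diff measurable_fst_comp measurable_snd_comp u
        powr_real_measurable measurable_norm_diff borel_measurable_const)
  ultimately show ?thesis by (simp cong: measurable_cong_sets add: sets_mu)
qed

lemma weight_measurable:
  "(\<lambda>(x, y). ennreal (1 / norm (x - y :: 'a::euclidean_space) ^ DIM('a))) \<in>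
      borel_measurable (lebesgue \<Otimes>\<^sub>M lebesgue)"
  unfolding case_prod_beta
  by (intro measurable_compose[OF _ measurable_ennreal] borel_measurable_divide borel_measurable_power
      measurable_norm_diff borel_measurable_const)

text \<open>A null set \<open>N\<close> of points becomes the two null strips
  \<open>N \<times> UNIV\<close> and \<open>UNIV \<times> N\<close>. In this way equalities and
  limits that hold almost everywhere pass to difference quotients.\<close>

lemma AE_muI:
  assumes "AE x in lebesgue. P x"
  shows "AE p in mu. P (fst p) \<and> P (snd p)"
proof -
  obtain N where N: "N \<in> null_sets lebesgue" "{x. \<not> P x} \<subseteq> N"
    using AE_E3[OF assms] by (metis (mono_tags, lifting) DiffI UNIV_I mem_Collect_eq space_completion space_lborel subsetI space_borel)
  have n: "N \<times> UNIV \<in> null_sets (lebesgue \<Otimes>\<^sub>M lebesgue)" "UNIV \<times> N \<in> null_sets (lebesgue \<Otimes>\<^sub>M lebesgue)"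
    by (rule lebesgue.times_in_null_sets1[OF N(1)], simp, rule lebesgue.times_in_null_sets2[OF _ N(1)], simp)
  have "AE p in lebesgue \<Otimes>\<^sub>M lebesgue. P (fst p) \<and> P (snd p)"
    using AE_not_in[OF n(1)] AE_not_in[OF n(2)]
  proof eventually_elim
    case (elim p)
    then show ?case using N(2) by (cases p) auto
  qed
  then show ?thesis
    unfolding mu_def by (subst AE_density[OF weight_measurable]) (auto elim: eventually_mono)
qed

lemma AE_dq_cong:
  assumes "AE x in lebesgue. u x = v x"
  shows "AE p in mu. dq s u p = dq s v p"
  using AE_muI[OF assms] by eventually_elim (auto simp: dq_def diff_quot_def)

lemma AE_dq_tendsto:
  assumes "AE x in lebesgue. (\<lambda>k. u k x) \<longlonglongrightarrow> v x"
  shows "AE p in mu. (\<lambda>k. dq s (u k) p) \<longlonglongrightarrow> dq s v p"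
  using AE_muI[OF assms]
  by eventually_elim (auto simp: dq_def diff_quot_def divide_inverse intro!: tendsto_intros)

lemma nn_integral_mu:
  assumes "(\<lambda>p. F (fst p) (snd p)) \<in> borel_measurable (lebesgue \<Otimes>\<^sub>M lebesgue)"
  shows "(\<integral>\<^sup>+ p. F (fst p) (snd p) \<partial>mu) =
    (\<integral>\<^sup>+ x. \<integral>\<^sup>+ y. F x y * ennreal (1 / norm (x - y :: 'a::euclidean_space) ^ DIM('a)) \<partial>lebesgue \<partial>lebesgue)"
proof -
  note [measurable] = assms weight_measurable
  have "(\<integral>\<^sup>+ p. F (fst p) (snd p) \<partial>mu) = (\<integral>\<^sup>+ p. (case p of (x, y) \<Rightarrow> ennreal (1 / norm (x - y) ^ DIM('a))) *
      F (fst p) (snd p) \<partial>(lebesgue \<Otimes>\<^sub>M lebesgue))"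
    unfolding mu_def by (rule nn_integral_density) measurable
  also have "\<dots> = (\<integral>\<^sup>+ x. \<integral>\<^sup>+ y. F x y * ennreal (1 / norm (x - y) ^ DIM('a)) \<partial>lebesgue \<partial>lebesgue)"
    by (subst lebesgue.nn_integral_fst[symmetric]) (auto simp: mult.commute)
  finally show ?thesis .
qed

text \<open>\<open>g_scale\<close> is the form in which the convexity of \<open>g\<close> on the
  half-line is used; it makes the pairing continuous. Continuity of \<open>g\<close> gives the limit
  in the Euler-Lagrange inequality and the smallness of \<open>G y / y\<close> near 0.\<close>

locale orlicz = nfun_growth G g pp for G g :: "real \<Rightarrow> real" and pp :: real +
  fixes s :: real
  assumes s_pos: "0 < s" and s_less_1: "s < 1"
    and g_scale: "\<And>c t. 0 < c \<Longrightarrow> c \<le> 1 \<Longrightarrow> 0 \<le> t \<Longrightarrow> g (c * t) \<le> c * g t"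
    and g_isCont: "\<And>t. isCont g t"
begin

lemma rho_s_eq: "rho_s s G u = (\<integral>\<^sup>+ p. ennreal (G (dq s u p)) \<partial>mu)"
  by (simp add: rho_s_def dq_def case_prod_unfold)

lemma rho_eq: "rho G u = (\<integral>\<^sup>+ x. ennreal (G (u x)) \<partial>lebesgue)"
  by (simp add: rho_def)

lemma W_iff: "u \<in> W s G \<longleftrightarrow> u \<in> borel_measurable lebesgue \<and>
    integrable lebesgue (\<lambda>x. G (u x)) \<and> integrable mu (\<lambda>p. G (dq s u p))"
  unfolding W_def rho_s_eq rho_eq
  by (auto simp: integrable_iff_bounded)

lemma W_I:
  assumes "u \<in> borel_measurable lebesgue"
    and "integrable lebesgue U" "AE x in lebesgue. G (u x) \<le> U x"
    and "integrable mu V" "AE p in mu. G (dq s u p) \<le> V p"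
  shows "u \<in> W s G"
proof -
  note [measurable] = assms(1)
  have "integrable lebesgue (\<lambda>x. G (u x))"
    by (rule Bochner_Integration.integrable_bound[OF assms(2)])
       (use assms(3) in \<open>auto elim!: eventually_mono intro: order.trans\<close>)
  moreover have "integrable mu (\<lambda>p. G (dq s u p))"
    by (rule Bochner_Integration.integrable_bound[OF assms(4)])
       (use assms(5) in \<open>auto elim!: eventually_mono intro: order.trans\<close>)
  ultimately show ?thesis using assms(1) by (simp add: W_iff)
qed

lemma W_measurable: "u \<in> W s G \<Longrightarrow> u \<in> borel_measurable lebesgue"
  and W_integrable: "u \<in> W s G \<Longrightarrow> integrable lebesgue (\<lambda>x. G (u x))"
  and W_integrable_mu: "u \<in> W s G \<Longrightarrow> integrable mu (\<lambda>p. G (dq s u p))"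
  by (auto simp: W_iff)

lemma W_add: assumes "u \<in> W s G" "v \<in> W s G" shows "(\<lambda>x. u x + v x) \<in> W s G"
  using assms
  by (intro W_I[where U = "\<lambda>x. D2 * G (u x) + D2 * G (v x)" and V = "\<lambda>p. D2 * G (dq s u p) + D2 * G (dq s v p)"])
     (auto simp: W_iff dq_add A_add)

lemma W_cmult: assumes "u \<in> W s G" shows "(\<lambda>x. c * u x) \<in> W s G"
proof -
  obtain C where "\<And>t. G (c * t) \<le> C * G t" using Delta2_mult by blast
  then show ?thesis using assms
    by (intro W_I[where U = "\<lambda>x. C * G (u x)" and V = "\<lambda>p. C * G (dq s u p)"]) (auto simp: W_iff dq_cmult)
qed

lemma W_minus: "u \<in> W s G \<Longrightarrow> (\<lambda>x. - u x) \<in> W s G"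
  using W_cmult[of u "-1"] by simp

lemma W_diff: "u \<in> W s G \<Longrightarrow> v \<in> W s G \<Longrightarrow> (\<lambda>x. u x - v x) \<in> W s G"
  using W_add[OF _ W_minus, of u v] by simp

text \<open>Made for lattice operations: an increment of a maximum or minimum of two functions is
  bounded by an increment of one of them.\<close>

lemma W_dominated:
  assumes "w \<in> borel_measurable lebesgue" "u \<in> W s G" "v \<in> W s G"
    and "AE x in lebesgue. \<bar>w x\<bar> \<le> \<bar>u x\<bar> \<or> \<bar>w x\<bar> \<le> \<bar>v x\<bar>"
    and "\<And>x y. \<bar>w x - w y\<bar> \<le> \<bar>u x - u y\<bar> \<or> \<bar>w x - w y\<bar> \<le> \<bar>v x - v y\<bar>"
  shows "w \<in> W s G"
proof (rule W_I[where U = "\<lambda>x. G (u x) + G (v x)" and V = "\<lambda>p. G (dq s u p) + G (dq s v p)"])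
  have *: "G a \<le> G b + G c" if "\<bar>a\<bar> \<le> \<bar>b\<bar> \<or> \<bar>a\<bar> \<le> \<bar>c\<bar>" for a b c
    using that A_mono[of a b] A_mono[of a c] A_nonneg[of b] A_nonneg[of c] by linarith
  show "AE x in lebesgue. G (w x) \<le> G (u x) + G (v x)"
    using assms(4) by eventually_elim (rule *)
  have "\<bar>dq s w p\<bar> \<le> \<bar>dq s u p\<bar> \<or> \<bar>dq s w p\<bar> \<le> \<bar>dq s v p\<bar>" for p
  proof (cases p)
    case (Pair x y)
    then show ?thesis
      using assms(5)[of x y] abs_dq_le[of w x y u s] abs_dq_le[of w x y v s] by auto
  qed
  then show "AE p in mu. G (dq s w p) \<le> G (dq s u p) + G (dq s v p)"
    using * by (intro AE_I2) blast
  show "integrable lebesgue (\<lambda>x. G (u x) + G (v x))" "integrable mu (\<lambda>p. G (dq s u p) + G (dq s v p))"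
    using assms(2,3) by (auto simp: W_iff)
qed (rule assms(1))

lemma W_max: assumes "u \<in> W s G" "v \<in> W s G" shows "(\<lambda>x. max (u x) (v x)) \<in> W s G"
  by (rule W_dominated[OF _ assms]) (use assms in \<open>auto simp: W_iff max_def\<close>)

lemma W_min: assumes "u \<in> W s G" "v \<in> W s G" shows "(\<lambda>x. min (u x) (v x)) \<in> W s G"
  by (rule W_dominated[OF _ assms]) (use assms in \<open>auto simp: W_iff min_def\<close>)

lemma W_zero: "(\<lambda>x. 0) \<in> W s G"
  by (auto simp: W_iff dq_def diff_quot_def)

lemma W_cong_AE: assumes "u \<in> W s G" "v \<in> borel_measurable lebesgue" "AE x in lebesgue. u x = v x"
  shows "v \<in> W s G"
  using assms AE_dq_cong[OF assms(3), of s]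
  by (intro W_I[where U = "\<lambda>x. G (u x)" and V = "\<lambda>p. G (dq s u p)"]) (auto simp: W_iff elim!: eventually_mono)

definition Phi :: "('a::euclidean_space \<Rightarrow> real) \<Rightarrow> real" where
  "Phi u = (\<integral> p. G (dq s u p) \<partial>mu)"

lemma rho_s_Phi: "u \<in> W s G \<Longrightarrow> rho_s s G u = ennreal (Phi u)"
  unfolding rho_s_eq Phi_def by (intro nn_integral_eq_integral) (auto simp: W_iff)

lemma Phi_nonneg: "Phi u \<ge> 0"
  unfolding Phi_def by (rule integral_nonneg_AE) auto

lemma flap_eq: "frac_g_laplacian s g u v = (\<integral> p. g (dq s u p) * dq s v p \<partial>mu)"
  by (simp add: frac_g_laplacian_def dq_def case_prod_unfold)

lemma pairing_integrable:
  assumes u: "u \<in> W s G" and v: "v \<in> W s G"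
  shows "integrable mu (\<lambda>p. g (dq s u p) * dq s v p)"
proof (rule Bochner_Integration.integrable_bound[where f = "\<lambda>p. pp * G (dq s u p) + pp * G (dq s v p)"])
  note [measurable] = W_measurable[OF u] W_measurable[OF v]
  show "(\<lambda>p. g (dq s u p) * dq s v p) \<in> borel_measurable mu" by measurable
  have "0 \<le> pp * G a" for a using pp_ge1 by simp
  then show "AE p in mu. norm (g (dq s u p) * dq s v p) \<le> norm (pp * G (dq s u p) + pp * G (dq s v p))"
    by (auto simp: abs_mult a_abs abs_growth)
qed (use assms in \<open>auto simp: W_iff\<close>)

lemma flap_minus: "frac_g_laplacian s g u (\<lambda>x. - v x) = - frac_g_laplacian s g u v"
  by (simp add: flap_eq dq_minus)

text \<open>Where \<open>t \<le> R \<bar>U\<bar>\<close> the product \<open>g U t\<close> is dominated by an integrable function; elsewhere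
  \<open>g U t \<le> pp / R * G t\<close>.\<close>

lemma pairing_split:
  assumes "R \<ge> 1" "t \<ge> 0"
  shows "g \<bar>U\<bar> * t \<le> min (g \<bar>U\<bar> * t) (R * pp * G U) + pp / R * G t"
proof (cases "t \<le> R * \<bar>U\<bar>")
  case True
  have "g \<bar>U\<bar> * t \<le> g \<bar>U\<bar> * (R * \<bar>U\<bar>)" using True a_nonneg by (intro mult_left_mono) auto
  also have "\<dots> = R * (\<bar>U\<bar> * g \<bar>U\<bar>)" by simp
  also have "\<dots> \<le> R * (pp * G U)" using growth[of "\<bar>U\<bar>"] assms by (intro mult_left_mono) auto
  finally have "g \<bar>U\<bar> * t \<le> R * pp * G U" by simp
  moreover have "0 \<le> pp / R * G t" using pp_ge1 assms by simp
  ultimately show ?thesis by simp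
next
  case False
  have "g \<bar>U\<bar> * t \<le> g (1 / R * t) * t"
    using False assms by (intro mult_right_mono a_mono) (auto simp: field_simps)
  also have "\<dots> \<le> (1 / R * g t) * t" using assms by (intro mult_right_mono g_scale) auto
  also have "\<dots> = 1 / R * (t * g t)" by simp
  also have "\<dots> \<le> 1 / R * (pp * G t)" using assms growth by (intro mult_left_mono) auto
  finally have "g \<bar>U\<bar> * t \<le> pp / R * G t" by simp
  moreover have "0 \<le> min (g \<bar>U\<bar> * t) (R * pp * G U)"
    using assms pp_ge1 a_nonneg[of "\<bar>U\<bar>"] by simp
  ultimately show ?thesis by linarith
qed

text \<open>Norm convergence is replaced by convergence almost everywhere with bounded modulars. For
  fixed \<open>R\<close> the part of the pairing of \<open>U\<close> with
  \<open>\<phi> k - w\<close> that is dominated by a multiple of \<open>G (dq s U p)\<close> tends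
  to 0 by dominated convergence, and the rest is at most \<open>pp / R * K\<close> for every
  \<open>k\<close>. Then \<open>R\<close> is taken large.\<close>

lemma pairing_tendsto:
  fixes U w :: "'a::euclidean_space \<Rightarrow> real"
  assumes U: "U \<in> W s G" and w: "w \<in> W s G" and \<phi>: "\<And>k::nat. \<phi> k \<in> W s G"
    and AE: "AE x in lebesgue. (\<lambda>k. \<phi> k x) \<longlonglongrightarrow> w x" and R: "\<And>k. Phi (\<phi> k) \<le> C"
  shows "(\<lambda>k. frac_g_laplacian s g U (\<phi> k)) \<longlonglongrightarrow> frac_g_laplacian s g U w"
proof -
  note [measurable] = W_measurable[OF U] W_measurable[OF w] W_measurable[OF \<phi>]
  have pp: "pp \<ge> 1" by (rule pp_ge1)
  define d where "d k = (\<lambda>x. \<phi> k x - w x)" for k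
  have dW: "d k \<in> W s G" for k unfolding d_def using \<phi> w by (rule W_diff)
  note [measurable] = W_measurable[OF dW]
  have dAE: "AE p in mu. (\<lambda>k. dq s (d k) p) \<longlonglongrightarrow> 0"
  proof -
    have "AE p in mu. (\<lambda>k. dq s (\<phi> k) p) \<longlonglongrightarrow> dq s w p" by (rule AE_dq_tendsto[OF AE])
    then show ?thesis unfolding d_def dq_diff by eventually_elim (simp add: LIM_zero)
  qed
  define K where "K = D2 * C + D2 * Phi w"
  have dK: "Phi (d k) \<le> K" for k
  proof -
    have "Phi (d k) \<le> (\<integral> p. D2 * G (dq s (\<phi> k) p) + D2 * G (dq s w p) \<partial>mu)"
      unfolding Phi_def d_def dq_diff using \<phi>[of k] w dW[of k, unfolded d_def]
      by (intro integral_mono) (auto simp: W_iff A_diff_le dq_diff)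
    also have "\<dots> = D2 * Phi (\<phi> k) + D2 * Phi w"
      unfolding Phi_def using \<phi>[of k] w by (subst Bochner_Integration.integral_add) (auto simp: W_iff)
    also have "\<dots> \<le> K" unfolding K_def using R D2 by simp
    finally show ?thesis .
  qed
  have K0: "K \<ge> 0" using dK[of 0] Phi_nonneg[of "d 0"] by linarith
  have bound: "\<bar>frac_g_laplacian s g U (d k)\<bar> \<le>
     (\<integral> p. min (g \<bar>dq s U p\<bar> * \<bar>dq s (d k) p\<bar>) (R * pp * G (dq s U p)) \<partial>mu) + pp / R * K" if "R \<ge> 1" for R k
  proof -
    have i1: "integrable mu (\<lambda>p. min (g \<bar>dq s U p\<bar> * \<bar>dq s (d k) p\<bar>) (R * pp * G (dq s U p)))"
      by (rule Bochner_Integration.integrable_bound[where f = "\<lambda>p. R * pp * G (dq s U p)"])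
         (use U that pp a_nonneg in \<open>auto simp: W_iff abs_mult min_def\<close>)
    have "\<bar>frac_g_laplacian s g U (d k)\<bar> \<le> (\<integral> p. g \<bar>dq s U p\<bar> * \<bar>dq s (d k) p\<bar> \<partial>mu)"
      unfolding flap_eq using integral_abs_bound[of mu "\<lambda>p. g (dq s U p) * dq s (d k) p"]
      by (simp add: abs_mult a_abs)
    also have "\<dots> \<le> (\<integral> p. min (g \<bar>dq s U p\<bar> * \<bar>dq s (d k) p\<bar>) (R * pp * G (dq s U p))
        + pp / R * G (dq s (d k) p) \<partial>mu)"
    proof (rule integral_mono)
      show "integrable mu (\<lambda>p. g \<bar>dq s U p\<bar> * \<bar>dq s (d k) p\<bar>)"
        using integrable_abs[OF pairing_integrable[OF U dW[of k]]] by (simp add: abs_mult a_abs)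
      show "integrable mu (\<lambda>p. min (g \<bar>dq s U p\<bar> * \<bar>dq s (d k) p\<bar>) (R * pp * G (dq s U p))
        + pp / R * G (dq s (d k) p))"
        using i1 dW[of k] by (auto simp: W_iff)
      show "g \<bar>dq s U p\<bar> * \<bar>dq s (d k) p\<bar> \<le> min (g \<bar>dq s U p\<bar> * \<bar>dq s (d k) p\<bar>) (R * pp * G (dq s U p))
        + pp / R * G (dq s (d k) p)" for p
        using pairing_split[OF that, of "\<bar>dq s (d k) p\<bar>" "dq s U p"] by simp
    qed
    also have "\<dots> = (\<integral> p. min (g \<bar>dq s U p\<bar> * \<bar>dq s (d k) p\<bar>) (R * pp * G (dq s U p)) \<partial>mu) + pp / R * Phi (d k)"
      unfolding Phi_def using i1 dW[of k]
      by (subst Bochner_Integration.integral_add) (auto simp: W_iff)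
    also have "\<dots> \<le> (\<integral> p. min (g \<bar>dq s U p\<bar> * \<bar>dq s (d k) p\<bar>) (R * pp * G (dq s U p)) \<partial>mu) + pp / R * K"
      using dK that pp by (intro add_left_mono mult_left_mono) auto
    finally show ?thesis .
  qed
  have lim: "(\<lambda>k. \<integral> p. min (g \<bar>dq s U p\<bar> * \<bar>dq s (d k) p\<bar>) (R * pp * G (dq s U p)) \<partial>mu) \<longlonglongrightarrow> 0"
    if "R \<ge> 1" for R
  proof -
    have "(\<lambda>k. \<integral> p. min (g \<bar>dq s U p\<bar> * \<bar>dq s (d k) p\<bar>) (R * pp * G (dq s U p)) \<partial>mu) \<longlonglongrightarrow> (\<integral> p. 0 \<partial>(mu :: ('a \<times> 'a) measure))"
    proof (rule integral_dominated_convergence[of "\<lambda>p. 0" mu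
          "\<lambda>k p. min (g \<bar>dq s U p\<bar> * \<bar>dq s (d k) p\<bar>) (R * pp * G (dq s U p))" "\<lambda>p. R * pp * G (dq s U p)"])
      show "AE p in mu. (\<lambda>k. min (g \<bar>dq s U p\<bar> * \<bar>dq s (d k) p\<bar>) (R * pp * G (dq s U p))) \<longlonglongrightarrow> 0"
        using dAE
      proof eventually_elim
        case (elim p)
        have "(\<lambda>k. min (g \<bar>dq s U p\<bar> * \<bar>dq s (d k) p\<bar>) (R * pp * G (dq s U p))) \<longlonglongrightarrow>
            min (g \<bar>dq s U p\<bar> * \<bar>0\<bar>) (R * pp * G (dq s U p))"
          by (intro tendsto_intros elim)
        then show ?case using that pp by (simp add: min_def)
      qed
      show "AE p in mu. norm (min (g \<bar>dq s U p\<bar> * \<bar>dq s (d k) p\<bar>) (R * pp * G (dq s U p))) \<le> R * pp * G (dq s U p)" for k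
        using that pp a_nonneg by (auto simp: abs_mult min_def)
    qed (use U in \<open>auto simp: W_iff\<close>)
    then show ?thesis by simp
  qed
  have "(\<lambda>k. frac_g_laplacian s g U (d k)) \<longlonglongrightarrow> 0"
  proof (rule LIMSEQ_I)
    fix r :: real assume r: "r > 0"
    \<comment> \<open>Makes the uniform remainder \<open>pp / R * K\<close> smaller than
      \<open>r / 2\<close>; the maximum secures \<open>R \<ge> 1\<close> for
      \<open>pairing_split\<close>.\<close>
    define R where "R = max 1 (2 * pp * K / r + 1)"
    have R1: "R \<ge> 1" by (simp add: R_def)
    have "pp / R * K < r / 2"
    proof -
      have "2 * pp * K / r < R" unfolding R_def by simp
      then have "2 * pp * K < R * r" using r by (simp add: field_simps)
      then show ?thesis using R1 by (simp add: field_simps)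
    qed
    moreover obtain k0 where "\<And>k. k \<ge> k0 \<Longrightarrow>
       \<bar>\<integral> p. min (g \<bar>dq s U p\<bar> * \<bar>dq s (d k) p\<bar>) (R * pp * G (dq s U p)) \<partial>mu\<bar> < r / 2"
      using LIMSEQ_D[OF lim[OF R1], of "r/2"] r by auto
    ultimately show "\<exists>no. \<forall>k\<ge>no. norm (frac_g_laplacian s g U (d k) - 0) < r"
      using bound[OF R1] by (intro exI[of _ k0]) (smt (verit, best) field_sum_of_halves real_norm_def)
  qed
  moreover have "frac_g_laplacian s g U (d k) = frac_g_laplacian s g U (\<phi> k) - frac_g_laplacian s g U w" for k
    unfolding flap_eq d_def dq_diff right_diff_distrib
    using pairing_integrable[OF U \<phi>[of k]] pairing_integrable[OF U w]
    by (rule Bochner_Integration.integral_diff)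
  ultimately show ?thesis by (simp add: LIM_zero_iff)
qed

end

section \<open>The fractional Orlicz--Sobolev embedding\<close>

text \<open>The slice of \<open>t\<close> between the levels \<open>l\<close> and
  \<open>l + d\<close>, as in Maz'ya's truncation method.\<close>

definition clip :: "real \<Rightarrow> real \<Rightarrow> real \<Rightarrow> real" where
  "clip l d t = min (max (t - l) 0) d"

lemma clip_mono: "a \<le> b \<Longrightarrow> clip l d a \<le> clip l d b"
  by (simp add: clip_def min_def max_def)

lemma clip_lipschitz: "\<bar>clip l d a - clip l d b\<bar> \<le> \<bar>a - b\<bar>"
  by (simp add: clip_def min_def max_def)

lemma clip_sum:
  assumes "\<And>i. l i \<le> l (Suc i)"
  shows "(\<Sum>i<N. clip (l i) (l (Suc i) - l i) t) = clip (l 0) (l N - l 0) t"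
proof (induction N)
  case 0 then show ?case by (simp add: clip_def)
next
  case (Suc N)
  have "l 0 \<le> l N" by (rule lift_Suc_mono_le[of l, OF assms]) simp
  then show ?case using Suc assms[of N] by (simp add: clip_def min_def max_def)
qed

text \<open>Slices are non-decreasing in their argument, so all their increments have the same sign
  and the sum telescopes to the increment of a single slice, which is 1-Lipschitz.\<close>

lemma clip_sum_abs:
  assumes "\<And>i. l i \<le> l (Suc i)"
  shows "(\<Sum>i<N. \<bar>clip (l i) (l (Suc i) - l i) a - clip (l i) (l (Suc i) - l i) b\<bar>) \<le> \<bar>a - b\<bar>"
proof -
  have *: "(\<Sum>i<N. \<bar>clip (l i) (l (Suc i) - l i) a - clip (l i) (l (Suc i) - l i) b\<bar>) \<le> \<bar>a - b\<bar>" if "b \<le> a" for a b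
  proof -
    have "(\<Sum>i<N. \<bar>clip (l i) (l (Suc i) - l i) a - clip (l i) (l (Suc i) - l i) b\<bar>) =
        (\<Sum>i<N. clip (l i) (l (Suc i) - l i) a - clip (l i) (l (Suc i) - l i) b)"
      using clip_mono[OF that] by (intro sum.cong) auto
    also have "\<dots> = clip (l 0) (l N - l 0) a - clip (l 0) (l N - l 0) b"
      by (simp add: sum_subtractf clip_sum[of l, OF assms])
    also have "\<dots> \<le> \<bar>a - b\<bar>" using clip_lipschitz[of "l 0" "l N - l 0" a b] by linarith
    finally show ?thesis .
  qed
  show ?thesis
  proof (cases "b \<le> a")
    case False
    then show ?thesis using *[of a b] by (simp add: abs_minus_commute)
  qed (rule *)
qed

lemma IVT_pos:
  fixes F :: "real \<Rightarrow> real"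
  assumes "continuous_on {0<..} F" "0 < a" "F a \<le> c" "0 < b" "c \<le> F b"
  shows "\<exists>y>0. F y = c"
proof -
  have "connected (F ` {0<..})" using assms(1) by (rule connected_continuous_image) auto
  then have "c \<in> F ` {0<..}"
    by (rule connectedD_interval[of _ "F a" "F b"]) (use assms in auto)
  then show ?thesis by auto
qed

context orlicz
begin

text \<open>Superadditivity of \<open>G\<close> applied pointwise to the difference quotients. No
  doubling constant is lost, so the number of slices does not enter the bound.\<close>

lemma rho_s_sum_le:
  fixes v :: "'a::euclidean_space \<Rightarrow> real"
  assumes "finite I" and v: "v \<in> borel_measurable lebesgue"
    and vi: "\<And>i. i \<in> I \<Longrightarrow> w i \<in> borel_measurable lebesgue"
    and le: "\<And>x y. (\<Sum>i\<in>I. \<bar>w i x - w i y\<bar>) \<le> \<bar>v x - v y\<bar>"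
  shows "(\<Sum>i\<in>I. rho_s s G (w i)) \<le> rho_s s G v"
proof -
  note [measurable] = v vi
  have "(\<Sum>i\<in>I. rho_s s G (w i)) = (\<integral>\<^sup>+ p. (\<Sum>i\<in>I. ennreal (G (dq s (w i) p))) \<partial>mu)"
    unfolding rho_s_eq by (subst nn_integral_sum) auto
  also have "\<dots> \<le> rho_s s G v" unfolding rho_s_eq
  proof (rule nn_integral_mono)
    fix p :: "'a \<times> 'a"
    obtain x y where p: "p = (x, y)" by (cases p)
    have "(\<Sum>i\<in>I. \<bar>dq s (w i) p\<bar>) = (\<Sum>i\<in>I. \<bar>w i x - w i y\<bar>) / norm (x - y) powr s"
      by (simp add: p dq_Pair sum_divide_distrib)
    also have "\<dots> \<le> \<bar>dq s v p\<bar>" using le by (simp add: p dq_Pair divide_right_mono)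
    finally have le': "(\<Sum>i\<in>I. \<bar>dq s (w i) p\<bar>) \<le> \<bar>dq s v p\<bar>" .
    have "(\<Sum>i\<in>I. G (dq s (w i) p)) = (\<Sum>i\<in>I. G \<bar>dq s (w i) p\<bar>)" by simp
    also have "\<dots> \<le> G (\<Sum>i\<in>I. \<bar>dq s (w i) p\<bar>)" using assms(1) by (intro A_superadd_sum) auto
    also have "\<dots> \<le> G (dq s v p)" using le' by (intro A_mono) (simp add: sum_nonneg)
    finally show "(\<Sum>i\<in>I. ennreal (G (dq s (w i) p))) \<le> ennreal (G (dq s v p))"
      by (simp add: sum_ennreal ennreal_leI)
  qed
  finally show ?thesis .
qed

text \<open>Around each point of \<open>P\<close> a ball of measure \<open>2 * r\<close> contains a
  part of measure at least \<open>r\<close> outside \<open>X\<close>. There the increment is at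
  least \<open>d\<close>, the distance at most the radius, and the weight of \<open>mu\<close> at
  least the inverse power of the radius.\<close>

lemma rho_s_lower:
  fixes v :: "'a::euclidean_space \<Rightarrow> real"
  defines "om \<equiv> unit_ball_vol (real DIM('a)) / 2"
  assumes v: "v \<in> borel_measurable lebesgue" and P: "P \<in> sets lebesgue" and X: "X \<in> sets lebesgue"
    and r: "0 < r" "emeasure lebesgue X \<le> ennreal r" and d: "0 \<le> d"
    and le: "\<And>x y. x \<in> P \<Longrightarrow> y \<notin> X \<Longrightarrow> d \<le> \<bar>v x - v y\<bar>"
  shows "emeasure lebesgue P * ennreal (om * G (d * (om / r) powr (s / DIM('a)))) \<le> rho_s s G v"
proof -
  note [measurable] = v P X
  let ?n = "DIM('a)"
  have om: "om > 0" by (simp add: om_def)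
  have u: "unit_ball_vol (real DIM('a)) = 2 * om" by (simp add: om_def)
  \<comment> \<open>As \<open>om\<close> is half the volume of the unit ball, the ball of this
    radius has measure \<open>2 * r\<close>, twice the bound on \<open>X\<close>.\<close>
  define R where "R = (r / om) powr (1 / ?n)"
  have R: "R > 0" using r om by (simp add: R_def)
  have Rn: "R ^ ?n = r / om"
    using r om by (simp add: R_def powr_powr flip: powr_realpow)
  have Rs: "R powr s = (r / om) powr (s / ?n)" by (simp add: R_def powr_powr)
  define K where "K = ennreal (G (d / R powr s) / R ^ ?n)"
  have inner: "ennreal (om * G (d * (om / r) powr (s / ?n))) \<le>
      (\<integral>\<^sup>+ y. ennreal (G (dq s v (x, y))) * ennreal (1 / norm (x - y) ^ ?n) \<partial>lebesgue)" if x: "x \<in> P" for x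
  proof -
    have b: "emeasure lebesgue (ball x R) = ennreal (2 * r)"
      using R r om u by (simp add: emeasure_ball Rn)
    have B: "ball x R - X - {x} \<in> sets lebesgue" by (intro sets.Diff X) auto
    have "ennreal (2 * r) \<le> emeasure lebesgue (ball x R - X - {x}) + emeasure lebesgue X + emeasure lebesgue {x}"
    proof -
      have BX: "(ball x R - X - {x}) \<union> X \<in> sets lebesgue" by (intro sets.Un B X)
      have "emeasure lebesgue (ball x R) \<le> emeasure lebesgue ((ball x R - X - {x}) \<union> X \<union> {x})"
        by (rule emeasure_mono) (auto intro!: sets.Un BX simp del: Un_insert_right)
      also have "\<dots> \<le> emeasure lebesgue ((ball x R - X - {x}) \<union> X) + emeasure lebesgue {x}"
        by (rule emeasure_subadditive[OF BX]) auto
      also have "\<dots> \<le> emeasure lebesgue (ball x R - X - {x}) + emeasure lebesgue X + emeasure lebesgue {x}"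
        by (rule add_right_mono[OF emeasure_subadditive[OF B X]])
      finally show ?thesis by (simp add: b)
    qed
    also have "\<dots> \<le> emeasure lebesgue (ball x R - X - {x}) + ennreal r"
      using r by (simp add: add_left_mono)
    also have "ennreal (2 * r) = ennreal r + ennreal r" using r by (subst ennreal_plus[symmetric]) auto
    finally have "ennreal r + ennreal r \<le> ennreal r + emeasure lebesgue (ball x R - X - {x})"
      by (subst (2) add.commute)
    then have e: "ennreal r \<le> emeasure lebesgue (ball x R - X - {x})"
      unfolding ennreal_add_left_cancel_le by simp
    have "ennreal (om * G (d * (om / r) powr (s / ?n))) = ennreal (G (d / R powr s) / R ^ ?n * r)"
      using r om by (simp add: Rn Rs powr_divide field_simps)
    also have "\<dots> = K * ennreal r" using r R unfolding K_def by (subst ennreal_mult) auto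
    also have "\<dots> \<le> K * emeasure lebesgue (ball x R - X - {x})" using e by (intro mult_left_mono) auto
    also have "\<dots> = (\<integral>\<^sup>+ y. K * indicator (ball x R - X - {x}) y \<partial>lebesgue)"
      by (rule nn_integral_cmult_indicator[OF B, symmetric])
    also have "\<dots> \<le> (\<integral>\<^sup>+ y. ennreal (G (dq s v (x, y))) * ennreal (1 / norm (x - y) ^ ?n) \<partial>lebesgue)"
    proof (rule nn_integral_mono)
      fix y
      show "K * indicator (ball x R - X - {x}) y \<le> ennreal (G (dq s v (x, y))) * ennreal (1 / norm (x - y) ^ ?n)"
      proof (cases "y \<in> ball x R - X - {x}")
        case True
        then have y: "0 < norm (x - y)" "norm (x - y) \<le> R" "y \<notin> X" by (auto simp: dist_norm)
        have "d / R powr s \<le> \<bar>v x - v y\<bar> / norm (x - y) powr s"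
          using le[OF x y(3)] y d s_pos by (intro frac_le) (auto intro!: powr_mono2)
        then have "G (d / R powr s) \<le> G (dq s v (x, y))"
          using d by (intro A_mono) (auto simp: dq_Pair)
        moreover have "1 / R ^ ?n \<le> 1 / norm (x - y) ^ ?n"
          using y R by (intro divide_left_mono power_mono) auto
        ultimately have "G (d / R powr s) * (1 / R ^ ?n) \<le> G (dq s v (x, y)) * (1 / norm (x - y) ^ ?n)"
          using R by (intro mult_mono) auto
        then show ?thesis using True by (simp add: K_def ennreal_leI flip: ennreal_mult)
      qed simp
    qed
    finally show ?thesis .
  qed
  have "emeasure lebesgue P * ennreal (om * G (d * (om / r) powr (s / ?n))) =
      (\<integral>\<^sup>+ x. ennreal (om * G (d * (om / r) powr (s / ?n))) * indicator P x \<partial>lebesgue)"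
    by (subst nn_integral_cmult_indicator[OF P]) (rule mult.commute)
  also have "\<dots> \<le> (\<integral>\<^sup>+ x. \<integral>\<^sup>+ y. ennreal (G (dq s v (x, y))) * ennreal (1 / norm (x - y) ^ ?n) \<partial>lebesgue \<partial>lebesgue)"
    using inner by (intro nn_integral_mono) (auto split: split_indicator)
  also have "\<dots> = rho_s s G v"
  proof -
    have "(\<lambda>p. ennreal (G (dq s v (fst p, snd p)))) \<in> borel_measurable (lebesgue \<Otimes>\<^sub>M lebesgue)"
      using measurable_compose[OF dq_measurable[OF v, of s], of "\<lambda>t. ennreal (G t)" borel]
      by (simp cong: measurable_cong_sets add: sets_mu)
    from nn_integral_mu[of "\<lambda>x y. ennreal (G (dq s v (x, y)))", OF this] show ?thesis
      by (simp add: rho_s_eq)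
  qed
  finally show ?thesis .
qed

end

section \<open>The Sobolev conjugate and a discrete Hardy inequality\<close>

locale orlicz_sobolev = orlicz +
  fixes n :: real
  assumes n_ge_1: "1 \<le> n"
    and integrable_zero: "\<exists>\<delta>>0. (\<integral>\<^sup>+ t\<in>{0..\<delta>}. ennreal ((t / G t) powr (s / (n - s))) \<partial>lborel) < \<infinity>"
begin

text \<open>The exponents are tied by \<open>al = th / (1 - th)\<close>, equivalently
  \<open>(1 - th) * (1 + al) = 1\<close>. So \<open>h\<close> is the power \<open>1 + al\<close> of
  \<open>H\<close>, and this relation drives the computations in \<open>hardy\<close>.\<close>

definition th where "th = s / n"
definition al where "al = s / (n - s)"
definition wt where "wt t = (t / G t) powr al"
definition h where "h t = (LINT \<tau>:{0..t}|lborel. wt \<tau>)"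
definition H where "H t = h t powr (1 - th)"

lemma th: "0 < th" "th < 1" and al: "0 < al" "al = th / (1 - th)"
  using s_pos s_less_1 n_ge_1 by (auto simp: th_def al_def field_simps)

lemma conj_H_eq: "conj_H n s G = H"
  using n_ge_1 by (auto simp: conj_H_def H_def h_def wt_def al_def th_def diff_divide_distrib)

lemma wt_pos: "t > 0 \<Longrightarrow> wt t > 0"
  using A_pos[of t] by (simp add: wt_def)

lemma wt_nonneg: "wt t \<ge> 0"
  by (simp add: wt_def)

lemma wt_antimono: "0 < x \<Longrightarrow> x \<le> y \<Longrightarrow> wt y \<le> wt x"
proof -
  assume xy: "0 < x" "x \<le> y"
  have "y / G y \<le> x / G x" using ratio_mono[OF xy] A_pos[of x] A_pos[of y] xy by (simp add: field_simps)
  then show ?thesis unfolding wt_def using al xy by (intro powr_mono2) auto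
qed

lemma wt_measurable [measurable]: "wt \<in> borel_measurable borel"
  unfolding wt_def by measurable

text \<open>Near 0 this is \<open>integrable_zero\<close>; beyond \<open>\<delta>\<close> the weight
  is bounded because it is non-increasing.\<close>

lemma wt_integrable: "set_integrable lborel {0..t} wt"
proof -
  obtain \<delta> where \<delta>: "\<delta> > 0" "(\<integral>\<^sup>+ t\<in>{0..\<delta>}. ennreal ((t / G t) powr (s / (n - s))) \<partial>lborel) < \<infinity>"
    using integrable_zero by auto
  have 1: "set_integrable lborel {0..\<delta>} wt" unfolding set_integrable_def
  proof (rule integrableI_bounded)
    have "(\<integral>\<^sup>+ x. ennreal (norm (indicat_real {0..\<delta>} x *\<^sub>R wt x)) \<partial>lborel) =
       (\<integral>\<^sup>+ t\<in>{0..\<delta>}. ennreal ((t / G t) powr (s / (n - s))) \<partial>lborel)"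
      by (intro nn_integral_cong) (auto simp: wt_def al_def split: split_indicator)
    then show "(\<integral>\<^sup>+ x. ennreal (norm (indicat_real {0..\<delta>} x *\<^sub>R wt x)) \<partial>lborel) < \<infinity>" using \<delta> by simp
  qed simp
  have 2: "set_integrable lborel {\<delta>..t} wt" unfolding set_integrable_def
  proof (rule Bochner_Integration.integrable_bound)
    show "integrable lborel (\<lambda>x. indicator {\<delta>..t} x * wt \<delta>)"
      by (intro integrable_mult_left integrable_real_indicator) (auto simp: emeasure_lborel_Icc_eq)
    show "AE x in lborel. norm (indicat_real {\<delta>..t} x *\<^sub>R wt x) \<le> norm (indicat_real {\<delta>..t} x * wt \<delta>)"
      using \<delta> by (intro AE_I2) (auto simp: wt_nonneg wt_antimono split: split_indicator)
  qed simp
  have "set_integrable lborel ({0..\<delta>} \<union> {\<delta>..t}) wt" by (rule set_integrable_Un[OF 1 2]) auto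
  then show ?thesis by (rule set_integrable_subset) auto
qed

lemma h_diff: assumes "0 \<le> x" "x \<le> y"
  shows "(y - x) * wt y \<le> h y - h x" "0 < x \<Longrightarrow> h y - h x \<le> (y - x) * wt x"
proof -
  have i: "set_integrable lborel {x<..y} wt"
    by (rule set_integrable_subset[OF wt_integrable[of y]]) (use assms in auto)
  have "{0..y} = {0..x} \<union> {x<..y}" using assms by auto
  then have "h y = h x + (LINT \<tau>:{x<..y}|lborel. wt \<tau>)"
    unfolding h_def using wt_integrable[of x] i
    by (simp add: set_integral_Un disjoint_iff)
  moreover have c: "set_integrable lborel {x<..y} (\<lambda>_. c::real)" for c
    unfolding set_integrable_def using assms(2) by (auto intro!: integrable_real_indicator)
  moreover have "(LINT \<tau>:{x<..y}|lborel. c) = (y - x) * c" for c :: real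
    using assms unfolding set_lebesgue_integral_def by simp
  ultimately show "(y - x) * wt y \<le> h y - h x" "0 < x \<Longrightarrow> h y - h x \<le> (y - x) * wt x"
    using set_integral_mono[OF c[of "wt y"] i] set_integral_mono[OF i c[of "wt x"]]
      wt_antimono[of _ y] wt_antimono[of x] assms(1)
    by (simp_all add: greaterThanAtMost_iff)
qed

lemma h_0: "h 0 = 0"
proof -
  have "h 0 = (LINT \<tau>:{0..0}|lborel. wt \<tau>)" by (simp add: h_def)
  also have "\<dots> = 0" unfolding set_lebesgue_integral_def
    by (rule integral_eq_zero_AE) (auto simp: wt_def split: split_indicator)
  finally show ?thesis .
qed

lemma h_strict_mono: assumes "0 \<le> x" "x < y" shows "h x < h y"
proof -
  have "0 < (y - x) * wt y" using assms by (intro mult_pos_pos wt_pos) auto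
  then show ?thesis using h_diff(1)[of x y] assms by linarith
qed

lemma h_mono: "0 \<le> x \<Longrightarrow> x \<le> y \<Longrightarrow> h x \<le> h y"
  using h_strict_mono[of x y] by (cases "x = y") auto

lemma h_pos: "0 < y \<Longrightarrow> 0 < h y"
  using h_strict_mono[of 0 y] h_0 by simp

lemma h_nonneg: "0 \<le> y \<Longrightarrow> 0 \<le> h y"
  using h_pos[of y] h_0 by (cases "y = 0") auto

lemma H_strict_mono: assumes "0 \<le> x" "x < y" shows "H x < H y"
  unfolding H_def using h_strict_mono[OF assms] h_nonneg[OF assms(1)] th
  by (intro powr_less_mono2) auto

lemma H_pos: "0 < y \<Longrightarrow> 0 < H y"
  using h_pos[of y] by (simp add: H_def)

lemma h_continuous: "continuous_on {0<..} h"
proof (rule continuous_at_imp_continuous_on, safe)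
  fix x :: real assume x: "0 < x"
  have *: "\<bar>h z - h x\<bar> \<le> wt (x/2) * \<bar>z - x\<bar>" if z: "z \<ge> x/2" for z
  proof (cases "x \<le> z")
    case True
    have "h z - h x \<le> (z - x) * wt x" using h_diff(2)[of x z] x True by auto
    also have "\<dots> \<le> (z - x) * wt (x/2)" using wt_antimono[of "x/2" x] x True by (intro mult_left_mono) auto
    finally show ?thesis using h_strict_mono[of x z] x True by (cases "x = z") (auto simp: mult.commute)
  next
    case False
    have "h x - h z \<le> (x - z) * wt z" using h_diff(2)[of z x] x z False by auto
    also have "\<dots> \<le> (x - z) * wt (x/2)" using wt_antimono[of "x/2" z] x z False by (intro mult_left_mono) auto
    finally show ?thesis using h_strict_mono[of z x] x z False by (auto simp: mult.commute)
  qed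
  have "((\<lambda>z. h z - h x) \<longlongrightarrow> 0) (at x)"
  proof (rule Lim_null_comparison)
    have "\<forall>\<^sub>F z in at x. x / 2 < z"
      using order_tendstoD(1)[OF tendsto_ident_at[of x UNIV], of "x/2"] x by simp
    then show "\<forall>\<^sub>F z in at x. norm (h z - h x) \<le> wt (x/2) * \<bar>z - x\<bar>"
      by eventually_elim (use * in auto)
    have "((\<lambda>z. wt (x/2) * \<bar>z - x\<bar>) \<longlongrightarrow> wt (x/2) * \<bar>x - x\<bar>) (at x)"
      by (intro tendsto_intros)
    then show "((\<lambda>z. wt (x/2) * \<bar>z - x\<bar>) \<longlongrightarrow> 0) (at x)" by simp
  qed
  then show "isCont h x" by (simp add: isCont_def LIM_zero_iff)
qed

lemma ratio_continuous: "continuous_on {0<..} (\<lambda>y. G y / y)"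
  by (intro continuous_intros continuous_on_subset[OF A_continuous]) auto

lemma ratioH_continuous: "continuous_on {0<..} (\<lambda>y. G y / y * H y)"
  unfolding H_def
  by (intro continuous_on_mult ratio_continuous continuous_on_powr' h_continuous continuous_on_const)
    (simp add: h_nonneg th)

lemma ratio_small: assumes "c > 0" shows "\<exists>y>0. y \<le> 1 \<and> G y / y \<le> c"
proof -
  have "g \<midarrow>0\<rightarrow> 0" using g_isCont[of 0] by (simp add: isCont_def)
  from LIM_D[OF this assms] obtain d where d: "d > 0" "\<And>y. y \<noteq> 0 \<Longrightarrow> \<bar>y\<bar> < d \<Longrightarrow> \<bar>g y\<bar> < c" by auto
  define y where "y = min (d / 2) 1"
  have "y \<noteq> 0" "\<bar>y\<bar> < d" using d(1) by (auto simp: y_def min_def)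
  then have y: "0 < y" "y \<le> 1" "g y < c" using d(1) d(2)[of y] by (auto simp: y_def)
  have "G y / y \<le> g y" using slope[of y] y by (simp add: field_simps)
  then show ?thesis using y by (intro exI[of _ y]) auto
qed

lemma ratio_large: "\<exists>y\<ge>1. G y / y \<ge> c"
proof -
  have "filterlim g at_top at_top" using N by (simp add: N_function_def)
  then have "\<forall>\<^sub>F t in at_top. g t \<ge> 2 * c" by (simp add: filterlim_at_top)
  then obtain t where t: "t \<ge> 1" "g t \<ge> 2 * c"
    using eventually_conj[OF eventually_ge_at_top[of 1]] eventually_happens'[OF trivial_limit_at_top_linorder]
    by (metis (mono_tags, lifting))
  have "c * (2 * t) \<le> t * g t" using t by simp
  also have "\<dots> \<le> G (2 * t) - G t" using A_diff(1)[of t "2*t"] t by simp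
  also have "\<dots> \<le> G (2 * t)" by simp
  finally show ?thesis using t by (intro exI[of _ "2*t"]) (auto simp: field_simps)
qed

text \<open>The continuous quotient \<open>G y / y\<close> is arbitrarily small near 0 and unbounded
  at infinity. Equations of this kind define the comparison values in \<open>hardy\<close>.\<close>

lemma ratio_ex: assumes "c > 0" shows "\<exists>y>0. G y / y = c"
proof -
  obtain a b where "a > 0" "G a / a \<le> c" "b \<ge> 1" "c \<le> G b / b"
    using ratio_small[OF assms] ratio_large[of c] by auto
  then show ?thesis by (intro IVT_pos[of "\<lambda>y. G y / y" a c b] ratio_continuous) auto
qed

lemma H_mono: "0 \<le> x \<Longrightarrow> x \<le> y \<Longrightarrow> H x \<le> H y"
  using H_strict_mono[of x y] by (cases "x = y") auto

lemma ratioH_ex: assumes "c > 0" shows "\<exists>y>0. G y / y * H y = c"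
proof -
  have H1: "H 1 > 0" by (rule H_pos) simp
  obtain a where a: "a > 0" "a \<le> 1" "G a / a \<le> c / H 1" using ratio_small[of "c / H 1"] assms H1 by auto
  obtain b where b: "b \<ge> 1" "c / H 1 \<le> G b / b" using ratio_large[of "c / H 1"] by auto
  have "G a / a * H a \<le> c / H 1 * H 1"
    using a assms H1 H_mono[of a 1] H_pos[of a] by (intro mult_mono) auto
  moreover have "c / H 1 * H 1 \<le> G b / b * H b"
    using b assms H1 H_mono[of 1 b] by (intro mult_mono) auto
  ultimately show ?thesis
    using H1 a b by (intro IVT_pos[of "\<lambda>y. G y / y * H y" a c b] ratioH_continuous) auto
qed

text \<open>The ratio of the geometric sequence is chosen so that \<open>qq powr (1 - th)\<close>
  exceeds the doubling constant; this forces consecutive comparison values in \<open>hardy\<close>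
  to drop at least by half.\<close>

definition qq where "qq = (D2 + 1) powr (1 / (1 - th))"

lemma qq: "qq > 1" "qq powr (1 - th) = D2 + 1"
proof -
  show "qq > 1" unfolding qq_def using D2(1) th by (intro gr_one_powr) auto
  show "qq powr (1 - th) = D2 + 1" unfolding qq_def using D2(1) th by (simp add: powr_powr)
qed

text \<open>A Hardy-type inequality along the geometric sequence \<open>r * qq ^ i\<close>. The comparison values \<open>y\<^sub>i\<close>
  are the extremals of the dual problem of maximising the sum on the left under the constraint.\<close>

lemma hardy:
  fixes x :: "nat \<Rightarrow> real"
  assumes M: "0 < M" "M \<le> M0" and r: "0 < r" and x: "\<And>i. i < k \<Longrightarrow> 0 \<le> x i"
    and sum: "(\<Sum>i<k. r * qq ^ i * G (x i)) \<le> M"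
  shows "\<exists>y>0. (\<Sum>i<k. (r * qq ^ i) powr th * x i) \<le> (2 * M0 powr al + 1) * H y \<and> G y * r \<le> M0 powr al * M"
proof -
  define \<rho> where "\<rho> i = r * qq ^ i" for i
  have \<rho>: "\<rho> i > 0" for i using r qq by (simp add: \<rho>_def)
  \<comment> \<open>The multiplier \<open>\<kappa>\<close> has to satisfy
    \<open>\<kappa> * H y0 = M\<close>, and \<open>G y0 / y0 = \<kappa> / r powr (1 - th)\<close> at
    the first index. Eliminating \<open>\<kappa>\<close> gives this equation.\<close>
  obtain y0 where y0: "y0 > 0" "G y0 / y0 * H y0 = M / r powr (1 - th)"
    using ratioH_ex[of "M / r powr (1 - th)"] M r by auto
  define \<kappa> where "\<kappa> = M / H y0"
  have \<kappa>: "\<kappa> > 0" using M H_pos[OF y0(1)] by (simp add: \<kappa>_def)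
  have "\<exists>y. y > 0 \<and> G y / y = \<kappa> / \<rho> i powr (1 - th)" for i
    using ratio_ex[of "\<kappa> / \<rho> i powr (1 - th)"] \<kappa> \<rho>[of i] by auto
  then obtain y' where y': "\<And>i. y' i > 0" "\<And>i. G (y' i) / y' i = \<kappa> / \<rho> i powr (1 - th)" by metis
  define y where "y i = (if i = 0 then y0 else y' i)" for i
  have "G y0 / y0 = M / r powr (1 - th) / H y0"
    unfolding y0(2)[symmetric] using H_pos[OF y0(1)] by simp
  then have y: "y i > 0" "G (y i) / y i = \<kappa> / \<rho> i powr (1 - th)" for i
    using y' y0(1) by (auto simp: y_def \<kappa>_def \<rho>_def mult.commute)
  \<comment> \<open>Otherwise monotonicity of \<open>G t / t\<close> gives
    \<open>2 * (D2 + 1) * G (y i / 2) \<le> G (y i)\<close>, against the doubling bound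
    \<open>G (y i) \<le> D2 * G (y i / 2)\<close>.\<close>
  have halve: "y (Suc i) \<le> y i / 2" for i
  proof (rule ccontr)
    assume "\<not> ?thesis"
    then have "G (y i / 2) / (y i / 2) \<le> G (y (Suc i)) / y (Suc i)"
      using y[of i] by (intro ratio_mono) auto
    also have "\<dots> = G (y i) / y i / (D2 + 1)"
      unfolding y(2) using r qq by (simp add: \<rho>_def powr_mult field_simps)
    finally have "G (y i / 2) / (y i / 2) * (y i * (D2 + 1)) \<le> G (y i) / y i / (D2 + 1) * (y i * (D2 + 1))"
      using y(1)[of i] D2(1) by (intro mult_right_mono) auto
    then have "G (y i / 2) * (2 * D2 + 2) \<le> G (y i)"
      using y(1)[of i] D2(1) by simp
    then have "2 * G (y i / 2) * (D2 + 1) \<le> G (y i)" by (simp add: algebra_simps)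
    moreover have "G (y i) \<le> D2 * G (y i / 2)" using D2(2)[of "y i / 2"] by simp
    moreover have "0 \<le> D2 * G (y i / 2)" using D2(1) by simp
    ultimately show False using A_pos[of "y i / 2"] y(1)[of i] by (simp add: algebra_simps)
  qed
  \<comment> \<open>Since \<open>wt\<close> is non-increasing, half of each term is at most the
    integral of \<open>wt\<close> from \<open>y i / 2\<close> to \<open>y i\<close>. By
    \<open>halve\<close> these intervals do not overlap.\<close>
  have tele: "(\<Sum>i<k. y i * wt (y i)) \<le> 2 * (h (y 0) - h (y k))" for k
  proof (induction k)
    case (Suc k)
    have "(y k - y k / 2) * wt (y k) \<le> h (y k) - h (y k / 2)" using y(1)[of k] by (intro h_diff) auto
    moreover have "h (y (Suc k)) \<le> h (y k / 2)"
      using halve[of k] y(1)[of "Suc k"] by (intro h_mono) auto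
    ultimately show ?case using Suc by simp
  qed simp
  have wty: "\<rho> i powr th = \<kappa> powr al * wt (y i)" for i
  proof -
    have "y i / G (y i) = \<rho> i powr (1 - th) / \<kappa>"
      using y(2)[of i] y(1)[of i] \<rho>[of i] \<kappa> A_pos[of "y i"] by (simp add: field_simps)
    then have "wt (y i) = \<rho> i powr ((1 - th) * al) / \<kappa> powr al"
      unfolding wt_def using \<kappa> by (simp add: powr_divide powr_powr)
    then show ?thesis using th al \<kappa> by simp
  qed
  have H0: "H y0 > 0" using y0 H_pos by simp
  have h0: "h y0 = H y0 powr (1 + al)"
    using h_pos[OF y0(1)] th al(2) by (simp add: H_def powr_powr field_simps)
  \<comment> \<open>Term by term: a value \<open>x i \<le> y i\<close> is paid for by the comparison
    value; for a larger one, \<open>G (x i) / x i\<close> exceeds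
    \<open>\<kappa> / \<rho> i powr (1 - th)\<close>, and the term is paid for by the constraint
    divided by \<open>\<kappa>\<close>.\<close>
  have "(\<Sum>i<k. \<rho> i powr th * x i) \<le> (\<Sum>i<k. \<kappa> powr al * (y i * wt (y i)) + \<rho> i * G (x i) / \<kappa>)"
  proof (rule sum_mono)
    fix i assume i: "i \<in> {..<k}"
    show "\<rho> i powr th * x i \<le> \<kappa> powr al * (y i * wt (y i)) + \<rho> i * G (x i) / \<kappa>"
    proof (cases "x i \<le> y i")
      case True
      then have "\<rho> i powr th * x i \<le> \<rho> i powr th * y i" by (intro mult_left_mono) auto
      moreover have "0 \<le> \<rho> i * G (x i) / \<kappa>" using \<rho>[of i] \<kappa> by simp
      ultimately show ?thesis by (simp add: wty mult_ac)
    next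
      case False
      then have "\<kappa> / \<rho> i powr (1 - th) \<le> G (x i) / x i"
        using ratio_mono[of "y i" "x i"] y[of i] by auto
      then have "\<kappa> * x i \<le> G (x i) * \<rho> i powr (1 - th)"
        using False y(1)[of i] \<rho>[of i] by (simp add: field_simps)
      then have "\<rho> i powr th * (\<kappa> * x i) \<le> \<rho> i powr th * (G (x i) * \<rho> i powr (1 - th))"
        by (intro mult_left_mono) auto
      also have "\<dots> = \<rho> i * G (x i)"
        using \<rho>[of i] powr_add[of "\<rho> i" th "1 - th"] by (simp add: mult_ac)
      finally have "\<rho> i powr th * x i \<le> \<rho> i * G (x i) / \<kappa>" using \<kappa> by (simp add: field_simps)
      moreover have "0 \<le> \<kappa> powr al * (y i * wt (y i))" using y(1)[of i] wt_nonneg by simp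
      ultimately show ?thesis by linarith
    qed
  qed
  also have "\<dots> = \<kappa> powr al * (\<Sum>i<k. y i * wt (y i)) + (\<Sum>i<k. \<rho> i * G (x i)) / \<kappa>"
    by (simp add: sum.distrib sum_distrib_left sum_divide_distrib)
  also have "\<dots> \<le> \<kappa> powr al * (2 * h y0) + M / \<kappa>"
  proof (intro add_mono mult_left_mono divide_right_mono)
    show "(\<Sum>i<k. y i * wt (y i)) \<le> 2 * h y0"
      using tele[of k] h_nonneg[of "y k"] y(1)[of k] by (simp add: y_def)
    show "(\<Sum>i<k. \<rho> i * G (x i)) \<le> M" using sum by (simp add: \<rho>_def)
  qed (use \<kappa> in auto)
  \<comment> \<open>With \<open>\<kappa> = M / H y0\<close> and
    \<open>h y0 = H y0 powr (1 + al)\<close>, both summands become multiples of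
    \<open>H y0\<close>.\<close>
  also have "\<dots> = (2 * M powr al + 1) * H y0"
    using M H0 unfolding h0 \<kappa>_def by (simp add: powr_divide powr_add field_simps)
  also have "\<dots> \<le> (2 * M0 powr al + 1) * H y0"
    using M H0 al by (intro mult_right_mono add_right_mono mult_left_mono powr_mono2) auto
  finally have 1: "(\<Sum>i<k. \<rho> i powr th * x i) \<le> (2 * M0 powr al + 1) * H y0" .
  \<comment> \<open>The second claim: this bounds \<open>H y0\<close> below by
    \<open>(y0 / G y0) powr th\<close>. Inserted into the equation for \<open>y0\<close>, it leaves
    a bound for \<open>G y0 powr (1 - th)\<close>, and raising to the power \<open>1 + al\<close>
    removes the exponent.\<close>
  have "y0 * wt y0 \<le> h y0" using h_diff(1)[of 0 y0] y0 h_0 by simp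
  then have "(y0 * wt y0) powr (1 - th) \<le> H y0" unfolding H_def
    using y0 wt_nonneg th by (intro powr_mono2) auto
  moreover have "(y0 * wt y0) powr (1 - th) = y0 / G y0 powr th"
  proof -
    have "(y0 * wt y0) powr (1 - th) = y0 powr (1 - th) * (y0 / G y0) powr (al * (1 - th))"
      using y0 wt_nonneg by (simp add: powr_mult wt_def powr_powr)
    also have "al * (1 - th) = th" using al th by simp
    finally show ?thesis using y0 A_pos[of y0] by (simp add: powr_divide flip: powr_add)
  qed
  ultimately have "y0 / G y0 powr th \<le> H y0" by simp
  then have "G y0 / y0 * (y0 / G y0 powr th) \<le> G y0 / y0 * H y0"
    using y0 by (intro mult_left_mono) auto
  also have "\<dots> = M / r powr (1 - th)" by (rule y0)
  finally have "G y0 powr (1 - th) \<le> M / r powr (1 - th)"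
    using y0 A_pos[of y0] by (simp add: powr_diff)
  then have "(G y0 powr (1 - th)) powr (1 + al) \<le> (M / r powr (1 - th)) powr (1 + al)"
    using al by (intro powr_mono2) auto
  moreover have e: "(1 - th) * (1 + al) = 1" using th al(2) by (simp add: field_simps)
  ultimately have "G y0 \<le> M powr (1 + al) / r"
    using M r A_pos[of y0] y0 by (simp add: powr_powr powr_divide)
  also have "\<dots> = M powr al * M / r" using M by (simp add: powr_add)
  also have "\<dots> \<le> M0 powr al * M / r" using M r al by (intro divide_right_mono mult_right_mono powr_mono2) auto
  finally have "G y0 * r \<le> M0 powr al * M" using r by (simp add: field_simps)
  then show ?thesis using 1 y0 by (intro exI[of _ y0]) (auto simp: \<rho>_def)
qed

lemma sobolev_conjugate_H: "0 \<le> y \<Longrightarrow> sobolev_conjugate n s G (H y) = G y"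
proof -
  assume y: "0 \<le> y"
  have "inj_on H {0..}" using H_strict_mono by (intro linorder_inj_onI) fastforce+
  then have "the_inv_into {0..} H \<bar>H y\<bar> = y"
    using y by (subst abs_of_nonneg) (auto simp: the_inv_into_f_f, simp add: H_def)
  then show ?thesis by (simp add: sobolev_conjugate_def conj_H_eq)
qed


end

context orlicz_sobolev
begin

text \<open>Levels chosen by the measure of the superlevel sets turn the modular bound into the hypothesis of
  the Hardy-type inequality.\<close>

lemma weak_type:
  assumes n: "n = real DIM('a)" and M0: "0 < M0"
  shows "\<exists>C>0. \<forall>(v :: 'a::euclidean_space \<Rightarrow> real) M L m. v \<in> borel_measurable lebesgue \<longrightarrow> (\<forall>x. 0 \<le> v x) \<longrightarrow>
    emeasure lebesgue {x. 0 < v x} < \<infinity> \<longrightarrow> rho_s s G v \<le> ennreal M \<longrightarrow> 0 < M \<longrightarrow> M \<le> M0 \<longrightarrow>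
    0 < L \<longrightarrow> 0 < m \<longrightarrow> m \<le> measure lebesgue {x. L \<le> v x} \<longrightarrow> (\<exists>y>0. L \<le> C * H y \<and> G y * m \<le> C * M)"
proof -
  define om where "om = unit_ball_vol (real DIM('a)) / 2"
  have om: "om > 0" by (simp add: om_def)
  have thn: "th = s / real DIM('a)" unfolding th_def by (simp only: n)
  define Mt where "Mt = M0 / om"
  \<comment> \<open>The entries are the two constants of \<open>hardy\<close>: the first with the
    normalising factor contained in \<open>x i\<close> below, the second with the factor
    \<open>qq\<close> by which \<open>m\<close> may exceed \<open>r N\<close>.\<close>
  define C where "C = max ((2 * Mt powr al + 1) * (qq / om) powr th) (Mt powr al * qq / om)"
  have Mt: "Mt > 0" using M0 om by (simp add: Mt_def)
  have C: "C > 0" unfolding C_def using Mt om qq(1) by (simp add: less_max_iff_disj)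
  have "\<exists>y>0. L \<le> C * H y \<and> G y * m \<le> C * M"
    if v: "v \<in> borel_measurable lebesgue" and v0: "\<And>x. 0 \<le> v x" and fin: "emeasure lebesgue {x. 0 < v x} < \<infinity>"
      and rho: "rho_s s G v \<le> ennreal M" and M: "0 < M" "M \<le> M0" and L: "0 < L" and m: "0 < m" "m \<le> measure lebesgue {x. L \<le> v x}"
    for v :: "'a \<Rightarrow> real" and M L m
  proof -
    note [measurable] = v
    have gt: "{x. t < v x} \<in> sets lebesgue" and ge: "{x. t \<le> v x} \<in> sets lebesgue" for t
      using borel_measurable_le[OF borel_measurable_const v, of t] borel_measurable_less[OF borel_measurable_const v, of t]
      by auto
    define D where "D t = measure lebesgue {x. t < v x}" for t
    have fm: "{x. t < v x} \<in> fmeasurable lebesgue" if "t \<ge> 0" for t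
      using fin that gt[of 0] by (intro fmeasurableI2[OF _ _ gt[of t], of "{x. 0 < v x}"]) (auto simp: fmeasurable_def)
    have D_mono: "D b \<le> D a" if "0 \<le> a" "a \<le> b" for a b
      unfolding D_def using that by (intro measure_mono_fmeasurable fm gt) auto
    have mD: "m \<le> D t" if "0 \<le> t" "t < L" for t
      using m(2) measure_mono_fmeasurable[OF _ ge fm[OF that(1)], of L] that unfolding D_def by force
    \<comment> \<open>Prescribed measures of superlevel sets, descending geometrically from the
      measure of the set where \<open>v\<close> is positive.\<close>
    define r where "r j = D 0 / qq ^ j" for j :: nat
    have D0: "0 < D 0" using mD[of 0] m L by simp
    have r: "r j > 0" for j using D0 qq by (simp add: r_def)
    have rSuc: "r j = qq * r (Suc j)" for j using qq by (simp add: r_def)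
    have Dlim: "(\<lambda>k. D (real k)) \<longlonglongrightarrow> 0"
    proof -
      have "(\<lambda>k. measure lebesgue {x. real k < v x}) \<longlonglongrightarrow> measure lebesgue (\<Inter>k. {x. real k < v x})"
      proof (rule Lim_measure_decseq)
        show "range (\<lambda>k. {x. real k < v x}) \<subseteq> sets lebesgue" using gt by auto
        show "decseq (\<lambda>k. {x. real k < v x})" by (auto simp: decseq_def)
        show "emeasure lebesgue {x. real k < v x} \<noteq> \<infinity>" for k using fm[of "real k"] by (auto simp: fmeasurable_def)
      qed
      moreover have "(\<Inter>k. {x. real k < v x}) = {}"
      proof safe
        fix x assume "x \<in> (\<Inter>k. {x. real k < v x})"
        moreover obtain k where "v x < real k" using reals_Archimedean2[of "v x"] by blast
        ultimately have False by (auto dest: less_asym)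
        then show "x \<in> {}" ..
      qed
      ultimately show ?thesis by (simp add: D_def)
    qed
    \<comment> \<open>The infimum \<open>l j\<close> of this set is the generalised inverse of the
      distribution function \<open>D\<close> at \<open>r j\<close>. Its two one-sided properties are
      \<open>Dl\<close>, for the open superlevel set, and \<open>Pl\<close>, for the closed
      one.\<close>
    define S where "S j = {t. 0 \<le> t \<and> D t \<le> r j}" for j
    define l where "l j = Inf (S j)" for j
    have S_ne: "S j \<noteq> {}" for j
    proof -
      obtain k where "D (real k) < r j"
        using order_tendstoD(2)[OF Dlim r[of j]] by (auto simp: eventually_sequentially)
      then show ?thesis by (auto simp: S_def intro!: exI[of _ "real k"])
    qed
    have S_bdd: "bdd_below (S j)" for j by (auto simp: S_def intro!: bdd_belowI[of _ 0])
    have l_nonneg: "l j \<ge> 0" for j unfolding l_def by (rule cInf_greatest[OF S_ne]) (auto simp: S_def)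
    have l0: "l 0 = 0"
      using cInf_lower[OF _ S_bdd, of 0 0] l_nonneg[of 0] by (auto simp: l_def S_def r_def)
    have l_mono: "l j \<le> l (Suc j)" for j
    proof -
      have "S (Suc j) \<subseteq> S j" using rSuc[of j] r[of "Suc j"] qq
        by (auto simp: S_def) (smt (verit) mult_le_cancel_right1)
      then show ?thesis unfolding l_def by (intro cInf_superset_mono S_ne S_bdd)
    qed
    have above: "D t \<le> r j" if lt: "l j < t" for j t
    proof -
      obtain t' where "t' \<in> S j" "t' < t"
        using cInf_lessD[OF S_ne lt[unfolded l_def]] by blast
      then show ?thesis using D_mono[of t' t] by (auto simp: S_def)
    qed
    have Dl: "D (l j) \<le> r j" for j
    proof -
      have "(\<lambda>k. measure lebesgue {x. l j + 1 / real (Suc k) < v x}) \<longlonglongrightarrow>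
          measure lebesgue (\<Union>k. {x. l j + 1 / real (Suc k) < v x})"
      proof (rule Lim_measure_incseq)
        show "range (\<lambda>k. {x. l j + 1 / real (Suc k) < v x}) \<subseteq> sets lebesgue" using gt by auto
        show "incseq (\<lambda>k. {x. l j + 1 / real (Suc k) < v x})"
        proof (rule incseq_SucI, rule Collect_mono, rule impI)
          fix k x assume "l j + 1 / real (Suc k) < v x"
          moreover have "1 / real (Suc (Suc k)) \<le> 1 / real (Suc k)" by (intro divide_left_mono) auto
          ultimately show "l j + 1 / real (Suc (Suc k)) < v x" by linarith
        qed
        have "0 < v x" if "l j + 1 / real (Suc k) < v x" for k x
        proof -
          have "0 \<le> 1 / real (Suc k)" by simp
          then show ?thesis using l_nonneg[of j] that by linarith
        qed
        then have "emeasure lebesgue (\<Union>k. {x. l j + 1 / real (Suc k) < v x}) \<le> emeasure lebesgue {x. 0 < v x}"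
          by (intro emeasure_mono gt) blast
        then show "emeasure lebesgue (\<Union>k. {x. l j + 1 / real (Suc k) < v x}) \<noteq> \<infinity>" using fin by (simp add: top_unique)
      qed
      moreover have "(\<Union>k. {x. l j + 1 / real (Suc k) < v x}) = {x. l j < v x}"
      proof (intro equalityI subsetI)
        fix x assume "x \<in> {x. l j < v x}"
        then obtain k where "inverse (real (Suc k)) < v x - l j" using reals_Archimedean[of "v x - l j"] by auto
        then show "x \<in> (\<Union>k. {x. l j + 1 / real (Suc k) < v x})" by (auto simp: inverse_eq_divide intro!: exI[of _ k])
      next
        fix x assume "x \<in> (\<Union>k. {x. l j + 1 / real (Suc k) < v x})"
        then obtain k where "l j + 1 / real (Suc k) < v x" by auto
        moreover have "0 < 1 / real (Suc k)" by simp
        ultimately have "l j < v x" by linarith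
        then show "x \<in> {x. l j < v x}" by simp
      qed
      ultimately have "(\<lambda>k. D (l j + 1 / real (Suc k))) \<longlonglongrightarrow> D (l j)" by (simp add: D_def)
      then show ?thesis by (rule LIMSEQ_le_const2) (use above in auto)
    qed
    \<comment> \<open>Nonnegative levels below \<open>l j\<close> are not in \<open>S j\<close>, so
      their superlevel sets have measure above \<open>r j\<close>; they decrease to the closed
      superlevel set. A positive \<open>l j\<close> leaves room for such levels.\<close>
    have Pl: "ennreal (r j) \<le> emeasure lebesgue {x. l j \<le> v x}" if "l j > 0" for j
    proof -
      define t where "t k = l j - l j / real (Suc (Suc k))" for k
      have t: "0 \<le> t k" "t k < l j" for k
        using that by (auto simp: t_def field_simps)
      have "D (t k) \<ge> r j" for k
      proof (rule ccontr)
        assume "\<not> ?thesis"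
        then have "t k \<in> S j" using t by (auto simp: S_def)
        then show False using cInf_lower[OF _ S_bdd] t(2)[of k] unfolding l_def by force
      qed
      moreover have "(\<lambda>k. D (t k)) \<longlonglongrightarrow> measure lebesgue (\<Inter>k. {x. t k < v x})" unfolding D_def
      proof (rule Lim_measure_decseq)
        show "range (\<lambda>k. {x. t k < v x}) \<subseteq> sets lebesgue" using gt by auto
        show "decseq (\<lambda>k. {x. t k < v x})"
        proof (rule decseq_SucI, rule Collect_mono, rule impI)
          fix k x assume "t (Suc k) < v x"
          moreover have "l j / real (Suc (Suc (Suc k))) \<le> l j / real (Suc (Suc k))"
            using that by (intro divide_left_mono) auto
          ultimately show "t k < v x" by (simp add: t_def)
        qed
        show "emeasure lebesgue {x. t k < v x} \<noteq> \<infinity>" for k using fm[OF t(1)[of k]] by (auto simp: fmeasurable_def)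
      qed
      moreover have "(\<Inter>k. {x. t k < v x}) = {x. l j \<le> v x}"
      proof (intro equalityI subsetI)
        fix x assume x: "x \<in> (\<Inter>k. {x. t k < v x})"
        have "t \<longlonglongrightarrow> l j - 0" unfolding t_def
          by (intro tendsto_intros LIMSEQ_Suc[OF LIMSEQ_Suc[OF lim_const_over_n]])
        then have "l j - 0 \<le> v x" by (rule LIMSEQ_le_const2) (use x in \<open>auto intro!: exI[of _ 0] less_imp_le\<close>)
        then show "x \<in> {x. l j \<le> v x}" by simp
      qed (use t in \<open>auto intro: order.strict_trans2\<close>)
      ultimately have "r j \<le> measure lebesgue {x. l j \<le> v x}"
        by (metis (no_types, lifting) LIMSEQ_le_const)
      then have "ennreal (r j) \<le> ennreal (measure lebesgue {x. l j \<le> v x})" by (rule ennreal_leI)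
      also have "\<dots> \<le> emeasure lebesgue {x. l j \<le> v x}"
        by (cases "emeasure lebesgue {x. l j \<le> v x} = \<infinity>") (simp_all add: emeasure_eq_ennreal_measure del: emeasure_completion)
      finally show ?thesis .
    qed
    have "\<exists>N. r N < m"
      using real_arch_pow[OF qq(1), of "D 0 / m"] m qq by (auto simp: r_def field_simps)
    \<comment> \<open>Stops at the right scale: \<open>D (l N) \<le> r N < m\<close> forces
      \<open>L \<le> l N\<close>, while minimality gives \<open>m \<le> qq * r N\<close>.\<close>
    define N where "N = (LEAST N. r N < m)"
    have N: "r N < m" unfolding N_def using \<open>\<exists>N. r N < m\<close> by (rule LeastI_ex)
    have N0: "N \<noteq> 0"
    proof
      assume "N = 0"
      then show False using N mD[of 0] L by (simp add: r_def)
    qed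
    have mN: "m \<le> qq * r N"
      using not_less_Least[of "N - 1" "\<lambda>N. r N < m"] N0 rSuc[of "N - 1"] by (auto simp: N_def[symmetric])
    have LN: "L \<le> l N"
      using mD[of "l N"] l_nonneg[of N] Dl[of N] N by force
    define d where "d j = l (Suc j) - l j" for j
    have d: "d j \<ge> 0" for j using l_mono by (simp add: d_def)
    define w where "w j x = clip (l j) (d j) (v x)" for j x
    have w: "w j \<in> borel_measurable lebesgue" for j unfolding w_def clip_def by measurable
    have "(\<Sum>j<N. rho_s s G (w j)) \<le> rho_s s G v"
      by (rule rho_s_sum_le) (use w v clip_sum_abs[of l, OF l_mono] in \<open>auto simp: w_def d_def\<close>)
    then have sumrho: "(\<Sum>j<N. rho_s s G (w j)) \<le> ennreal M" using rho by (rule order.trans)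
    \<comment> \<open>The slice increases by its full height \<open>d j\<close> from the complement
      of \<open>{x. l j < v x}\<close>, a set of measure at most \<open>r j\<close>, to
      \<open>{x. l (Suc j) \<le> v x}\<close>, of measure at least \<open>r (Suc j)\<close>. For
      \<open>d j = 0\<close> the left side is 0.\<close>
    have low: "ennreal (r (Suc j) * (om * G (d j * (om / (qq * r (Suc j))) powr th))) \<le> rho_s s G (w j)" for j
    proof (cases "d j = 0")
      case False
      then have dj: "d j > 0" using d[of j] by simp
      then have lj: "l (Suc j) > 0" using l_nonneg[of j] by (simp add: d_def)
      have "ennreal (r (Suc j) * (om * G (d j * (om / (qq * r (Suc j))) powr th))) =
          ennreal (r (Suc j)) * ennreal (om * G (d j * (om / r j) powr (s / DIM('a))))"
        using r[of "Suc j"] om by (subst ennreal_mult) (auto simp: rSuc[of j] thn)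
      also have "\<dots> \<le> emeasure lebesgue {x. l (Suc j) \<le> v x} * ennreal (om * G (d j * (om / r j) powr (s / DIM('a))))"
        by (intro mult_right_mono Pl lj) auto
      also have "\<dots> \<le> rho_s s G (w j)" unfolding om_def
      proof (rule rho_s_lower[OF w ge gt r])
        show "emeasure lebesgue {x. l j < v x} \<le> ennreal (r j)"
          using fm[OF l_nonneg[of j]] Dl[of j] unfolding D_def
          by (simp add: emeasure_eq_measure2 ennreal_leI del: emeasure_completion)
        show "d j \<le> \<bar>w j x - w j y\<bar>" if "x \<in> {x. l (Suc j) \<le> v x}" "y \<notin> {x. l j < v x}" for x y
          using that d[of j] by (auto simp: w_def clip_def d_def)
      qed (use d in auto)
      finally show ?thesis .
    qed simp
    have "ennreal (\<Sum>j<N. r (Suc j) * (om * G (d j * (om / (qq * r (Suc j))) powr th))) \<le> (\<Sum>j<N. rho_s s G (w j))"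
    proof (subst sum_ennreal[symmetric])
      show "0 \<le> r (Suc j) * (om * G (d j * (om / (qq * r (Suc j))) powr th))" for j
        using r[of "Suc j"] om by simp
    qed (intro sum_mono low)
    then have "ennreal (\<Sum>j<N. r (Suc j) * (om * G (d j * (om / (qq * r (Suc j))) powr th))) \<le> ennreal M"
      using sumrho by (rule order.trans)
    then have "(\<Sum>j<N. r (Suc j) * (om * G (d j * (om / (qq * r (Suc j))) powr th))) \<le> M"
      using M by (simp add: ennreal_le_iff)
    then have "(\<Sum>j<N. r (Suc j) * G (d j * (om / (qq * r (Suc j))) powr th)) * om \<le> M"
      by (simp add: sum_distrib_left sum_distrib_right mult_ac)
    then have sum1: "(\<Sum>j<N. r (Suc j) * G (d j * (om / (qq * r (Suc j))) powr th)) \<le> M / om"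
      using om by (simp add: field_simps)
    \<comment> \<open>\<open>hardy\<close> runs along increasing measures, so the order is reversed:
      index \<open>i\<close> belongs to the slice \<open>j = N - Suc i\<close>, whose measure
      \<open>r (Suc j)\<close> is \<open>r N * qq ^ i\<close>.\<close>
    define x where "x i = d (N - Suc i) * (om / (qq * r (N - i))) powr th" for i
    have rN: "r (N - i) = r N * qq ^ i" if "i \<le> N" for i
      using qq that by (simp add: r_def power_diff)
    have "(\<Sum>i<N. r N * qq ^ i * G (x i)) = (\<Sum>j<N. r (Suc j) * G (d j * (om / (qq * r (Suc j))) powr th))"
      by (rule sum.reindex_bij_witness[of _ "\<lambda>j. N - Suc j" "\<lambda>i. N - Suc i"]) (auto simp: x_def Suc_diff_Suc rN)
    with sum1 have "(\<Sum>i<N. r N * qq ^ i * G (x i)) \<le> M / om" by simp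
    moreover have "0 < M / om" "M / om \<le> Mt" using M om by (auto simp: Mt_def divide_right_mono)
    moreover have "0 \<le> x i" for i using d by (simp add: x_def)
    ultimately obtain y where y: "y > 0" "(\<Sum>i<N. (r N * qq ^ i) powr th * x i) \<le> (2 * Mt powr al + 1) * H y"
        "G y * r N \<le> Mt powr al * (M / om)"
      using hardy[of "M / om" Mt "r N" N x] r by blast
    \<comment> \<open>The weight in \<open>hardy\<close> cancels the power of
      \<open>r (N - i)\<close> inside \<open>x i\<close>. What is left is a constant times the sum
      of the slice heights, which telescopes to \<open>l N\<close> because
      \<open>l 0 = 0\<close>.\<close>
    have "(\<Sum>i<N. (r N * qq ^ i) powr th * x i) = (\<Sum>i<N. d (N - Suc i) * (om / qq) powr th)"
    proof (rule sum.cong[OF refl])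
      fix i assume "i \<in> {..<N}"
      then have "(r N * qq ^ i) powr th = r (N - i) powr th" using rN[of i] by simp
      then show "(r N * qq ^ i) powr th * x i = d (N - Suc i) * (om / qq) powr th"
        using r[of "N - i"] om qq by (simp add: x_def powr_divide powr_mult)
    qed
    also have "\<dots> = (\<Sum>j<N. d j) * (om / qq) powr th"
      by (simp add: sum_distrib_right[symmetric] sum.nat_diff_reindex)
    also have "(\<Sum>j<N. d j) = l N" unfolding d_def by (simp add: sum_lessThan_telescope l0)
    finally have "l N * (om / qq) powr th \<le> (2 * Mt powr al + 1) * H y" using y by simp
    then have "l N * (om / qq) powr th * (qq / om) powr th \<le> (2 * Mt powr al + 1) * H y * (qq / om) powr th"
      by (intro mult_right_mono) auto
    moreover have "(om / qq) powr th * (qq / om) powr th = 1"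
      using om qq by (simp flip: powr_mult)
    ultimately have "l N \<le> (2 * Mt powr al + 1) * (qq / om) powr th * H y" by (simp add: mult_ac)
    also have "\<dots> \<le> C * H y" using H_pos[OF y(1)] by (intro mult_right_mono) (auto simp: C_def)
    finally have 1: "L \<le> C * H y" using LN by simp
    have "G y * m \<le> G y * (qq * r N)" using mN by (intro mult_left_mono) auto
    also have "\<dots> = qq * (G y * r N)" by simp
    also have "\<dots> \<le> qq * (Mt powr al * (M / om))" using y qq by (intro mult_left_mono) auto
    also have "\<dots> = Mt powr al * qq / om * M" by simp
    also have "\<dots> \<le> C * M" using M by (intro mult_right_mono) (auto simp: C_def)
    finally show ?thesis using 1 y by blast
  qed
  with C show ?thesis by blast
qed

text \<open>Chebyshev's inequality for the modular.\<close>

lemma W_superlevel: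
  assumes u: "u \<in> W s G" and t: "t > 0"
  shows "emeasure lebesgue {x. t \<le> \<bar>u x\<bar>} < \<infinity>" "{x. t \<le> \<bar>u x\<bar>} \<in> sets lebesgue"
proof -
  note [measurable] = W_measurable[OF u]
  have "(\<lambda>x. \<bar>u x\<bar>) \<in> borel_measurable lebesgue" by measurable
  from borel_measurable_le[OF borel_measurable_const this, of t]
  show m: "{x. t \<le> \<bar>u x\<bar>} \<in> sets lebesgue" by simp
  have "emeasure lebesgue {x. t \<le> \<bar>u x\<bar>} = (\<integral>\<^sup>+ x. indicator {x. t \<le> \<bar>u x\<bar>} x \<partial>lebesgue)"
    by (rule nn_integral_indicator[OF m, symmetric])
  also have "\<dots> \<le> (\<integral>\<^sup>+ x. ennreal (G (u x) / G t) \<partial>lebesgue)"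
  proof (rule nn_integral_mono)
    fix x
    show "indicator {x. t \<le> \<bar>u x\<bar>} x \<le> ennreal (G (u x) / G t)"
      using A_mono[of t "u x"] A_pos[of t] t
      by (auto split: split_indicator simp: field_simps simp flip: ennreal_1 intro!: ennreal_leI)
  qed
  also have "\<dots> < \<infinity>"
  proof -
    have "integrable lebesgue (\<lambda>x. G (u x) / G t)" using W_integrable[OF u] by simp
    then show ?thesis by (subst nn_integral_eq_integral) auto
  qed
  finally show "emeasure lebesgue {x. t \<le> \<bar>u x\<bar>} < \<infinity>" .
qed

text \<open>Maz'ya truncation: the weak-type bound for the dyadic slices of \<open>\<bar>u\<bar>\<close> sums up to a strong one.\<close>

theorem sobolev_embedding:
  fixes u :: "'a::euclidean_space \<Rightarrow> real"
  assumes n: "n = real DIM('a)" and u: "u \<in> W s G" and B: "N_function B b"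
    and small: "ess_smaller B (sobolev_conjugate n s G)"
    and \<Omega>: "\<Omega> \<in> sets lebesgue" "emeasure lebesgue \<Omega> < \<infinity>"
  shows "(\<integral>\<^sup>+ x. ennreal (B (u x)) * indicator \<Omega> x \<partial>lebesgue) < \<infinity>"
proof -
  interpret B: nfun B b by unfold_locales (rule B)
  note [measurable] = W_measurable[OF u] \<Omega>(1)
  define v where "v k x = clip (2 ^ k) (2 ^ k) \<bar>u x\<bar>" for k :: nat and x
  have v: "v k \<in> borel_measurable lebesgue" for k unfolding v_def clip_def by measurable
  define R where "R = Phi u"
  have R: "R \<ge> 0" by (simp add: R_def Phi_nonneg)
  have sum_rho: "(\<Sum>k<K. rho_s s G (v k)) \<le> ennreal R" for K
  proof -
    have "(\<Sum>k<K. rho_s s G (v k)) \<le> rho_s s G u"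
    proof (rule rho_s_sum_le)
      fix x y
      have "(\<Sum>k<K. \<bar>v k x - v k y\<bar>) \<le> \<bar>\<bar>u x\<bar> - \<bar>u y\<bar>\<bar>"
        using clip_sum_abs[where l = "\<lambda>k. 2 ^ k" and N = K and a = "\<bar>u x\<bar>" and b = "\<bar>u y\<bar>"] by (simp add: v_def)
      then show "(\<Sum>k<K. \<bar>v k x - v k y\<bar>) \<le> \<bar>u x - u y\<bar>" by linarith
    qed (use v u in \<open>auto simp: W_iff\<close>)
    then show ?thesis using rho_s_Phi[OF u] by (simp add: R_def)
  qed
  have fin: "rho_s s G (v k) < \<infinity>" for k
  proof -
    have "rho_s s G (v k) \<le> (\<Sum>k<Suc k. rho_s s G (v k))" by (rule member_le_sum) auto
    also have "\<dots> \<le> ennreal R" by (rule sum_rho)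
    finally show ?thesis using order.strict_trans1 by (metis ennreal_less_top infinity_ennreal_def)
  qed
  define a where "a k = enn2real (rho_s s G (v k))" for k
  have a: "rho_s s G (v k) = ennreal (a k)" "a k \<ge> 0" for k
    using fin[of k] by (auto simp: a_def)
  have sum_a: "(\<Sum>k<K. a k) \<le> R" for K
    using sum_rho[of K] a R by (simp add: ennreal_le_iff)
  \<comment> \<open>The weak-type bound asks for strictly positive moduli; the added geometric term
    provides this and keeps the series summable.\<close>
  define M where "M k = a k + (1 / 2) ^ k" for k
  have sM: "summable M" unfolding M_def
    by (intro summable_add summable_geometric summableI_nonneg_bounded[OF a(2) sum_a]) auto
  have M: "0 < M k" "M k \<le> R + 1" "rho_s s G (v k) \<le> ennreal (M k)" for k
  proof -
    have "a k \<le> (\<Sum>k<Suc k. a k)" by (rule member_le_sum) (auto simp: a)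
    also have "\<dots> \<le> R" by (rule sum_a)
    finally have "a k \<le> R" .
    moreover have "(1 / 2) ^ k \<le> (1 :: real)" by (simp add: power_le_one)
    ultimately show "M k \<le> R + 1" by (simp add: M_def)
    show "0 < M k" using a(2)[of k] by (simp add: M_def add_nonneg_pos)
    show "rho_s s G (v k) \<le> ennreal (M k)" unfolding a by (intro ennreal_leI) (simp add: M_def)
  qed
  define E where "E k = {x. 2 ^ Suc k \<le> \<bar>u x\<bar>}" for k :: nat
  have E: "E k \<in> sets lebesgue" "emeasure lebesgue (E k) < \<infinity>" for k
    using W_superlevel[OF u, of "2 ^ Suc k"] by (auto simp: E_def)
  obtain C where C: "C > 0" and weak: "\<And>v L m M. v \<in> borel_measurable lebesgue \<Longrightarrow> (\<forall>x::'a. 0 \<le> v x) \<Longrightarrow>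
    emeasure lebesgue {x. 0 < v x} < \<infinity> \<Longrightarrow> rho_s s G v \<le> ennreal M \<Longrightarrow> 0 < M \<Longrightarrow> M \<le> R + 1 \<Longrightarrow>
    0 < L \<Longrightarrow> 0 < m \<Longrightarrow> m \<le> measure lebesgue {x. L \<le> v x} \<Longrightarrow> \<exists>y>0. L \<le> C * H y \<and> G y * m \<le> C * M"
    using weak_type[OF n, of "R + 1"] R by (auto simp: add_nonneg_pos)
  \<comment> \<open>The factor \<open>C\<close> is the one in \<open>2 ^ k \<le> C * H y\<close>.
    The factor 4 is needed because points with \<open>\<bar>u x\<bar>\<close> between
    \<open>2 ^ (k + 1)\<close> and \<open>2 ^ (k + 2)\<close> are charged to \<open>E k\<close>,
    that is, to the slice at level \<open>2 ^ k\<close>. As \<open>sobolev_conjugate\<close> at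
    \<open>H y\<close> is \<open>G y\<close>, this gives
    \<open>B (2 ^ (k + 2)) \<le> G y\<close>.\<close>
  have "((\<lambda>t. B ((4 * C) * t) / sobolev_conjugate n s G t) \<longlongrightarrow> 0) at_top"
    using small C unfolding ess_smaller_def by simp
  then have "\<forall>\<^sub>F t in at_top. B ((4 * C) * t) / sobolev_conjugate n s G t < 1"
    by (rule order_tendstoD(2)) simp
  then obtain \<Lambda> where \<Lambda>: "\<And>t. t \<ge> \<Lambda> \<Longrightarrow> B ((4 * C) * t) / sobolev_conjugate n s G t < 1"
    by (auto simp: eventually_at_top_linorder)
  obtain k0 where k0: "C * \<Lambda> < 2 ^ k0" using real_arch_pow[of 2 "C * \<Lambda>"] by auto
  have key: "B (2 ^ (k + 2)) * measure lebesgue (E k) \<le> C * M k" if k: "k \<ge> k0" for k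
  proof (cases "measure lebesgue (E k) = 0")
    case True then show ?thesis using C M(1)[of k] by simp
  next
    case False
    have "{x. 0 < v k x} \<subseteq> {x. 2 ^ k \<le> \<bar>u x\<bar>}" by (auto simp: v_def clip_def)
    then have "emeasure lebesgue {x. 0 < v k x} \<le> emeasure lebesgue {x. 2 ^ k \<le> \<bar>u x\<bar>}"
      by (rule emeasure_mono) (rule W_superlevel[OF u], simp)
    also have "\<dots> < \<infinity>" using W_superlevel[OF u, of "2 ^ k"] by simp
    finally have f: "emeasure lebesgue {x. 0 < v k x} < \<infinity>" .
    have eE: "{x. 2 ^ k \<le> v k x} = E k" by (auto simp: v_def clip_def E_def)
    have nn: "\<forall>x. 0 \<le> v k x" by (simp add: v_def clip_def)
    obtain y where y: "y > 0" "2 ^ k \<le> C * H y" "G y * measure lebesgue (E k) \<le> C * M k"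
      using weak[OF v nn f M(3) M(1) M(2), of "2 ^ k" "measure lebesgue (E k)"] False
      by (auto simp: eE zero_less_measure_iff)
    have "C * \<Lambda> \<le> C * H y"
      using k0 y(2) power_increasing[OF k, of "2::real"] by linarith
    then have "\<Lambda> \<le> H y" using C by simp
    from \<Lambda>[OF this] have "B (4 * C * H y) \<le> G y"
      using sobolev_conjugate_H[of y] y(1) A_pos[of y] by simp
    moreover have "B (2 ^ (k + 2)) \<le> B (4 * C * H y)"
      using y(2) by (intro B.A_mono) auto
    ultimately have "B (2 ^ (k + 2)) * measure lebesgue (E k) \<le> G y * measure lebesgue (E k)"
      by (intro mult_right_mono) auto
    then show ?thesis using y(3) by linarith
  qed
  have "(\<integral>\<^sup>+ x. ennreal (B (u x)) * indicator \<Omega> x \<partial>lebesgue) \<le>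
      (\<integral>\<^sup>+ x. ennreal (B (2 ^ Suc k0)) * indicator \<Omega> x + (\<Sum>k. ennreal (B (2 ^ (k + k0 + 2))) * indicator (E (k + k0)) x) \<partial>lebesgue)"
  proof (rule nn_integral_mono)
    fix x
    show "ennreal (B (u x)) * indicator \<Omega> x \<le> ennreal (B (2 ^ Suc k0)) * indicator \<Omega> x + (\<Sum>k. ennreal (B (2 ^ (k + k0 + 2))) * indicator (E (k + k0)) x)"
    proof (cases "\<bar>u x\<bar> \<le> 2 ^ Suc k0")
      case True
      then have "B (u x) \<le> B (2 ^ Suc k0)" by (intro B.A_mono) simp
      then show ?thesis by (intro add_increasing2 mult_right_mono ennreal_leI) auto
    next
      case False
      obtain j where j: "\<bar>u x\<bar> < 2 ^ j" using real_arch_pow[of 2 "\<bar>u x\<bar>"] by auto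
      define J where "J = (LEAST j. \<bar>u x\<bar> < 2 ^ j)"
      have J: "\<bar>u x\<bar> < 2 ^ J" unfolding J_def using j by (rule LeastI[where P = "\<lambda>j. \<bar>u x\<bar> < 2 ^ j"])
      have "Suc k0 < J"
      proof (rule ccontr)
        assume "\<not> ?thesis"
        then have "(2::real) ^ J \<le> 2 ^ Suc k0" by (intro power_increasing) auto
        then show False using J False by linarith
      qed
      then obtain k where k: "J = k + k0 + 2" using less_iff_Suc_add[of "Suc k0" J] by (auto simp: add_ac)
      have "\<not> \<bar>u x\<bar> < 2 ^ (k + k0 + 1)"
        using not_less_Least[of "k + k0 + 1" "\<lambda>j. \<bar>u x\<bar> < 2 ^ j"] k by (simp add: J_def[symmetric])
      then have xE: "x \<in> E (k + k0)" by (simp add: E_def)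
      have "B (u x) \<le> B (2 ^ (k + k0 + 2))" using J k by (intro B.A_mono) simp
      then have "ennreal (B (u x)) * indicator \<Omega> x \<le> ennreal (B (2 ^ (k + k0 + 2))) * indicator (E (k + k0)) x"
        using xE by (auto intro!: ennreal_leI split: split_indicator)
      also have "\<dots> \<le> (\<Sum>k. ennreal (B (2 ^ (k + k0 + 2))) * indicator (E (k + k0)) x)"
        using sum_le_suminf[OF summableI, of "{k}" "\<lambda>k. ennreal (B (2 ^ (k + k0 + 2))) * indicator (E (k + k0)) x"]
        by (simp del: sum_mult_indicator)
      finally show ?thesis by (intro add_increasing) simp_all
    qed
  qed
  also have "\<dots> = ennreal (B (2 ^ Suc k0)) * emeasure lebesgue \<Omega> +
      (\<Sum>k. ennreal (B (2 ^ (k + k0 + 2))) * emeasure lebesgue (E (k + k0)))"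
    using E \<Omega>(1) by (subst nn_integral_add) (auto simp: nn_integral_suminf nn_integral_cmult_indicator simp del: emeasure_completion)
  also have "(\<Sum>k. ennreal (B (2 ^ (k + k0 + 2))) * emeasure lebesgue (E (k + k0))) \<le> (\<Sum>k. ennreal (C * M (k + k0)))"
  proof (rule suminf_le)
    fix k
    have "emeasure lebesgue (E (k + k0)) = ennreal (measure lebesgue (E (k + k0)))"
      using E(2)[of "k + k0"] by (intro emeasure_eq_ennreal_measure) (auto simp del: emeasure_completion)
    then have "ennreal (B (2 ^ (k + k0 + 2))) * emeasure lebesgue (E (k + k0)) =
        ennreal (B (2 ^ (k + k0 + 2)) * measure lebesgue (E (k + k0)))"
      by (simp add: ennreal_mult del: emeasure_completion)
    then show "ennreal (B (2 ^ (k + k0 + 2))) * emeasure lebesgue (E (k + k0)) \<le> ennreal (C * M (k + k0))"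
      using key[of "k + k0"] by (simp add: ennreal_leI del: emeasure_completion)
  qed auto
  also have "(\<Sum>k. ennreal (C * M (k + k0))) = ennreal (\<Sum>k. C * M (k + k0))"
    using C M(1) sM by (intro suminf_ennreal2 summable_mult) (auto simp: summable_iff_shift intro: less_imp_le)
  finally show ?thesis using \<Omega>(2)
    by (simp add: ennreal_mult_less_top order.strict_trans1 del: emeasure_completion)
qed

end

section \<open>Compactness\<close>

lemma nn_integral_indicator_add:
  fixes a b :: ennreal
  assumes S: "S \<in> sets M" and f: "f \<in> borel_measurable M"
  shows "(\<integral>\<^sup>+ y. a * indicator S y + b * f y \<partial>M) = a * emeasure M S + b * (\<integral>\<^sup>+ y. f y \<partial>M)"
  using S f by (subst nn_integral_add) (simp_all only: nn_integral_cmult_indicator nn_integral_cmult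
      borel_measurable_times_ennreal borel_measurable_const borel_measurable_indicator)

context orlicz
begin

text \<open>For \<open>norm (x - y) \<le> e\<close> the increment is the difference quotient times
  at most \<open>e powr s\<close>, the quotient is controlled by \<open>linear_le\<close>, and the
  factor \<open>e ^ DIM('a) / norm (x - y) ^ DIM('a) \<ge> 1\<close> brings in the weight of
  \<open>mu\<close>. After averaging over balls a rate \<open>e powr s\<close> remains, which serves
  both compactness and mollification.\<close>

lemma L1_rate:
  fixes u :: "'a::euclidean_space \<Rightarrow> real"
  assumes u: "u \<in> borel_measurable lebesgue" and S: "S \<in> sets lebesgue" and e: "0 < e"
  shows "(\<integral>\<^sup>+ x. (\<integral>\<^sup>+ y. ennreal \<bar>u x - u y\<bar> * indicator (cball x e) y \<partial>lebesgue) * indicator S x \<partial>lebesgue)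
    \<le> ennreal (e powr s * e ^ DIM('a)) *
       (ennreal (unit_ball_vol (real DIM('a))) * emeasure lebesgue S + ennreal (1 / G 1) * rho_s s G u)"
proof -
  let ?n = "DIM('a)"
  define c where "c = e powr s * e ^ ?n / G 1"
  have c: "c \<ge> 0" using e by (simp add: c_def)
  define F where "F x y = ennreal (G (dq s u (x, y)))" for x y :: 'a
  have "(\<lambda>p. ennreal (G (dq s u (fst p, snd p)))) \<in> borel_measurable (lebesgue \<Otimes>\<^sub>M lebesgue)"
    using measurable_compose[OF dq_measurable[OF u, of s], of "\<lambda>t. ennreal (G t)" borel]
    by (simp cong: measurable_cong_sets add: sets_mu)
  then have Fm: "(\<lambda>p. F (fst p) (snd p)) \<in> borel_measurable (lebesgue \<Otimes>\<^sub>M lebesgue)" by (simp add: F_def)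
  define K where "K p = F (fst p) (snd p) * ennreal (1 / norm (fst p - snd p) ^ ?n)" for p
  have Km: "K \<in> borel_measurable (lebesgue \<Otimes>\<^sub>M lebesgue)"
    unfolding K_def using weight_measurable[where 'a = 'a] unfolding case_prod_beta
    by (intro borel_measurable_times_ennreal Fm) simp
  have Kx: "(\<lambda>y. K (x, y)) \<in> borel_measurable lebesgue" for x
    by (rule measurable_Pair2[OF Km]) simp
  have inner: "(\<integral>\<^sup>+ y. ennreal \<bar>u x - u y\<bar> * indicator (cball x e) y \<partial>lebesgue) \<le>
      ennreal (e powr s * (unit_ball_vol (real ?n) * e ^ ?n)) + ennreal c * (\<integral>\<^sup>+ y. K (x, y) \<partial>lebesgue)" for x
  proof -
    have "(\<integral>\<^sup>+ y. ennreal \<bar>u x - u y\<bar> * indicator (cball x e) y \<partial>lebesgue) \<le>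
       (\<integral>\<^sup>+ y. ennreal (e powr s) * indicator (cball x e) y + ennreal c * K (x, y) \<partial>lebesgue)"
    proof (rule nn_integral_mono)
      fix y
      show "ennreal \<bar>u x - u y\<bar> * indicator (cball x e) y \<le> ennreal (e powr s) * indicator (cball x e) y + ennreal c * K (x, y)"
      proof (cases "y \<in> cball x e \<and> x \<noteq> y")
        case True
        define N where "N = norm (x - y)"
        have N: "0 < N" "N \<le> e" using True by (auto simp: N_def dist_norm)
        define t where "t = dq s u (x, y)"
        have "\<bar>u x - u y\<bar> = \<bar>t\<bar> * N powr s"
          using N by (simp add: t_def dq_Pair N_def[symmetric] abs_divide)
        also have "\<dots> \<le> (1 + G t / G 1) * e powr s"
          using N s_pos linear_le[of t] by (intro mult_mono powr_mono2) (auto simp: add_nonneg_nonneg)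
        also have "\<dots> = e powr s + e powr s * (G t / G 1)" by (simp add: algebra_simps)
        also have "e powr s * (G t / G 1) \<le> e powr s * (G t / G 1) * (e ^ ?n / N ^ ?n)"
        proof -
          have "1 \<le> e ^ ?n / N ^ ?n" using N by (simp add: power_mono)
          moreover have "0 \<le> e powr s * (G t / G 1)" by simp
          ultimately show ?thesis by (metis mult.right_neutral mult_left_mono)
        qed
        also have "e powr s * (G t / G 1) * (e ^ ?n / N ^ ?n) = c * (G t * (1 / N ^ ?n))"
          by (simp add: c_def)
        finally have "ennreal \<bar>u x - u y\<bar> \<le> ennreal (e powr s + c * (G t * (1 / N ^ ?n)))" by (simp add: ennreal_leI)
        also have "\<dots> = ennreal (e powr s) + ennreal c * K (x, y)"
          using c N by (simp add: K_def F_def t_def N_def ennreal_mult[symmetric] ennreal_plus[symmetric] del: ennreal_plus)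
        finally show ?thesis using True by simp
      qed (auto split: split_indicator)
    qed
    also have "\<dots> = ennreal (e powr s) * emeasure lebesgue (cball x e) + ennreal c * (\<integral>\<^sup>+ y. K (x, y) \<partial>lebesgue)"
      by (rule nn_integral_indicator_add[OF _ Kx]) simp
    also have "emeasure lebesgue (cball x e) = ennreal (unit_ball_vol (real ?n) * e ^ ?n)"
      using e by (simp add: emeasure_cball)
    finally show ?thesis using e by (simp add: ennreal_mult)
  qed
  have KI: "(\<lambda>x. \<integral>\<^sup>+ y. K (x, y) \<partial>lebesgue) \<in> borel_measurable lebesgue"
    by (rule lebesgue.borel_measurable_nn_integral_fst[OF Km])
  have "(\<integral>\<^sup>+ x. (\<integral>\<^sup>+ y. ennreal \<bar>u x - u y\<bar> * indicator (cball x e) y \<partial>lebesgue) * indicator S x \<partial>lebesgue) \<le>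
    (\<integral>\<^sup>+ x. ennreal (e powr s * (unit_ball_vol (real ?n) * e ^ ?n)) * indicator S x + ennreal c * (\<integral>\<^sup>+ y. K (x, y) \<partial>lebesgue) \<partial>lebesgue)"
  proof (rule nn_integral_mono)
    fix x
    show "(\<integral>\<^sup>+ y. ennreal \<bar>u x - u y\<bar> * indicator (cball x e) y \<partial>lebesgue) * indicator S x \<le>
      ennreal (e powr s * (unit_ball_vol (real ?n) * e ^ ?n)) * indicator S x + ennreal c * (\<integral>\<^sup>+ y. K (x, y) \<partial>lebesgue)"
      using inner[of x] by (cases "x \<in> S") auto
  qed
  also have "\<dots> = ennreal (e powr s * (unit_ball_vol (real ?n) * e ^ ?n)) * emeasure lebesgue S
      + ennreal c * (\<integral>\<^sup>+ x. \<integral>\<^sup>+ y. K (x, y) \<partial>lebesgue \<partial>lebesgue)"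
    by (rule nn_integral_indicator_add[OF S KI])
  also have "(\<integral>\<^sup>+ x. \<integral>\<^sup>+ y. K (x, y) \<partial>lebesgue \<partial>lebesgue) = rho_s s G u"
    using nn_integral_mu[OF Fm] by (simp add: rho_s_eq F_def K_def)
  also have "ennreal (e powr s * (unit_ball_vol (real ?n) * e ^ ?n)) * emeasure lebesgue S + ennreal c * rho_s s G u
     = ennreal (e powr s * e ^ ?n) *
       (ennreal (unit_ball_vol (real DIM('a))) * emeasure lebesgue S + ennreal (1 / G 1) * rho_s s G u)"
  proof -
    have 1: "e powr s * (unit_ball_vol (real ?n) * e ^ ?n) = (e powr s * e ^ ?n) * unit_ball_vol (real ?n)"
      and 2: "c = (e powr s * e ^ ?n) * (1 / G 1)" by (simp_all add: c_def)
    show ?thesis unfolding 1 2 using e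
      by (subst (1 2) ennreal_mult) (simp_all add: distrib_left mult.assoc del: emeasure_completion)
  qed
  finally show ?thesis .
qed

end

text \<open>The half-open cube of the grid of side \<open>e\<close> that contains \<open>x\<close>.
  With floors the cells of one grid visibly form a partition, and membership is a measurable
  relation in both points.\<close>

definition cell :: "real \<Rightarrow> 'a::euclidean_space \<Rightarrow> 'a set" where
  "cell e x = {y. \<forall>b\<in>Basis. \<lfloor>y \<bullet> b / e\<rfloor> = \<lfloor>x \<bullet> b / e\<rfloor>}"

lemma cell_eq: "y \<in> cell e x \<Longrightarrow> cell e y = cell e x"
  by (auto simp: cell_def)

lemma cell_dist:
  fixes x y :: "'a::euclidean_space" and e :: real
  assumes "0 < e" "y \<in> cell e x"
  shows "dist x y \<le> DIM('a) * e"
proof -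
  have "\<bar>(x - y) \<bullet> b\<bar> \<le> e" if b: "b \<in> Basis" for b
  proof -
    have "\<lfloor>y \<bullet> b / e\<rfloor> = \<lfloor>x \<bullet> b / e\<rfloor>" using assms b by (auto simp: cell_def)
    then have "\<bar>x \<bullet> b / e - y \<bullet> b / e\<bar> \<le> 1" by linarith
    then have "\<bar>x \<bullet> b - y \<bullet> b\<bar> / e \<le> 1" using assms by (simp add: diff_divide_distrib[symmetric] abs_divide)
    then show ?thesis using assms by (simp add: inner_diff_left field_simps)
  qed
  then have "norm (x - y) \<le> (\<Sum>b\<in>(Basis::'a set). e)"
    by (intro order.trans[OF norm_le_l1] sum_mono)
  then show ?thesis by (simp add: dist_norm)
qed

text \<open>The two boxes have the same measure, which determines that of the cell; the nonempty
  open box ensures that every cell contains a point of a given dense set.\<close>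

lemma cell_box:
  fixes x :: "'a::euclidean_space"
  assumes e: "0 < e"
  defines "l \<equiv> \<Sum>b\<in>Basis. (e * \<lfloor>x \<bullet> b / e\<rfloor>) *\<^sub>R b"
  shows "box l (l + e *\<^sub>R One) \<subseteq> cell e x" "cell e x \<subseteq> cbox l (l + e *\<^sub>R One)"
    "box l (l + e *\<^sub>R One) \<noteq> {}"
proof -
  have l: "l \<bullet> b = e * \<lfloor>x \<bullet> b / e\<rfloor>" if "b \<in> Basis" for b using that by (simp add: l_def)
  show "box l (l + e *\<^sub>R One) \<subseteq> cell e x"
  proof
    fix y assume y: "y \<in> box l (l + e *\<^sub>R One)"
    have "\<lfloor>y \<bullet> b / e\<rfloor> = \<lfloor>x \<bullet> b / e\<rfloor>" if b: "b \<in> Basis" for b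
    proof -
      have "l \<bullet> b < y \<bullet> b" "y \<bullet> b < l \<bullet> b + e" using y b by (auto simp: mem_box inner_add_left)
      then have "\<lfloor>x \<bullet> b / e\<rfloor> < y \<bullet> b / e" "y \<bullet> b / e < \<lfloor>x \<bullet> b / e\<rfloor> + 1"
        using e l[OF b] by (auto simp: field_simps)
      then show ?thesis by linarith
    qed
    then show "y \<in> cell e x" by (simp add: cell_def)
  qed
  show "cell e x \<subseteq> cbox l (l + e *\<^sub>R One)"
  proof
    fix y assume y: "y \<in> cell e x"
    show "y \<in> cbox l (l + e *\<^sub>R One)" unfolding mem_box
    proof
      fix b :: 'a assume b: "b \<in> Basis"
      have "\<lfloor>y \<bullet> b / e\<rfloor> = \<lfloor>x \<bullet> b / e\<rfloor>" using y b by (simp add: cell_def)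
      then have "\<lfloor>x \<bullet> b / e\<rfloor> \<le> y \<bullet> b / e" "y \<bullet> b / e \<le> \<lfloor>x \<bullet> b / e\<rfloor> + 1" by linarith+
      then show "l \<bullet> b \<le> y \<bullet> b \<and> y \<bullet> b \<le> (l + e *\<^sub>R One) \<bullet> b"
        using e b l[OF b] by (simp add: field_simps inner_add_left)
    qed
  qed
  show "box l (l + e *\<^sub>R One) \<noteq> {}" using e by (simp add: box_ne_empty inner_add_left)
qed

lemma cell_rel_sets: "{p :: 'a \<times> 'a::euclidean_space. snd p \<in> cell e (fst p)} \<in> sets (borel \<Otimes>\<^sub>M borel)"
proof -
  have "{p :: 'a \<times> 'a. snd p \<in> cell e (fst p)} =
     (\<Inter>b\<in>Basis. {p \<in> space (borel \<Otimes>\<^sub>M borel). \<lfloor>snd p \<bullet> b / e\<rfloor> = \<lfloor>fst p \<bullet> b / e\<rfloor>})"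
    by (auto simp: cell_def space_pair_measure)
  also have "\<dots> \<in> sets (borel \<Otimes>\<^sub>M borel)"
    by (intro sets.finite_INT) auto
  finally show ?thesis .
qed

lemma cell_sets: "cell e x \<in> sets borel"
proof -
  have "cell e x = (\<Inter>b\<in>Basis. {y \<in> space borel. \<lfloor>y \<bullet> b / e\<rfloor> = \<lfloor>x \<bullet> b / e\<rfloor>})"
    by (auto simp: cell_def)
  also have "\<dots> \<in> sets borel" by (intro sets.finite_INT) auto
  finally show ?thesis .
qed

lemma emeasure_cell:
  fixes x :: "'a::euclidean_space"
  assumes e: "0 < e"
  shows "emeasure lebesgue (cell e x) = ennreal (e ^ DIM('a))"
proof (rule antisym)
  define l where "l = (\<Sum>b\<in>Basis. (e * \<lfloor>x \<bullet> b / e\<rfloor>) *\<^sub>R b)"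
  note b = cell_box[OF e, of x, folded l_def]
  have "emeasure lborel (cbox l (l + e *\<^sub>R One)) = ennreal (e ^ DIM('a))"
    using e by (subst emeasure_lborel_cbox) (auto simp: inner_add_left)
  moreover have "emeasure lebesgue (cell e x) \<le> emeasure lebesgue (cbox l (l + e *\<^sub>R One))"
    by (rule emeasure_mono[OF b(2)]) simp
  ultimately show "emeasure lebesgue (cell e x) \<le> ennreal (e ^ DIM('a))" by simp
  have "emeasure lborel (box l (l + e *\<^sub>R One)) = ennreal (e ^ DIM('a))"
    using e by (subst emeasure_lborel_box) (auto simp: inner_add_left)
  moreover have "emeasure lebesgue (box l (l + e *\<^sub>R One)) \<le> emeasure lebesgue (cell e x)"
    by (rule emeasure_mono[OF b(1)]) (simp add: cell_sets)
  ultimately show "ennreal (e ^ DIM('a)) \<le> emeasure lebesgue (cell e x)" by simp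
qed

text \<open>Tychonoff's theorem for a countable product of intervals takes the place of a diagonal
  argument.\<close>

lemma bounded_family_convergent_subseq:
  fixes a :: "nat \<Rightarrow> nat \<times> nat \<Rightarrow> real"
  assumes "\<And>k i. \<bar>a k i\<bar> \<le> c"
  shows "\<exists>r l. strict_mono (r :: nat \<Rightarrow> nat) \<and> (\<forall>i. (\<lambda>k. a (r k) i) \<longlonglongrightarrow> l i)"
proof -
  have "compactin (product_topology (\<lambda>_::nat \<times> nat. euclidean) UNIV) (PiE UNIV (\<lambda>_. {-c..c}))"
    by (subst compactin_PiE) (auto simp: compactin_euclidean_iff)
  then have "compact (PiE UNIV (\<lambda>_::nat \<times> nat. {-c..c}))"
    by (simp add: euclidean_product_topology compactin_euclidean_iff)
  then have "seq_compact (PiE UNIV (\<lambda>_::nat \<times> nat. {-c..c}))" by (rule compact_imp_seq_compact)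
  moreover have "\<forall>k. a k \<in> PiE UNIV (\<lambda>_::nat \<times> nat. {-c..c})"
    using assms by (auto simp: abs_le_iff) (metis abs_le_iff minus_le_iff)
  ultimately obtain l r where lr: "strict_mono (r :: nat \<Rightarrow> nat)" "(a \<circ> r) \<longlonglongrightarrow> l"
    by (rule seq_compactE) blast
  have "(\<lambda>k. a (r k) i) \<longlonglongrightarrow> l i" for i
    using continuous_on_tendsto_compose[OF continuous_on_product_coordinates[of i] lr(2)] by (simp add: o_def)
  then show ?thesis using lr(1) by blast
qed

context orlicz
begin

text \<open>A cell lies in the ball of radius \<open>DIM('a) * e\<close> around each of its points,
  so the error is at most the oscillation of \<open>L1_rate\<close> at that radius divided by the
  measure of the cell. The quotient of the two volumes leaves
  \<open>DIM('a) ^ DIM('a)\<close>.\<close>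

lemma cell_average_error:
  fixes u :: "'a::euclidean_space \<Rightarrow> real" and e :: real
  assumes u: "integrable lebesgue u" and S: "S \<in> sets lebesgue" and e: "0 < e"
  defines "A \<equiv> \<lambda>x. (1 / e ^ DIM('a)) * (LINT y|lebesgue. indicator (cell e x) y * u y)"
  shows "A \<in> borel_measurable lebesgue"
    and "(\<integral>\<^sup>+ x. ennreal \<bar>u x - A x\<bar> * indicator S x \<partial>lebesgue) \<le>
      ennreal (real DIM('a) ^ DIM('a) * (DIM('a) * e) powr s) *
       (ennreal (unit_ball_vol (real DIM('a))) * emeasure lebesgue S + ennreal (1 / G 1) * rho_s s G u)"
proof -
  let ?n = "DIM('a)"
  note um = borel_measurable_integrable[OF u]
  have "(\<lambda>p::'a\<times>'a. p) \<in> measurable (lebesgue \<Otimes>\<^sub>M lebesgue) (borel \<Otimes>\<^sub>M borel)"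
    using measurable_Pair[OF measurable_fst_comp[OF id_measurable_lebesgue] measurable_snd_comp[OF id_measurable_lebesgue]]
    by simp
  from measurable_sets[OF this cell_rel_sets[of e]]
  have rel: "{p :: 'a \<times> 'a. snd p \<in> cell e (fst p)} \<in> sets (lebesgue \<Otimes>\<^sub>M lebesgue)"
    by (simp add: space_pair_measure)
  have "(\<lambda>p. indicator {p :: 'a \<times> 'a. snd p \<in> cell e (fst p)} p * u (snd p)) \<in> borel_measurable (lebesgue \<Otimes>\<^sub>M lebesgue)"
    using rel measurable_snd_comp[OF um] by (intro borel_measurable_times) auto
  then have "(\<lambda>(x, y). indicator (cell e x) y * u y) \<in> borel_measurable (lebesgue \<Otimes>\<^sub>M lebesgue)"
    by (rule measurable_cong[THEN iffD1, rotated]) (auto split: split_indicator)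
  from lebesgue.borel_measurable_lebesgue_integral[OF this]
  show "A \<in> borel_measurable lebesgue" unfolding A_def by measurable
  have cs: "cell e x \<in> sets lebesgue" for x :: 'a using cell_sets[of e x] by simp
  have iu: "integrable lebesgue (\<lambda>y. indicator (cell e x) y * u y)" for x
    using integrable_mult_indicator[OF cs u] by simp
  have ic: "integrable lebesgue (\<lambda>y. indicator (cell e x) y * c)" for x :: 'a and c :: real
    using e emeasure_cell[OF e, of x] by (intro integrable_mult_left integrable_real_indicator cs) (simp del: emeasure_completion)
  have pw: "ennreal \<bar>u x - A x\<bar> \<le> ennreal (1 / e ^ ?n) * (\<integral>\<^sup>+ y. ennreal \<bar>u x - u y\<bar> * indicator (cball x (?n * e)) y \<partial>lebesgue)" for x
  proof -
    have "measure lebesgue (cell e x) = e ^ ?n" using e by (simp add: measure_def emeasure_cell del: emeasure_completion)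
    then have "(LINT y|lebesgue. indicator (cell e x) y * u x) = e ^ ?n * u x"
      using cs by simp
    then have "u x - A x = (1 / e ^ ?n) * (LINT y|lebesgue. indicator (cell e x) y * u x - indicator (cell e x) y * u y)"
      using e ic iu unfolding A_def by (subst Bochner_Integration.integral_diff) (auto simp: field_simps)
    then have "ennreal \<bar>u x - A x\<bar> = ennreal (1 / e ^ ?n) * ennreal \<bar>LINT y|lebesgue. indicator (cell e x) y * u x - indicator (cell e x) y * u y\<bar>"
      using e by (simp add: abs_mult ennreal_mult[symmetric])
    also have "ennreal \<bar>LINT y|lebesgue. indicator (cell e x) y * u x - indicator (cell e x) y * u y\<bar> \<le>
        (\<integral>\<^sup>+ y. ennreal \<bar>indicator (cell e x) y * u x - indicator (cell e x) y * u y\<bar> \<partial>lebesgue)"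
      using integral_norm_bound_ennreal[OF Bochner_Integration.integrable_diff[OF ic[of x "u x"] iu[of x]]] by simp
    also have "\<dots> \<le> (\<integral>\<^sup>+ y. ennreal \<bar>u x - u y\<bar> * indicator (cball x (?n * e)) y \<partial>lebesgue)"
      using cell_dist[OF e, of _ x] by (intro nn_integral_mono) (auto split: split_indicator)
    finally show ?thesis by (simp add: mult_left_mono)
  qed
  have ne: "0 < ?n * e" using e by simp
  have "(\<integral>\<^sup>+ x. ennreal \<bar>u x - A x\<bar> * indicator S x \<partial>lebesgue) \<le>
     (\<integral>\<^sup>+ x. ennreal (1 / e ^ ?n) * ((\<integral>\<^sup>+ y. ennreal \<bar>u x - u y\<bar> * indicator (cball x (?n * e)) y \<partial>lebesgue) * indicator S x) \<partial>lebesgue)"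
    using pw by (intro nn_integral_mono) (auto split: split_indicator)
  also have "\<dots> = ennreal (1 / e ^ ?n) * (\<integral>\<^sup>+ x. (\<integral>\<^sup>+ y. ennreal \<bar>u x - u y\<bar> * indicator (cball x (?n * e)) y \<partial>lebesgue) * indicator S x \<partial>lebesgue)"
  proof (rule nn_integral_cmult)
    have "{p :: 'a \<times> 'a. dist (fst p) (snd p) \<le> ?n * e} \<in> sets (borel \<Otimes>\<^sub>M borel)"
    proof -
      have "closed {p :: 'a \<times> 'a. dist (fst p) (snd p) \<le> ?n * e}"
        by (intro closed_Collect_le continuous_intros)
      then show ?thesis unfolding borel_prod by (rule borel_closed)
    qed
    from measurable_sets[OF \<open>(\<lambda>p::'a\<times>'a. p) \<in> measurable (lebesgue \<Otimes>\<^sub>M lebesgue) (borel \<Otimes>\<^sub>M borel)\<close> this]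
    have "{p :: 'a \<times> 'a. dist (fst p) (snd p) \<le> ?n * e} \<in> sets (lebesgue \<Otimes>\<^sub>M lebesgue)"
      by (simp add: space_pair_measure)
    then have "(\<lambda>p. ennreal \<bar>u (fst p) - u (snd p)\<bar> * indicator {p :: 'a \<times> 'a. dist (fst p) (snd p) \<le> ?n * e} p)
        \<in> borel_measurable (lebesgue \<Otimes>\<^sub>M lebesgue)"
      using measurable_snd_comp[OF um] measurable_fst_comp[OF um]
      by (intro borel_measurable_times_ennreal measurable_compose[OF _ measurable_ennreal] borel_measurable_abs borel_measurable_diff) auto
    then have "(\<lambda>p. ennreal \<bar>u (fst p) - u (snd p)\<bar> * indicator (cball (fst p) (?n * e)) (snd p))
        \<in> borel_measurable (lebesgue \<Otimes>\<^sub>M lebesgue)"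
      by (rule measurable_cong[THEN iffD1, rotated]) (auto split: split_indicator)
    from lebesgue.borel_measurable_nn_integral_fst[OF this]
    show "(\<lambda>x. (\<integral>\<^sup>+ y. ennreal \<bar>u x - u y\<bar> * indicator (cball x (?n * e)) y \<partial>lebesgue) * indicator S x) \<in> borel_measurable lebesgue"
      using S by (intro borel_measurable_times_ennreal) auto
  qed
  also have "\<dots> \<le> ennreal (1 / e ^ ?n) * (ennreal ((?n * e) powr s * (?n * e) ^ ?n) *
       (ennreal (unit_ball_vol (real DIM('a))) * emeasure lebesgue S + ennreal (1 / G 1) * rho_s s G u))"
    by (intro mult_left_mono L1_rate[OF um S ne]) simp
  also have "\<dots> = ennreal (real ?n ^ ?n * (?n * e) powr s) *
       (ennreal (unit_ball_vol (real DIM('a))) * emeasure lebesgue S + ennreal (1 / G 1) * rho_s s G u)"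
    using e by (simp add: mult.assoc[symmetric] ennreal_mult[symmetric] power_mult_distrib mult.commute[of "real ?n ^ ?n"] del: emeasure_completion)
  finally show "(\<integral>\<^sup>+ x. ennreal \<bar>u x - A x\<bar> * indicator S x \<partial>lebesgue) \<le>
      ennreal (real ?n ^ ?n * (?n * e) powr s) *
       (ennreal (unit_ball_vol (real DIM('a))) * emeasure lebesgue S + ennreal (1 / G 1) * rho_s s G u)" .
qed

text \<open>The Kolmogorov-Riesz argument: along a subsequence the averages over all cells of all
  grids converge, and averaging changes the functions by an L1 amount on \<open>\<Omega>\<close>
  that is small uniformly in the sequence. Hence the subsequence is Cauchy in L1 on
  \<open>\<Omega>\<close>, and a further one converges almost everywhere.\<close>

theorem compactness:
  fixes w :: "nat \<Rightarrow> 'a::euclidean_space \<Rightarrow> real"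
  assumes \<Omega>: "\<Omega> \<in> sets lebesgue" "emeasure lebesgue \<Omega> < \<infinity>"
    and w: "\<And>k. w k \<in> borel_measurable lebesgue" and zero: "\<And>k. AE x in lebesgue. x \<notin> \<Omega> \<longrightarrow> w k x = 0"
    and M: "integrable lebesgue M" "\<And>k. AE x in lebesgue. \<bar>w k x\<bar> \<le> M x"
    and rho: "\<And>k. rho_s s G (w k) \<le> ennreal C"
  shows "\<exists>r u. strict_mono (r :: nat \<Rightarrow> nat) \<and> u \<in> borel_measurable lebesgue \<and>
    (AE x in lebesgue. (\<lambda>k. w (r k) x) \<longlonglongrightarrow> u x)"
proof -
  let ?n = "DIM('a)"
  have iw: "integrable lebesgue (w k)" for k
    by (rule Bochner_Integration.integrable_bound[OF M(1) w])
       (use M(2)[of k] in \<open>auto elim!: eventually_mono\<close>)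
  define e where "e m = 1 / real (Suc m)" for m
  have e: "e m > 0" for m by (simp add: e_def)
  \<comment> \<open>Every cell contains a point of a countable dense set, so the averages over all
    cells are indexed by pairs of naturals: the grid and the representative point.\<close>
  obtain D :: "'a set" where D: "countable D" "\<And>X. open X \<Longrightarrow> X \<noteq> {} \<Longrightarrow> \<exists>d\<in>D. d \<in> X"
    using countable_dense_exists by blast
  define d where "d i = from_nat_into D i" for i
  define a where "a k p = (LINT y|lebesgue. indicator (cell (e (fst p)) (d (snd p))) y * w k y)" for k and p :: "nat \<times> nat"
  have cs: "cell e x \<in> sets lebesgue" for e and x :: 'a using cell_sets[of e x] by simp
  have ci: "integrable lebesgue (\<lambda>y. indicator (cell e x) y * w k y)" for e x k
    using integrable_mult_indicator[OF cs iw] by simp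
  have cb: "\<bar>LINT y|lebesgue. indicator (cell e x) y * w k y\<bar> \<le> (LINT y|lebesgue. M y)" for e x k
  proof -
    have "\<bar>LINT y|lebesgue. indicator (cell e x) y * w k y\<bar> \<le> (LINT y|lebesgue. \<bar>indicator (cell e x) y * w k y\<bar>)"
      by (rule integral_abs_bound)
    also have "\<dots> \<le> (LINT y|lebesgue. M y)"
    proof (rule integral_mono_AE[OF integrable_abs[OF ci] M(1)])
      show "AE y in lebesgue. \<bar>indicator (cell e x) y * w k y\<bar> \<le> M y"
        using M(2)[of k] by eventually_elim (auto split: split_indicator intro: order.trans[OF abs_ge_zero])
    qed
    finally show ?thesis .
  qed
  obtain r l where r: "strict_mono (r :: nat \<Rightarrow> nat)" and l: "\<And>p. (\<lambda>k. a (r k) p) \<longlonglongrightarrow> l p"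
    using bounded_family_convergent_subseq[of a "LINT y|lebesgue. M y"] cb unfolding a_def by blast
  define A where "A m k x = (1 / e m ^ ?n) * (LINT y|lebesgue. indicator (cell (e m) x) y * w (r k) y)" for m k x
  define Al where "Al m x = lim (\<lambda>k. A m k x)" for m x
  have Alim: "(\<lambda>k. A m k x) \<longlonglongrightarrow> Al m x" for m x
  proof -
    obtain q where q: "q \<in> D" "q \<in> cell (e m) x"
      using D(2)[OF open_box cell_box(3)[OF e[of m], of x]] cell_box(1)[OF e[of m], of x] by blast
    then obtain i where "q = d i" using from_nat_into_surj[OF D(1)] unfolding d_def by metis
    then have "cell (e m) x = cell (e m) (d i)" using cell_eq[OF q(2)] by simp
    then have "A m k x = (1 / e m ^ ?n) * a (r k) (m, i)" for k by (simp add: A_def a_def)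
    moreover have "(\<lambda>k. (1 / e m ^ ?n) * a (r k) (m, i)) \<longlonglongrightarrow> (1 / e m ^ ?n) * l (m, i)"
      by (intro tendsto_intros l)
    ultimately have "convergent (\<lambda>k. A m k x)" by (auto simp: convergent_def)
    then show ?thesis unfolding Al_def by (simp add: convergent_LIMSEQ_iff)
  qed
  have Am: "A m k \<in> borel_measurable lebesgue" for m k
    unfolding A_def using cell_average_error(1)[OF iw \<Omega>(1) e] .
  have Alm: "Al m \<in> borel_measurable lebesgue" for m
    using borel_measurable_LIMSEQ_real[OF Alim Am] .
  define I where "I x = (indicator \<Omega> x :: real)" for x
  have I: "integrable lebesgue (\<lambda>x. c * I x)" for c
    unfolding I_def using \<Omega> by (intro integrable_mult_right integrable_real_indicator) auto
  have Im: "I \<in> borel_measurable lebesgue" unfolding I_def using \<Omega> by simp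
  define S where "S k x = I x * w (r k) x" for k x
  have iS: "integrable lebesgue (S k)" for k
    using integrable_mult_indicator[OF \<Omega>(1) iw] by (simp add: S_def[abs_def] I_def)
  define B where "B m = (1 / e m ^ ?n) * (LINT y|lebesgue. M y)" for m
  have Ab: "\<bar>A m k x\<bar> \<le> B m" for m k x
    unfolding A_def B_def abs_mult using cb[of "e m" x "r k"] e[of m] by (intro mult_mono) auto
  have Alb: "\<bar>Al m x\<bar> \<le> B m" for m x
    by (rule LIMSEQ_le_const2[OF tendsto_rabs[OF Alim]]) (use Ab in auto)
  have iIb: "integrable lebesgue (\<lambda>x. I x * F x)"
    if F: "F \<in> borel_measurable lebesgue" and b: "\<And>x. \<bar>F x\<bar> \<le> B m" for F m
  proof (rule Bochner_Integration.integrable_bound[OF I[of "B m"]])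
    show "(\<lambda>x. I x * F x) \<in> borel_measurable lebesgue" by (rule borel_measurable_times[OF Im F])
    show "AE x in lebesgue. norm (I x * F x) \<le> norm (B m * I x)"
    proof (rule AE_I2)
      fix x :: 'a
      have "\<bar>F x\<bar> \<le> \<bar>B m\<bar>" using b[of x] by linarith
      then show "norm (I x * F x) \<le> norm (B m * I x)"
        by (simp add: abs_mult I_def split: split_indicator)
    qed
  qed
  have iIA: "integrable lebesgue (\<lambda>x. I x * A m k x)" "integrable lebesgue (\<lambda>x. I x * Al m x)" for m k
    by (rule iIb[OF Am Ab], rule iIb[OF Alm Alb])
  \<comment> \<open>\<open>max C 0\<close> because \<open>ennreal C\<close> reads a negative
    \<open>C\<close> as 0.\<close>
  define K where "K = real ?n ^ ?n * (unit_ball_vol (real ?n) * measure lebesgue \<Omega> + 1 / G 1 * max C 0)"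
  define \<eta> where "\<eta> m = (?n * e m) powr s * K" for m
  have K0: "K \<ge> 0" unfolding K_def by (intro mult_nonneg_nonneg add_nonneg_nonneg) auto
  have err: "(LINT x|lebesgue. \<bar>S k x - I x * A m k x\<bar>) \<le> \<eta> m" for m k
  proof -
    have "ennreal (LINT x|lebesgue. \<bar>S k x - I x * A m k x\<bar>) = (\<integral>\<^sup>+ x. ennreal \<bar>S k x - I x * A m k x\<bar> \<partial>lebesgue)"
      using iS[of k] iIA(1)[of m k] by (intro nn_integral_eq_integral[symmetric]) auto
    also have "\<dots> = (\<integral>\<^sup>+ x. ennreal \<bar>w (r k) x - A m k x\<bar> * indicator \<Omega> x \<partial>lebesgue)"
      by (intro nn_integral_cong) (auto simp: S_def I_def split: split_indicator)
    also have "\<dots> \<le> ennreal (real ?n ^ ?n * (?n * e m) powr s) *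
       (ennreal (unit_ball_vol (real ?n)) * emeasure lebesgue \<Omega> + ennreal (1 / G 1) * rho_s s G (w (r k)))"
      unfolding A_def by (rule cell_average_error(2)[OF iw \<Omega>(1) e])
    also have "\<dots> \<le> ennreal (real ?n ^ ?n * (?n * e m) powr s) *
       (ennreal (unit_ball_vol (real ?n)) * ennreal (measure lebesgue \<Omega>) + ennreal (1 / G 1) * ennreal (max C 0))"
    proof (intro mult_left_mono add_mono)
      show "emeasure lebesgue \<Omega> \<le> ennreal (measure lebesgue \<Omega>)"
        using \<Omega>(2) by (subst emeasure_eq_ennreal_measure) (auto simp del: emeasure_completion)
      show "rho_s s G (w (r k)) \<le> ennreal (max C 0)"
        using rho[of "r k"] by (rule order.trans) (simp add: ennreal_leI)
    qed auto
    also have "\<dots> = ennreal (\<eta> m)"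
      by (simp add: \<eta>_def K_def ennreal_mult[symmetric] ennreal_plus[symmetric] mult_ac del: ennreal_plus)
    finally show ?thesis using K0 by (simp add: \<eta>_def ennreal_le_iff)
  qed
  have \<eta>: "\<eta> \<longlonglongrightarrow> 0"
  proof -
    have "(\<lambda>m. real ?n * e m) \<longlonglongrightarrow> real ?n * 0"
      unfolding e_def by (intro tendsto_intros LIMSEQ_Suc[OF lim_const_over_n])
    then have "(\<lambda>m. (real ?n * e m) powr s) \<longlonglongrightarrow> 0"
      using s_pos by (intro tendsto_zero_powrI[where b = s]) (auto simp: e_def)
    then have "(\<lambda>m. (real ?n * e m) powr s * K) \<longlonglongrightarrow> 0 * K" by (intro tendsto_intros)
    then show ?thesis by (simp add: \<eta>_def[abs_def])
  qed
  have mid: "(\<lambda>k. LINT x|lebesgue. \<bar>I x * A m k x - I x * Al m x\<bar>) \<longlonglongrightarrow> 0" for m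
  proof -
    have "(\<lambda>k. LINT x|lebesgue. \<bar>I x * A m k x - I x * Al m x\<bar>) \<longlonglongrightarrow> (LINT x|(lebesgue :: 'a measure). 0)"
    proof (rule integral_dominated_convergence[where w = "\<lambda>x. (2 * B m) * I x"])
      show "AE x in lebesgue. (\<lambda>k. \<bar>I x * A m k x - I x * Al m x\<bar>) \<longlonglongrightarrow> 0"
      proof (rule AE_I2)
        fix x :: 'a
        have "(\<lambda>k. \<bar>I x * A m k x - I x * Al m x\<bar>) \<longlonglongrightarrow> \<bar>I x * Al m x - I x * Al m x\<bar>"
          by (intro tendsto_intros Alim)
        then show "(\<lambda>k. \<bar>I x * A m k x - I x * Al m x\<bar>) \<longlonglongrightarrow> 0" by simp
      qed
      show "AE x in lebesgue. norm \<bar>I x * A m k x - I x * Al m x\<bar> \<le> (2 * B m) * I x" for k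
      proof (rule AE_I2)
        fix x :: 'a
        have "\<bar>A m k x - Al m x\<bar> \<le> 2 * B m" using Ab[of m k x] Alb[of m x] by linarith
        then show "norm \<bar>I x * A m k x - I x * Al m x\<bar> \<le> (2 * B m) * I x"
          by (auto simp: I_def split: split_indicator)
      qed
    qed (use I iIA Im Am Alm in auto)
    then show ?thesis by simp
  qed
  \<comment> \<open>Four differences, each below a quarter of \<open>\<epsilon>\<close>: two
    averaging errors, controlled by the choice of the grid \<open>m\<close>, and two distances of
    averages to their limit \<open>Al m\<close>, controlled by \<open>N\<close>.\<close>
  have cauchy: "\<exists>N. \<forall>i\<ge>N. \<forall>j\<ge>N. (LINT x|lebesgue. norm (S i x - S j x)) < \<epsilon>" if ep: "\<epsilon> > 0" for \<epsilon>
  proof -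
    have ep4: "0 < \<epsilon> / 4" using ep by simp
    obtain m where m: "\<eta> m < \<epsilon> / 4"
      using order_tendstoD(2)[OF \<eta> ep4] unfolding eventually_sequentially by blast
    obtain N where N: "\<And>k. k \<ge> N \<Longrightarrow> (LINT x|lebesgue. \<bar>I x * A m k x - I x * Al m x\<bar>) < \<epsilon> / 4"
      using order_tendstoD(2)[OF mid[of m] ep4] unfolding eventually_sequentially by blast
    have "(LINT x|lebesgue. norm (S i x - S j x)) < \<epsilon>" if "i \<ge> N" "j \<ge> N" for i j
    proof -
      have "(LINT x|lebesgue. norm (S i x - S j x)) \<le>
         (LINT x|lebesgue. (\<bar>S i x - I x * A m i x\<bar> + \<bar>S j x - I x * A m j x\<bar>) +
            (\<bar>I x * A m i x - I x * Al m x\<bar> + \<bar>I x * A m j x - I x * Al m x\<bar>))"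
      proof (rule integral_mono)
        show "norm (S i x - S j x) \<le> (\<bar>S i x - I x * A m i x\<bar> + \<bar>S j x - I x * A m j x\<bar>) +
            (\<bar>I x * A m i x - I x * Al m x\<bar> + \<bar>I x * A m j x - I x * Al m x\<bar>)" for x by simp
      qed (intro integrable_norm integrable_abs Bochner_Integration.integrable_add Bochner_Integration.integrable_diff iS iIA)+
      also have "\<dots> = ((LINT x|lebesgue. \<bar>S i x - I x * A m i x\<bar>) + (LINT x|lebesgue. \<bar>S j x - I x * A m j x\<bar>)) +
            ((LINT x|lebesgue. \<bar>I x * A m i x - I x * Al m x\<bar>) + (LINT x|lebesgue. \<bar>I x * A m j x - I x * Al m x\<bar>))"
        by (simp add: iS iIA)
      also have "\<dots> < \<epsilon>" using err[of i m] err[of j m] m N[OF that(1)] N[OF that(2)] by linarith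
      finally show ?thesis .
    qed
    then show ?thesis by blast
  qed
  obtain r' where r': "strict_mono r'" "AE x in lebesgue. Cauchy (\<lambda>i. S (r' i) x)"
    using cauchy_L1_AE_cauchy_subseq[OF iS cauchy] by blast
  define u where "u x = lim (\<lambda>i. S (r' i) x)" for x
  have "u \<in> borel_measurable lebesgue"
    unfolding u_def using iS by (intro borel_measurable_lim_metric) auto
  moreover have "AE x in lebesgue. (\<lambda>k. w ((r \<circ> r') k) x) \<longlonglongrightarrow> u x"
  proof -
    have "AE x in lebesgue. \<forall>k. x \<notin> \<Omega> \<longrightarrow> w k x = 0" unfolding AE_all_countable using zero by blast
    then show ?thesis using r'(2)
    proof eventually_elim
      case (elim x)
      have "S (r' k) x = w ((r \<circ> r') k) x" for k using elim(1) by (auto simp: S_def I_def split: split_indicator)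
      moreover have "(\<lambda>k. S (r' k) x) \<longlonglongrightarrow> u x"
        unfolding u_def using elim(2) by (simp add: Cauchy_convergent_iff convergent_LIMSEQ_iff)
      ultimately show ?case by simp
    qed
  qed
  moreover have "strict_mono (r \<circ> r')" using r r'(1) by (rule strict_mono_o)
  ultimately show ?thesis by blast
qed

end

section \<open>Lipschitz functions and cut-offs\<close>

lemma power_le_powr_neg:
  fixes N \<sigma> :: real and k d :: nat
  assumes "0 < \<sigma>" "2 ^ k \<le> N"
  shows "N powr (- \<sigma>) * (1 / N ^ d) \<le> (2 powr (- \<sigma>)) ^ k * (1 / (2 ^ k) ^ d)"
proof (rule mult_mono)
  have N: "N > 0" using assms(2) by (rule less_le_trans[rotated]) simp
  have "N powr (- \<sigma>) \<le> (2 ^ k) powr (- \<sigma>)" using assms by (intro powr_mono2') auto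
  also have "\<dots> = (2 powr (- \<sigma>)) ^ k" by (simp add: powr_realpow[symmetric] powr_powr mult.commute)
  finally show "N powr (- \<sigma>) \<le> (2 powr (- \<sigma>)) ^ k" .
  show "1 / N ^ d \<le> 1 / (2 ^ k) ^ d" using assms N by (intro divide_left_mono power_mono) auto
  show "0 \<le> 1 / N ^ d" using N by simp
qed simp

text \<open>A majorant with a positive power at 0 and a negative one at infinity, hence integrable
  at both ends against the inverse power of the distance that is the weight of
  \<open>mu\<close>.\<close>

definition radial :: "real \<Rightarrow> real \<Rightarrow> real" where
  "radial \<sigma> N = (if N \<le> 1 then N powr \<sigma> else N powr (- \<sigma>))"

lemma radial_nonneg: "radial \<sigma> N \<ge> 0" by (simp add: radial_def)

lemma radial_measurable [measurable]: "radial \<sigma> \<in> borel_measurable borel"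
  unfolding radial_def by measurable

text \<open>On a dyadic annulus around \<open>x\<close> the weight is comparable to the inverse of
  the volume, so the annulus contributes a constant times \<open>q ^ k\<close>. Both the inner and
  the outer annuli form geometric series, with a bound independent of \<open>x\<close>.\<close>

lemma radial_integral_bound:
  assumes \<sigma>: "0 < \<sigma>"
  shows "\<exists>K. \<forall>x::'a::euclidean_space.
    (\<integral>\<^sup>+ y. ennreal (radial \<sigma> (norm (x - y))) * ennreal (1 / norm (x - y) ^ DIM('a)) \<partial>lebesgue) \<le> ennreal K"
proof -
  let ?n = "DIM('a)"
  define q where "q = 2 powr (- \<sigma>)"
  have q: "0 < q" "q < 1" using \<sigma> by (auto simp: q_def powr_less_one)
  \<comment> \<open>With \<open>N\<close> the distance to \<open>x\<close>, \<open>a k\<close>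
    bounds the integrand where \<open>2 ^ k \<le> 1 / N < 2 ^ Suc k\<close>, and \<open>b k\<close>
    where \<open>2 ^ k \<le> N < 2 ^ Suc k\<close>. At \<open>N = 0\<close> the integrand is
    0.\<close>
  define a where "a k = q ^ k * (2 ^ k) ^ ?n * 2 ^ ?n" for k :: nat
  define b where "b k = q ^ k * (1 / (2 ^ k) ^ ?n)" for k :: nat
  define r where "r k = (1 / 2 :: real) ^ k" for k :: nat
  define R where "R k = (2 :: real) ^ Suc k" for k :: nat
  define V where "V = unit_ball_vol (real ?n)"
  define K where "K = (\<Sum>k. 2 * (q ^ k * (2 ^ ?n * V)))"
  have "(\<integral>\<^sup>+ y. ennreal (radial \<sigma> (norm (x - y))) * ennreal (1 / norm (x - y) ^ ?n) \<partial>lebesgue) \<le> ennreal K" for x :: 'a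
  proof -
    have "(\<integral>\<^sup>+ y. ennreal (radial \<sigma> (norm (x - y))) * ennreal (1 / norm (x - y) ^ ?n) \<partial>lebesgue) \<le>
      (\<integral>\<^sup>+ y. (\<Sum>k. ennreal (a k) * indicator (cball x (r k)) y + ennreal (b k) * indicator (cball x (R k)) y) \<partial>lebesgue)"
    proof (rule nn_integral_mono)
      fix y
      define N where "N = norm (x - y)"
      have le: "t \<le> (\<Sum>k. ennreal (a k) * indicator (cball x (r k)) y + ennreal (b k) * indicator (cball x (R k)) y)"
        if "t \<le> ennreal (a k) * indicator (cball x (r k)) y + ennreal (b k) * indicator (cball x (R k)) y" for t k
        using sum_le_suminf[OF summableI, of "{k}" "\<lambda>k. ennreal (a k) * indicator (cball x (r k)) y + ennreal (b k) * indicator (cball x (R k)) y"]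
          that by (simp del: sum_mult_indicator)
      consider "N = 0" | "0 < N" "N \<le> 1" | "N > 1" using norm_ge_zero[of "x - y"] unfolding N_def by linarith
      then show "ennreal (radial \<sigma> (norm (x - y))) * ennreal (1 / norm (x - y) ^ ?n) \<le>
          (\<Sum>k. ennreal (a k) * indicator (cball x (r k)) y + ennreal (b k) * indicator (cball x (R k)) y)"
      proof cases
        case 1
        then show ?thesis using \<sigma> by (simp add: N_def radial_def)
      next
        case 2
        obtain k where k: "2 ^ k \<le> 1 / N" "1 / N < 2 ^ Suc k"
        proof -
          obtain j where j: "1 / N < 2 ^ j" using real_arch_pow[of 2 "1 / N"] by auto
          define J where "J = (LEAST j. 1 / N < 2 ^ j)"
          have J: "1 / N < 2 ^ J" unfolding J_def using j by (rule LeastI)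
          have "J \<noteq> 0" using J 2 by (cases J) auto
          then obtain k where k: "J = Suc k" by (cases J) auto
          have "\<not> 1 / N < 2 ^ k" using not_less_Least[of k "\<lambda>j. 1 / N < 2 ^ j"] k by (simp add: J_def[symmetric])
          then show ?thesis using that[of k] J k by simp
        qed
        have Nr: "N \<le> r k" using k(1) 2 by (simp add: r_def field_simps power_divide)
        have "N powr \<sigma> \<le> q ^ k"
        proof -
          have "N powr \<sigma> \<le> (r k) powr \<sigma>" using Nr 2 \<sigma> by (intro powr_mono2) auto
          also have "\<dots> = (1 / 2) powr (real k * \<sigma>)"
            unfolding r_def by (simp only: powr_realpow[symmetric] powr_powr half_gt_zero zero_less_one)
          also have "\<dots> = q ^ k" unfolding q_def
            by (simp add: powr_realpow[symmetric] powr_powr powr_divide powr_minus_divide mult.commute)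
          finally show ?thesis .
        qed
        moreover have "1 / N ^ ?n \<le> (2 ^ Suc k) ^ ?n"
          using k(2) 2 power_mono[of "1 / N" "2 ^ Suc k" ?n] by (simp add: power_divide)
        ultimately have "N powr \<sigma> * (1 / N ^ ?n) \<le> q ^ k * (2 ^ Suc k) ^ ?n"
          using 2 q by (intro mult_mono) auto
        also have "\<dots> = a k" by (simp add: a_def power_mult_distrib)
        finally have "ennreal (radial \<sigma> N) * ennreal (1 / N ^ ?n) \<le> ennreal (a k)"
          using 2 by (simp add: radial_def ennreal_mult[symmetric] ennreal_leI)
        moreover have "y \<in> cball x (r k)" using Nr by (simp add: N_def dist_norm)
        ultimately show ?thesis unfolding N_def[symmetric] by (intro le[of _ k] add_increasing2) auto
      next
        case 3
        obtain k where k: "2 ^ k \<le> N" "N < 2 ^ Suc k"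
        proof -
          obtain j where j: "N < 2 ^ j" using real_arch_pow[of 2 "N"] by auto
          define J where "J = (LEAST j. N < 2 ^ j)"
          have J: "N < 2 ^ J" unfolding J_def using j by (rule LeastI)
          have "J \<noteq> 0" using J 3 by (cases J) auto
          then obtain k where k: "J = Suc k" by (cases J) auto
          have "\<not> N < 2 ^ k" using not_less_Least[of k "\<lambda>j. N < 2 ^ j"] k by (simp add: J_def[symmetric])
          then show ?thesis using that[of k] J k by simp
        qed
        have "N powr (- \<sigma>) * (1 / N ^ ?n) \<le> b k"
          unfolding b_def q_def by (rule power_le_powr_neg[OF \<sigma> k(1)])
        then have "ennreal (radial \<sigma> N) * ennreal (1 / N ^ ?n) \<le> ennreal (b k)"
          using 3 by (simp add: radial_def ennreal_mult[symmetric] ennreal_leI)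
        moreover have "y \<in> cball x (R k)" using k by (simp add: N_def dist_norm R_def)
        ultimately show ?thesis unfolding N_def[symmetric] by (intro le[of _ k] add_increasing) auto
      qed
    qed
    also have "\<dots> = (\<Sum>k. ennreal (a k) * emeasure lebesgue (cball x (r k)) + ennreal (b k) * emeasure lebesgue (cball x (R k)))"
    proof (subst nn_integral_suminf)
      show "(\<Sum>k. \<integral>\<^sup>+ y. ennreal (a k) * indicator (cball x (r k)) y + ennreal (b k) * indicator (cball x (R k)) y \<partial>lebesgue) =
        (\<Sum>k. ennreal (a k) * emeasure lebesgue (cball x (r k)) + ennreal (b k) * emeasure lebesgue (cball x (R k)))"
        by (rule suminf_cong, subst nn_integral_indicator_add) (auto intro!: borel_measurable_indicator simp del: emeasure_completion simp: nn_integral_indicator)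
    qed (intro borel_measurable_add borel_measurable_times_ennreal borel_measurable_indicator borel_measurable_const; simp)
    also have "\<dots> = (\<Sum>k. ennreal (2 * (q ^ k * (2 ^ ?n * V))))"
    proof (rule suminf_cong)
      fix k
      have m: "emeasure lebesgue (cball x (r k)) = ennreal (V * r k ^ ?n)" "emeasure lebesgue (cball x (R k)) = ennreal (V * R k ^ ?n)"
        by (simp_all add: emeasure_cball r_def R_def V_def)
      have e: "a k * (V * r k ^ ?n) = q ^ k * (2 ^ ?n * V)" "b k * (V * R k ^ ?n) = q ^ k * (2 ^ ?n * V)"
        by (simp_all add: a_def r_def b_def R_def power_divide power_mult_distrib)
      have nn: "0 \<le> a k" "0 \<le> b k" "0 \<le> V" "0 \<le> r k" "0 \<le> R k"
        using q by (auto simp: a_def b_def V_def r_def R_def)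
      have "ennreal (a k) * ennreal (V * r k ^ ?n) = ennreal (q ^ k * (2 ^ ?n * V))"
        unfolding e(1)[symmetric] using nn by (auto intro!: ennreal_mult[symmetric])
      moreover have "ennreal (b k) * ennreal (V * R k ^ ?n) = ennreal (q ^ k * (2 ^ ?n * V))"
        unfolding e(2)[symmetric] using nn by (auto intro!: ennreal_mult[symmetric])
      ultimately show "ennreal (a k) * emeasure lebesgue (cball x (r k)) + ennreal (b k) * emeasure lebesgue (cball x (R k))
          = ennreal (2 * (q ^ k * (2 ^ ?n * V)))"
        unfolding m using q nn by (simp add: ennreal_plus[symmetric] del: ennreal_plus)
    qed
    also have "\<dots> = ennreal K" unfolding K_def
      using q by (intro suminf_ennreal2 summable_mult summable_mult2 summable_geometric) (auto simp: V_def)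
    finally show ?thesis .
  qed
  then show ?thesis by blast
qed

section \<open>Modulars of Lipschitz functions and of products with cut-offs\<close>

context orlicz
begin

text \<open>Majorant for the difference quotient of a bounded Lipschitz function supported in
  \<open>S\<close>: the minimum joins the Lipschitz bound near the diagonal with boundedness far
  from it, and the indicators vanish when both points lie outside \<open>S\<close>.\<close>

definition lip_kernel :: "'a::euclidean_space set \<Rightarrow> real \<Rightarrow> 'a \<times> 'a \<Rightarrow> real" where
  "lip_kernel S C p = C * (indicator S (fst p) + indicator S (snd p)) * min 1 (norm (fst p - snd p)) /
     norm (fst p - snd p) powr s"

lemma lip_kernel_measurable:
  assumes S: "S \<in> sets lebesgue" shows "lip_kernel S C \<in> borel_measurable mu"
proof -
  have I: "(indicator S :: 'a \<Rightarrow> real) \<in> borel_measurable lebesgue" using S by simp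
  have "lip_kernel S C \<in> borel_measurable (lebesgue \<Otimes>\<^sub>M lebesgue)"
    unfolding lip_kernel_def
    by (intro borel_measurable_divide borel_measurable_times borel_measurable_add borel_measurable_min
        borel_measurable_const measurable_fst_comp[OF I] measurable_snd_comp[OF I] measurable_norm_diff powr_real_measurable)
  then show ?thesis by (simp cong: measurable_cong_sets add: sets_mu)
qed

text \<open>Convexity makes the problem linear: the factor \<open>radial \<sigma> N\<close>, being
  at most 1, can be pulled out of \<open>G\<close> by \<open>A_scale\<close>. Then
  \<open>radial_integral_bound\<close> integrates in one point and the indicator in the
  other.\<close>

lemma lip_kernel_integrable:
  fixes S :: "'a::euclidean_space set"
  assumes S: "S \<in> sets lebesgue" "emeasure lebesgue S < \<infinity>" and C: "C \<ge> 0"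
  shows "integrable mu (\<lambda>p. G (lip_kernel S C p))"
proof (rule integrableI_nonneg)
  let ?n = "DIM('a)"
  \<comment> \<open>The kernel behaves like the power \<open>1 - s\<close> of the distance near the
    diagonal and like the power \<open>- s\<close> far away; \<open>\<sigma>\<close> serves
    both.\<close>
  define \<sigma> where "\<sigma> = min s (1 - s)"
  have \<sigma>: "0 < \<sigma>" using s_pos s_less_1 by (simp add: \<sigma>_def)
  obtain K where K: "\<And>x::'a. (\<integral>\<^sup>+ y. ennreal (radial \<sigma> (norm (x - y))) * ennreal (1 / norm (x - y) ^ ?n) \<partial>lebesgue) \<le> ennreal K"
    using radial_integral_bound[OF \<sigma>, where 'a = 'a] by blast
  have I: "(indicator S :: 'a \<Rightarrow> ennreal) \<in> borel_measurable lebesgue" using S by simp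
  define F where "F x y = ennreal (radial \<sigma> (norm (x - y)))" for x y :: 'a
  have Fm: "(\<lambda>p. F (fst p) (snd p)) \<in> borel_measurable (lebesgue \<Otimes>\<^sub>M lebesgue)"
    unfolding F_def by (intro measurable_compose[OF measurable_norm_diff] measurable_compose[OF radial_measurable]) simp
  have pw: "ennreal (G (lip_kernel S C p)) \<le>
      ennreal (G (2 * C)) * (indicator S (fst p) * F (fst p) (snd p)) + ennreal (G (2 * C)) * (indicator S (snd p) * F (fst p) (snd p))" for p
  proof -
    define N where "N = norm (fst p - snd p)"
    define m where "m = min 1 N / N powr s"
    have N0: "N \<ge> 0" by (simp add: N_def)
    have m: "0 \<le> m" "m \<le> radial \<sigma> N" "radial \<sigma> N \<le> 1"
    proof -
      show "0 \<le> m" using N0 by (simp add: m_def)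
      show "m \<le> radial \<sigma> N"
      proof (cases "N \<le> 1")
        case True
        then have "m = N powr (1 - s)"
          using N0 by (cases "N = 0") (auto simp: m_def powr_diff)
        also have "\<dots> \<le> N powr \<sigma>" using True N0 by (intro powr_mono') (auto simp: \<sigma>_def)
        finally show ?thesis using True by (simp add: radial_def)
      next
        case False
        then have "m = N powr (- s)" by (simp add: m_def powr_minus_divide)
        also have "\<dots> \<le> N powr (- \<sigma>)" using False by (intro powr_mono) (auto simp: \<sigma>_def)
        finally show ?thesis using False by (simp add: radial_def)
      qed
      show "radial \<sigma> N \<le> 1"
        using N0 \<sigma> powr_mono2[of \<sigma> N 1] powr_mono2'[of "- \<sigma>" 1 N] by (auto simp: radial_def)
    qed
    define j where "j = (indicator S (fst p) + indicator S (snd p) :: real)"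
    have k: "lip_kernel S C p = C * j * m"
      by (simp add: lip_kernel_def j_def m_def N_def)
    have j: "j = 0 \<or> (0 \<le> j \<and> j \<le> 2)" by (auto simp: j_def split: split_indicator)
    have G2: "G (C * j * m) \<le> G (2 * C) * radial \<sigma> N"
    proof -
      have "G (C * j * m) \<le> G (radial \<sigma> N * (2 * C))"
      proof (rule A_mono)
        have "C * j * m \<le> C * 2 * radial \<sigma> N" using j m C by (intro mult_mono) auto
        moreover have "0 \<le> C * j * m" using j m C by auto
        ultimately show "\<bar>C * j * m\<bar> \<le> \<bar>radial \<sigma> N * (2 * C)\<bar>" by (simp add: mult_ac)
      qed
      also have "\<dots> \<le> radial \<sigma> N * G (2 * C)" using m by (intro A_scale) (auto simp: radial_nonneg)
      finally show ?thesis by (simp add: mult.commute)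
    qed
    have "ennreal (G (C * j * m)) \<le> ennreal (G (2 * C)) * ennreal (radial \<sigma> N)"
      using ennreal_leI[OF G2] by (simp add: ennreal_mult radial_nonneg)
    then show ?thesis unfolding k F_def N_def[symmetric]
      by (auto simp: j_def split: split_indicator intro: add_increasing add_increasing2)
  qed
  have sym: "F x y * ennreal (1 / norm (x - y) ^ ?n) = F y x * ennreal (1 / norm (y - x) ^ ?n)" for x y
    by (simp add: F_def norm_minus_commute)
  have 1: "(\<integral>\<^sup>+ p. indicator S (fst p) * F (fst p) (snd p) \<partial>mu) \<le> ennreal K * emeasure lebesgue S"
  proof -
    have "(\<integral>\<^sup>+ p. indicator S (fst p) * F (fst p) (snd p) \<partial>mu) =
       (\<integral>\<^sup>+ x. \<integral>\<^sup>+ y. (indicator S x * F x y) * ennreal (1 / norm (x - y) ^ ?n) \<partial>lebesgue \<partial>lebesgue)"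
      by (rule nn_integral_mu) (intro borel_measurable_times_ennreal Fm measurable_fst_comp[OF I])
    also have "\<dots> \<le> (\<integral>\<^sup>+ x. ennreal K * indicator S x \<partial>lebesgue)"
      using K by (intro nn_integral_mono) (auto simp: F_def split: split_indicator)
    also have "\<dots> = ennreal K * emeasure lebesgue S" by (rule nn_integral_cmult_indicator[OF S(1)])
    finally show ?thesis .
  qed
  have 2: "(\<integral>\<^sup>+ p. indicator S (snd p) * F (fst p) (snd p) \<partial>mu) \<le> ennreal K * emeasure lebesgue S"
  proof -
    have "(\<integral>\<^sup>+ p. indicator S (snd p) * F (fst p) (snd p) \<partial>mu) =
       (\<integral>\<^sup>+ x. \<integral>\<^sup>+ y. (indicator S y * F x y) * ennreal (1 / norm (x - y) ^ ?n) \<partial>lebesgue \<partial>lebesgue)"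
      by (rule nn_integral_mu) (intro borel_measurable_times_ennreal Fm measurable_snd_comp[OF I])
    also have "\<dots> = (\<integral>\<^sup>+ y. \<integral>\<^sup>+ x. (indicator S y * F x y) * ennreal (1 / norm (x - y) ^ ?n) \<partial>lebesgue \<partial>lebesgue)"
    proof (rule lebesgue_pair.Fubini'[symmetric])
      have "(\<lambda>p. (indicator S (snd p) * F (fst p) (snd p)) * ennreal (1 / norm (fst p - snd p) ^ ?n)) \<in> borel_measurable (lebesgue \<Otimes>\<^sub>M lebesgue)"
        using weight_measurable[where 'a = 'a] unfolding case_prod_beta
        by (intro borel_measurable_times_ennreal Fm measurable_snd_comp[OF I]) simp
      then show "(\<lambda>(x, y). (indicator S y * F x y) * ennreal (1 / norm (x - y) ^ ?n)) \<in> borel_measurable (lebesgue \<Otimes>\<^sub>M lebesgue)"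
        by (simp add: case_prod_unfold)
    qed
    also have "\<dots> \<le> (\<integral>\<^sup>+ y. ennreal K * indicator S y \<partial>lebesgue)"
      using K by (intro nn_integral_mono) (auto simp: sym F_def norm_minus_commute split: split_indicator)
    also have "\<dots> = ennreal K * emeasure lebesgue S" by (rule nn_integral_cmult_indicator[OF S(1)])
    finally show ?thesis .
  qed
  have m1: "(\<lambda>p. indicator S (fst p) * F (fst p) (snd p)) \<in> borel_measurable mu"
    and m2: "(\<lambda>p. indicator S (snd p) * F (fst p) (snd p)) \<in> borel_measurable mu"
    unfolding measurable_cong_sets[OF sets_mu refl]
    by (intro borel_measurable_times_ennreal Fm measurable_fst_comp[OF I] measurable_snd_comp[OF I])+
  have "(\<integral>\<^sup>+ p. ennreal (G (lip_kernel S C p)) \<partial>mu) \<le>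
     (\<integral>\<^sup>+ p. ennreal (G (2 * C)) * (indicator S (fst p) * F (fst p) (snd p)) + ennreal (G (2 * C)) * (indicator S (snd p) * F (fst p) (snd p)) \<partial>mu)"
    by (rule nn_integral_mono) (rule pw)
  also have "\<dots> = ennreal (G (2 * C)) * (\<integral>\<^sup>+ p. indicator S (fst p) * F (fst p) (snd p) \<partial>mu) +
      ennreal (G (2 * C)) * (\<integral>\<^sup>+ p. indicator S (snd p) * F (fst p) (snd p) \<partial>mu)"
    using m1 m2 by (subst nn_integral_add) (simp_all only: nn_integral_cmult borel_measurable_times_ennreal borel_measurable_const)
  also have "\<dots> \<le> ennreal (G (2 * C)) * (ennreal K * emeasure lebesgue S) + ennreal (G (2 * C)) * (ennreal K * emeasure lebesgue S)"
    by (intro add_mono mult_left_mono 1 2) auto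
  also have "\<dots> < \<infinity>" using S(2) by (simp add: ennreal_mult_less_top del: emeasure_completion)
  finally show "(\<integral>\<^sup>+ p. ennreal (G (lip_kernel S C p)) \<partial>mu) < \<infinity>" .
  show "(\<lambda>p. G (lip_kernel S C p)) \<in> borel_measurable mu"
    using measurable_compose[OF lip_kernel_measurable[OF S(1)] A_measurable] .
qed simp

lemma bounded_support_integrable:
  assumes S: "S \<in> sets lebesgue" "emeasure lebesgue S < \<infinity>"
    and w: "w \<in> borel_measurable lebesgue" "\<And>x. x \<notin> S \<Longrightarrow> w x = 0" "\<And>x. \<bar>w x\<bar> \<le> B"
  shows "integrable lebesgue (\<lambda>x. G (w x))" "integrable lebesgue w"
proof -
  have i: "integrable lebesgue (\<lambda>x. c * indicator S x)" for c :: real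
    using S by (intro integrable_mult_right integrable_real_indicator) auto
  show "integrable lebesgue (\<lambda>x. G (w x))"
  proof (rule Bochner_Integration.integrable_bound[OF i[of "G B"]])
    show "AE x in lebesgue. norm (G (w x)) \<le> norm (G B * indicator S x)"
    proof (rule AE_I2)
      fix x
      have "\<bar>w x\<bar> \<le> \<bar>B\<bar>" using w(3)[of x] by linarith
      then show "norm (G (w x)) \<le> norm (G B * indicator S x)"
        using w(2)[of x] A_mono[of "w x" B] by (auto split: split_indicator)
    qed
  qed (rule measurable_compose[OF w(1) A_measurable])
  show "integrable lebesgue w"
  proof (rule Bochner_Integration.integrable_bound[OF i[of B] w(1)], rule AE_I2)
    fix x
    have "\<bar>w x\<bar> \<le> \<bar>B\<bar>" using w(3)[of x] by linarith
    then show "norm (w x) \<le> norm (B * indicator S x)"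
      using w(2)[of x] by (auto split: split_indicator)
  qed
qed

lemma lipschitz_W:
  fixes v :: "'a::euclidean_space \<Rightarrow> real"
  assumes S: "S \<in> sets lebesgue" "emeasure lebesgue S < \<infinity>"
    and v: "v \<in> borel_measurable lebesgue" "\<And>x. x \<notin> S \<Longrightarrow> v x = 0" "\<And>x. \<bar>v x\<bar> \<le> B"
    and L: "\<And>x y. \<bar>v x - v y\<bar> \<le> L * norm (x - y)"
  shows "v \<in> W s G"
proof (rule W_I[OF v(1) bounded_support_integrable(1)[OF S v]])
  show "AE x in lebesgue. G (v x) \<le> G (v x)" by simp
next
  define C where "C = max \<bar>L\<bar> (2 * \<bar>B\<bar>)"
  have C0: "C \<ge> 0" by (simp add: C_def)
  show "integrable mu (\<lambda>p. G (lip_kernel S C p))" by (rule lip_kernel_integrable[OF S C0])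
  show "AE p in mu. G (dq s v p) \<le> G (lip_kernel S C p)"
  proof (intro AE_I2 A_mono)
    fix p :: "'a \<times> 'a"
    obtain x y where p: "p = (x, y)" by (cases p)
    have "\<bar>v x - v y\<bar> \<le> C * (indicator S x + indicator S y) * min 1 (norm (x - y))"
    proof (cases "x \<in> S \<or> y \<in> S")
      case True
      have "\<bar>v x - v y\<bar> \<le> C" using v(3)[of x] v(3)[of y] by (simp add: C_def)
      moreover have "\<bar>v x - v y\<bar> \<le> C * norm (x - y)"
        using L[of x y] by (rule order.trans) (auto simp: C_def intro!: mult_right_mono)
      ultimately have "\<bar>v x - v y\<bar> \<le> C * min 1 (norm (x - y))" by (simp add: min_def)
      also have "\<dots> \<le> C * (indicator S x + indicator S y) * min 1 (norm (x - y))"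
        using True C0 by (auto split: split_indicator intro!: mult_right_mono)
      finally show ?thesis .
    qed (use v(2) in simp)
    then show "\<bar>dq s v p\<bar> \<le> \<bar>lip_kernel S C p\<bar>"
      using C0 by (simp add: p dq_Pair lip_kernel_def abs_divide divide_right_mono order.trans[OF _ abs_ge_self])
  qed
qed

text \<open>Product rule for differences: the increment of \<open>\<zeta> * w\<close> is
  \<open>\<zeta> y\<close> times the increment of \<open>w\<close> plus \<open>w x\<close> times the
  increment of \<open>\<zeta>\<close>. The second part vanishes for \<open>x\<close> outside
  \<open>S\<close> and is bounded by \<open>lip_kernel\<close>.\<close>

lemma cutoff_W:
  fixes w :: "'a::euclidean_space \<Rightarrow> real"
  assumes S: "S \<in> sets lebesgue" "emeasure lebesgue S < \<infinity>"
    and w: "w \<in> W s G" "\<And>x. x \<notin> S \<Longrightarrow> w x = 0" "\<And>x. \<bar>w x\<bar> \<le> B"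
    and \<zeta>: "\<zeta> \<in> borel_measurable lebesgue" "\<And>x. 0 \<le> \<zeta> x" "\<And>x. \<zeta> x \<le> 1"
    and L: "\<And>x y. \<bar>\<zeta> x - \<zeta> y\<bar> \<le> L * norm (x - y)"
  shows "(\<lambda>x. \<zeta> x * w x) \<in> W s G"
proof (rule W_I)
  note [measurable] = W_measurable[OF w(1)] \<zeta>(1)
  show "(\<lambda>x. \<zeta> x * w x) \<in> borel_measurable lebesgue" by measurable
  show "integrable lebesgue (\<lambda>x. G (w x))" using w(1) by (simp add: W_iff)
  show "AE x in lebesgue. G (\<zeta> x * w x) \<le> G (w x)"
    using \<zeta> by (intro AE_I2 A_mono) (auto simp: abs_mult intro!: mult_left_le_one_le)
  define C where "C = max \<bar>L\<bar> 1 * \<bar>B\<bar>"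
  have C0: "C \<ge> 0" by (simp add: C_def)
  show "integrable mu (\<lambda>p. D2 * G (dq s w p) + D2 * G (lip_kernel S C p))"
    using lip_kernel_integrable[OF S C0] w(1) by (auto simp: W_iff)
  show "AE p in mu. G (dq s (\<lambda>x. \<zeta> x * w x) p) \<le> D2 * G (dq s w p) + D2 * G (lip_kernel S C p)"
  proof (intro AE_I2)
    fix p :: "'a \<times> 'a"
    obtain x y where p: "p = (x, y)" by (cases p)
    have "\<bar>w x\<bar> * \<bar>\<zeta> x - \<zeta> y\<bar> \<le> C * (indicator S x + indicator S y) * min 1 (norm (x - y))"
    proof (cases "x \<in> S")
      case True
      have "\<bar>\<zeta> x - \<zeta> y\<bar> \<le> 1" using \<zeta>(2,3)[of x] \<zeta>(2,3)[of y] by linarith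
      then have "\<bar>\<zeta> x - \<zeta> y\<bar> \<le> max \<bar>L\<bar> 1 * 1" by simp
      moreover have "\<bar>\<zeta> x - \<zeta> y\<bar> \<le> max \<bar>L\<bar> 1 * norm (x - y)"
        using L[of x y] by (rule order.trans) (auto intro!: mult_right_mono)
      ultimately have "\<bar>\<zeta> x - \<zeta> y\<bar> \<le> max \<bar>L\<bar> 1 * min 1 (norm (x - y))" by (simp add: min_def)
      moreover have "\<bar>w x\<bar> \<le> \<bar>B\<bar>" using w(3)[of x] by linarith
      ultimately have "\<bar>w x\<bar> * \<bar>\<zeta> x - \<zeta> y\<bar> \<le> \<bar>B\<bar> * (max \<bar>L\<bar> 1 * min 1 (norm (x - y)))" by (intro mult_mono) auto
      also have "\<dots> = C * 1 * min 1 (norm (x - y))" by (simp add: C_def)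
      also have "\<dots> \<le> C * (indicator S x + indicator S y) * min 1 (norm (x - y))"
        using True C0 by (intro mult_right_mono mult_left_mono) (auto split: split_indicator)
      finally show ?thesis .
    qed (use w(2) C0 in \<open>simp\<close>)
    then have k: "\<bar>w x * (\<zeta> x - \<zeta> y) / norm (x - y) powr s\<bar> \<le> \<bar>lip_kernel S C p\<bar>"
      using C0 by (simp add: p lip_kernel_def abs_divide abs_mult divide_right_mono order.trans[OF _ abs_ge_self])
    have "dq s (\<lambda>x. \<zeta> x * w x) p = \<zeta> y * dq s w p + w x * (\<zeta> x - \<zeta> y) / norm (x - y) powr s"
      by (simp add: p dq_Pair add_divide_distrib[symmetric] algebra_simps)
    then have "G (dq s (\<lambda>x. \<zeta> x * w x) p) \<le> D2 * G (\<zeta> y * dq s w p) + D2 * G (w x * (\<zeta> x - \<zeta> y) / norm (x - y) powr s)"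
      using A_add by simp
    also have "\<dots> \<le> D2 * G (dq s w p) + D2 * G (lip_kernel S C p)"
      using \<zeta>(2,3)[of y] D2(1) k by (intro add_mono mult_left_mono A_mono) (auto simp: abs_mult intro!: mult_left_le_one_le)
    finally show "G (dq s (\<lambda>x. \<zeta> x * w x) p) \<le> D2 * G (dq s w p) + D2 * G (lip_kernel S C p)" .
  qed
qed

end

section \<open>Smooth kernels\<close>

text \<open>\<open>Ck_on\<close> speaks of \<open>frechet_derivative\<close>; uniqueness of the
  derivative allows any derivative that has been computed.\<close>

lemma Ck_SucI:
  assumes "\<And>x. (f has_derivative f' x) (at x)" "\<And>v. Ck_on k UNIV (\<lambda>x. f' x v)"
  shows "Ck_on (Suc k) UNIV f"
proof -
  have "frechet_derivative f (at x) = f' x" for x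
    using frechet_derivative_at[OF assms(1)] by simp
  then show ?thesis using assms by (auto simp: differentiable_def)
qed

lemma Ck_SucD:
  assumes "Ck_on (Suc k) UNIV f"
  shows "(f has_derivative frechet_derivative f (at x)) (at x)" "Ck_on k UNIV (\<lambda>x. frechet_derivative f (at x) v)"
  using assms by (auto simp: frechet_derivative_works)

lemma Ck_continuous: "Ck_on k UNIV f \<Longrightarrow> continuous_on UNIV f"
  by (cases k) (auto intro!: differentiable_imp_continuous_on simp: differentiable_on_def)

lemma Ck_mono: "Ck_on (Suc k) UNIV f \<Longrightarrow> Ck_on k UNIV f"
proof (induction k arbitrary: f)
  case 0 then show ?case using Ck_continuous by (simp only: Ck_on.simps(1)) blast
next
  case (Suc k)
  show ?case by (rule Ck_SucI[OF Ck_SucD(1)[OF Suc.prems] Suc.IH[OF Ck_SucD(2)[OF Suc.prems]]])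
qed

lemma Ck_const: "Ck_on k UNIV (\<lambda>x. c)"
  by (induction k arbitrary: c) (auto simp: frechet_derivative_const)

lemma Ck_add: "Ck_on k UNIV f \<Longrightarrow> Ck_on k UNIV h \<Longrightarrow> Ck_on k UNIV (\<lambda>x. f x + h x)"
proof (induction k arbitrary: f h)
  case 0 then show ?case by (auto intro: continuous_on_add)
next
  case (Suc k)
  show ?case
    by (rule Ck_SucI[OF has_derivative_add[OF Ck_SucD(1)[OF Suc.prems(1)] Ck_SucD(1)[OF Suc.prems(2)]]])
       (intro Suc.IH Ck_SucD(2)[OF Suc.prems(1)] Ck_SucD(2)[OF Suc.prems(2)])
qed

lemma Ck_mult: "Ck_on k UNIV f \<Longrightarrow> Ck_on k UNIV h \<Longrightarrow> Ck_on k UNIV (\<lambda>x. f x * h x)"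
proof (induction k arbitrary: f h)
  case 0 then show ?case by (auto intro: continuous_on_mult)
next
  case (Suc k)
  show ?case
    by (rule Ck_SucI[OF has_derivative_mult[OF Ck_SucD(1)[OF Suc.prems(1)] Ck_SucD(1)[OF Suc.prems(2)]]])
       (intro Ck_add Suc.IH Ck_mono[OF Suc.prems(1)] Ck_mono[OF Suc.prems(2)]
        Ck_SucD(2)[OF Suc.prems(1)] Ck_SucD(2)[OF Suc.prems(2)])
qed

lemma Ck_prod: "finite I \<Longrightarrow> (\<And>i. i \<in> I \<Longrightarrow> Ck_on k UNIV (f i)) \<Longrightarrow> Ck_on k UNIV (\<lambda>x. \<Prod>i\<in>I. f i x)"
proof (induction I rule: finite_induct)
  case (insert i I)
  have "Ck_on k UNIV (\<lambda>x. f i x * (\<Prod>i\<in>I. f i x))"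
    by (rule Ck_mult) (use insert in auto)
  then show ?case using insert.hyps by simp
qed (simp add: Ck_const)

lemma Ck_compose_affine:
  fixes f :: "real \<Rightarrow> real" and b :: "'a::euclidean_space"
  shows "Ck_on k UNIV f \<Longrightarrow> Ck_on k UNIV (\<lambda>x. f (a * (x \<bullet> b) + c))"
proof (induction k arbitrary: f)
  case 0
  then have "continuous_on UNIV f" by simp
  moreover have "continuous_on UNIV (\<lambda>x. a * (x \<bullet> b) + c)" by (intro continuous_intros)
  ultimately show ?case using continuous_on_compose2[of UNIV f UNIV "\<lambda>x. a * (x \<bullet> b) + c"] by simp
next
  case (Suc k)
  show ?case
  proof (rule Ck_SucI)
    fix x :: 'a
    have "((\<lambda>x. a * (x \<bullet> b) + c) has_derivative (\<lambda>v. a * (v \<bullet> b))) (at x)"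
      by (auto intro!: derivative_eq_intros)
    from has_derivative_compose[OF this Ck_SucD(1)[OF Suc.prems]]
    have "((\<lambda>x. f (a * (x \<bullet> b) + c)) has_derivative
        (\<lambda>v. frechet_derivative f (at (a * (x \<bullet> b) + c)) (a * (v \<bullet> b)))) (at x)" .
    moreover have "frechet_derivative f (at t) (a * (v \<bullet> b)) = frechet_derivative f (at t) 1 * (a * (v \<bullet> b))" for t v
      using linear_scale[OF has_derivative_linear[OF Ck_SucD(1)[OF Suc.prems]], of t "a * (v \<bullet> b)" 1] by simp
    ultimately show "((\<lambda>x. f (a * (x \<bullet> b) + c)) has_derivative
        (\<lambda>v. frechet_derivative f (at (a * (x \<bullet> b) + c)) 1 * (a * (v \<bullet> b)))) (at x)" by simp
  next
    fix v :: 'a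
    show "Ck_on k UNIV (\<lambda>x. frechet_derivative f (at (a * (x \<bullet> b) + c)) 1 * (a * (v \<bullet> b)))"
      using Suc.IH[OF Ck_SucD(2)[OF Suc.prems, of 1]] by (intro Ck_mult Ck_const)
  qed
qed

text \<open>The classical function that is flat at 0, divided by powers of \<open>t\<close>. The
  family is closed under differentiation up to linear combinations, so smoothness becomes one
  induction.\<close>

definition flat :: "nat \<Rightarrow> real \<Rightarrow> real" where
  "flat m t = (if t > 0 then exp (- 1 / t) / t ^ m else 0)"

lemma flat_tendsto_0: "(flat m \<longlongrightarrow> 0) (at_right 0)"
proof -
  have "((\<lambda>x::real. x ^ m / exp x) \<longlongrightarrow> 0) at_top" by (rule tendsto_power_div_exp_0)
  then have "((\<lambda>t::real. inverse t ^ m / exp (inverse t)) \<longlongrightarrow> 0) (at_right 0)"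
    by (rule filterlim_compose) (rule filterlim_inverse_at_top_right)
  moreover have "\<forall>\<^sub>F t in at_right 0. inverse t ^ m / exp (inverse t) = flat m t"
    using eventually_at_right_less[of "0::real"]
    by eventually_elim (simp add: flat_def field_simps exp_minus power_inverse)
  ultimately show ?thesis by (rule Lim_transform_eventually)
qed

lemma flat_derivative: "(flat m has_real_derivative - real m * flat (Suc m) t + flat (Suc (Suc m)) t) (at t)"
proof -
  consider "t > 0" | "t < 0" | "t = 0" by linarith
  then show ?thesis
  proof cases
    case 1
    have "((\<lambda>t. exp (- 1 / t) / t ^ m) has_real_derivative - real m * flat (Suc m) t + flat (Suc (Suc m)) t) (at t)"
    proof -
      have *: "((\<lambda>t. exp (- 1 / t) / t ^ m) has_real_derivative
         (exp (- 1 / t) * (1 / t\<^sup>2) * t ^ m - exp (- 1 / t) * (real m * t ^ (m - 1))) / (t ^ m * t ^ m)) (at t)"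
        using 1 by (auto intro!: derivative_eq_intros simp: power2_eq_square)
      have "exp (- 1 / t) * (real m * t ^ (m - 1)) / (t ^ m * t ^ m) = real m * flat (Suc m) t"
        using 1 by (cases m) (auto simp: flat_def field_simps)
      moreover have "exp (- 1 / t) * (1 / t\<^sup>2) * t ^ m / (t ^ m * t ^ m) = flat (Suc (Suc m)) t"
        using 1 by (simp add: flat_def field_simps power2_eq_square)
      ultimately show ?thesis using * by (simp add: diff_divide_distrib)
    qed
    then show ?thesis
      by (rule has_field_derivative_transform_within_open[OF _ open_greaterThan[of 0]]) (use 1 in \<open>auto simp: flat_def\<close>)
  next
    case 2
    have "((\<lambda>t. 0) has_real_derivative 0) (at t)" by simp
    then have "(flat m has_real_derivative 0) (at t)"
      by (rule has_field_derivative_transform_within_open[OF _ open_lessThan[of 0]]) (use 2 in \<open>auto simp: flat_def\<close>)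
    then show ?thesis using 2 by (simp add: flat_def)
  next
    case 3
    have "((\<lambda>h. (flat m (0 + h) - flat m 0) / h) \<longlongrightarrow> 0) (at 0)"
      unfolding filterlim_at_split
    proof
      \<comment> \<open>To the right of 0 the difference quotient is exactly
        \<open>flat (Suc m)\<close>, which tends to 0.\<close>
      show "((\<lambda>h. (flat m (0 + h) - flat m 0) / h) \<longlongrightarrow> 0) (at_right 0)"
        by (rule Lim_transform_eventually[OF flat_tendsto_0[of "Suc m"]])
           (use eventually_at_right_less[of "0::real"] in \<open>eventually_elim, simp add: flat_def\<close>)
      have "\<forall>\<^sub>F h in at_left (0::real). h < 0" by (simp add: eventually_at_filter)
      then have "\<forall>\<^sub>F h in at_left (0::real). 0 = (flat m (0 + h) - flat m 0) / h"
        by eventually_elim (simp add: flat_def)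
      then show "((\<lambda>h. (flat m (0 + h) - flat m 0) / h) \<longlongrightarrow> 0) (at_left 0)"
        by (rule Lim_transform_eventually[OF tendsto_const])
    qed
    then show ?thesis using 3 by (simp add: DERIV_def flat_def)
  qed
qed

lemma Ck_flat: "Ck_on k UNIV (flat m)"
proof (induction k arbitrary: m)
  case 0
  have "isCont (flat m) t" for t using flat_derivative by (rule DERIV_isCont)
  then show ?case by (simp add: continuous_at_imp_continuous_on)
next
  case (Suc k)
  show ?case
  proof (rule Ck_SucI)
    show "(flat m has_derivative (\<lambda>v. (- real m * flat (Suc m) t + flat (Suc (Suc m)) t) * v)) (at t)" for t
      using flat_derivative[of m t] by (simp add: has_field_derivative_def)
    show "Ck_on k UNIV (\<lambda>t. (- real m * flat (Suc m) t + flat (Suc (Suc m)) t) * v)" for v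
      by (intro Ck_mult Ck_add Ck_const Suc)
  qed
qed

lemma flat_bounds: "0 \<le> flat 0 t" "flat 0 t \<le> 1" "flat 0 t \<noteq> 0 \<Longrightarrow> 0 < t" "1 / 2 \<le> t \<Longrightarrow> exp (- 2) \<le> flat 0 t"
  by (auto simp: flat_def field_simps split: if_splits)

text \<open>A normalised product of one-dimensional bumps. The centre is arbitrary, for the inward
  shift, and the height is at most a constant over the volume uniformly in centre and radius, which
  keeps the mollification error small.\<close>

lemma smooth_kernel_exists:
  "\<exists>C>0. \<forall>(c :: 'a::euclidean_space) r. 0 < r \<longrightarrow> (\<exists>K. smooth_on UNIV K \<and> (\<forall>z. 0 \<le> K z) \<and>
     (\<forall>z. K z \<noteq> 0 \<longrightarrow> dist c z < r) \<and> integrable lborel K \<and> (\<integral>z. K z \<partial>lborel) = 1 \<and> (\<forall>z. K z \<le> C / r ^ DIM('a)))"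
proof -
  let ?n = "DIM('a)"
  \<comment> \<open>On the concentric cube of side \<open>q\<close> each of the two factors of
    \<open>\<beta>\<close> is at least \<open>exp (- 2)\<close>, so the integral is at least
    \<open>(exp (- 4) * q) ^ DIM('a)\<close>. The reciprocal equals
    \<open>C / r ^ DIM('a)\<close>.\<close>
  define C where "C = (2 * real ?n * exp 4) ^ ?n"
  have C: "C > 0" by (simp add: C_def)
  have "\<exists>K. smooth_on UNIV K \<and> (\<forall>z. 0 \<le> K z) \<and>
     (\<forall>z. K z \<noteq> 0 \<longrightarrow> dist c z < r) \<and> integrable lborel K \<and> (\<integral>z. K z \<partial>lborel) = 1 \<and> (\<forall>z. K z \<le> C / r ^ ?n)"
    if r: "0 < r" for c :: 'a and r
  proof -
    \<comment> \<open>The support lies in a cube of half-side \<open>q\<close>, whose points have l1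
      distance at most \<open>DIM('a) * q = r / 2\<close> from the centre.\<close>
    define q where "q = r / (2 * real ?n)"
    have q: "q > 0" using r by (simp add: q_def)
    define \<beta> where "\<beta> z b = flat 0 ((- 1 / q) * (z \<bullet> b) + (1 + c \<bullet> b / q)) * flat 0 ((1 / q) * (z \<bullet> b) + (1 - c \<bullet> b / q))" for z b
    define K0 where "K0 z = (\<Prod>b\<in>Basis. \<beta> z b)" for z
    have smooth: "Ck_on k UNIV K0" for k
      unfolding K0_def \<beta>_def by (rule Ck_prod, simp, rule Ck_mult; rule Ck_compose_affine[OF Ck_flat])
    have \<beta>: "0 \<le> \<beta> z b" "\<beta> z b \<le> 1" for z b
      using flat_bounds by (auto simp: \<beta>_def intro!: mult_le_one)
    have K0: "0 \<le> K0 z" "K0 z \<le> 1" for z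
      unfolding K0_def using \<beta> by (auto intro!: prod_nonneg prod_le_1)
    have supp: "\<bar>(z - c) \<bullet> b\<bar> < q" if "K0 z \<noteq> 0" "b \<in> Basis" for z b
    proof -
      have "\<beta> z b \<noteq> 0" using that by (auto simp: K0_def)
      then have nz: "flat 0 ((- 1 / q) * (z \<bullet> b) + (1 + c \<bullet> b / q)) \<noteq> 0"
          "flat 0 ((1 / q) * (z \<bullet> b) + (1 - c \<bullet> b / q)) \<noteq> 0"
        unfolding \<beta>_def by (auto simp only: mult_eq_0_iff de_Morgan_disj)
      have "0 < (- 1 / q) * (z \<bullet> b) + (1 + c \<bullet> b / q)" "0 < (1 / q) * (z \<bullet> b) + (1 - c \<bullet> b / q)"
        by (rule flat_bounds(3)[OF nz(1)], rule flat_bounds(3)[OF nz(2)])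
      then have "(z \<bullet> b - c \<bullet> b) / q < 1" "(c \<bullet> b - z \<bullet> b) / q < 1" by (simp_all add: diff_divide_distrib)
      then have "z \<bullet> b - c \<bullet> b < q" "c \<bullet> b - z \<bullet> b < q" using q by (simp_all add: pos_divide_less_eq)
      then show ?thesis by (simp add: abs_less_iff inner_diff_left)
    qed
    define cq where "cq = cbox (c - q *\<^sub>R One) (c + q *\<^sub>R One)"
    define cp where "cp = cbox (c - (q / 2) *\<^sub>R One) (c + (q / 2) *\<^sub>R One)"
    have fin: "emeasure lborel (cbox a b) < \<infinity>" for a b :: 'a
      by (rule emeasure_bounded_finite) (rule bounded_cbox)
    have up: "K0 z \<le> indicator cq z" for z
      using K0[of z] supp[of z] by (cases "K0 z = 0")
        (force split: split_indicator simp: cq_def mem_box inner_diff_left inner_add_left abs_less_iff)+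
    have low: "exp (- 4) ^ ?n * indicator cp z \<le> K0 z" for z
    proof (cases "z \<in> cp")
      case True
      have "exp (- 4) \<le> \<beta> z b" if b: "b \<in> Basis" for b
      proof -
        have "c \<bullet> b - q / 2 \<le> z \<bullet> b" "z \<bullet> b \<le> c \<bullet> b + q / 2"
          using True b by (auto simp: cp_def mem_box inner_diff_left inner_add_left)
        then have "(z \<bullet> b - c \<bullet> b) / q \<le> 1 / 2" "(c \<bullet> b - z \<bullet> b) / q \<le> 1 / 2"
          using q by (simp_all add: pos_divide_le_eq)
        then have "1 / 2 \<le> (- 1 / q) * (z \<bullet> b) + (1 + c \<bullet> b / q)" "1 / 2 \<le> (1 / q) * (z \<bullet> b) + (1 - c \<bullet> b / q)"
          by (simp_all add: diff_divide_distrib)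
        then have "exp (- 2) * exp (- 2) \<le> \<beta> z b"
          unfolding \<beta>_def by (intro mult_mono flat_bounds(4) flat_bounds(1)) auto
        then show ?thesis by (simp add: exp_add[symmetric])
      qed
      then have "(\<Prod>b\<in>(Basis::'a set). exp (- 4)) \<le> K0 z" unfolding K0_def by (intro prod_mono) auto
      then show ?thesis using True by simp
    qed (use K0 in simp)
    have [measurable]: "K0 \<in> borel_measurable borel"
      using Ck_continuous[OF smooth[of 0]] by (rule borel_measurable_continuous_onI)
    have int: "integrable lborel K0"
    proof (rule Bochner_Integration.integrable_bound)
      show "integrable lborel (\<lambda>z. indicator cq z :: real)"
        by (intro integrable_real_indicator) (auto simp: cq_def fin[unfolded infinity_ennreal_def])
      show "AE z in lborel. norm (K0 z) \<le> norm (indicator cq z :: real)" using K0 up by simp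
    qed simp
    define I where "I = (\<integral>z. K0 z \<partial>lborel)"
    have Ilow: "exp (- 4) ^ ?n * q ^ ?n \<le> I"
    proof -
      have "exp (- 4) ^ ?n * q ^ ?n = (\<integral>z. exp (- 4) ^ ?n * indicator cp z \<partial>(lborel :: 'a measure))"
        using q by (simp add: cp_def content_cbox_if box_ne_empty inner_diff_left inner_add_left)
      also have "\<dots> \<le> I" unfolding I_def using low int
        by (intro integral_mono integrable_mult_right integrable_real_indicator) (auto simp: cp_def fin[unfolded infinity_ennreal_def])
      finally show ?thesis .
    qed
    have I: "I > 0" using q by (intro less_le_trans[OF _ Ilow]) auto
    have "1 / I \<le> 1 / (exp (- 4) ^ ?n * q ^ ?n)" using q I Ilow by (intro divide_left_mono) auto
    also have "\<dots> = C / r ^ ?n"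
      unfolding C_def q_def by (simp add: power_divide power_mult_distrib exp_minus power_inverse field_simps)
    finally have Ib: "1 / I \<le> C / r ^ ?n" .
    have "dist c z < r" if "K0 z \<noteq> 0" for z
    proof -
      have "norm (z - c) \<le> (\<Sum>b\<in>(Basis::'a set). \<bar>(z - c) \<bullet> b\<bar>)" by (rule norm_le_l1)
      also have "\<dots> \<le> (\<Sum>b\<in>(Basis::'a set). q)" using supp[OF that] by (intro sum_mono less_imp_le)
      also have "\<dots> < r" using r by (simp add: q_def)
      finally show ?thesis by (simp add: dist_norm norm_minus_commute)
    qed
    moreover have "smooth_on UNIV (\<lambda>z. 1 / I * K0 z)"
      unfolding smooth_on_def by (intro allI Ck_mult Ck_const smooth)
    moreover have "1 / I * K0 z \<le> C / r ^ ?n" for z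
      using mult_left_mono[OF K0(2)[of z], of "1 / I"] I Ib by simp
    ultimately show ?thesis using K0 I int
      by (intro exI[of _ "\<lambda>z. 1 / I * K0 z"]) (auto simp: I_def)
  qed
  then show ?thesis using C by blast
qed

section \<open>Mollification\<close>

declare id_measurable_lebesgue [measurable del]

text \<open>Smooth with compact support; a bounded set has compact closure here.\<close>

definition cs :: "('a::euclidean_space \<Rightarrow> real) \<Rightarrow> bool" where
  "cs K \<longleftrightarrow> smooth_on UNIV K \<and> bounded {x. K x \<noteq> 0}"

lemma cs_has_derivative: "cs K \<Longrightarrow> (K has_derivative frechet_derivative K (at x)) (at x)"
  using Ck_SucD(1)[of 0 K] unfolding cs_def smooth_on_def by blast

lemma cs_linear: "cs K \<Longrightarrow> linear (frechet_derivative K (at x))"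
  by (rule has_derivative_linear[OF cs_has_derivative])

lemma cs_continuous: "cs K \<Longrightarrow> continuous_on UNIV K"
  using Ck_continuous unfolding cs_def smooth_on_def by blast

lemma cs_measurable: "cs K \<Longrightarrow> K \<in> borel_measurable borel"
  using cs_continuous by (rule borel_measurable_continuous_onI)

text \<open>The factor \<open>c\<close> accommodates the sign \<open>- 1\<close> that appears when
  \<open>K (y - x)\<close> is differentiated in \<open>x\<close>, so that the kernels stay in one
  class under repeated differentiation.\<close>

lemma cs_deriv:
  assumes "cs K" shows "cs (\<lambda>x. c * frechet_derivative K (at x) v)"
proof -
  have "Ck_on k UNIV (\<lambda>x. c * frechet_derivative K (at x) v)" for k
    using assms Ck_SucD(2)[of k K v] unfolding cs_def smooth_on_def by (intro Ck_mult Ck_const) blast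
  moreover have "frechet_derivative K (at x) v = 0" if "x \<notin> closure {x. K x \<noteq> 0}" for x
  proof -
    have "(K has_derivative (\<lambda>_. 0)) (at x)"
      by (rule has_derivative_transform_within_open[OF has_derivative_const[of 0] open_Compl[OF closed_closure[of "{x. K x \<noteq> 0}"]]])
         (use that closure_subset[of "{x. K x \<noteq> 0}"] in auto)
    from frechet_derivative_at[OF this] show ?thesis by (metis)
  qed
  then have "{x. c * frechet_derivative K (at x) v \<noteq> 0} \<subseteq> closure {x. K x \<noteq> 0}" by auto
  then have "bounded {x. c * frechet_derivative K (at x) v \<noteq> 0}"
    using assms bounded_subset[OF bounded_closure] unfolding cs_def by blast
  ultimately show ?thesis by (simp add: cs_def smooth_on_def)
qed

lemma cs_bounded:
  fixes K :: "'a::euclidean_space \<Rightarrow> real"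
  assumes "cs K" obtains B where "B \<ge> 0" "\<And>x. \<bar>K x\<bar> \<le> B"
proof -
  have "compact (closure {x. K x \<noteq> 0})" using assms by (simp add: cs_def)
  then have "bounded (K ` closure {x. K x \<noteq> 0})"
    by (intro compact_imp_bounded compact_continuous_image continuous_on_subset[OF cs_continuous[OF assms]]) auto
  then obtain B where B: "\<And>x. x \<in> closure {x. K x \<noteq> 0} \<Longrightarrow> \<bar>K x\<bar> \<le> B" by (auto simp: bounded_iff)
  have "\<bar>K x\<bar> \<le> \<bar>B\<bar>" for x
    using B[of x] closure_subset[of "{x. K x \<noteq> 0}"] by (cases "K x = 0") force+
  then show ?thesis using that[of "\<bar>B\<bar>"] by auto
qed

lemma cs_lipschitz:
  fixes K :: "'a::euclidean_space \<Rightarrow> real"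
  assumes "cs K"
  obtains L where "L \<ge> 0" "\<And>x v. \<bar>frechet_derivative K (at x) v\<bar> \<le> L * norm v"
    "\<And>x y. \<bar>K x - K y\<bar> \<le> L * norm (x - y)"
proof -
  have "\<exists>B. B \<ge> 0 \<and> (\<forall>x. \<bar>frechet_derivative K (at x) b\<bar> \<le> B)" for b
    using cs_bounded[OF cs_deriv[OF assms, of 1 b]] by (metis mult_1)
  then obtain B where B: "\<And>b. B b \<ge> 0" "\<And>b x. \<bar>frechet_derivative K (at x) b\<bar> \<le> B b" by metis
  define L where "L = (\<Sum>b\<in>(Basis::'a set). B b)"
  have 1: "\<bar>frechet_derivative K (at x) v\<bar> \<le> L * norm v" for x v
  proof -
    have "frechet_derivative K (at x) v = frechet_derivative K (at x) (\<Sum>b\<in>Basis. (v \<bullet> b) *\<^sub>R b)"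
      by (simp add: euclidean_representation)
    also have "\<dots> = (\<Sum>b\<in>Basis. (v \<bullet> b) * frechet_derivative K (at x) b)"
      using cs_linear[OF assms, of x] by (simp add: linear_sum linear_scale)
    also have "\<bar>\<dots>\<bar> \<le> (\<Sum>b\<in>Basis. \<bar>(v \<bullet> b) * frechet_derivative K (at x) b\<bar>)" by (rule sum_abs)
    also have "\<dots> \<le> (\<Sum>b\<in>Basis. norm v * B b)"
      using B by (intro sum_mono) (auto simp: abs_mult Basis_le_norm intro!: mult_mono)
    also have "\<dots> = L * norm v" by (simp add: L_def sum_distrib_left mult.commute)
    finally show ?thesis .
  qed
  have 2: "\<bar>K x - K y\<bar> \<le> L * norm (x - y)" for x y
  proof -
    have "norm (K x - K y) \<le> L * norm (x - y)"
    proof (rule differentiable_bound[of UNIV])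
      show "(K has_derivative frechet_derivative K (at x)) (at x within UNIV)" for x
        using cs_has_derivative[OF assms] by simp
      show "onorm (frechet_derivative K (at x)) \<le> L" for x
        using 1 by (intro onorm_le) auto
    qed auto
    then show ?thesis by simp
  qed
  have "L \<ge> 0" unfolding L_def using B by (intro sum_nonneg) auto
  then show ?thesis using that 1 2 by blast
qed

text \<open>Convolution with the reflected kernel. Substitution turns it into an average of the
  translates \<open>w (z + x)\<close> with weights \<open>K z\<close>, the form in which Jensen's
  inequality applies.\<close>

definition cv :: "('a::euclidean_space \<Rightarrow> real) \<Rightarrow> ('a \<Rightarrow> real) \<Rightarrow> 'a \<Rightarrow> real" where
  "cv K w x = (\<integral>y. K (y - x) * w y \<partial>lborel)"

lemma cv_integrable:
  assumes "cs K" "integrable lborel w"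
  shows "integrable lborel (\<lambda>y. K (y - x) * w y)"
proof -
  obtain B where B: "B \<ge> 0" "\<And>x. \<bar>K x\<bar> \<le> B" using cs_bounded[OF assms(1)] by blast
  note [measurable] = cs_measurable[OF assms(1)]
  have [measurable]: "w \<in> borel_measurable borel" using assms(2) by auto
  show ?thesis
  proof (rule Bochner_Integration.integrable_bound)
    show "integrable lborel (\<lambda>y. B * w y)" using assms(2) by simp
    show "AE y in lborel. norm (K (y - x) * w y) \<le> norm (B * w y)"
      using B by (auto simp: abs_mult intro!: mult_right_mono)
  qed simp
qed

text \<open>Differentiation under the integral along sequences: the remainder quotients tend to 0
  pointwise and are dominated by \<open>2 * L * \<bar>w y\<bar>\<close> thanks to the Lipschitz
  bound for \<open>K\<close>.\<close>

lemma cv_has_derivative: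
  fixes K :: "'a::euclidean_space \<Rightarrow> real"
  assumes K: "cs K" and w: "integrable lborel w"
  shows "(cv K w has_derivative (\<lambda>v. cv (\<lambda>z. - 1 * frechet_derivative K (at z) v) w x)) (at x)"
proof -
  let ?D = "\<lambda>z v. frechet_derivative K (at z) v"
  define T where "T v = cv (\<lambda>z. - 1 * ?D z v) w x" for v
  obtain L where L: "L \<ge> 0" "\<And>x v. \<bar>?D x v\<bar> \<le> L * norm v" "\<And>x y. \<bar>K x - K y\<bar> \<le> L * norm (x - y)"
    using cs_lipschitz[OF K] by blast
  have iD: "integrable lborel (\<lambda>y. - 1 * ?D (y - x) v * w y)" for v
    using cv_integrable[OF cs_deriv[OF K] w] .
  have bl: "bounded_linear T"
  proof (rule bounded_linear_intro)
    show "T (u + v) = T u + T v" for u v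
    proof -
      have "T (u + v) = (\<integral>y. - 1 * ?D (y - x) u * w y + - 1 * ?D (y - x) v * w y \<partial>lborel)"
        unfolding T_def cv_def by (simp add: linear_add[OF cs_linear[OF K]] algebra_simps)
      also have "\<dots> = T u + T v" unfolding T_def cv_def
        by (rule Bochner_Integration.integral_add[OF iD iD])
      finally show ?thesis .
    qed
    show "T (r *\<^sub>R v) = r *\<^sub>R T v" for r v
      unfolding T_def cv_def by (simp add: linear_scale[OF cs_linear[OF K]] mult.assoc)
    show "norm (T v) \<le> norm v * (L * (\<integral>y. \<bar>w y\<bar> \<partial>lborel))" for v
    proof -
      have "\<bar>T v\<bar> \<le> (\<integral>y. \<bar>- 1 * ?D (y - x) v * w y\<bar> \<partial>lborel)" unfolding T_def cv_def by (rule integral_abs_bound)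
      also have "\<dots> \<le> (\<integral>y. (L * norm v) * \<bar>w y\<bar> \<partial>lborel)"
      proof (rule integral_mono)
        show "integrable lborel (\<lambda>y. \<bar>- 1 * ?D (y - x) v * w y\<bar>)" using iD by (rule integrable_abs)
        show "integrable lborel (\<lambda>y. (L * norm v) * \<bar>w y\<bar>)" using w by simp
        show "\<bar>- 1 * ?D (y - x) v * w y\<bar> \<le> (L * norm v) * \<bar>w y\<bar>" for y
          using L(2) by (auto simp: abs_mult intro!: mult_right_mono)
      qed
      finally show ?thesis by (simp add: mult_ac)
    qed
  qed
  have "((\<lambda>y. (cv K w y - cv K w x - T (y - x)) /\<^sub>R norm (y - x)) \<longlongrightarrow> 0) (at x)"
    unfolding tendsto_at_iff_sequentially comp_def
  proof (intro allI impI)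
    fix X :: "nat \<Rightarrow> 'a" assume X: "\<forall>i. X i \<in> UNIV - {x}" "X \<longlonglongrightarrow> x"
    define F where "F i y = (K (y - X i) - K (y - x) - - 1 * ?D (y - x) (X i - x)) / norm (X i - x) * w y" for i y
    have Feq: "F i = (\<lambda>y. (K (y - X i) * w y - K (y - x) * w y - - 1 * ?D (y - x) (X i - x) * w y) / norm (X i - x))" for i
      by (rule ext) (simp only: F_def left_diff_distrib times_divide_eq_left)
    have iF: "integrable lborel (F i)" for i
      unfolding Feq by (intro integrable_divide Bochner_Integration.integrable_diff cv_integrable[OF K w] iD)
    have eq: "(cv K w (X i) - cv K w x - T (X i - x)) /\<^sub>R norm (X i - x) = (\<integral>y. F i y \<partial>lborel)" for i
    proof -
      have e1: "cv K w (X i) - cv K w x - T (X i - x) =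
         (\<integral>y. K (y - X i) * w y - K (y - x) * w y - - 1 * ?D (y - x) (X i - x) * w y \<partial>lborel)"
        unfolding T_def cv_def
        by (simp only: Bochner_Integration.integral_diff Bochner_Integration.integrable_diff cv_integrable[OF K w] iD)
      have "(cv K w (X i) - cv K w x - T (X i - x)) / norm (X i - x) = (\<integral>y. F i y \<partial>lborel)"
        unfolding e1 Feq by (rule integral_divide_zero[symmetric])
      then show ?thesis by (simp add: divide_inverse mult.commute)
    qed
    have "(\<lambda>i. \<integral>y. F i y \<partial>lborel) \<longlonglongrightarrow> (\<integral>y. 0 \<partial>(lborel :: 'a measure))"
    proof (rule integral_dominated_convergence[where w = "\<lambda>y. (2 * L) * \<bar>w y\<bar>"])
      show "AE y in lborel. (\<lambda>i. F i y) \<longlonglongrightarrow> 0"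
      proof (rule AE_I2)
        fix y :: 'a
        define Q where "Q z' = (K z' - K (y - x) - ?D (y - x) (z' - (y - x))) /\<^sub>R norm (z' - (y - x))" for z'
        have h: "(Q \<longlongrightarrow> 0) (at (y - x))"
          using cs_has_derivative[OF K, of "y - x"] unfolding Q_def has_derivative_def by (simp add: Lim_ident_at)
        have a: "\<forall>i. y - X i \<in> UNIV - {y - x}" using X(1) by auto
        have b: "(\<lambda>i. y - X i) \<longlonglongrightarrow> y - x" by (rule tendsto_diff[OF tendsto_const X(2)])
        have "(\<lambda>i. Q (y - X i)) \<longlonglongrightarrow> 0"
          using h[unfolded tendsto_at_iff_sequentially, THEN spec, THEN mp, THEN mp, OF a b] by (simp only: comp_def)
        then have "(\<lambda>i. (K (y - X i) - K (y - x) - ?D (y - x) ((y - X i) - (y - x))) /\<^sub>R norm ((y - X i) - (y - x))) \<longlonglongrightarrow> 0"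
          unfolding Q_def .
        moreover have "?D (y - x) ((y - X i) - (y - x)) = - 1 * ?D (y - x) (X i - x)" for i
          using linear_neg[OF cs_linear[OF K, of "y - x"], of "X i - x"] by (simp add: algebra_simps)
        ultimately have "(\<lambda>i. (K (y - X i) - K (y - x) - - 1 * ?D (y - x) (X i - x)) / norm (X i - x)) \<longlonglongrightarrow> 0"
          by (simp add: divide_inverse mult.commute norm_minus_commute)
        then have "(\<lambda>i. (K (y - X i) - K (y - x) - - 1 * ?D (y - x) (X i - x)) / norm (X i - x) * w y) \<longlonglongrightarrow> 0 * w y"
          by (intro tendsto_mult tendsto_const)
        then show "(\<lambda>i. F i y) \<longlonglongrightarrow> 0" by (simp add: F_def)
      qed
      show "AE y in lborel. norm (F i y) \<le> (2 * L) * \<bar>w y\<bar>" for i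
      proof (rule AE_I2)
        fix y
        have n: "norm (X i - x) > 0" using X by auto
        have "\<bar>K (y - X i) - K (y - x) - - 1 * ?D (y - x) (X i - x)\<bar> \<le> 2 * L * norm (X i - x)"
          using L(3)[of "y - X i" "y - x"] L(2)[of "y - x" "X i - x"] by (simp add: norm_minus_commute)
        then have "\<bar>(K (y - X i) - K (y - x) - - 1 * ?D (y - x) (X i - x)) / norm (X i - x)\<bar> \<le> 2 * L"
          using n by (simp add: abs_divide pos_divide_le_eq)
        then show "norm (F i y) \<le> (2 * L) * \<bar>w y\<bar>" unfolding F_def real_norm_def abs_mult by (intro mult_right_mono) auto
      qed
    qed (use iF w in auto)
    then show "(\<lambda>i. (cv K w (X i) - cv K w x - T (X i - x)) /\<^sub>R norm (X i - x)) \<longlonglongrightarrow> 0" unfolding eq by simp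
  qed
  with bl have "(cv K w has_derivative T) (at x)" by (simp add: has_derivative_def Lim_ident_at)
  then show ?thesis by (simp add: T_def[abs_def])
qed

text \<open>A derivative of \<open>cv K w\<close> is again of the form \<open>cv\<close>, with a
  derivative of \<open>K\<close> as kernel, so induction over all kernels at once works.\<close>

lemma cv_smooth: assumes "integrable lborel w" shows "cs K \<Longrightarrow> smooth_on UNIV (cv K w)"
proof -
  have "Ck_on k UNIV (cv K w)" if "cs K" for k K
    using that
  proof (induction k arbitrary: K)
    case 0
    have "isCont (cv K w) x" for x using has_derivative_continuous[OF cv_has_derivative[OF 0 assms]] .
    then show ?case by (simp add: continuous_at_imp_continuous_on)
  next
    case (Suc k)
    show ?case
      by (rule Ck_SucI[OF cv_has_derivative[OF Suc.prems assms] Suc.IH[OF cs_deriv[OF Suc.prems]]])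
  qed
  then show "cs K \<Longrightarrow> smooth_on UNIV (cv K w)" by (simp add: smooth_on_def)
qed

lemma nn_integral_translate:
  assumes "h \<in> borel_measurable borel"
  shows "(\<integral>\<^sup>+ y. h (y + z) \<partial>(lborel :: 'a::euclidean_space measure)) = (\<integral>\<^sup>+ y. h y \<partial>lborel)"
proof -
  have "(\<integral>\<^sup>+ y. h y \<partial>lborel) = (\<integral>\<^sup>+ y. h y \<partial>distr lborel borel ((+) z))" by (simp add: lborel_distr_plus)
  also have "\<dots> = (\<integral>\<^sup>+ y. h (z + y) \<partial>lborel)" using assms by (subst nn_integral_distr) auto
  finally show ?thesis by (simp add: add.commute)
qed

lemma integral_translate:
  fixes h :: "'a::euclidean_space \<Rightarrow> real"
  assumes "h \<in> borel_measurable borel"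
  shows "(\<integral>y. h (y + z) \<partial>lborel) = (\<integral>y. h y \<partial>lborel)"
proof -
  have "(\<integral>y. h y \<partial>lborel) = (\<integral>y. h y \<partial>distr lborel borel ((+) z))" by (simp add: lborel_distr_plus)
  also have "\<dots> = (\<integral>y. h (z + y) \<partial>lborel)" using assms by (subst integral_distr) auto
  finally show ?thesis by (simp add: add.commute)
qed

section \<open>The modular and the L1 error of mollified functions\<close>

context orlicz
begin

lemma rho_s_borel:
  fixes w :: "'a::euclidean_space \<Rightarrow> real"
  assumes w: "w \<in> borel_measurable borel"
  shows "rho_s s G w = (\<integral>\<^sup>+ x. \<integral>\<^sup>+ y. ennreal (G (dq s w (x, y))) * ennreal (1 / norm (x - y) ^ DIM('a)) \<partial>lborel \<partial>lborel)"
proof -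
  have "w \<in> borel_measurable lebesgue" using w by (simp add: measurable_completion)
  then have "(\<lambda>p. ennreal (G (dq s w (fst p, snd p)))) \<in> borel_measurable (lebesgue \<Otimes>\<^sub>M lebesgue)"
    using measurable_compose[OF dq_measurable[of w s], of "\<lambda>t. ennreal (G t)" borel]
    by (simp cong: measurable_cong_sets add: sets_mu)
  from nn_integral_mu[of "\<lambda>x y. ennreal (G (dq s w (x, y)))", OF this]
  show ?thesis by (simp add: rho_s_eq nn_integral_completion)
qed

text \<open>\<open>cv K w\<close> is an average of translates of \<open>w\<close>, and the modular
  is convex and translation invariant. The rest is Tonelli's theorem.\<close>

lemma rho_s_cv_le:
  fixes w K :: "'a::euclidean_space \<Rightarrow> real"
  assumes K: "cs K" "\<And>z. 0 \<le> K z" "integrable lborel K" "(\<integral>z. K z \<partial>lborel) = 1"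
    and w: "w \<in> borel_measurable borel" "integrable lborel w" "\<And>x. \<bar>w x\<bar> \<le> B"
  shows "rho_s s G (cv K w) \<le> rho_s s G w"
proof -
  note [measurable] = cs_measurable[OF K(1)] w(1)
  have cvm [measurable]: "cv K w \<in> borel_measurable borel"
    using Ck_continuous cv_smooth[OF w(2) K(1)] unfolding smooth_on_def by (blast intro: borel_measurable_continuous_onI)
  have cvt: "cv K w x = (\<integral>z. K z * w (z + x) \<partial>lborel)" for x
    unfolding cv_def using integral_translate[of "\<lambda>y. K (y - x) * w y" x] by simp
  have iw: "integrable lborel (\<lambda>z. K z * h z)" if [measurable]: "h \<in> borel_measurable borel" and "\<And>z. \<bar>h z\<bar> \<le> c" for h c
  proof (rule Bochner_Integration.integrable_bound[where f = "\<lambda>z. c * K z"])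
    have "0 \<le> c" using that(2)[of 0] by linarith
    then show "AE z in lborel. norm (K z * h z) \<le> norm (c * K z)"
      using mult_left_mono[OF that(2) K(2)] K(2) by (intro AE_I2) (simp add: abs_mult mult.commute)
  qed (use K(3) in auto)
  have jensen: "ennreal (G (dq s (cv K w) (x, y))) \<le> (\<integral>\<^sup>+ z. ennreal (K z) * ennreal (G (dq s w (z + x, z + y))) \<partial>lborel)" for x y
  proof -
    define D where "D z = dq s w (z + x, z + y)" for z
    have [measurable]: "D \<in> borel_measurable borel" unfolding D_def dq_Pair by measurable
    have Db: "\<bar>D z\<bar> \<le> (2 * \<bar>B\<bar>) / norm (x - y) powr s" for z
    proof -
      have "\<bar>w (z + x) - w (z + y)\<bar> \<le> 2 * \<bar>B\<bar>" using w(3)[of "z + x"] w(3)[of "z + y"] by linarith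
      then show ?thesis by (simp add: D_def dq_Pair abs_divide divide_right_mono)
    qed
    define m where "m = (\<integral>z. K z * D z \<partial>lborel)"
    have "dq s (cv K w) (x, y) = m"
    proof -
      have "m = (\<integral>z. (K z * w (z + x) - K z * w (z + y)) / norm (x - y) powr s \<partial>lborel)"
        unfolding m_def D_def dq_Pair by (simp add: right_diff_distrib)
      also have "\<dots> = (cv K w x - cv K w y) / norm (x - y) powr s"
        unfolding cvt using iw[of "\<lambda>z. w (z + x)" B] iw[of "\<lambda>z. w (z + y)" B] w(3)
        by (simp add: Bochner_Integration.integral_diff)
      finally show ?thesis by (simp add: dq_Pair)
    qed
    moreover have iG: "integrable lborel (\<lambda>z. K z * G (D z))"
    proof (rule iw)
      show "\<bar>G (D z)\<bar> \<le> G ((2 * \<bar>B\<bar>) / norm (x - y) powr s)" for z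
        using Db[of z] by (simp add: A_mono order.trans[OF _ abs_ge_self])
    qed simp
    moreover have iD: "integrable lborel (\<lambda>z. K z * D z)" by (rule iw[OF _ Db]) simp
    \<comment> \<open>Jensen's inequality from the tangent of \<open>G\<close> at the mean
      \<open>m\<close>, integrated against \<open>K\<close>: the linear terms cancel because
      \<open>K\<close> has integral 1.\<close>
    have "G m \<le> (\<integral>z. K z * G (D z) \<partial>lborel)"
    proof -
      have "(\<integral>z. (G m - g m * m) * K z + g m * (K z * D z) \<partial>lborel) \<le> (\<integral>z. K z * G (D z) \<partial>lborel)"
      proof (rule integral_mono[OF _ iG])
        show "integrable lborel (\<lambda>z. (G m - g m * m) * K z + g m * (K z * D z))" using iD K(3) by auto
        show "(G m - g m * m) * K z + g m * (K z * D z) \<le> K z * G (D z)" for z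
          using mult_left_mono[OF tangent[of m "D z"] K(2)[of z]] by (simp add: algebra_simps)
      qed
      moreover have "(\<integral>z. (G m - g m * m) * K z + g m * (K z * D z) \<partial>lborel) = (G m - g m * m) * 1 + g m * m"
        using iD K(3) by (subst Bochner_Integration.integral_add) (auto simp: K(4) m_def)
      ultimately show ?thesis by simp
    qed
    moreover have "ennreal (\<integral>z. K z * G (D z) \<partial>lborel) = (\<integral>\<^sup>+ z. ennreal (K z) * ennreal (G (D z)) \<partial>lborel)"
      using K(2) by (subst nn_integral_eq_integral[OF iG, symmetric]) (auto simp: ennreal_mult)
    ultimately show ?thesis unfolding D_def by (metis ennreal_leI)
  qed
  define f where "f x y = ennreal (G (dq s w (x, y))) * ennreal (1 / norm (x - y) ^ DIM('a))" for x y
  have fm: "(\<lambda>p. f (fst p) (snd p)) \<in> borel_measurable (borel \<Otimes>\<^sub>M borel)"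
    unfolding f_def dq_Pair by measurable
  have fm2 [measurable]: "(\<lambda>x. f (a x) (b x)) \<in> borel_measurable M"
    if [measurable]: "a \<in> borel_measurable M" "b \<in> borel_measurable M" for a b and M :: "'b measure"
    using measurable_compose[OF measurable_Pair[OF that] fm] by simp
  have fmp: "(\<lambda>p. f (h (fst p) (snd p)) (h' (fst p) (snd p))) \<in> borel_measurable (lborel \<Otimes>\<^sub>M lborel)"
    if "(\<lambda>p. h (fst p) (snd p)) \<in> borel_measurable (lborel \<Otimes>\<^sub>M lborel)" "(\<lambda>p. h' (fst p) (snd p)) \<in> borel_measurable (lborel \<Otimes>\<^sub>M lborel)"
    for h h' :: "'a \<Rightarrow> 'a \<Rightarrow> 'a"
    using measurable_compose[OF measurable_Pair[OF that] fm] by simp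
  define F where "F x = (\<integral>\<^sup>+ y. f x y \<partial>lborel)" for x
  have Fm [measurable]: "F \<in> borel_measurable borel"
    using lborel.borel_measurable_nn_integral_fst[of "\<lambda>p. f (fst p) (snd p)" borel] fm
    unfolding F_def by (simp cong: measurable_cong_sets)
  have km: "(\<lambda>z. ennreal (K z)) \<in> borel_measurable borel" by measurable
  have "rho_s s G (cv K w) \<le> (\<integral>\<^sup>+ x. \<integral>\<^sup>+ y. \<integral>\<^sup>+ z. ennreal (K z) * f (z + x) (z + y) \<partial>lborel \<partial>lborel \<partial>lborel)"
    unfolding rho_s_borel[OF cvm]
  proof (intro nn_integral_mono)
    fix x y :: 'a
    have "ennreal (G (dq s (cv K w) (x, y))) * ennreal (1 / norm (x - y) ^ DIM('a)) \<le>
       (\<integral>\<^sup>+ z. ennreal (K z) * ennreal (G (dq s w (z + x, z + y))) \<partial>lborel) * ennreal (1 / norm (x - y) ^ DIM('a))"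
      by (intro mult_right_mono jensen) auto
    also have "\<dots> = (\<integral>\<^sup>+ z. ennreal (K z) * ennreal (G (dq s w (z + x, z + y))) * ennreal (1 / norm (x - y) ^ DIM('a)) \<partial>lborel)"
    proof (rule nn_integral_multc[symmetric])
      show "(\<lambda>z. ennreal (K z) * ennreal (G (dq s w (z + x, z + y)))) \<in> borel_measurable lborel"
        unfolding dq_Pair by measurable
    qed
    also have "\<dots> = (\<integral>\<^sup>+ z. ennreal (K z) * f (z + x) (z + y) \<partial>lborel)"
      by (simp add: f_def mult.assoc)
    finally show "ennreal (G (dq s (cv K w) (x, y))) * ennreal (1 / norm (x - y) ^ DIM('a)) \<le>
       (\<integral>\<^sup>+ z. ennreal (K z) * f (z + x) (z + y) \<partial>lborel)" .
  qed
  also have "\<dots> = (\<integral>\<^sup>+ x. \<integral>\<^sup>+ z. \<integral>\<^sup>+ y. ennreal (K z) * f (z + x) (z + y) \<partial>lborel \<partial>lborel \<partial>lborel)"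
  proof (rule nn_integral_cong)
    fix x :: 'a
    have "(\<lambda>p. ennreal (K (snd p)) * f (snd p + x) (snd p + fst p)) \<in> borel_measurable (lborel \<Otimes>\<^sub>M lborel)"
      by (intro borel_measurable_times_ennreal measurable_compose[OF _ km] fmp) (auto simp: borel_prod)
    then show "(\<integral>\<^sup>+ y. \<integral>\<^sup>+ z. ennreal (K z) * f (z + x) (z + y) \<partial>lborel \<partial>lborel) =
       (\<integral>\<^sup>+ z. \<integral>\<^sup>+ y. ennreal (K z) * f (z + x) (z + y) \<partial>lborel \<partial>lborel)"
      by (intro lborel_pair.Fubini'[symmetric]) (simp add: case_prod_unfold)
  qed
  also have "\<dots> = (\<integral>\<^sup>+ x. \<integral>\<^sup>+ z. ennreal (K z) * F (z + x) \<partial>lborel \<partial>lborel)"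
  proof (intro nn_integral_cong)
    fix x z :: 'a
    have "(\<integral>\<^sup>+ y. ennreal (K z) * f (z + x) (z + y) \<partial>lborel) = ennreal (K z) * (\<integral>\<^sup>+ y. f (z + x) (z + y) \<partial>lborel)"
      by (rule nn_integral_cmult) (rule fm2; simp)
    also have "(\<integral>\<^sup>+ y. f (z + x) (z + y) \<partial>lborel) = F (z + x)"
      unfolding F_def using nn_integral_translate[of "\<lambda>y. f (z + x) y" z] by (simp add: add.commute fm2)
    finally show "(\<integral>\<^sup>+ y. ennreal (K z) * f (z + x) (z + y) \<partial>lborel) = ennreal (K z) * F (z + x)" .
  qed
  also have "\<dots> = (\<integral>\<^sup>+ z. \<integral>\<^sup>+ x. ennreal (K z) * F (z + x) \<partial>lborel \<partial>lborel)"
    by (intro lborel_pair.Fubini'[symmetric]) (auto simp: case_prod_unfold borel_prod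
        intro!: borel_measurable_times_ennreal measurable_compose[OF _ km] measurable_compose[OF _ Fm])
  also have "\<dots> = (\<integral>\<^sup>+ z. ennreal (K z) * (\<integral>\<^sup>+ x. F x \<partial>lborel) \<partial>lborel)"
  proof (rule nn_integral_cong)
    fix z :: 'a
    have "(\<integral>\<^sup>+ x. ennreal (K z) * F (z + x) \<partial>lborel) = ennreal (K z) * (\<integral>\<^sup>+ x. F (z + x) \<partial>lborel)"
      by (rule nn_integral_cmult) simp
    then show "(\<integral>\<^sup>+ x. ennreal (K z) * F (z + x) \<partial>lborel) = ennreal (K z) * (\<integral>\<^sup>+ x. F x \<partial>lborel)"
      using nn_integral_translate[OF Fm, of z] by (simp add: add.commute)
  qed
  also have "\<dots> = (\<integral>\<^sup>+ z. ennreal (K z) \<partial>lborel) * (\<integral>\<^sup>+ x. F x \<partial>lborel)"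
    by (rule nn_integral_multc) simp
  also have "(\<integral>\<^sup>+ z. ennreal (K z) \<partial>lborel) = 1"
    using K by (subst nn_integral_eq_integral) auto
  also have "1 * (\<integral>\<^sup>+ x. F x \<partial>lborel) = rho_s s G w"
    unfolding rho_s_borel[OF w(1)] F_def f_def by simp
  finally show ?thesis .
qed

text \<open>The kernel need not be centred: \<open>e\<close> bounds the distance of its support from
  0, so the shift is included. The bound \<open>k\<close> on the height reduces the error to the
  oscillation in \<open>L1_rate\<close>.\<close>

lemma cv_L1_error:
  fixes w K :: "'a::euclidean_space \<Rightarrow> real"
  assumes K: "cs K" "\<And>z. 0 \<le> K z" "integrable lborel K" "(\<integral>z. K z \<partial>lborel) = 1" "\<And>z. K z \<le> k" "\<And>z. K z \<noteq> 0 \<Longrightarrow> norm z \<le> e"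
    and w: "w \<in> borel_measurable borel" "integrable lborel w" and S: "S \<in> sets lebesgue" and e: "0 < e"
  shows "(\<integral>\<^sup>+ x. ennreal \<bar>cv K w x - w x\<bar> * indicator S x \<partial>lebesgue) \<le>
    ennreal (k * (e powr s * e ^ DIM('a))) *
       (ennreal (unit_ball_vol (real DIM('a))) * emeasure lebesgue S + ennreal (1 / G 1) * rho_s s G w)"
proof -
  note [measurable] = cs_measurable[OF K(1)] w(1)
  have k0: "0 \<le> k" using K(2)[of 0] K(5)[of 0] by linarith
  have wl: "w \<in> borel_measurable lebesgue" using w(1) by (simp add: measurable_completion)
  have iK: "integrable lborel (\<lambda>y. K (y - x) * c)" for x c
  proof -
    have "integrable (distr lborel borel ((+) (- x))) K" using K(3) by (simp add: lborel_distr_plus)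
    then have "integrable lborel (\<lambda>y. K (- x + y))" by (subst (asm) integrable_distr_eq) auto
    then show ?thesis by simp
  qed
  have pw: "ennreal \<bar>cv K w x - w x\<bar> \<le> ennreal k * (\<integral>\<^sup>+ y. ennreal \<bar>w x - w y\<bar> * indicator (cball x e) y \<partial>lebesgue)" for x
  proof -
    have "(\<integral>y. K (y - x) \<partial>lborel) = 1" using integral_translate[of K "- x"] K(4) by simp
    then have "(\<integral>y. K (y - x) * w x \<partial>lborel) = w x" by simp
    then have "cv K w x - w x = (\<integral>y. K (y - x) * w y - K (y - x) * w x \<partial>lborel)"
      unfolding cv_def using Bochner_Integration.integral_diff[OF cv_integrable[OF K(1) w(2)] iK] by simp
    then have "ennreal \<bar>cv K w x - w x\<bar> \<le> (\<integral>\<^sup>+ y. ennreal \<bar>K (y - x) * w y - K (y - x) * w x\<bar> \<partial>lborel)"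
      using integral_norm_bound_ennreal[OF Bochner_Integration.integrable_diff[OF cv_integrable[OF K(1) w(2)] iK], of x x "w x"] by simp
    also have "\<dots> \<le> (\<integral>\<^sup>+ y. ennreal k * (ennreal \<bar>w x - w y\<bar> * indicator (cball x e) y) \<partial>lborel)"
    proof (rule nn_integral_mono)
      fix y
      show "ennreal \<bar>K (y - x) * w y - K (y - x) * w x\<bar> \<le> ennreal k * (ennreal \<bar>w x - w y\<bar> * indicator (cball x e) y)"
      proof (cases "K (y - x) = 0")
        case False
        have "\<bar>K (y - x) * w y - K (y - x) * w x\<bar> = K (y - x) * \<bar>w x - w y\<bar>"
          using K(2)[of "y - x"] by (simp add: right_diff_distrib[symmetric] abs_mult abs_minus_commute)
        also have "\<dots> \<le> k * \<bar>w x - w y\<bar>" by (intro mult_right_mono K(5)) auto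
        finally have "ennreal \<bar>K (y - x) * w y - K (y - x) * w x\<bar> \<le> ennreal (k * \<bar>w x - w y\<bar>)" by (rule ennreal_leI)
        moreover have "y \<in> cball x e" using K(6)[OF False] by (simp add: dist_norm norm_minus_commute)
        ultimately show ?thesis using k0 by (simp add: ennreal_mult)
      qed simp
    qed
    also have "\<dots> = ennreal k * (\<integral>\<^sup>+ y. ennreal \<bar>w x - w y\<bar> * indicator (cball x e) y \<partial>lborel)"
    proof (rule nn_integral_cmult, rule borel_measurable_times_ennreal)
      show "(\<lambda>y. ennreal \<bar>w x - w y\<bar>) \<in> borel_measurable lborel" by measurable
      show "indicator (cball x e) \<in> borel_measurable lborel" by (rule borel_measurable_indicator) simp
    qed
    finally show ?thesis by (simp add: nn_integral_completion)
  qed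
  have "{p :: 'a \<times> 'a. dist (fst p) (snd p) \<le> e} \<in> sets (borel \<Otimes>\<^sub>M borel)"
    unfolding borel_prod by (intro borel_closed closed_Collect_le continuous_intros)
  then have "(\<lambda>p. ennreal \<bar>w (fst p) - w (snd p)\<bar> * indicator {p :: 'a \<times> 'a. dist (fst p) (snd p) \<le> e} p)
      \<in> borel_measurable (borel \<Otimes>\<^sub>M lborel)"
    by (intro borel_measurable_times_ennreal borel_measurable_indicator) (auto cong: sets_pair_measure_cong)
  then have "(\<lambda>p. ennreal \<bar>w (fst p) - w (snd p)\<bar> * indicator (cball (fst p) e) (snd p))
      \<in> borel_measurable (borel \<Otimes>\<^sub>M lborel)"
    by (rule measurable_cong[THEN iffD1, rotated]) (auto split: split_indicator)
  from lborel.borel_measurable_nn_integral_fst[OF this]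
  have m: "(\<lambda>x. \<integral>\<^sup>+ y. ennreal \<bar>w x - w y\<bar> * indicator (cball x e) y \<partial>lebesgue) \<in> borel_measurable lebesgue"
    by (simp add: nn_integral_completion measurable_completion)
  have "(\<integral>\<^sup>+ x. ennreal \<bar>cv K w x - w x\<bar> * indicator S x \<partial>lebesgue) \<le>
     (\<integral>\<^sup>+ x. ennreal k * ((\<integral>\<^sup>+ y. ennreal \<bar>w x - w y\<bar> * indicator (cball x e) y \<partial>lebesgue) * indicator S x) \<partial>lebesgue)"
    using pw by (intro nn_integral_mono) (auto split: split_indicator)
  also have "\<dots> = ennreal k * (\<integral>\<^sup>+ x. (\<integral>\<^sup>+ y. ennreal \<bar>w x - w y\<bar> * indicator (cball x e) y \<partial>lebesgue) * indicator S x \<partial>lebesgue)"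
    by (rule nn_integral_cmult) (intro borel_measurable_times_ennreal m borel_measurable_indicator S)
  also have "\<dots> \<le> ennreal k * (ennreal (e powr s * e ^ DIM('a)) *
       (ennreal (unit_ball_vol (real DIM('a))) * emeasure lebesgue S + ennreal (1 / G 1) * rho_s s G w))"
    by (intro mult_left_mono L1_rate wl S e) simp
  also have "\<dots> = ennreal (k * (e powr s * e ^ DIM('a))) *
       (ennreal (unit_ball_vol (real DIM('a))) * emeasure lebesgue S + ennreal (1 / G 1) * rho_s s G w)"
    using k0 e by (subst ennreal_mult[of k]) (auto simp: mult.assoc simp del: emeasure_completion)
  finally show ?thesis .
qed

end

section \<open>Density of test functions\<close>

text \<open>At a boundary point the defining function \<open>\<phi>\<close> increases along some
  \<open>v\<close>, and by continuity with rate above \<open>c\<close> from all nearby points in all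
  nearby directions. Moving by \<open>\<epsilon>\<close> against such a direction lowers
  \<open>\<phi>\<close> by at least \<open>c * \<epsilon>\<close>, so the shifted points lie in a
  compact part of the domain. At interior points \<open>v = 0\<close> works.\<close>

lemma boundary_geometry:
  fixes \<Omega> :: "'a::euclidean_space set"
  assumes \<Omega>: "smooth_bounded_domain \<Omega>" and x0: "x0 \<in> closure \<Omega>"
  shows "\<exists>r>0. \<exists>v \<rho> \<epsilon>0. \<rho> > 0 \<and> \<epsilon>0 > 0 \<and> (\<forall>\<epsilon>. 0 < \<epsilon> \<and> \<epsilon> < \<epsilon>0 \<longrightarrow>
    (\<exists>T. compact T \<and> T \<subseteq> \<Omega> \<and> (\<forall>p \<zeta>. p \<in> \<Omega> \<inter> ball x0 r \<longrightarrow> \<zeta> \<in> ball v \<rho> \<longrightarrow> p - \<epsilon> *\<^sub>R \<zeta> \<in> T)))"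
proof (cases "x0 \<in> \<Omega>")
  case True
  have "open \<Omega>" using \<Omega> by (simp add: smooth_bounded_domain_def)
  then obtain d where d: "d > 0" "cball x0 d \<subseteq> \<Omega>" using True open_contains_cball by blast
  have "p - \<epsilon> *\<^sub>R \<zeta> \<in> cball x0 d" if "0 < \<epsilon>" "\<epsilon> < d / 2" "p \<in> ball x0 (d / 2)" "\<zeta> \<in> ball 0 1" for p \<zeta> \<epsilon>
  proof -
    have "norm (\<epsilon> *\<^sub>R \<zeta>) \<le> \<epsilon> * 1" using that by (auto simp: intro!: mult_left_mono)
    moreover have "norm (x0 - p) < d / 2" using that by (simp add: dist_norm)
    ultimately have "norm ((x0 - p) + \<epsilon> *\<^sub>R \<zeta>) \<le> d" using that norm_triangle_ineq[of "x0 - p" "\<epsilon> *\<^sub>R \<zeta>"] by linarith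
    then show ?thesis by (simp add: dist_norm algebra_simps)
  qed
  then show ?thesis using d
    by (intro exI[of _ "d / 2"] conjI exI[of _ 0] exI[of _ 1] exI[of _ "d / 2"] allI impI exI[of _ "cball x0 d"]) auto
next
  case False
  have op: "open \<Omega>" using \<Omega> by (simp add: smooth_bounded_domain_def)
  then have "x0 \<in> frontier \<Omega>" using x0 False by (simp add: frontier_def interior_open)
  then obtain U \<phi> where U: "open U" "x0 \<in> U" "smooth_on U \<phi>"
      and crit: "\<forall>x\<in>U. \<exists>v. frechet_derivative \<phi> (at x) v \<noteq> 0" and \<Omega>U: "\<Omega> \<inter> U = {x \<in> U. \<phi> x < 0}"
    using \<Omega> unfolding smooth_bounded_domain_def smooth_boundary_def by blast
  let ?D = "\<lambda>x v. frechet_derivative \<phi> (at x) v"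
  have C1: "Ck_on (Suc 0) U \<phi>" using U(3) unfolding smooth_on_def by blast
  then have diff: "(\<phi> has_derivative ?D x) (at x)" if "x \<in> U" for x
    using that by (auto simp: frechet_derivative_works)
  have contD: "continuous_on U (\<lambda>x. ?D x v)" for v using C1 by simp
  have lin: "linear (?D x)" if "x \<in> U" for x using has_derivative_linear[OF diff[OF that]] .
  obtain v where v: "?D x0 v > 0"
  proof -
    obtain v where "?D x0 v \<noteq> 0" using crit U(2) by blast
    then consider "?D x0 v > 0" | "?D x0 (- v) > 0" using linear_neg[OF lin[OF U(2)], of v] by fastforce
    then show ?thesis using that by cases auto
  qed
  define c where "c = ?D x0 v / 2"
  have c: "c > 0" using v by (simp add: c_def)
  \<comment> \<open>The derivative in coordinates, which makes it jointly continuous in the point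
    and the direction.\<close>
  define q where "q p = (\<Sum>b\<in>Basis. (snd p \<bullet> b) * ?D (fst p) b)" for p
  have q: "q (x, z) = ?D x z" if "x \<in> U" for x z
  proof -
    have "?D x z = ?D x (\<Sum>b\<in>Basis. (z \<bullet> b) *\<^sub>R b)" by (simp add: euclidean_representation)
    also have "\<dots> = q (x, z)" using lin[OF that] by (simp add: linear_sum linear_scale q_def)
    finally show ?thesis by simp
  qed
  have "continuous_on (U \<times> UNIV) q" unfolding q_def
    by (intro continuous_on_sum continuous_on_mult continuous_on_inner continuous_on_snd continuous_on_id continuous_on_const
        continuous_on_compose2[OF contD continuous_on_fst[OF continuous_on_id]]) auto
  then have "open ((U \<times> UNIV) \<inter> q -` {c<..})"
    by (intro continuous_open_preimage open_Times U(1) open_UNIV open_greaterThan)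
  moreover have "(x0, v) \<in> (U \<times> UNIV) \<inter> q -` {c<..}" using U(2) v by (simp add: q c_def)
  ultimately obtain A B where AB: "open A" "open B" "(x0, v) \<in> A \<times> B" "A \<times> B \<subseteq> (U \<times> UNIV) \<inter> q -` {c<..}"
    by (rule open_prod_elim)
  have "x0 \<in> A" "v \<in> B" using AB(3) by auto
  obtain R where R: "R > 0" "cball x0 R \<subseteq> A"
    using AB(1) \<open>x0 \<in> A\<close> unfolding open_contains_cball by blast
  obtain \<rho> where \<rho>: "\<rho> > 0" "ball v \<rho> \<subseteq> B"
    using AB(2) \<open>v \<in> B\<close> unfolding open_contains_ball by blast
  have AU: "A \<subseteq> U" using AB by auto
  have Dpos: "?D x \<zeta> > c" if "x \<in> cball x0 R" "\<zeta> \<in> ball v \<rho>" for x \<zeta>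
  proof -
    have "(x, \<zeta>) \<in> A \<times> B" using that R \<rho> by auto
    then show ?thesis using AB(4) AU q[of x \<zeta>] by force
  qed
  \<comment> \<open>Keeps every shift below \<open>R / 2\<close>, so that segments starting in the
    ball of radius \<open>R / 2\<close> stay in \<open>cball x0 R\<close>.\<close>
  define \<epsilon>0 where "\<epsilon>0 = (R / 2) / (norm v + \<rho>)"
  have \<epsilon>0: "\<epsilon>0 > 0" using R \<rho> by (simp add: \<epsilon>0_def add_nonneg_pos)
  have main: "\<exists>T. compact T \<and> T \<subseteq> \<Omega> \<and> (\<forall>p \<zeta>. p \<in> \<Omega> \<inter> ball x0 (R / 2) \<longrightarrow> \<zeta> \<in> ball v \<rho> \<longrightarrow> p - \<epsilon> *\<^sub>R \<zeta> \<in> T)"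
    if \<epsilon>: "0 < \<epsilon>" "\<epsilon> < \<epsilon>0" for \<epsilon>
  proof (intro exI conjI allI impI)
    define T where "T = cball x0 R \<inter> \<phi> -` {.. - (c * \<epsilon>)}"
    have cU: "continuous_on U \<phi>"
    proof (rule continuous_at_imp_continuous_on, rule ballI)
      fix x assume "x \<in> U"
      show "isCont \<phi> x" by (rule has_derivative_continuous[OF diff[OF \<open>x \<in> U\<close>]])
    qed
    have "cball x0 R \<subseteq> U" using R(2) AU by (rule subset_trans)
    then have "closed T" unfolding T_def
      by (rule continuous_closed_preimage[OF continuous_on_subset[OF cU] closed_cball closed_atMost])
    moreover have "bounded T" unfolding T_def by (rule bounded_subset[OF bounded_cball]) auto
    ultimately show "compact T" by (simp add: compact_eq_bounded_closed)
    show "T \<subseteq> \<Omega>"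
    proof
      fix x assume "x \<in> T"
      then have "x \<in> U" "\<phi> x \<le> - (c * \<epsilon>)" using R AU by (auto simp: T_def)
      moreover have "- (c * \<epsilon>) < 0" using c \<epsilon> by simp
      ultimately have "x \<in> {x \<in> U. \<phi> x < 0}" by simp
      then show "x \<in> \<Omega>" using \<Omega>U by blast
    qed
    fix p \<zeta> assume p: "p \<in> \<Omega> \<inter> ball x0 (R / 2)" and \<zeta>: "\<zeta> \<in> ball v \<rho>"
    have seg: "p - t *\<^sub>R \<zeta> \<in> cball x0 R" if "0 \<le> t" "t \<le> \<epsilon>" for t
    proof -
      have "norm \<zeta> \<le> norm v + \<rho>"
        using \<zeta> norm_triangle_ineq2[of \<zeta> v] by (simp add: dist_norm norm_minus_commute)
      then have "t * norm \<zeta> \<le> \<epsilon>0 * (norm v + \<rho>)"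
        using that \<epsilon> by (intro mult_mono) auto
      also have "\<dots> = R / 2"
      proof -
        have "norm v + \<rho> \<noteq> 0" using \<rho> norm_ge_zero[of v] by linarith
        from nonzero_eq_divide_eq[THEN iffD1, OF this \<epsilon>0_def] show ?thesis .
      qed
      finally have "norm (t *\<^sub>R \<zeta>) \<le> R / 2" using that by simp
      moreover have "norm (x0 - p) < R / 2" using p by (simp add: dist_norm)
      ultimately have "norm ((x0 - p) + t *\<^sub>R \<zeta>) \<le> R" using norm_triangle_ineq[of "x0 - p" "t *\<^sub>R \<zeta>"] by linarith
      then show ?thesis by (simp add: dist_norm algebra_simps)
    qed
    have "\<phi> (p - \<epsilon> *\<^sub>R \<zeta>) + c * \<epsilon> \<le> \<phi> (p - 0 *\<^sub>R \<zeta>) + c * 0"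
    proof (rule DERIV_nonpos_imp_nonincreasing[where f = "\<lambda>t. \<phi> (p - t *\<^sub>R \<zeta>) + c * t"])
      show "0 \<le> \<epsilon>" using \<epsilon> by simp
      fix t assume t: "0 \<le> t" "t \<le> \<epsilon>"
      have inU: "p - t *\<^sub>R \<zeta> \<in> U" using seg[OF t] R AU by blast
      have "((\<lambda>t. p - t *\<^sub>R \<zeta>) has_derivative (\<lambda>h. - (h *\<^sub>R \<zeta>))) (at t)"
        by (auto intro!: derivative_eq_intros)
      from has_derivative_compose[OF this diff[OF inU]]
      have h1: "((\<lambda>t. \<phi> (p - t *\<^sub>R \<zeta>)) has_derivative (\<lambda>h. ?D (p - t *\<^sub>R \<zeta>) (- (h *\<^sub>R \<zeta>)))) (at t)" .
      have h2: "?D (p - t *\<^sub>R \<zeta>) (- (h *\<^sub>R \<zeta>)) = h * (- ?D (p - t *\<^sub>R \<zeta>) \<zeta>)" for h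
        using linear_neg[OF lin[OF inU], of "h *\<^sub>R \<zeta>"] linear_scale[OF lin[OF inU], of h \<zeta>] by simp
      have "((\<lambda>t. \<phi> (p - t *\<^sub>R \<zeta>)) has_real_derivative - ?D (p - t *\<^sub>R \<zeta>) \<zeta>) (at t)"
        by (rule has_derivative_imp_has_field_derivative[OF h1]) (rule h2[symmetric])
      moreover have "((\<lambda>t. c * t) has_real_derivative c) (at t)" by (auto intro!: derivative_eq_intros)
      ultimately have "((\<lambda>t. \<phi> (p - t *\<^sub>R \<zeta>) + c * t) has_real_derivative - ?D (p - t *\<^sub>R \<zeta>) \<zeta> + c) (at t)"
        by (rule DERIV_add)
      then show "\<exists>y. DERIV (\<lambda>t. \<phi> (p - t *\<^sub>R \<zeta>) + c * t) t :> y \<and> y \<le> 0"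
        using Dpos[OF seg[OF t] \<zeta>] by (intro exI[of _ "- ?D (p - t *\<^sub>R \<zeta>) \<zeta> + c"] conjI) auto
    qed
    moreover have "\<phi> p < 0"
    proof -
      have "p \<in> U" using seg[of 0] \<epsilon> R AU by auto
      then have "p \<in> {x \<in> U. \<phi> x < 0}" using p \<Omega>U by blast
      then show ?thesis by simp
    qed
    ultimately have "\<phi> (p - \<epsilon> *\<^sub>R \<zeta>) \<le> - (c * \<epsilon>)" by simp
    then show "p - \<epsilon> *\<^sub>R \<zeta> \<in> T" using seg[of \<epsilon>] \<epsilon> by (simp add: T_def)
  qed
  show ?thesis
    using R \<rho> \<epsilon>0 main by (intro exI[of _ "R / 2"] conjI exI[of _ v] exI[of _ \<rho>] exI[of _ \<epsilon>0]) auto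
qed

context orlicz
begin

text \<open>Approximation in the weak sense that \<open>pairing_tendsto\<close> and dominated
  convergence ask for: convergence almost everywhere with bounded modulars and uniformly bounded
  values.\<close>

definition approx :: "'a::euclidean_space set \<Rightarrow> ('a \<Rightarrow> real) \<Rightarrow> bool" where
  "approx \<Omega> w \<longleftrightarrow> (\<exists>\<phi> B R. (\<forall>k::nat. \<phi> k \<in> test_functions \<Omega> \<and> \<phi> k \<in> W s G \<and> Phi (\<phi> k) \<le> R \<and>
     (\<forall>x. 0 \<le> \<phi> k x \<and> \<phi> k x \<le> B)) \<and> (AE x in lebesgue. (\<lambda>k. \<phi> k x) \<longlonglongrightarrow> w x))"

lemma approx_zero: "approx \<Omega> (\<lambda>x. 0)"
  unfolding approx_def
  by (intro exI[of _ "\<lambda>k x. 0"] exI[of _ 0] exI[of _ "Phi (\<lambda>x. 0)"])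
     (auto simp: test_functions_def smooth_on_def Ck_const W_zero)

lemma Phi_add_le:
  assumes "u \<in> W s G" "v \<in> W s G"
  shows "Phi (\<lambda>x. u x + v x) \<le> D2 * Phi u + D2 * Phi v"
proof -
  have "Phi (\<lambda>x. u x + v x) \<le> (\<integral> p. D2 * G (dq s u p) + D2 * G (dq s v p) \<partial>mu)"
    unfolding Phi_def using assms W_integrable_mu[OF W_add[OF assms]]
    by (intro integral_mono) (auto simp: W_iff A_add dq_add)
  also have "\<dots> = D2 * Phi u + D2 * Phi v"
    unfolding Phi_def using assms by (subst Bochner_Integration.integral_add) (auto simp: W_iff)
  finally show ?thesis .
qed

lemma test_functions_add:
  assumes "f \<in> test_functions \<Omega>" "h \<in> test_functions \<Omega>"
  shows "(\<lambda>x. f x + h x) \<in> test_functions \<Omega>"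
proof -
  have sub: "{x. f x + h x \<noteq> 0} \<subseteq> {x. f x \<noteq> 0} \<union> {x. h x \<noteq> 0}" by auto
  have "bounded ({x. f x \<noteq> 0} \<union> {x. h x \<noteq> 0})" using assms by (auto simp: test_functions_def)
  then have "bounded {x. f x + h x \<noteq> 0}" using sub by (rule bounded_subset)
  moreover have "closure {x. f x + h x \<noteq> 0} \<subseteq> \<Omega>"
    using closure_mono[OF sub] assms by (auto simp: test_functions_def closure_Un)
  ultimately show ?thesis using assms by (auto simp: test_functions_def smooth_on_def intro: Ck_add)
qed

lemma approx_add:
  assumes "approx \<Omega> v" "approx \<Omega> w" shows "approx \<Omega> (\<lambda>x. v x + w x)"
proof -
  obtain \<phi> B R where 1: "\<And>k. \<phi> k \<in> test_functions \<Omega>" "\<And>k. \<phi> k \<in> W s G" "\<And>k. Phi (\<phi> k) \<le> R"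
      "\<And>k x. 0 \<le> \<phi> k x" "\<And>k x. \<phi> k x \<le> B" "AE x in lebesgue. (\<lambda>k::nat. \<phi> k x) \<longlonglongrightarrow> v x"
    using assms(1) unfolding approx_def by blast
  obtain \<psi> B' R' where 2: "\<And>k. \<psi> k \<in> test_functions \<Omega>" "\<And>k. \<psi> k \<in> W s G" "\<And>k. Phi (\<psi> k) \<le> R'"
      "\<And>k x. 0 \<le> \<psi> k x" "\<And>k x. \<psi> k x \<le> B'" "AE x in lebesgue. (\<lambda>k::nat. \<psi> k x) \<longlonglongrightarrow> w x"
    using assms(2) unfolding approx_def by blast
  have "Phi (\<lambda>x. \<phi> k x + \<psi> k x) \<le> D2 * R + D2 * R'" for k
    using Phi_add_le[OF 1(2) 2(2), of k k] mult_left_mono[OF 1(3)[of k], of D2] mult_left_mono[OF 2(3)[of k], of D2] D2(1) by linarith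
  moreover have "AE x in lebesgue. (\<lambda>k. \<phi> k x + \<psi> k x) \<longlonglongrightarrow> v x + w x"
    using 1(6) 2(6) by eventually_elim (rule tendsto_add)
  ultimately show ?thesis unfolding approx_def
    using 1 2 by (intro exI[of _ "\<lambda>k x. \<phi> k x + \<psi> k x"] exI[of _ "B + B'"] exI[of _ "D2 * R + D2 * R'"])
      (auto intro!: test_functions_add W_add add_mono add_nonneg_nonneg)
qed

text \<open>The kernels are centred at \<open>\<epsilon> k *\<^sub>R v\<close> with radius
  \<open>\<epsilon> k * \<rho>\<close>. If the mollification is nonzero at \<open>x\<close>, then
  \<open>x = y - \<epsilon> k *\<^sub>R \<zeta>\<close> for some \<open>y\<close> with
  \<open>w y \<noteq> 0\<close> and \<open>\<zeta>\<close> in the ball around \<open>v\<close>, so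
  \<open>x\<close> lies in the compact set supplied by the hypothesis.\<close>

lemma approx_local:
  fixes w :: "'a::euclidean_space \<Rightarrow> real"
  assumes \<Omega>: "open \<Omega>" "bounded \<Omega>"
    and w: "w \<in> W s G" "w \<in> borel_measurable borel" "\<And>x. 0 \<le> w x" "\<And>x. w x \<le> B" "\<And>x. x \<notin> \<Omega> \<Longrightarrow> w x = 0"
    and \<rho>: "0 < \<rho>" and \<epsilon>0: "0 < \<epsilon>0"
    and T: "\<And>\<epsilon>. 0 < \<epsilon> \<Longrightarrow> \<epsilon> < \<epsilon>0 \<Longrightarrow> \<exists>T. compact T \<and> T \<subseteq> \<Omega> \<and> (\<forall>p \<zeta>. w p \<noteq> 0 \<longrightarrow> \<zeta> \<in> ball v \<rho> \<longrightarrow> p - \<epsilon> *\<^sub>R \<zeta> \<in> T)"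
  shows "approx \<Omega> w"
proof -
  let ?n = "DIM('a)"
  have \<Omega>m: "\<Omega> \<in> sets lebesgue" "emeasure lebesgue \<Omega> < \<infinity>"
    using \<Omega> emeasure_bounded_finite[OF \<Omega>(2)] by auto
  have wb: "\<bar>w x\<bar> \<le> B" for x using w(3,4)[of x] by simp
  have iw: "integrable lborel w"
    using bounded_support_integrable(2)[OF \<Omega>m W_measurable[OF w(1)] w(5) wb] w(2) integrable_completion[of w lborel] by simp
  \<comment> \<open>Geometric scales make the L1 errors summable, at the rate \<open>q ^ k\<close>
    with \<open>q = (1 / 2) powr s\<close>.\<close>
  define \<epsilon> where "\<epsilon> k = \<epsilon>0 / 2 * (1 / 2) ^ k" for k :: nat
  have \<epsilon>: "0 < \<epsilon> k" "\<epsilon> k < \<epsilon>0" for k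
  proof -
    show "0 < \<epsilon> k" using \<epsilon>0 by (simp add: \<epsilon>_def)
    have "(1 / 2) ^ k \<le> (1 :: real)" by (simp add: power_le_one)
    then have "\<epsilon> k \<le> \<epsilon>0 / 2 * 1" unfolding \<epsilon>_def using \<epsilon>0 by (intro mult_left_mono) auto
    then show "\<epsilon> k < \<epsilon>0" using \<epsilon>0 by simp
  qed
  obtain C where C: "C > 0" and ker: "\<And>(c::'a) r. 0 < r \<Longrightarrow> (\<exists>K. smooth_on UNIV K \<and> (\<forall>z. 0 \<le> K z) \<and>
     (\<forall>z. K z \<noteq> 0 \<longrightarrow> dist c z < r) \<and> integrable lborel K \<and> (\<integral>z. K z \<partial>lborel) = 1 \<and> (\<forall>z. K z \<le> C / r ^ ?n))"
    using smooth_kernel_exists by blast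
  define P where "P k K \<longleftrightarrow> smooth_on UNIV K \<and> (\<forall>z. 0 \<le> K z) \<and>
     (\<forall>z. K z \<noteq> 0 \<longrightarrow> dist (\<epsilon> k *\<^sub>R v) z < \<epsilon> k * \<rho>) \<and> integrable lborel K \<and> (\<integral>z. K z \<partial>lborel) = 1 \<and>
     (\<forall>z. K z \<le> C / (\<epsilon> k * \<rho>) ^ ?n)" for k K
  have "\<exists>K. P k K" for k unfolding P_def using ker[of "\<epsilon> k * \<rho>" "\<epsilon> k *\<^sub>R v"] \<epsilon>(1)[of k] \<rho> by simp
  then obtain K where KP: "\<And>k. P k (K k)" by metis
  have K: "\<And>k. smooth_on UNIV (K k)" "\<And>k z. 0 \<le> K k z" "\<And>k z. K k z \<noteq> 0 \<Longrightarrow> dist (\<epsilon> k *\<^sub>R v) z < \<epsilon> k * \<rho>"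
     "\<And>k. integrable lborel (K k)" "\<And>k. (\<integral>z. K k z \<partial>lborel) = 1" "\<And>k z. K k z \<le> C / (\<epsilon> k * \<rho>) ^ ?n"
    using KP unfolding P_def by blast+
  have csK: "cs (K k)" for k
  proof -
    have "{x. K k x \<noteq> 0} \<subseteq> ball (\<epsilon> k *\<^sub>R v) (\<epsilon> k * \<rho>)" using K(3) by auto
    then show ?thesis using K(1) bounded_subset[OF bounded_ball] unfolding cs_def by blast
  qed
  define \<phi> where "\<phi> k = cv (K k) w" for k
  have smooth: "smooth_on UNIV (\<phi> k)" for k unfolding \<phi>_def by (rule cv_smooth[OF iw csK])
  have \<phi>m: "\<phi> k \<in> borel_measurable lebesgue" for k
  proof -
    have "continuous_on UNIV (\<phi> k)" using smooth[of k] Ck_continuous unfolding smooth_on_def by blast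
    from borel_measurable_continuous_onI[OF this] show ?thesis by (simp add: measurable_completion)
  qed
  have \<phi>0: "0 \<le> \<phi> k x" for k x
    unfolding \<phi>_def cv_def using K(2) w(3) by (intro integral_nonneg_AE) auto
  have \<phi>B: "\<phi> k x \<le> B" for k x
  proof -
    have Km: "K k \<in> borel_measurable borel" by (rule cs_measurable[OF csK])
    have "integrable (distr lborel borel ((+) (- x))) (K k)" using K(4) by (simp add: lborel_distr_plus)
    then have iK: "integrable lborel (\<lambda>y. K k (y - x))" by (subst (asm) integrable_distr_eq) (use Km in auto)
    have "\<phi> k x \<le> (\<integral>y. K k (y - x) * B \<partial>lborel)"
      unfolding \<phi>_def cv_def using iK K(2) w(4) by (intro integral_mono cv_integrable csK iw integrable_mult_left mult_left_mono) auto
    also have "\<dots> = B" using integral_translate[OF Km, of "- x"] K(5)[of k] by simp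
    finally show ?thesis .
  qed
  have supp: "\<exists>T. compact T \<and> T \<subseteq> \<Omega> \<and> {x. \<phi> k x \<noteq> 0} \<subseteq> T" for k
  proof -
    obtain T' where T': "compact T'" "T' \<subseteq> \<Omega>" "\<And>p \<zeta>. w p \<noteq> 0 \<Longrightarrow> \<zeta> \<in> ball v \<rho> \<Longrightarrow> p - \<epsilon> k *\<^sub>R \<zeta> \<in> T'"
      using T[OF \<epsilon>] by blast
    have "\<phi> k x = 0" if "x \<notin> T'" for x
    proof -
      have "K k (y - x) * w y = 0" for y
      proof (rule ccontr)
        assume "\<not> ?thesis"
        then have y: "K k (y - x) \<noteq> 0" "w y \<noteq> 0" by auto
        define \<zeta> where "\<zeta> = (1 / \<epsilon> k) *\<^sub>R (y - x)"
        have yx: "y - x = \<epsilon> k *\<^sub>R \<zeta>" using \<epsilon>(1)[of k] by (simp add: \<zeta>_def)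
        have "dist (\<epsilon> k *\<^sub>R v) (\<epsilon> k *\<^sub>R \<zeta>) < \<epsilon> k * \<rho>" using K(3)[OF y(1)] by (simp add: yx)
        then have "\<epsilon> k * dist v \<zeta> < \<epsilon> k * \<rho>" using \<epsilon>(1)[of k] by (simp add: dist_norm scaleR_diff_right[symmetric])
        then have "\<zeta> \<in> ball v \<rho>" using \<epsilon>(1)[of k] by simp
        from T'(3)[OF y(2) this] have "y - (y - x) \<in> T'" by (simp only: yx)
        then show False using that by simp
      qed
      then have "(\<lambda>y. K k (y - x) * w y) = (\<lambda>_. 0)" by (intro ext)
      then show ?thesis unfolding \<phi>_def cv_def by (simp only: integral_zero)
    qed
    then show ?thesis using T' by blast
  qed
  have test: "\<phi> k \<in> test_functions \<Omega>" for k
  proof -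
    obtain T where T: "compact T" "T \<subseteq> \<Omega>" "{x. \<phi> k x \<noteq> 0} \<subseteq> T" using supp by blast
    then have "closure {x. \<phi> k x \<noteq> 0} \<subseteq> T" by (intro closure_minimal compact_imp_closed)
    moreover have "bounded {x. \<phi> k x \<noteq> 0}" using T compact_imp_bounded bounded_subset by blast
    ultimately show ?thesis using T smooth by (auto simp: test_functions_def)
  qed
  have \<phi>zero: "\<phi> k x = 0" if "x \<notin> \<Omega>" for k x using supp[of k] that by blast
  have \<phi>abs: "\<bar>\<phi> k x\<bar> \<le> B" for k x using \<phi>0[of k x] \<phi>B[of k x] by simp
  have rho_le: "rho_s s G (\<phi> k) \<le> ennreal (Phi w)" for k
    using rho_s_cv_le[OF csK K(2) K(4) K(5) w(2) iw wb, of k] rho_s_Phi[OF w(1)] by (simp add: \<phi>_def)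
  have \<phi>W: "\<phi> k \<in> W s G" for k
  proof -
    have "rho_s s G (\<phi> k) < \<infinity>" using rho_le[of k] by (rule order.strict_trans1) simp
    then have "integrable mu (\<lambda>p. G (dq s (\<phi> k) p))"
      using measurable_compose[OF dq_measurable[OF \<phi>m[of k]] A_measurable, of s] by (intro integrableI_nonneg) (auto simp: rho_s_eq)
    then show ?thesis
      using \<phi>m[of k] bounded_support_integrable(1)[OF \<Omega>m \<phi>m \<phi>zero \<phi>abs] by (auto simp: W_iff)
  qed
  have PhiR: "Phi (\<phi> k) \<le> Phi w" for k
    using rho_le[of k] by (simp add: rho_s_Phi[OF \<phi>W] Phi_nonneg)
  define L where "L = norm v + \<rho>"
  have L: "L > 0" using \<rho> by (simp add: L_def add_nonneg_pos)
  define q where "q = (1 / 2 :: real) powr s"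
  have q: "0 < q" "q < 1" using powr_less_mono2[of s "1 / 2" 1] s_pos by (auto simp: q_def)
  define A where "A = C * (L / \<rho>) ^ ?n * (\<epsilon>0 / 2 * L) powr s"
  define Z where "Z = ennreal (unit_ball_vol (real ?n)) * emeasure lebesgue \<Omega> + ennreal (1 / G 1) * rho_s s G w"
  have Z: "Z < \<infinity>" unfolding Z_def rho_s_Phi[OF w(1)] using \<Omega>m(2) by (simp add: ennreal_mult_less_top del: emeasure_completion)
  have err: "(\<integral>\<^sup>+ x. ennreal \<bar>\<phi> k x - w x\<bar> * indicator \<Omega> x \<partial>lebesgue) \<le> ennreal (A * q ^ k) * Z" for k
  proof -
    have "(\<integral>\<^sup>+ x. ennreal \<bar>\<phi> k x - w x\<bar> * indicator \<Omega> x \<partial>lebesgue) \<le>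
      ennreal (C / (\<epsilon> k * \<rho>) ^ ?n * ((\<epsilon> k * L) powr s * (\<epsilon> k * L) ^ ?n)) * Z"
      unfolding \<phi>_def Z_def
    proof (rule cv_L1_error[OF csK K(2) K(4) K(5) K(6) _ w(2) iw \<Omega>m(1)])
      show "norm z \<le> \<epsilon> k * L" if "K k z \<noteq> 0" for z
      proof -
        have "norm z \<le> norm (\<epsilon> k *\<^sub>R v) + norm (\<epsilon> k *\<^sub>R v - z)" using norm_triangle_sub[of z "\<epsilon> k *\<^sub>R v"] by (simp add: norm_minus_commute)
        then show ?thesis using K(3)[OF that] \<epsilon>(1)[of k] by (simp add: dist_norm L_def distrib_left)
      qed
      show "0 < \<epsilon> k * L" using \<epsilon> L by simp
    qed
    also have "C / (\<epsilon> k * \<rho>) ^ ?n * ((\<epsilon> k * L) powr s * (\<epsilon> k * L) ^ ?n) = A * q ^ k"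
    proof -
      have "(\<epsilon> k * L) powr s = (\<epsilon>0 / 2 * L) powr s * q ^ k"
      proof -
        have "(\<epsilon> k * L) powr s = ((\<epsilon>0 / 2 * L) * (1 / 2) ^ k) powr s" by (simp add: \<epsilon>_def mult_ac)
        also have "\<dots> = (\<epsilon>0 / 2 * L) powr s * ((1 / 2) ^ k) powr s" by (rule powr_mult)
        also have "((1 / 2 :: real) ^ k) powr s = q ^ k"
          unfolding q_def by (subst (1 2) powr_realpow[symmetric]; simp add: powr_powr mult.commute)
        finally show ?thesis .
      qed
      then show ?thesis using \<epsilon>(1)[of k] \<rho> by (simp add: A_def power_mult_distrib power_divide)
    qed
    finally show ?thesis .
  qed
  have A0: "A \<ge> 0" using C L \<rho> by (simp add: A_def)
  have sm: "(\<lambda>x. ennreal \<bar>\<phi> k x - w x\<bar> * indicator \<Omega> x) \<in> borel_measurable lebesgue" for k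
    using \<phi>m[of k] W_measurable[OF w(1)] \<Omega>m(1)
    by (intro borel_measurable_times_ennreal borel_measurable_indicator measurable_compose[OF _ measurable_ennreal] borel_measurable_abs borel_measurable_diff)
  \<comment> \<open>The sum of the errors is integrable, hence finite almost everywhere, and there
    its terms tend to 0: the whole sequence converges.\<close>
  have "(\<integral>\<^sup>+ x. (\<Sum>k. ennreal \<bar>\<phi> k x - w x\<bar> * indicator \<Omega> x) \<partial>lebesgue) =
     (\<Sum>k. \<integral>\<^sup>+ x. ennreal \<bar>\<phi> k x - w x\<bar> * indicator \<Omega> x \<partial>lebesgue)"
    by (rule nn_integral_suminf[OF sm])
  also have "\<dots> \<le> (\<Sum>k. ennreal (A * q ^ k) * Z)" by (rule suminf_le) (auto intro: err)
  also have "\<dots> = (\<Sum>k. ennreal (A * q ^ k)) * Z" by (rule ennreal_suminf_multc)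
  also have "(\<Sum>k. ennreal (A * q ^ k)) = ennreal (\<Sum>k. A * q ^ k)"
    using A0 q by (intro suminf_ennreal2 summable_mult summable_geometric) auto
  also have "\<dots> * Z < \<infinity>" using Z by (simp add: ennreal_mult_less_top)
  finally have fin: "(\<integral>\<^sup>+ x. (\<Sum>k. ennreal \<bar>\<phi> k x - w x\<bar> * indicator \<Omega> x) \<partial>lebesgue) \<noteq> \<infinity>" by simp
  have "AE x in lebesgue. (\<Sum>k. ennreal \<bar>\<phi> k x - w x\<bar> * indicator \<Omega> x) \<noteq> \<infinity>"
    by (rule nn_integral_noteq_infinite[OF borel_measurable_suminf_order[OF sm] fin])
  then have "AE x in lebesgue. (\<lambda>k. \<phi> k x) \<longlonglongrightarrow> w x"
  proof eventually_elim
    case (elim x)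
    show ?case
    proof (cases "x \<in> \<Omega>")
      case True
      then have "(\<Sum>k. ennreal \<bar>\<phi> k x - w x\<bar>) \<noteq> top" using elim by simp
      then have "summable (\<lambda>k. \<bar>\<phi> k x - w x\<bar>)" by (intro summable_suminf_not_top) auto
      then have "(\<lambda>k. \<bar>\<phi> k x - w x\<bar>) \<longlonglongrightarrow> 0" by (rule summable_LIMSEQ_zero)
      then have "(\<lambda>k. \<phi> k x - w x) \<longlonglongrightarrow> 0" by (rule tendsto_rabs_zero_cancel)
      then show ?thesis by (simp add: LIM_zero_iff)
    qed (simp add: \<phi>zero w(5))
  qed
  then show ?thesis unfolding approx_def using test \<phi>W PhiR \<phi>0 \<phi>B by blast
qed

text \<open>Induction over a finite cover: one ball is peeled off with a cut-off, and the remainder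
  vanishes outside the other balls. Lipschitz cut-offs suffice, since smoothness is supplied by the
  mollification of each piece.\<close>

theorem approx_bounded:
  fixes w :: "'a::euclidean_space \<Rightarrow> real"
  assumes \<Omega>: "smooth_bounded_domain \<Omega>"
    and w: "w \<in> W s G" "w \<in> borel_measurable borel" "\<And>x. 0 \<le> w x" "\<And>x. w x \<le> B" "\<And>x. x \<notin> \<Omega> \<Longrightarrow> w x = 0"
  shows "approx \<Omega> w"
proof -
  have op: "open \<Omega>" "bounded \<Omega>" using \<Omega> by (auto simp: smooth_bounded_domain_def)
  have \<Omega>m: "\<Omega> \<in> sets lebesgue" "emeasure lebesgue \<Omega> < \<infinity>"
    using op emeasure_bounded_finite[OF op(2)] by auto
  define Q where "Q x0 r \<longleftrightarrow> (\<exists>v \<rho> \<epsilon>0. \<rho> > 0 \<and> \<epsilon>0 > 0 \<and> (\<forall>\<epsilon>. 0 < \<epsilon> \<and> \<epsilon> < \<epsilon>0 \<longrightarrow>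
    (\<exists>T. compact T \<and> T \<subseteq> \<Omega> \<and> (\<forall>p \<zeta>. p \<in> \<Omega> \<inter> ball x0 r \<longrightarrow> \<zeta> \<in> ball v \<rho> \<longrightarrow> p - \<epsilon> *\<^sub>R \<zeta> \<in> T))))" for x0 r
  have "\<forall>x0\<in>closure \<Omega>. \<exists>r. r > 0 \<and> Q x0 r" unfolding Q_def using boundary_geometry[OF \<Omega>] by simp
  from bchoice[OF this] obtain r where rQ: "\<forall>x0\<in>closure \<Omega>. r x0 > 0 \<and> Q x0 (r x0)" ..
  then have r: "\<And>x0. x0 \<in> closure \<Omega> \<Longrightarrow> r x0 > 0" and geo: "\<And>x0. x0 \<in> closure \<Omega> \<Longrightarrow> Q x0 (r x0)" by auto
  have cpt: "compact (closure \<Omega>)" using op by simp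
  have cover: "closure \<Omega> \<subseteq> (\<Union>x\<in>closure \<Omega>. ball x (r x / 2))" using r by force
  obtain F where F: "F \<subseteq> closure \<Omega>" "finite F" "closure \<Omega> \<subseteq> (\<Union>x\<in>F. ball x (r x / 2))"
    by (rule compactE_image[OF cpt _ cover]) auto
  have "approx \<Omega> w" if "F \<subseteq> closure \<Omega>" "w \<in> W s G" "w \<in> borel_measurable borel" "\<And>x. 0 \<le> w x" "\<And>x. w x \<le> B"
      "\<And>x. x \<notin> \<Omega> \<inter> (\<Union>x\<in>F. ball x (r x / 2)) \<Longrightarrow> w x = 0" for w
    using F(2) that
  proof (induction F arbitrary: w rule: finite_induct)
    case empty
    then have "w = (\<lambda>x. 0)" by auto
    then show ?case using approx_zero by simp
  next
    case (insert z F)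
    note w = insert.prems
    have z: "z \<in> closure \<Omega>" "r z > 0" using w(1) r by auto
    \<comment> \<open>Equal to 1 on the ball of half the radius, the one used in the cover, and 0
      outside the full ball, where \<open>boundary_geometry\<close> holds no longer.\<close>
    define \<theta> where "\<theta> x = max 0 (min 1 (2 - 2 * dist z x / r z))" for x
    have trunc: "\<bar>max 0 (min 1 (2 - a)) - max 0 (min 1 (2 - b))\<bar> \<le> \<bar>a - b\<bar>" for a b :: real
      by (auto simp: max_def min_def abs_if)
    have \<theta>01: "0 \<le> \<theta> x" "\<theta> x \<le> 1" for x by (auto simp: \<theta>_def)
    have \<theta>m: "\<theta> \<in> borel_measurable borel" unfolding \<theta>_def by measurable
    have \<theta>L: "\<bar>\<theta> x - \<theta> y\<bar> \<le> (2 / r z) * norm (x - y)" for x y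
    proof -
      have "\<bar>\<theta> x - \<theta> y\<bar> \<le> \<bar>2 * dist z x / r z - 2 * dist z y / r z\<bar>"
        unfolding \<theta>_def by (rule trunc)
      also have "2 * dist z x / r z - 2 * dist z y / r z = (2 / r z) * (dist z x - dist z y)"
        by (simp add: diff_divide_distrib right_diff_distrib)
      also have "\<bar>(2 / r z) * (dist z x - dist z y)\<bar> = (2 / r z) * \<bar>dist z x - dist z y\<bar>"
        using z(2) by (simp only: abs_mult) simp
      also have "\<dots> \<le> (2 / r z) * norm (x - y)"
      proof (rule mult_left_mono)
        show "\<bar>dist z x - dist z y\<bar> \<le> norm (x - y)"
          using dist_triangle[of z x y] dist_triangle[of z y x] by (simp add: dist_norm[symmetric] dist_commute abs_le_iff)
      qed (use z(2) in simp)
      finally show ?thesis .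
    qed
    have \<theta>1: "\<theta> x = 1" if "x \<in> ball z (r z / 2)" for x
    proof -
      have "2 * dist z x / r z \<le> 1" using that z by (simp add: pos_divide_le_eq)
      then show ?thesis by (simp add: \<theta>_def)
    qed
    have \<theta>0: "\<theta> x = 0" if "x \<notin> ball z (r z)" for x
    proof -
      have "2 \<le> 2 * dist z x / r z" using that z by (simp add: pos_le_divide_eq)
      then show ?thesis by (simp add: \<theta>_def)
    qed
    have w0: "w x = 0" if "x \<notin> \<Omega>" for x using w(6)[of x] that by auto
    have wb: "\<bar>w x\<bar> \<le> B" for x using w(4,5)[of x] by simp
    define w1 where "w1 x = \<theta> x * w x" for x
    define w2 where "w2 x = (1 - \<theta> x) * w x" for x
    have \<theta>ml: "\<theta> \<in> borel_measurable lebesgue" "(\<lambda>x. 1 - \<theta> x) \<in> borel_measurable lebesgue"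
      using \<theta>m by (auto simp: measurable_completion)
    have \<theta>L': "\<bar>(1 - \<theta> x) - (1 - \<theta> y)\<bar> \<le> (2 / r z) * norm (x - y)" for x y using \<theta>L[of x y] by simp
    have le: "t * w x \<le> B" if "0 \<le> t" "t \<le> 1" for t x
      using mult_left_le_one_le[OF w(4) that, of x] w(5)[of x] by linarith
    have "approx \<Omega> w1"
    proof -
      obtain v \<rho> \<epsilon>0 where g: "\<rho> > 0" "\<epsilon>0 > 0" "\<forall>\<epsilon>. 0 < \<epsilon> \<and> \<epsilon> < \<epsilon>0 \<longrightarrow>
        (\<exists>T. compact T \<and> T \<subseteq> \<Omega> \<and> (\<forall>p \<zeta>. p \<in> \<Omega> \<inter> ball z (r z) \<longrightarrow> \<zeta> \<in> ball v \<rho> \<longrightarrow> p - \<epsilon> *\<^sub>R \<zeta> \<in> T))"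
        using geo[OF z(1)] unfolding Q_def by (elim exE conjE)
      have in_ball: "p \<in> \<Omega> \<inter> ball z (r z)" if "w1 p \<noteq> 0" for p
        using that w0[of p] \<theta>0[of p] by (auto simp: w1_def)
      show ?thesis
      proof (rule approx_local[OF op _ _ _ _ _ g(1,2)])
        show "w1 \<in> W s G" unfolding w1_def by (rule cutoff_W[OF \<Omega>m w(2) w0 wb \<theta>ml(1) \<theta>01 \<theta>L])
        show "w1 \<in> borel_measurable borel" unfolding w1_def by (rule borel_measurable_times[OF \<theta>m w(3)])
        show "0 \<le> w1 x" for x using \<theta>01 w(4) by (simp add: w1_def)
        show "w1 x \<le> B" for x unfolding w1_def by (rule le[OF \<theta>01])
        show "w1 x = 0" if "x \<notin> \<Omega>" for x using w0[OF that] by (simp add: w1_def)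
        show "\<exists>T. compact T \<and> T \<subseteq> \<Omega> \<and> (\<forall>p \<zeta>. w1 p \<noteq> 0 \<longrightarrow> \<zeta> \<in> ball v \<rho> \<longrightarrow> p - \<epsilon> *\<^sub>R \<zeta> \<in> T)"
          if "0 < \<epsilon>" "\<epsilon> < \<epsilon>0" for \<epsilon>
          using g(3)[THEN spec, THEN mp, OF conjI[OF that]] in_ball by blast
      qed
    qed
    moreover have "approx \<Omega> w2"
    proof (rule insert.IH)
      show "w2 \<in> W s G" unfolding w2_def
        by (rule cutoff_W[OF \<Omega>m w(2) w0 wb \<theta>ml(2) _ _ \<theta>L']) (use \<theta>01 in auto)
      show "w2 \<in> borel_measurable borel" unfolding w2_def
        by (intro borel_measurable_times borel_measurable_diff borel_measurable_const \<theta>m w(3))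
      show "0 \<le> w2 x" for x using \<theta>01 w(4) by (simp add: w2_def)
      show "w2 x \<le> B" for x unfolding w2_def using \<theta>01[of x] by (intro le) auto
      show "w2 x = 0" if "x \<notin> \<Omega> \<inter> (\<Union>x\<in>F. ball x (r x / 2))" for x
        using that w(6)[of x] \<theta>1[of x] by (cases "x \<in> ball z (r z / 2)") (auto simp: w2_def)
    qed (use w(1) in auto)
    ultimately have "approx \<Omega> (\<lambda>x. w1 x + w2 x)" by (rule approx_add)
    moreover have "(\<lambda>x. w1 x + w2 x) = w" by (auto simp: w1_def w2_def algebra_simps)
    ultimately show ?case by simp
  qed
  moreover have "x \<notin> \<Omega> \<inter> (\<Union>x\<in>F. ball x (r x / 2)) \<Longrightarrow> w x = 0" for x
    using F(3) closure_subset[of \<Omega>] w(5)[of x] by blast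
  ultimately show ?thesis using F(1) w by blast
qed

end

section \<open>Test functions in the equation\<close>

lemma standing_orlicz_sobolev:
  assumes s: "0 < s" "s < 1" and n: "1 \<le> n" and st: "standing_assumptions n s G g"
  shows "\<exists>pp. orlicz_sobolev G g pp s n"
proof -
  have N: "N_function G g" and gc: "growth_condition G g" and df: "\<And>t. t > 0 \<Longrightarrow> g differentiable (at t)"
    and mono: "mono_on {0<..} (deriv g)"
    and iz: "\<exists>\<delta>>0. (\<integral>\<^sup>+ t\<in>{0..\<delta>}. ennreal ((t / G t) powr (s / (n - s))) \<partial>lborel) < \<infinity>"
    using st unfolding standing_assumptions_def by auto
  interpret nfun G g by unfold_locales (rule N)
  obtain pp where pp: "\<And>t. t > 0 \<Longrightarrow> t * g t / G t \<le> pp" using gc unfolding growth_condition_def by blast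
  have pp': "t * g t \<le> pp * G t" if "t > 0" for t
    using pp[OF that] A_pos[of t] that by (simp add: pos_divide_le_eq)
  have d: "(g has_real_derivative deriv g t) (at t)" if "t > 0" for t
    using df[OF that] by (simp add: DERIV_deriv_iff_real_differentiable)
  \<comment> \<open>Right-continuity of the density together with oddness.\<close>
  have c0: "isCont g 0"
  proof -
    have "continuous (at_right 0) g" using N unfolding N_function_def by blast
    then have r: "(g \<longlongrightarrow> 0) (at_right 0)" by (simp add: continuous_within)
    then have "((\<lambda>x. - g x) \<longlongrightarrow> - 0) (at_right 0)" by (rule tendsto_minus)
    then have "((\<lambda>x. g (- x)) \<longlongrightarrow> 0) (at_right (- 0))" by (simp add: odd)
    then have "(g \<longlongrightarrow> 0) (at_left 0)" by (simp only: filterlim_at_left_to_right)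
    then have "(g \<longlongrightarrow> 0) (at 0)" using r by (simp add: filterlim_at_split)
    then show ?thesis by (simp add: isCont_def)
  qed
  have cpos: "isCont g t" if "t > 0" for t using d[OF that] by (rule DERIV_isCont)
  have cont: "isCont g t" for t
  proof -
    consider "t > 0" | "t = 0" | "t < 0" by linarith
    then show ?thesis
    proof cases
      case 3
      have "isCont (\<lambda>x. g (- x)) t"
        by (rule isCont_o2[where f = "\<lambda>x. - x" and g = g]) (use cpos[of "- t"] 3 in auto)
      then have "isCont (\<lambda>x. - g (- x)) t" by (rule continuous_minus)
      then show ?thesis by (simp add: odd)
    qed (use cpos c0 in auto)
  qed
  \<comment> \<open>Convexity through the mean value theorem: the slope of \<open>g\<close> over the
    interval from 0 to \<open>c * t\<close> is at most that over the interval from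
    \<open>c * t\<close> to \<open>t\<close>.\<close>
  have scale: "g (c * t) \<le> c * g t" if c: "0 < c" "c \<le> 1" and t: "0 \<le> t" for c t
  proof (cases "t = 0 \<or> c = 1")
    case False
    then have t0: "t > 0" and c1: "c < 1" using t c by auto
    have ct: "0 < c * t" "c * t < t" using t0 c c1 by auto
    obtain l1 z1 where z1: "0 < z1" "z1 < c * t" "DERIV g z1 :> l1" "g (c * t) - g 0 = (c * t - 0) * l1"
      using MVT[of 0 "c * t" g] ct cont df by (auto simp: continuous_at_imp_continuous_on)
    obtain l2 z2 where z2: "c * t < z2" "z2 < t" "DERIV g z2 :> l2" "g t - g (c * t) = (t - c * t) * l2"
      using MVT[of "c * t" t g] ct cont df by (auto simp: continuous_at_imp_continuous_on)
    have "l1 = deriv g z1" "l2 = deriv g z2"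
      using DERIV_imp_deriv[OF z1(3)] DERIV_imp_deriv[OF z2(3)] by simp_all
    moreover have "deriv g z1 \<le> deriv g z2"
      using mono z1 z2 ct by (intro mono_onD[OF mono]) auto
    ultimately have "l1 \<le> l2" by simp
    have "(1 - c) * g (c * t) = c * ((1 - c) * t * l1)" using z1(4) by simp
    also have "\<dots> \<le> c * ((1 - c) * t * l2)" using \<open>l1 \<le> l2\<close> c c1 t0 by (intro mult_left_mono) auto
    also have "(1 - c) * t * l2 = g t - g (c * t)" unfolding z2(4) by (simp add: algebra_simps)
    finally show ?thesis by (simp add: algebra_simps)
  qed auto
  have "orlicz_sobolev G g pp s n"
    by unfold_locales (use pp' s scale cont n iz in auto)
  then show ?thesis by blast
qed

context orlicz
begin

lemma test_functions_cs: "\<phi> \<in> test_functions \<Omega> \<Longrightarrow> cs \<phi>"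
  unfolding test_functions_def cs_def by simp

lemma test_functions_zero: "\<phi> \<in> test_functions \<Omega> \<Longrightarrow> x \<notin> \<Omega> \<Longrightarrow> \<phi> x = 0"
  unfolding test_functions_def using closure_subset[of "{x. \<phi> x \<noteq> 0}"] by blast

lemma test_functions_W:
  assumes \<Omega>: "\<Omega> \<in> sets lebesgue" "emeasure lebesgue \<Omega> < \<infinity>" and \<phi>: "\<phi> \<in> test_functions \<Omega>"
  shows "\<phi> \<in> W s G"
proof -
  note c = test_functions_cs[OF \<phi>]
  obtain B where B: "B \<ge> 0" "\<And>x. \<bar>\<phi> x\<bar> \<le> B" using cs_bounded[OF c] by blast
  obtain L where L: "L \<ge> 0" "\<And>x v. \<bar>frechet_derivative \<phi> (at x) v\<bar> \<le> L * norm v" "\<And>x y. \<bar>\<phi> x - \<phi> y\<bar> \<le> L * norm (x - y)"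
    using cs_lipschitz[OF c] by blast
  have "\<phi> \<in> borel_measurable lebesgue" using cs_measurable[OF c] by (simp add: measurable_completion)
  from lipschitz_W[OF \<Omega> this test_functions_zero[OF \<phi>] B(2) L(3)] show ?thesis .
qed

lemma W_norm_zero: "W_norm s G (\<lambda>x::'a::euclidean_space. 0) = 0"
proof -
  have "rho G (\<lambda>x::'a. 0 / r) \<le> 1" "rho_s s G (\<lambda>x::'a. 0 / r) \<le> 1" for r :: real
    by (simp_all add: rho_eq rho_s_eq dq_def diff_quot_def)
  moreover have "{r. (0::real) < r} = {0<..}" by auto
  ultimately show ?thesis by (simp add: W_norm_def)
qed

lemma test_functions_E: "\<phi> \<in> test_functions \<Omega> \<Longrightarrow> \<phi> \<in> W s G \<Longrightarrow> \<phi> \<in> E s G \<Omega>"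
  unfolding E_def by (auto intro!: bexI[of _ \<phi>] simp: W_norm_zero)

text \<open>Shows that the sets in \<open>W_norm\<close> are nonempty, so that their infima have the
  intended meaning.\<close>

lemma modular_scale_down:
  assumes "integrable M (\<lambda>x. G (u x))"
  shows "\<exists>r\<ge>1. (\<integral>\<^sup>+ x. ennreal (G (u x / r)) \<partial>M) \<le> 1"
proof -
  define r where "r = max 1 (\<integral>x. G (u x) \<partial>M)"
  have r: "r \<ge> 1" by (simp add: r_def)
  have "(\<integral>\<^sup>+ x. ennreal (G (u x / r)) \<partial>M) \<le> (\<integral>\<^sup>+ x. ennreal (1 / r * G (u x)) \<partial>M)"
  proof (intro nn_integral_mono ennreal_leI)
    show "G (u x / r) \<le> 1 / r * G (u x)" for x using A_scale[of "1 / r" "u x"] r by simp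
  qed
  also have "\<dots> = ennreal (1 / r * (\<integral>x. G (u x) \<partial>M))"
    using assms r by (subst nn_integral_eq_integral) auto
  also have "\<dots> \<le> ennreal 1" using r by (intro ennreal_leI) (auto simp: r_def pos_divide_le_eq)
  finally show ?thesis using r by auto
qed

text \<open>Outside \<open>\<Omega>\<close> a function of \<open>E\<close> equals its difference to
  any test function. A norm below \<open>\<epsilon>\<close> gives some \<open>r < \<epsilon>\<close>
  for which that difference divided by \<open>r\<close> has modular at most 1, and
  \<open>A_scale\<close> bounds the modular of the function outside \<open>\<Omega>\<close> by
  \<open>r\<close>.\<close>

lemma E_zero_outside:
  assumes \<Omega>: "\<Omega> \<in> sets lebesgue" "emeasure lebesgue \<Omega> < \<infinity>" and v: "v \<in> E s G \<Omega>"
  shows "AE x in lebesgue. x \<notin> \<Omega> \<longrightarrow> v x = 0"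
proof -
  have vW: "v \<in> W s G" using v by (simp add: E_def)
  note vm = W_measurable[OF vW]
  have le: "(\<integral>\<^sup>+ x. ennreal (G (v x)) * indicator (- \<Omega>) x \<partial>lebesgue) \<le> ennreal \<epsilon>" if \<epsilon>: "0 < \<epsilon>" "\<epsilon> < 1" for \<epsilon>
  proof -
    obtain \<phi> where \<phi>: "\<phi> \<in> test_functions \<Omega>" "W_norm s G (\<lambda>x. v x - \<phi> x) < \<epsilon>"
      using v \<epsilon>(1) unfolding E_def by blast
    define d where "d x = v x - \<phi> x" for x
    have dW: "d \<in> W s G" unfolding d_def by (rule W_diff[OF vW test_functions_W[OF \<Omega> \<phi>(1)]])
    define A1 where "A1 = {r. 0 < r \<and> rho G (\<lambda>x. d x / r) \<le> 1}"
    define A2 where "A2 = {r. 0 < r \<and> rho_s s G (\<lambda>x. d x / r) \<le> 1}"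
    have "A1 \<noteq> {}"
    proof -
      obtain r where "r \<ge> 1" "(\<integral>\<^sup>+ x. ennreal (G (d x / r)) \<partial>lebesgue) \<le> 1"
        using modular_scale_down[OF W_integrable[OF dW]] by blast
      then have "r \<in> A1" by (simp add: A1_def rho_eq)
      then show ?thesis by blast
    qed
    have "A2 \<noteq> {}"
    proof -
      obtain r where r: "r \<ge> 1" "(\<integral>\<^sup>+ p. ennreal (G (dq s d p / r)) \<partial>mu) \<le> 1"
        using modular_scale_down[OF W_integrable_mu[OF dW]] by blast
      have "dq s (\<lambda>x. d x / r) p = dq s d p / r" for p using dq_cmult[of s "1 / r" d p] by simp
      then have "r \<in> A2" using r by (simp add: A2_def rho_s_eq)
      then show ?thesis by blast
    qed
    then have "Inf A2 \<ge> 0" by (rule cInf_greatest) (simp add: A2_def)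
    moreover have "W_norm s G d = Inf A1 + Inf A2" by (simp add: W_norm_def A1_def A2_def)
    ultimately have "Inf A1 < \<epsilon>" using \<phi>(2) by (simp add: d_def[abs_def])
    then obtain r where r: "r \<in> A1" "r < \<epsilon>" using cInf_lessD[OF \<open>A1 \<noteq> {}\<close>] by blast
    have "(\<integral>\<^sup>+ x. ennreal (G (v x)) * indicator (- \<Omega>) x \<partial>lebesgue) \<le> (\<integral>\<^sup>+ x. ennreal r * ennreal (G (d x / r)) \<partial>lebesgue)"
    proof (rule nn_integral_mono)
      fix x
      show "ennreal (G (v x)) * indicator (- \<Omega>) x \<le> ennreal r * ennreal (G (d x / r))"
      proof (cases "x \<in> \<Omega>")
        case False
        have "v x = r * (d x / r)" using test_functions_zero[OF \<phi>(1) False] r by (simp add: d_def A1_def)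
        then have "G (v x) \<le> r * G (d x / r)" using A_scale[of r "d x / r"] r \<epsilon> by (simp add: A1_def)
        then have "ennreal (G (v x)) \<le> ennreal (r * G (d x / r))" by (rule ennreal_leI)
        then show ?thesis using False r by (simp add: ennreal_mult A1_def)
      qed simp
    qed
    also have "\<dots> = ennreal r * (\<integral>\<^sup>+ x. ennreal (G (d x / r)) \<partial>lebesgue)"
    proof (rule nn_integral_cmult)
      have "(\<lambda>x. d x / r) \<in> borel_measurable lebesgue" by (intro borel_measurable_divide W_measurable[OF dW] borel_measurable_const)
      from measurable_compose[OF this A_measurable] show "(\<lambda>x. ennreal (G (d x / r))) \<in> borel_measurable lebesgue" by simp
    qed
    also have "\<dots> \<le> ennreal r * 1" using r by (intro mult_left_mono) (auto simp: A1_def rho_eq)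
    also have "\<dots> \<le> ennreal \<epsilon>" using r by (simp add: ennreal_leI)
    finally show ?thesis .
  qed
  have "(\<integral>\<^sup>+ x. ennreal (G (v x)) * indicator (- \<Omega>) x \<partial>lebesgue) \<le> 0"
  proof (rule ennreal_le_epsilon)
    fix e :: real assume e: "0 < e"
    have "(\<integral>\<^sup>+ x. ennreal (G (v x)) * indicator (- \<Omega>) x \<partial>lebesgue) \<le> ennreal (min e (1 / 2))"
      by (rule le) (use e in auto)
    also have "\<dots> \<le> ennreal e" by (rule ennreal_leI) simp
    finally show "(\<integral>\<^sup>+ x. ennreal (G (v x)) * indicator (- \<Omega>) x \<partial>lebesgue) \<le> 0 + ennreal e" by simp
  qed
  then have "(\<integral>\<^sup>+ x. ennreal (G (v x)) * indicator (- \<Omega>) x \<partial>lebesgue) = 0" by simp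
  moreover have "(\<lambda>x. ennreal (G (v x)) * indicator (- \<Omega>) x) \<in> borel_measurable lebesgue"
    using measurable_compose[OF vm A_measurable] sets.compl_sets[OF \<Omega>(1)]
    by (intro borel_measurable_times_ennreal borel_measurable_indicator) (auto simp: Compl_eq_Diff_UNIV)
  ultimately have "AE x in lebesgue. ennreal (G (v x)) * indicator (- \<Omega>) x = 0"
    by (subst (asm) nn_integral_0_iff_AE) auto
  then show ?thesis
  proof eventually_elim
    case (elim x)
    show ?case
    proof
      assume "x \<notin> \<Omega>"
      then have "G (v x) \<le> 0" using elim by (simp add: ennreal_eq_0_iff)
      then show "v x = 0" using A_pos[of "v x"] by linarith
    qed
  qed
qed

text \<open>Two limits: from test functions to bounded functions by \<open>approx_bounded\<close>,
  then from the truncations \<open>min w j\<close> to \<open>w\<close>. The sign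
  \<open>\<sigma>\<close> allows one proof for supersolutions (\<open>1\<close>) and subsolutions
  (\<open>- 1\<close>).\<close>

lemma test_passage:
  fixes \<Omega> :: "'a::euclidean_space set" and U \<kappa> h :: "'a \<Rightarrow> real"
  assumes dom: "smooth_bounded_domain \<Omega>" and U: "U \<in> W s G"
    and \<kappa>: "\<kappa> \<in> borel_measurable lebesgue" "\<And>x. \<bar>\<kappa> x\<bar> \<le> h x"
    and h: "integrable lebesgue h" "\<And>v. v \<in> W s G \<Longrightarrow> integrable lebesgue (\<lambda>x. h x * \<bar>v x\<bar>)"
    and pos: "\<And>v. v \<in> E_plus s G \<Omega> \<Longrightarrow> 0 \<le> \<sigma> * (frac_g_laplacian s g U v - (\<integral>x. \<kappa> x * v x \<partial>lebesgue))"
    and w: "w \<in> W s G" "AE x in lebesgue. 0 \<le> w x" "AE x in lebesgue. x \<notin> \<Omega> \<longrightarrow> w x = 0"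
  shows "0 \<le> \<sigma> * (frac_g_laplacian s g U w - (\<integral>x. \<kappa> x * w x \<partial>lebesgue))"
proof -
  have op: "open \<Omega>" "bounded \<Omega>" using dom by (auto simp: smooth_bounded_domain_def)
  have \<Omega>m: "\<Omega> \<in> sets borel" using op by simp
  have h0: "0 \<le> h x" for x using \<kappa>(2)[of x] by linarith
  have hm: "h \<in> borel_measurable lebesgue" using h(1) by auto
  have conv: "(\<lambda>k. \<integral>x. \<kappa> x * \<phi> k x \<partial>lebesgue) \<longlonglongrightarrow> (\<integral>x. \<kappa> x * z x \<partial>lebesgue)"
    if \<phi>: "\<And>k. \<phi> k \<in> borel_measurable lebesgue" "z \<in> borel_measurable lebesgue"
      and b: "integrable lebesgue (\<lambda>x. h x * b x)" "\<And>k. AE x in lebesgue. \<bar>\<phi> k x\<bar> \<le> b x"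
      and AE: "AE x in lebesgue. (\<lambda>k. \<phi> k x) \<longlonglongrightarrow> z x" for \<phi> z b
  proof (rule integral_dominated_convergence[OF _ _ b(1)])
    show "AE x in lebesgue. (\<lambda>k. \<kappa> x * \<phi> k x) \<longlonglongrightarrow> \<kappa> x * z x"
      using AE by eventually_elim (intro tendsto_mult tendsto_const)
    show "AE x in lebesgue. norm (\<kappa> x * \<phi> k x) \<le> h x * b x" for k
      using b(2)[of k] by eventually_elim (auto simp: abs_mult intro!: mult_mono \<kappa>(2) h0)
  qed (intro borel_measurable_times \<kappa>(1) \<phi>)+
  obtain w' where w'0: "w' \<in> borel_measurable borel" "AE x in lborel. w x = w' x"
    using completion_ex_borel_measurable_real[OF W_measurable[OF w(1)]] by auto
  have w': "w' \<in> borel_measurable borel" "AE x in lebesgue. w x = w' x"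
    using w'0(1) AE_completion[OF w'0(2)] by auto
  \<comment> \<open>\<open>approx_bounded\<close> asks for a Borel function with bounds at every
    point, hence the Borel version \<open>w'\<close> and the explicit value 0 outside
    \<open>\<Omega>\<close>. Truncation does not increase the modular.\<close>
  define wj where "wj j x = (if x \<in> \<Omega> then min (max (w' x) 0) (real j) else 0)" for j x
  have wjm: "wj j \<in> borel_measurable borel" for j
    unfolding wj_def by (intro measurable_If borel_measurable_min borel_measurable_max w'(1) borel_measurable_const) (use \<Omega>m in auto)
  have wjml: "wj j \<in> borel_measurable lebesgue" for j using wjm[of j] by (simp add: measurable_completion)
  have wjAE: "AE x in lebesgue. min (w x) (real j) = wj j x" for j
    using w(2,3) w'(2) by eventually_elim (auto simp: wj_def)
  have minW: "(\<lambda>x. min (w x) (real j)) \<in> W s G" for j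
  proof (rule W_dominated[OF _ w(1) w(1)])
    show "(\<lambda>x. min (w x) (real j)) \<in> borel_measurable lebesgue"
      by (intro borel_measurable_min W_measurable[OF w(1)] borel_measurable_const)
    show "AE x in lebesgue. \<bar>min (w x) (real j)\<bar> \<le> \<bar>w x\<bar> \<or> \<bar>min (w x) (real j)\<bar> \<le> \<bar>w x\<bar>"
      using w(2) by eventually_elim auto
    show "\<bar>min (w x) (real j) - min (w y) (real j)\<bar> \<le> \<bar>w x - w y\<bar> \<or> \<bar>min (w x) (real j) - min (w y) (real j)\<bar> \<le> \<bar>w x - w y\<bar>" for x y
      by (auto simp: min_def)
  qed
  have wjW: "wj j \<in> W s G" for j by (rule W_cong_AE[OF minW wjml wjAE])
  have Phi_j: "Phi (wj j) \<le> Phi w" for j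
    unfolding Phi_def
  proof (rule integral_mono_AE)
    show "AE p in mu. G (dq s (wj j) p) \<le> G (dq s w p)"
      using AE_dq_cong[OF wjAE[of j], of s]
    proof eventually_elim
      case (elim p)
      obtain x y where p: "p = (x, y)" by (cases p)
      have "\<bar>dq s (\<lambda>x. min (w x) (real j)) p\<bar> \<le> \<bar>dq s w p\<bar>"
        unfolding p by (rule abs_dq_le) (auto simp: min_def)
      then show ?case using elim by (metis A_mono)
    qed
  qed (use wjW[of j] w(1) in \<open>auto simp: W_iff\<close>)
  have step: "0 \<le> \<sigma> * (frac_g_laplacian s g U (wj j) - (\<integral>x. \<kappa> x * wj j x \<partial>lebesgue))" for j
  proof -
    have "approx \<Omega> (wj j)"
      by (rule approx_bounded[OF dom wjW wjm, where B = "real j"]) (auto simp: wj_def)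
    then obtain \<phi> B R where \<phi>: "\<And>k. \<phi> k \<in> test_functions \<Omega>" "\<And>k. \<phi> k \<in> W s G" "\<And>k. Phi (\<phi> k) \<le> R"
      "\<And>k x. 0 \<le> \<phi> k x" "\<And>k x. \<phi> k x \<le> B" "AE x in lebesgue. (\<lambda>k::nat. \<phi> k x) \<longlonglongrightarrow> wj j x"
      unfolding approx_def by blast
    have "0 \<le> \<sigma> * (frac_g_laplacian s g U (\<phi> k) - (\<integral>x. \<kappa> x * \<phi> k x \<partial>lebesgue))" for k
      using test_functions_E[OF \<phi>(1,2)] \<phi>(4) by (intro pos) (auto simp: E_plus_def)
    moreover have "(\<lambda>k. \<sigma> * (frac_g_laplacian s g U (\<phi> k) - (\<integral>x. \<kappa> x * \<phi> k x \<partial>lebesgue))) \<longlonglongrightarrow>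
      \<sigma> * (frac_g_laplacian s g U (wj j) - (\<integral>x. \<kappa> x * wj j x \<partial>lebesgue))"
    proof (intro tendsto_mult tendsto_diff tendsto_const)
      show "(\<lambda>k. frac_g_laplacian s g U (\<phi> k)) \<longlonglongrightarrow> frac_g_laplacian s g U (wj j)"
        by (rule pairing_tendsto[OF U wjW \<phi>(2) \<phi>(6) \<phi>(3)])
      show "(\<lambda>k. \<integral>x. \<kappa> x * \<phi> k x \<partial>lebesgue) \<longlonglongrightarrow> (\<integral>x. \<kappa> x * wj j x \<partial>lebesgue)"
        by (rule conv[OF W_measurable[OF \<phi>(2)] wjml integrable_mult_left[OF h(1), of B] _ \<phi>(6)]) (use \<phi>(4,5) in auto)
    qed
    ultimately show ?thesis by (intro LIMSEQ_le_const) auto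
  qed
  have wlim: "AE x in lebesgue. (\<lambda>j. wj j x) \<longlonglongrightarrow> w x"
  proof -
    have "AE x in lebesgue. \<forall>j. min (w x) (real j) = wj j x" unfolding AE_all_countable using wjAE by blast
    then show ?thesis
    proof eventually_elim
      case (elim x)
      obtain j0 where j0: "w x \<le> real j0" using real_arch_simple by blast
      have "eventually (\<lambda>j. wj j x = w x) sequentially"
        using eventually_ge_at_top[of j0]
      proof eventually_elim
        case (elim j)
        then have "w x \<le> real j" using j0 by linarith
        then show ?case using \<open>\<forall>j. min (w x) (real j) = wj j x\<close> by (metis min.absorb1)
      qed
      then show ?case by (rule tendsto_eventually)
    qed
  qed
  have "(\<lambda>j. \<sigma> * (frac_g_laplacian s g U (wj j) - (\<integral>x. \<kappa> x * wj j x \<partial>lebesgue))) \<longlonglongrightarrow>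
      \<sigma> * (frac_g_laplacian s g U w - (\<integral>x. \<kappa> x * w x \<partial>lebesgue))"
  proof (intro tendsto_mult tendsto_diff tendsto_const)
    show "(\<lambda>j. frac_g_laplacian s g U (wj j)) \<longlonglongrightarrow> frac_g_laplacian s g U w"
      by (rule pairing_tendsto[OF U w(1) wjW wlim Phi_j])
    have "AE x in lebesgue. \<bar>wj j x\<bar> \<le> \<bar>w x\<bar>" for j
      using wjAE[of j] w(2) by eventually_elim auto
    then show "(\<lambda>j. \<integral>x. \<kappa> x * wj j x \<partial>lebesgue) \<longlonglongrightarrow> (\<integral>x. \<kappa> x * w x \<partial>lebesgue)"
      by (rule conv[OF wjml W_measurable[OF w(1)] h(2)[OF w(1)] _ wlim])
  qed
  then show ?thesis by (rule LIMSEQ_le_const) (use step in auto)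
qed

end

section \<open>Primitives of Caratheodory functions\<close>

text \<open>Rounding \<open>w\<close> down to multiples of \<open>1 / 2 ^ j\<close> leaves countably
  many values, for which the composition is measurable; continuity in the second argument yields the
  limit.\<close>

lemma caratheodory_compose:
  fixes k :: "'b \<Rightarrow> real \<Rightarrow> real"
  assumes k: "\<And>t. (\<lambda>x. k x t) \<in> borel_measurable M" "\<And>x. continuous_on UNIV (k x)"
    and w: "w \<in> borel_measurable M"
  shows "(\<lambda>x. k x (w x)) \<in> borel_measurable M"
proof (rule borel_measurable_LIMSEQ_real)
  define a where "a j x = (of_int \<lfloor>2 ^ j * w x\<rfloor> / 2 ^ j :: real)" for j :: nat and x
  show "(\<lambda>x. k x (a j x)) \<in> borel_measurable M" for j
  proof -
    have "(\<lambda>x. \<lfloor>2 ^ j * w x\<rfloor>) \<in> measurable M (count_space UNIV)" using w by measurable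
    from measurable_compose_countable[of "\<lambda>i x. k x (of_int i / 2 ^ j)", OF k(1) this]
    show ?thesis by (simp add: a_def)
  qed
  show "(\<lambda>j. k x (a j x)) \<longlonglongrightarrow> k x (w x)" for x
  proof -
    have "(\<lambda>j. w x - a j x) \<longlonglongrightarrow> 0"
    proof (rule Lim_null_comparison)
      show "\<forall>\<^sub>F j in sequentially. norm (w x - a j x) \<le> (1 / 2) ^ j"
      proof (intro always_eventually allI)
        fix j
        have "\<bar>2 ^ j * w x - of_int \<lfloor>2 ^ j * w x\<rfloor>\<bar> \<le> 1" by linarith
        then have "\<bar>2 ^ j * w x - of_int \<lfloor>2 ^ j * w x\<rfloor>\<bar> / 2 ^ j \<le> 1 / 2 ^ j" by (intro divide_right_mono) auto
        moreover have "w x - a j x = (2 ^ j * w x - of_int \<lfloor>2 ^ j * w x\<rfloor>) / 2 ^ j"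
          by (simp add: a_def diff_divide_distrib)
        ultimately show "norm (w x - a j x) \<le> (1 / 2) ^ j" by (simp add: abs_divide power_divide)
      qed
      show "(\<lambda>j. (1 / 2 :: real) ^ j) \<longlonglongrightarrow> 0" by (rule LIMSEQ_power_zero) simp
    qed
    then have "(\<lambda>j. w x - (w x - a j x)) \<longlonglongrightarrow> w x - 0" by (intro tendsto_diff tendsto_const)
    then have "(\<lambda>j. a j x) \<longlonglongrightarrow> w x" by simp
    moreover have "isCont (k x) (w x)" using k(2)[of x] by (simp add: continuous_on_eq_continuous_at)
    ultimately show ?thesis by (rule isCont_tendsto_compose[rotated])
  qed
qed

text \<open>The signed integral from 0 to \<open>t\<close>. Written as Lebesgue integrals over the
  whole line, it depends measurably on parameters in \<open>k\<close> and \<open>t\<close> by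
  Fubini-type results.\<close>

definition primitive :: "(real \<Rightarrow> real) \<Rightarrow> real \<Rightarrow> real" where
  "primitive k t = (\<integral>y. indicator {0<..<t} y * k y \<partial>lborel) - (\<integral>y. indicator {t<..<0} y * k y \<partial>lborel)"

lemma primitive_derivative:
  assumes k: "continuous_on UNIV k"
  shows "(primitive k has_real_derivative k t) (at t)"
proof -
  have "\<exists>F. \<forall>x::real. - \<infinity> < ereal x \<longrightarrow> ereal x < \<infinity> \<longrightarrow> (F has_vector_derivative k x) (at x)"
    using k by (intro einterval_antiderivative) (auto simp: continuous_on_eq_continuous_at)
  then obtain F where F: "\<And>x. (F has_vector_derivative k x) (at x)" by auto
  have eq: "primitive k t = F t - F 0" for t
  proof -
    have "(LBINT x=0..t. k x) = F t - F 0"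
      using interval_integral_FTC_finite[of 0 t k F] F k
      by (simp add: continuous_on_subset has_vector_derivative_at_within zero_ereal_def)
    moreover have "(LBINT x=0..t. k x) = primitive k t"
    proof -
      have e: "einterval 0 (ereal t) = {0<..<t}" "einterval (ereal t) 0 = {t<..<0}"
        by (auto simp: einterval_def)
      show ?thesis
        by (cases "0 \<le> t") (simp_all add: interval_lebesgue_integral_def e primitive_def set_lebesgue_integral_def)
    qed
    ultimately show ?thesis by simp
  qed
  have "((\<lambda>t. F t - F 0) has_real_derivative k t) (at t)"
    using F[of t] by (auto simp: has_real_derivative_iff_has_vector_derivative intro!: derivative_eq_intros)
  moreover have "primitive k = (\<lambda>t. F t - F 0)" using eq by blast
  ultimately show ?thesis by simp
qed

lemma primitive_0 [simp]: "primitive k 0 = 0"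
  by (simp add: primitive_def)

lemma primitive_MVT:
  assumes k: "continuous_on UNIV k" and ab: "a < b"
  shows "\<exists>z. a < z \<and> z < b \<and> primitive k b - primitive k a = (b - a) * k z"
  using MVT2[OF ab, of "primitive k" k] primitive_derivative[OF k] by blast

lemma primitive_lipschitz:
  assumes k: "continuous_on UNIV k" and c: "\<And>t. \<bar>k t\<bar> \<le> c"
  shows "\<bar>primitive k b - primitive k a\<bar> \<le> c * \<bar>b - a\<bar>"
proof -
  have *: "\<bar>primitive k b - primitive k a\<bar> \<le> c * \<bar>b - a\<bar>" if ab: "a < b" for a b
  proof -
    obtain z where "primitive k b - primitive k a = (b - a) * k z" using primitive_MVT[OF k ab] by blast
    then show ?thesis using mult_right_mono[OF c[of z], of "\<bar>b - a\<bar>"] by (simp add: abs_mult mult.commute)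
  qed
  consider "a < b" | "a = b" | "b < a" by linarith
  then show ?thesis by cases (use *[of a b] *[of b a] in \<open>auto simp: abs_minus_commute\<close>)
qed

lemma primitive_measurable:
  fixes k :: "'a::euclidean_space \<Rightarrow> real \<Rightarrow> real"
  assumes k: "\<And>t. (\<lambda>x. k x t) \<in> borel_measurable lebesgue" "\<And>x. continuous_on UNIV (k x)"
    and w: "w \<in> borel_measurable lebesgue"
  shows "(\<lambda>x. primitive (k x) (w x)) \<in> borel_measurable lebesgue"
proof -
  have km: "(\<lambda>p. k (fst p) (snd p)) \<in> borel_measurable (lebesgue \<Otimes>\<^sub>M lborel)"
  proof (rule caratheodory_compose[where k = "\<lambda>p. k (fst p)" and w = snd])
    show "(\<lambda>p. k (fst p) t) \<in> borel_measurable (lebesgue \<Otimes>\<^sub>M lborel)" for t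
      by (rule measurable_compose[OF measurable_fst k(1)])
    show "snd \<in> borel_measurable (lebesgue \<Otimes>\<^sub>M (lborel :: real measure))"
      using measurable_snd[of lebesgue "lborel :: real measure"] by simp
  qed (rule k(2))
  have wm: "(\<lambda>p. w (fst p)) \<in> borel_measurable (lebesgue \<Otimes>\<^sub>M (lborel :: real measure))"
    by (rule measurable_compose[OF measurable_fst w])
  have sm: "(\<lambda>p. snd p) \<in> borel_measurable (lebesgue \<Otimes>\<^sub>M (lborel :: real measure))"
    using measurable_snd[of lebesgue "lborel :: real measure"] by simp
  have S1: "{p \<in> space (lebesgue \<Otimes>\<^sub>M lborel). 0 < snd p} \<inter> {p \<in> space (lebesgue \<Otimes>\<^sub>M lborel). snd p < w (fst p)} \<in> sets (lebesgue \<Otimes>\<^sub>M (lborel :: real measure))"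
    by (intro sets.Int borel_measurable_less sm wm borel_measurable_const)
  have S2: "{p \<in> space (lebesgue \<Otimes>\<^sub>M lborel). snd p < 0} \<inter> {p \<in> space (lebesgue \<Otimes>\<^sub>M lborel). w (fst p) < snd p} \<in> sets (lebesgue \<Otimes>\<^sub>M (lborel :: real measure))"
    by (intro sets.Int borel_measurable_less sm wm borel_measurable_const)
  have 1: "(\<lambda>(x, y). indicator {0<..<w x} y * k x y) \<in> borel_measurable (lebesgue \<Otimes>\<^sub>M lborel)"
    by (rule measurable_cong[THEN iffD1, OF _ borel_measurable_times[OF borel_measurable_indicator[OF S1] km]])
       (auto split: split_indicator simp: space_pair_measure)
  have 2: "(\<lambda>(x, y). indicator {w x<..<0} y * k x y) \<in> borel_measurable (lebesgue \<Otimes>\<^sub>M lborel)"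
    by (rule measurable_cong[THEN iffD1, OF _ borel_measurable_times[OF borel_measurable_indicator[OF S2] km]])
       (auto split: split_indicator simp: space_pair_measure)
  show ?thesis unfolding primitive_def
    by (intro borel_measurable_diff lborel.borel_measurable_lebesgue_integral 1 2)
qed

section \<open>Minimisation between the sub- and the supersolution\<close>

text \<open>\<open>k\<close> stands for the nonlinearity evaluated at the argument clipped to the
  interval between \<open>lo\<close> and \<open>up\<close>, hence constant beyond them. Its majorant
  \<open>h\<close> does not depend on \<open>t\<close> and is integrable against all of
  \<open>W\<close>, which makes the lower order term finite and differentiable there.\<close>

locale truncated_problem = orlicz G g pp s for G g :: "real \<Rightarrow> real" and pp s :: real +
  fixes \<Omega> :: "'a::euclidean_space set" and lo up h :: "'a \<Rightarrow> real" and k :: "'a \<Rightarrow> real \<Rightarrow> real"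
  assumes \<Omega>_sets: "\<Omega> \<in> sets lebesgue" and \<Omega>_fin: "emeasure lebesgue \<Omega> < \<infinity>"
    and lo: "lo \<in> W s G" and up: "up \<in> W s G"
    and k_meas: "\<And>t. (\<lambda>x. k x t) \<in> borel_measurable lebesgue"
    and k_cont: "\<And>x. continuous_on UNIV (k x)"
    and k_le: "\<And>x t. \<bar>k x t\<bar> \<le> h x"
    and k_up: "\<And>x t. up x \<le> t \<Longrightarrow> k x t = k x (up x)"
    and k_lo: "\<And>x t. lo x \<le> up x \<Longrightarrow> t \<le> lo x \<Longrightarrow> k x t = k x (lo x)"
    and h_int: "\<And>v. v \<in> W s G \<Longrightarrow> integrable lebesgue (\<lambda>x. h x * \<bar>v x\<bar>)"
begin

definition J :: "('a \<Rightarrow> real) \<Rightarrow> real" where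
  "J u = Phi u - (\<integral>x. primitive (k x) (u x) \<partial>lebesgue)"

definition K :: "('a \<Rightarrow> real) set" where
  "K = {u \<in> W0 s G \<Omega>. AE x in lebesgue. lo x \<le> u x \<and> u x \<le> up x}"

lemma k_comp: "w \<in> borel_measurable lebesgue \<Longrightarrow> (\<lambda>x. k x (w x)) \<in> borel_measurable lebesgue"
  by (rule caratheodory_compose[OF k_meas k_cont])

lemma P_meas: "w \<in> borel_measurable lebesgue \<Longrightarrow> (\<lambda>x. primitive (k x) (w x)) \<in> borel_measurable lebesgue"
  by (rule primitive_measurable[OF k_meas k_cont])

lemma P_lip: "\<bar>primitive (k x) b - primitive (k x) a\<bar> \<le> h x * \<bar>b - a\<bar>"
  by (rule primitive_lipschitz[OF k_cont k_le])

lemma P_le: "\<bar>primitive (k x) b\<bar> \<le> h x * \<bar>b\<bar>"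
  using P_lip[of x b 0] by simp

lemma h_nonneg: "0 \<le> h x"
  using k_le[of x 0] by linarith

lemma P_int: "w \<in> W s G \<Longrightarrow> integrable lebesgue (\<lambda>x. primitive (k x) (w x))"
  by (rule Bochner_Integration.integrable_bound[OF h_int[of w] P_meas[OF W_measurable]])
     (use P_le h_nonneg in \<open>auto intro: order.trans[OF _ abs_ge_self]\<close>)

lemma kv_int:
  assumes w: "w \<in> borel_measurable lebesgue" and v: "v \<in> W s G"
  shows "integrable lebesgue (\<lambda>x. k x (w x) * v x)"
proof (rule Bochner_Integration.integrable_bound[OF h_int[OF v]])
  show "(\<lambda>x. k x (w x) * v x) \<in> borel_measurable lebesgue"
    by (rule borel_measurable_times[OF k_comp[OF w] W_measurable[OF v]])
  show "AE x in lebesgue. norm (k x (w x) * v x) \<le> norm (h x * \<bar>v x\<bar>)"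
    by (intro AE_I2) (auto simp: abs_mult h_nonneg intro!: mult_right_mono k_le)
qed

lemma K_minimizer:
  assumes "K \<noteq> {}"
  shows "\<exists>u\<in>K. \<forall>z\<in>K. J u \<le> J z"
proof -
  define M where "M x = \<bar>lo x\<bar> + \<bar>up x\<bar>" for x
  have hM: "integrable lebesgue (\<lambda>x. h x * M x)"
    unfolding M_def distrib_left by (rule Bochner_Integration.integrable_add[OF h_int[OF lo] h_int[OF up]])
  define c0 where "c0 = (\<integral>x. h x * M x \<partial>lebesgue)"
  have KW: "u \<in> W s G" if "u \<in> K" for u using that by (simp add: K_def W0_def)
  have KM: "AE x in lebesgue. \<bar>u x\<bar> \<le> M x" if "u \<in> K" for u
  proof -
    have "AE x in lebesgue. lo x \<le> u x \<and> u x \<le> up x" using that by (simp add: K_def)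
    then show ?thesis by eventually_elim (auto simp: M_def)
  qed
  have PM: "AE x in lebesgue. norm (primitive (k x) (u x)) \<le> h x * M x" if "u \<in> K" for u
    using KM[OF that]
  proof eventually_elim
    case (elim x)
    show ?case using P_le[of x "u x"] mult_left_mono[OF elim h_nonneg[of x]] by simp
  qed
  have Pc: "\<bar>\<integral>x. primitive (k x) (u x) \<partial>lebesgue\<bar> \<le> c0" if "u \<in> K" for u
    unfolding c0_def
    by (rule order.trans[OF integral_abs_bound integral_mono_AE[OF integrable_abs[OF P_int[OF KW[OF that]]] hM]])
       (use PM[OF that] in simp)
  have Jlow: "- c0 \<le> J u" if "u \<in> K" for u
    using Pc[OF that] Phi_nonneg[of u] unfolding J_def by linarith
  have bdd: "bdd_below (J ` K)" using Jlow by (auto intro!: bdd_belowI[of _ "- c0"])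
  define m where "m = Inf (J ` K)"
  have m_le: "m \<le> J z" if "z \<in> K" for z unfolding m_def using that by (intro cInf_lower bdd) auto
  have "\<exists>u\<in>K. J u < m + 1 / real (Suc n)" for n
    using cInf_lessD[of "J ` K" "m + 1 / real (Suc n)"] assms by (auto simp: m_def)
  then obtain w where w: "\<And>n. w n \<in> K" "\<And>n. J (w n) < m + 1 / real (Suc n)" by metis
  have PhiC: "Phi (w n) \<le> m + 1 + c0" for n
  proof -
    have "1 / real (Suc n) \<le> 1" by simp
    then show ?thesis using w(2)[of n] Pc[OF w(1)[of n]] unfolding J_def by linarith
  qed
  \<comment> \<open>\<open>linear_le\<close> gives integrability of \<open>M\<close> only over sets
    of finite measure; the functions of \<open>K\<close> vanish outside \<open>\<Omega>\<close>, so
    this is enough.\<close>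
  have iM: "integrable lebesgue (\<lambda>x. indicator \<Omega> x * M x)"
  proof (rule Bochner_Integration.integrable_bound)
    show "integrable lebesgue (\<lambda>x. (1 * indicator \<Omega> x + G (lo x) / G 1) + (1 * indicator \<Omega> x + G (up x) / G 1))"
      using W_integrable[OF lo] W_integrable[OF up] \<Omega>_sets \<Omega>_fin
      by (intro Bochner_Integration.integrable_add integrable_divide integrable_mult_right integrable_real_indicator) auto
    show "(\<lambda>x. indicator \<Omega> x * M x) \<in> borel_measurable lebesgue"
      unfolding M_def by (intro borel_measurable_times borel_measurable_add borel_measurable_abs W_measurable lo up borel_measurable_indicator \<Omega>_sets)
    show "AE x in lebesgue. norm (indicator \<Omega> x * M x) \<le>
       norm ((1 * indicator \<Omega> x + G (lo x) / G 1) + (1 * indicator \<Omega> x + G (up x) / G 1))"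
    proof (rule AE_I2)
      fix x
      show "norm (indicator \<Omega> x * M x) \<le> norm ((1 * indicator \<Omega> x + G (lo x) / G 1) + (1 * indicator \<Omega> x + G (up x) / G 1))"
      proof (cases "x \<in> \<Omega>")
        case True
        have "M x \<le> (1 + G (lo x) / G 1) + (1 + G (up x) / G 1)"
          unfolding M_def by (rule add_mono[OF linear_le linear_le])
        moreover have "0 \<le> M x" by (simp add: M_def)
        ultimately show ?thesis using True by simp
      qed simp
    qed
  qed
  have wz: "AE x in lebesgue. x \<notin> \<Omega> \<longrightarrow> w n x = 0" for n using w(1)[of n] by (simp add: K_def W0_def)
  obtain r u where r: "strict_mono (r :: nat \<Rightarrow> nat)" and u: "u \<in> borel_measurable lebesgue"
    and lim: "AE x in lebesgue. (\<lambda>n. w (r n) x) \<longlonglongrightarrow> u x"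
  proof -
    have 1: "AE x in lebesgue. \<bar>w n x\<bar> \<le> indicator \<Omega> x * M x" for n
      using KM[OF w(1)[of n]] wz[of n] by eventually_elim (auto split: split_indicator)
    have 2: "rho_s s G (w n) \<le> ennreal (m + 1 + c0)" for n
      unfolding rho_s_Phi[OF KW[OF w(1)[of n]]] by (rule ennreal_leI[OF PhiC])
    from compactness[where w = w, OF \<Omega>_sets \<Omega>_fin W_measurable[OF KW[OF w(1)]] wz iM 1 2]
    obtain r u where "strict_mono (r :: nat \<Rightarrow> nat) \<and> u \<in> borel_measurable lebesgue \<and>
        (AE x in lebesgue. (\<lambda>k. w (r k) x) \<longlonglongrightarrow> u x)"
      by (elim exE)
    then show ?thesis by (elim conjE) (rule that)
  qed
  have all: "AE x in lebesgue. \<forall>n. (lo x \<le> w n x \<and> w n x \<le> up x) \<and> (x \<notin> \<Omega> \<longrightarrow> w n x = 0)"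
    unfolding AE_all_countable
  proof
    fix n
    have "AE x in lebesgue. lo x \<le> w n x \<and> w n x \<le> up x" using w(1)[of n] by (simp add: K_def)
    then show "AE x in lebesgue. (lo x \<le> w n x \<and> w n x \<le> up x) \<and> (x \<notin> \<Omega> \<longrightarrow> w n x = 0)"
      using wz[of n] by eventually_elim auto
  qed
  have u_prop: "AE x in lebesgue. lo x \<le> u x \<and> u x \<le> up x \<and> (x \<notin> \<Omega> \<longrightarrow> u x = 0)"
    using all lim
  proof eventually_elim
    case (elim x)
    have "lo x \<le> u x" by (rule LIMSEQ_le_const[OF elim(2)]) (use elim(1) in auto)
    moreover have "u x \<le> up x" by (rule LIMSEQ_le_const2[OF elim(2)]) (use elim(1) in auto)
    moreover have "u x = 0" if "x \<notin> \<Omega>"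
    proof -
      have "(\<lambda>n. w (r n) x) = (\<lambda>n. 0)" using elim(1) that by auto
      then show ?thesis using elim(2) LIMSEQ_unique[OF _ tendsto_const] by metis
    qed
    ultimately show ?case by simp
  qed
  have Plim: "(\<lambda>n. \<integral>x. primitive (k x) (w (r n) x) \<partial>lebesgue) \<longlonglongrightarrow> (\<integral>x. primitive (k x) (u x) \<partial>lebesgue)"
  proof (rule integral_dominated_convergence[OF P_meas[OF u] P_meas[OF W_measurable[OF KW[OF w(1)]]] hM])
    show "AE x in lebesgue. (\<lambda>n. primitive (k x) (w (r n) x)) \<longlonglongrightarrow> primitive (k x) (u x)"
      using lim
    proof eventually_elim
      case (elim x)
      show ?case by (rule isCont_tendsto_compose[OF DERIV_isCont[OF primitive_derivative[OF k_cont]] elim])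
    qed
    show "AE x in lebesgue. norm (primitive (k x) (w (r n) x)) \<le> h x * M x" for n by (rule PM[OF w(1)])
  qed
  \<comment> \<open>Upper bounds for the modulars read off from \<open>J (w (r n))\<close>. They
    converge, so Fatou's lemma yields \<open>Phi u \<le> lim0\<close>, which is
    \<open>J u \<le> m\<close>.\<close>
  define a where "a n = m + 1 / real (Suc (r n)) + (\<integral>x. primitive (k x) (w (r n) x) \<partial>lebesgue)" for n
  define lim0 where "lim0 = m + (\<integral>x. primitive (k x) (u x) \<partial>lebesgue)"
  have alim: "a \<longlonglongrightarrow> lim0"
  proof -
    have "(\<lambda>n. 1 / real (Suc n)) \<longlonglongrightarrow> 0" by (rule LIMSEQ_Suc[OF lim_const_over_n])
    from LIMSEQ_subseq_LIMSEQ[OF this r] have "(\<lambda>n. 1 / real (Suc (r n))) \<longlonglongrightarrow> 0" by (simp add: comp_def)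
    then have "a \<longlonglongrightarrow> m + 0 + (\<integral>x. primitive (k x) (u x) \<partial>lebesgue)"
      unfolding a_def[abs_def] by (intro tendsto_add tendsto_const Plim)
    then show ?thesis by (simp add: lim0_def)
  qed
  have Phia: "Phi (w (r n)) \<le> a n" for n
    using w(2)[of "r n"] unfolding J_def a_def by linarith
  have lim00: "0 \<le> lim0"
    by (rule LIMSEQ_le_const[OF alim]) (use Phia Phi_nonneg in \<open>auto intro: order.trans\<close>)
  have dlim: "AE p in mu. (\<lambda>n. dq s (w (r n)) p) \<longlonglongrightarrow> dq s u p" by (rule AE_dq_tendsto[OF lim])
  have fatou: "(\<integral>\<^sup>+ p. ennreal (G (dq s u p)) \<partial>mu) \<le> ennreal lim0"
  proof -
    have "(\<integral>\<^sup>+ p. ennreal (G (dq s u p)) \<partial>mu) = (\<integral>\<^sup>+ p. liminf (\<lambda>n. ennreal (G (dq s (w (r n)) p))) \<partial>mu)"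
    proof (rule nn_integral_cong_AE)
      show "AE p in mu. ennreal (G (dq s u p)) = liminf (\<lambda>n. ennreal (G (dq s (w (r n)) p)))"
        using dlim
      proof eventually_elim
        case (elim p)
        have "(\<lambda>n. ennreal (G (dq s (w (r n)) p))) \<longlonglongrightarrow> ennreal (G (dq s u p))"
          by (intro tendsto_ennrealI A_tendsto elim)
        then show ?case by (intro lim_imp_Liminf[symmetric]) auto
      qed
    qed
    also have "\<dots> \<le> liminf (\<lambda>n. \<integral>\<^sup>+ p. ennreal (G (dq s (w (r n)) p)) \<partial>mu)"
    proof (rule nn_integral_liminf)
      show "(\<lambda>p. ennreal (G (dq s (w (r n)) p))) \<in> borel_measurable mu" for n
        using measurable_compose[OF dq_measurable[OF W_measurable[OF KW[OF w(1)]]] A_measurable] by simp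
    qed
    also have "\<dots> \<le> liminf (\<lambda>n. ennreal (a n))"
    proof (rule Liminf_mono, rule always_eventually, rule allI)
      fix n
      show "(\<integral>\<^sup>+ p. ennreal (G (dq s (w (r n)) p)) \<partial>mu) \<le> ennreal (a n)"
        using rho_s_Phi[OF KW[OF w(1)[of "r n"]]] ennreal_leI[OF Phia[of n]] by (simp add: rho_s_eq)
    qed
    also have "\<dots> = ennreal lim0" by (intro lim_imp_Liminf tendsto_ennrealI alim) auto
    finally show ?thesis .
  qed
  have int_mu: "integrable mu (\<lambda>p. G (dq s u p))"
  proof (rule integrableI_nonneg)
    show "(\<lambda>p. G (dq s u p)) \<in> borel_measurable mu" by (rule measurable_compose[OF dq_measurable[OF u] A_measurable])
    show "(\<integral>\<^sup>+ p. ennreal (G (dq s u p)) \<partial>mu) < \<infinity>" using fatou by (rule order.strict_trans1) simp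
  qed simp
  have uW: "u \<in> W s G"
  proof (rule W_I[OF u _ _ int_mu])
    show "integrable lebesgue (\<lambda>x. G (lo x) + G (up x))" using W_integrable[OF lo] W_integrable[OF up] by simp
    show "AE x in lebesgue. G (u x) \<le> G (lo x) + G (up x)"
      using u_prop
    proof eventually_elim
      case (elim x)
      then have "\<bar>u x\<bar> \<le> \<bar>lo x\<bar> \<or> \<bar>u x\<bar> \<le> \<bar>up x\<bar>" by linarith
      then show ?case using A_mono[of "u x" "lo x"] A_mono[of "u x" "up x"] A_nonneg[of "lo x"] A_nonneg[of "up x"] by linarith
    qed
  qed simp
  have uK: "u \<in> K"
    using uW u_prop by (auto simp: K_def W0_def elim: eventually_mono)
  have "Phi u \<le> lim0" using fatou rho_s_Phi[OF uW] lim00 by (simp add: rho_s_eq)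
  then have "J u \<le> m" unfolding J_def lim0_def by linarith
  then show ?thesis using uK m_le by (intro bexI[of _ u]) (auto intro: order.trans)
qed

text \<open>For \<open>\<tau> = 1\<close> this is used with \<open>U = up\<close>, \<open>m = min z up\<close>, and for \<open>\<tau> = - 1\<close> with \<open>U = lo\<close>, \<open>m = max z lo\<close>.
  The point is that \<open>\<tau> (g (dq s m p) - g (dq s U p))\<close> has the sign of \<open>dq s w p\<close>.\<close>

lemma J_compare:
  assumes \<tau>: "\<tau> = 1 \<or> \<tau> = - 1" and W: "z \<in> W s G" "m \<in> W s G" "w \<in> W s G" "U \<in> W s G"
    and z: "\<And>x. z x = m x + \<tau> * w x" and w: "\<And>x. 0 \<le> w x" "\<And>x. 0 < w x \<Longrightarrow> m x = U x" "\<And>x. 0 \<le> \<tau> * (U x - m x)"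
    and P: "AE x in lebesgue. primitive (k x) (z x) - primitive (k x) (m x) = \<tau> * (k x (U x) * w x)"
    and ineq: "0 \<le> \<tau> * (frac_g_laplacian s g U w - (\<integral>x. k x (U x) * w x \<partial>lebesgue))"
  shows "J m \<le> J z"
proof -
  have pw: "\<tau> * (g (dq s U p) * dq s w p) \<le> G (dq s z p) - G (dq s m p)" for p
  proof -
    obtain x y where p: "p = (x, y)" by (cases p)
    define N where "N = norm (x - y) powr s"
    have N: "N \<ge> 0" by (simp add: N_def)
    have zd: "dq s z p = dq s m p + \<tau> * dq s w p"
      unfolding p dq_Pair z N_def[symmetric] by (simp add: add_divide_distrib[symmetric] algebra_simps)
    \<comment> \<open>At the point of the pair where \<open>w\<close> is larger, \<open>w\<close> is
      positive and hence \<open>m = U\<close>; at the other point \<open>\<tau> * (U - m)\<close> is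
      nonnegative. So \<open>\<tau>\<close> times the difference of the quotients of
      \<open>m\<close> and \<open>U\<close> has the sign of the quotient of \<open>w\<close>, and
      \<open>g\<close> is monotone.\<close>
    have sgn: "0 \<le> \<tau> * (g (dq s m p) - g (dq s U p)) * dq s w p"
    proof -
      have diff: "\<tau> * (dq s m p - dq s U p) = (\<tau> * (U y - m y) - \<tau> * (U x - m x)) / N"
        unfolding p dq_Pair N_def[symmetric] by (simp add: diff_divide_distrib[symmetric] algebra_simps)
      consider "w x = w y" | "w y < w x" | "w x < w y" by linarith
      then show ?thesis
      proof cases
        case 1 then show ?thesis by (simp add: p dq_Pair)
      next
        case 2
        then have "m x = U x" using w(1)[of y] by (intro w(2)) linarith
        then have "0 \<le> \<tau> * (dq s m p - dq s U p)" unfolding diff using w(3)[of y] N by simp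
        then have "0 \<le> \<tau> * (g (dq s m p) - g (dq s U p))"
          using \<tau> a_mono[of "dq s U p" "dq s m p"] a_mono[of "dq s m p" "dq s U p"] by auto
        moreover have "0 \<le> dq s w p" using 2 N by (simp add: p dq_Pair N_def)
        ultimately show ?thesis by (rule mult_nonneg_nonneg)
      next
        case 3
        then have "m y = U y" using w(1)[of x] by (intro w(2)) linarith
        then have "\<tau> * (dq s m p - dq s U p) \<le> 0" unfolding diff using w(3)[of x] N by (simp add: divide_nonpos_nonneg)
        then have "\<tau> * (g (dq s m p) - g (dq s U p)) \<le> 0"
          using \<tau> a_mono[of "dq s U p" "dq s m p"] a_mono[of "dq s m p" "dq s U p"] by auto
        moreover have "dq s w p \<le> 0" using 3 N by (simp add: p dq_Pair N_def divide_nonpos_nonneg)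
        ultimately show ?thesis by (rule mult_nonpos_nonpos)
      qed
    qed
    have "g (dq s m p) * (\<tau> * dq s w p) \<le> G (dq s z p) - G (dq s m p)"
      using tangent[of "dq s m p" "dq s z p"] by (simp add: zd)
    then show ?thesis using sgn by (simp add: algebra_simps)
  qed
  have "\<tau> * frac_g_laplacian s g U w = (\<integral>p. \<tau> * (g (dq s U p) * dq s w p) \<partial>mu)" by (simp add: flap_eq)
  also have "\<dots> \<le> (\<integral>p. G (dq s z p) - G (dq s m p) \<partial>mu)"
    using W pairing_integrable[OF W(4,3)] pw by (intro integral_mono) (auto simp: W_iff)
  also have "\<dots> = Phi z - Phi m" unfolding Phi_def using W by (intro Bochner_Integration.integral_diff) (auto simp: W_iff)
  finally have 1: "\<tau> * frac_g_laplacian s g U w \<le> Phi z - Phi m" .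
  have "(\<integral>x. primitive (k x) (z x) \<partial>lebesgue) - (\<integral>x. primitive (k x) (m x) \<partial>lebesgue) =
      (\<integral>x. primitive (k x) (z x) - primitive (k x) (m x) \<partial>lebesgue)"
    using P_int W(1,2) by simp
  also have "\<dots> = (\<integral>x. \<tau> * (k x (U x) * w x) \<partial>lebesgue)"
    by (rule integral_cong_AE[OF _ _ P])
       (intro borel_measurable_diff P_meas W_measurable W borel_measurable_times borel_measurable_const k_comp)+
  also have "\<dots> = \<tau> * (\<integral>x. k x (U x) * w x \<partial>lebesgue)" by simp
  finally show ?thesis using 1 ineq unfolding J_def by (simp add: right_diff_distrib)
qed

text \<open>\<open>J_compare\<close> is used twice, first at \<open>up\<close> and then at
  \<open>lo\<close>. Its hypothesis on the primitive holds with equality because \<open>k\<close> is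
  constant beyond the barriers and the primitive is therefore affine there.\<close>

lemma J_clip:
  assumes z: "z \<in> W s G" and le: "AE x in lebesgue. x \<in> \<Omega> \<longrightarrow> lo x \<le> up x" and k0: "\<And>x t. x \<notin> \<Omega> \<Longrightarrow> k x t = 0"
    and sup: "\<And>w. w \<in> W s G \<Longrightarrow> (\<And>x. w x = max (z x - up x) 0) \<Longrightarrow>
      0 \<le> frac_g_laplacian s g up w - (\<integral>x. k x (up x) * w x \<partial>lebesgue)"
    and sub: "\<And>w. w \<in> W s G \<Longrightarrow> (\<And>x. w x = max (lo x - min (z x) (up x)) 0) \<Longrightarrow>
      frac_g_laplacian s g lo w - (\<integral>x. k x (lo x) * w x \<partial>lebesgue) \<le> 0"
  shows "J (\<lambda>x. max (min (z x) (up x)) (lo x)) \<le> J z"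
proof -
  define m where "m x = min (z x) (up x)" for x
  define w where "w x = max (z x - up x) 0" for x
  have mW: "m \<in> W s G" unfolding m_def by (rule W_min[OF z up])
  have wW: "w \<in> W s G" unfolding w_def by (rule W_max[OF W_diff[OF z up] W_zero])
  have "J m \<le> J z"
  proof (rule J_compare[OF disjI1[OF refl] z mW wW up])
    show "AE x in lebesgue. primitive (k x) (z x) - primitive (k x) (m x) = 1 * (k x (up x) * w x)"
    proof (rule AE_I2)
      fix x
      show "primitive (k x) (z x) - primitive (k x) (m x) = 1 * (k x (up x) * w x)"
      proof (cases "up x < z x")
        case True
        obtain c where "up x < c" "primitive (k x) (z x) - primitive (k x) (up x) = (z x - up x) * k x c"
          using primitive_MVT[OF k_cont True] by blast
        then show ?thesis using True k_up[of x c] by (simp add: m_def w_def)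
      qed (simp add: m_def w_def)
    qed
    show "0 \<le> 1 * (frac_g_laplacian s g up w - (\<integral>x. k x (up x) * w x \<partial>lebesgue))"
      using sup[OF wW w_def] by simp
  qed (auto simp: m_def w_def)
  define M where "M x = max (m x) (lo x)" for x
  define w' where "w' x = max (lo x - m x) 0" for x
  have MW: "M \<in> W s G" unfolding M_def by (rule W_max[OF mW lo])
  have w'W: "w' \<in> W s G" unfolding w'_def by (rule W_max[OF W_diff[OF lo mW] W_zero])
  have "J M \<le> J m"
  proof (rule J_compare[OF disjI2[OF refl] mW MW w'W lo])
    show "AE x in lebesgue. primitive (k x) (m x) - primitive (k x) (M x) = - 1 * (k x (lo x) * w' x)"
      using le
    proof eventually_elim
      case (elim x)
      show ?case
      proof (cases "m x < lo x")
        case True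
        obtain c where c: "m x < c" "c < lo x" "primitive (k x) (lo x) - primitive (k x) (m x) = (lo x - m x) * k x c"
          using primitive_MVT[OF k_cont True] by blast
        have "k x c = k x (lo x)"
          using elim k_lo[of x c] c k0[of x] by (cases "x \<in> \<Omega>") auto
        then show ?thesis using c True by (simp add: M_def w'_def algebra_simps)
      qed (simp add: M_def w'_def)
    qed
    show "0 \<le> - 1 * (frac_g_laplacian s g lo w' - (\<integral>x. k x (lo x) * w' x \<partial>lebesgue))"
      using sub[OF w'W] by (simp add: w'_def m_def)
  qed (auto simp: M_def w'_def)
  then have "J M \<le> J z" using \<open>J m \<le> J z\<close> by linarith
  then show ?thesis by (simp add: M_def[abs_def] m_def)
qed

text \<open>The tangent inequality at \<open>u + e * v\<close> bounds the difference quotient of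
  \<open>Phi\<close> by the pairing at the perturbed function, so only limits of integrals are taken
  and \<open>Phi\<close> itself is not differentiated.\<close>

lemma euler_lagrange_ineq:
  assumes u: "u \<in> W s G" and v: "v \<in> W s G" and min: "\<And>e. 0 < e \<Longrightarrow> J u \<le> J (\<lambda>x. u x + e * v x)"
  shows "0 \<le> frac_g_laplacian s g u v - (\<integral>x. k x (u x) * v x \<partial>lebesgue)"
proof -
  define e where "e j = 1 / real (Suc j)" for j
  have e: "0 < e j" "e j \<le> 1" for j by (auto simp: e_def)
  have elim0: "e \<longlonglongrightarrow> 0" unfolding e_def[abs_def] by (rule LIMSEQ_Suc[OF lim_const_over_n])
  define uj where "uj j x = u x + e j * v x" for j x
  have ujW: "uj j \<in> W s G" for j unfolding uj_def by (rule W_add[OF u W_cmult[OF v]])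
  have dquj: "dq s (uj j) p = dq s u p + e j * dq s v p" for j p
    unfolding uj_def dq_add dq_cmult ..
  define Q where "Q j x = (primitive (k x) (uj j x) - primitive (k x) (u x)) / e j" for j x
  have Qint: "integrable lebesgue (Q j)" for j
    unfolding Q_def by (intro integrable_divide Bochner_Integration.integrable_diff P_int ujW u)
  have step: "0 \<le> frac_g_laplacian s g (uj j) v - (\<integral>x. Q j x \<partial>lebesgue)" for j
  proof -
    have "Phi (uj j) - Phi u = (\<integral>p. G (dq s (uj j) p) - G (dq s u p) \<partial>mu)"
      unfolding Phi_def using u ujW[of j] by (intro Bochner_Integration.integral_diff[symmetric]) (auto simp: W_iff)
    also have "\<dots> \<le> (\<integral>p. e j * (g (dq s (uj j) p) * dq s v p) \<partial>mu)"
    proof (rule integral_mono)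
      show "G (dq s (uj j) p) - G (dq s u p) \<le> e j * (g (dq s (uj j) p) * dq s v p)" for p
        using tangent[of "dq s (uj j) p" "dq s u p"] by (simp add: dquj algebra_simps)
    qed (use u ujW[of j] pairing_integrable[OF ujW v] in \<open>auto simp: W_iff\<close>)
    also have "\<dots> = e j * frac_g_laplacian s g (uj j) v" by (simp add: flap_eq)
    finally have 1: "Phi (uj j) - Phi u \<le> e j * frac_g_laplacian s g (uj j) v" .
    have "(\<integral>x. Q j x \<partial>lebesgue) = ((\<integral>x. primitive (k x) (uj j x) \<partial>lebesgue) - (\<integral>x. primitive (k x) (u x) \<partial>lebesgue)) / e j"
      unfolding Q_def using P_int[OF ujW] P_int[OF u] by simp
    then have 2: "e j * (\<integral>x. Q j x \<partial>lebesgue) = (\<integral>x. primitive (k x) (uj j x) \<partial>lebesgue) - (\<integral>x. primitive (k x) (u x) \<partial>lebesgue)"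
      using e(1)[of j] by simp
    have "J u \<le> J (uj j)" using min[OF e(1)[of j]] by (simp add: uj_def[abs_def])
    then have "0 \<le> e j * (frac_g_laplacian s g (uj j) v - (\<integral>x. Q j x \<partial>lebesgue))"
      using 1 2 unfolding J_def by (simp add: right_diff_distrib)
    then show ?thesis using e(1)[of j] by (simp add: zero_le_mult_iff)
  qed
  have lim1: "(\<lambda>j. frac_g_laplacian s g (uj j) v) \<longlonglongrightarrow> frac_g_laplacian s g u v"
    unfolding flap_eq
  proof (rule integral_dominated_convergence[where w = "\<lambda>p. pp * (D2 * G (dq s u p) + D2 * G (dq s v p)) + pp * G (dq s v p)"])
    show "AE p in mu. (\<lambda>j. g (dq s (uj j) p) * dq s v p) \<longlonglongrightarrow> g (dq s u p) * dq s v p"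
    proof (rule AE_I2)
      fix p :: "'a \<times> 'a"
      have "(\<lambda>j. dq s u p + e j * dq s v p) \<longlonglongrightarrow> dq s u p + 0 * dq s v p"
        by (intro tendsto_add tendsto_mult tendsto_const elim0)
      then have "(\<lambda>j. dq s (uj j) p) \<longlonglongrightarrow> dq s u p" by (simp add: dquj)
      from isCont_tendsto_compose[OF g_isCont this]
      show "(\<lambda>j. g (dq s (uj j) p) * dq s v p) \<longlonglongrightarrow> g (dq s u p) * dq s v p" by (intro tendsto_mult tendsto_const)
    qed
    show "AE p in mu. norm (g (dq s (uj j) p) * dq s v p) \<le> pp * (D2 * G (dq s u p) + D2 * G (dq s v p)) + pp * G (dq s v p)" for j
    proof (rule AE_I2)
      fix p :: "'a \<times> 'a"
      define t where "t = \<bar>dq s u p\<bar> + \<bar>dq s v p\<bar>"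
      have "\<bar>dq s (uj j) p\<bar> \<le> t"
      proof -
        have "\<bar>e j * dq s v p\<bar> \<le> 1 * \<bar>dq s v p\<bar>" unfolding abs_mult using e[of j] by (intro mult_right_mono) auto
        then show ?thesis unfolding dquj t_def by linarith
      qed
      then have "g \<bar>dq s (uj j) p\<bar> * \<bar>dq s v p\<bar> \<le> g \<bar>t\<bar> * \<bar>dq s v p\<bar>" by (intro mult_right_mono a_mono) auto
      also have "\<dots> \<le> pp * G t + pp * G (dq s v p)" by (rule abs_growth)
      also have "\<dots> \<le> pp * (D2 * G (dq s u p) + D2 * G (dq s v p)) + pp * G (dq s v p)"
        using A_add[of "\<bar>dq s u p\<bar>" "\<bar>dq s v p\<bar>"] pp_ge1 unfolding t_def by (intro add_right_mono mult_left_mono) auto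
      finally show "norm (g (dq s (uj j) p) * dq s v p) \<le> pp * (D2 * G (dq s u p) + D2 * G (dq s v p)) + pp * G (dq s v p)"
        by (simp add: abs_mult a_abs)
    qed
    show "integrable mu (\<lambda>p. pp * (D2 * G (dq s u p) + D2 * G (dq s v p)) + pp * G (dq s v p))"
      using W_integrable_mu[OF u] W_integrable_mu[OF v] by auto
    show "(\<lambda>p. g (dq s u p) * dq s v p) \<in> borel_measurable mu"
      by (rule borel_measurable_integrable[OF pairing_integrable[OF u v]])
    show "(\<lambda>p. g (dq s (uj j) p) * dq s v p) \<in> borel_measurable mu" for j
      by (rule borel_measurable_integrable[OF pairing_integrable[OF ujW v]])
  qed
  have at0: "filterlim e (at 0) sequentially"
    using elim0 e(1) by (intro filterlim_atI) (auto intro!: always_eventually simp: less_imp_neq[symmetric])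
  have lim2: "(\<lambda>j. \<integral>x. Q j x \<partial>lebesgue) \<longlonglongrightarrow> (\<integral>x. k x (u x) * v x \<partial>lebesgue)"
  proof (rule integral_dominated_convergence[where w = "\<lambda>x. h x * \<bar>v x\<bar>"])
    show "AE x in lebesgue. (\<lambda>j. Q j x) \<longlonglongrightarrow> k x (u x) * v x"
    proof (rule AE_I2)
      fix x :: 'a
      have d: "((\<lambda>t. u x + t * v x) has_real_derivative v x) (at 0)" by (auto intro!: derivative_eq_intros)
      have "(primitive (k x) has_real_derivative k x (u x)) (at (u x + 0 * v x))"
        using primitive_derivative[OF k_cont[of x], of "u x"] by simp
      from DERIV_chain2[OF this d]
      have "((\<lambda>t. primitive (k x) (u x + t * v x)) has_real_derivative k x (u x) * v x) (at 0)" .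
      then have "((\<lambda>t. (primitive (k x) (u x + t * v x) - primitive (k x) (u x)) / t) \<longlongrightarrow> k x (u x) * v x) (at 0)"
        by (simp add: DERIV_def)
      from filterlim_compose[OF this at0] show "(\<lambda>j. Q j x) \<longlonglongrightarrow> k x (u x) * v x"
        by (simp add: Q_def uj_def)
    qed
    show "AE x in lebesgue. norm (Q j x) \<le> h x * \<bar>v x\<bar>" for j
    proof (rule AE_I2)
      fix x :: 'a
      have "\<bar>primitive (k x) (uj j x) - primitive (k x) (u x)\<bar> \<le> h x * \<bar>v x\<bar> * e j"
        using P_lip[of x "uj j x" "u x"] e(1)[of j] by (simp add: uj_def abs_mult mult_ac)
      then show "norm (Q j x) \<le> h x * \<bar>v x\<bar>"
        using e(1)[of j] by (simp add: Q_def abs_divide pos_divide_le_eq)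
    qed
    show "(\<lambda>x. k x (u x) * v x) \<in> borel_measurable lebesgue"
      by (rule borel_measurable_integrable[OF kv_int[OF W_measurable[OF u] v]])
    show "Q j \<in> borel_measurable lebesgue" for j by (rule borel_measurable_integrable[OF Qint])
    show "integrable lebesgue (\<lambda>x. h x * \<bar>v x\<bar>)" by (rule h_int[OF v])
  qed
  show ?thesis by (rule LIMSEQ_le_const[OF tendsto_diff[OF lim1 lim2]]) (use step in auto)
qed

end

section \<open>Reduction to the truncated problem\<close>

theorem lemma19:
  fixes \<Omega> :: "'a::euclidean_space set"
    and s :: real
    and G g :: "real \<Rightarrow> real"
    and f :: "'a \<Rightarrow> real \<Rightarrow> real"
    and u_lo u_up :: "'a \<Rightarrow> real"
  assumes "0 < s" and "s < 1"
    and "smooth_bounded_domain \<Omega>"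
    and "standing_assumptions (real DIM('a)) s G g"
    and "H0 s G \<Omega> f"
    and "sub_super_pair s G g \<Omega> f u_lo u_up"
  shows "\<exists>u. u \<in> solution_set s G g \<Omega> f u_lo u_up"
proof -
  have n1: "1 \<le> real DIM('a)" using DIM_positive[where 'a = 'a] by linarith
  obtain pp where os: "orlicz_sobolev G g pp s (real DIM('a))"
    using standing_orlicz_sobolev[OF assms(1,2) n1 assms(4)] by blast
  interpret orlicz_sobolev G g pp s "real DIM('a)" by (rule os)
  note dom = assms(3)
  have op: "open \<Omega>" "bounded \<Omega>" using dom by (auto simp: smooth_bounded_domain_def)
  have \<Omega>s: "\<Omega> \<in> sets lebesgue" and \<Omega>f: "emeasure lebesgue \<Omega> < \<infinity>"
    using op emeasure_bounded_finite[OF op(2)] by auto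
  have lo: "u_lo \<in> W s G" and lo_sub: "\<And>v. v \<in> E_plus s G \<Omega> \<Longrightarrow> frac_g_laplacian s g u_lo v \<le> rhs \<Omega> f u_lo v"
    and lo_out: "AE x in lebesgue. x \<notin> \<Omega> \<longrightarrow> u_lo x \<le> 0"
    and up: "u_up \<in> W s G" and up_super: "\<And>v. v \<in> E_plus s G \<Omega> \<Longrightarrow> rhs \<Omega> f u_up v \<le> frac_g_laplacian s g u_up v"
    and up_out: "AE x in lebesgue. x \<notin> \<Omega> \<longrightarrow> 0 \<le> u_up x"
    and le: "AE x in lebesgue. x \<in> \<Omega> \<longrightarrow> u_lo x \<le> u_up x"
    using assms(6) unfolding sub_super_pair_def subsolution_def supersolution_def by auto
  obtain c0 B b where car: "caratheodory \<Omega> f" and c0: "c0 > 0" and NB: "N_function B b" and gB: "growth_condition B b"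
    and small: "ess_smaller B (sobolev_conjugate (real DIM('a)) s G)"
    and fb: "AE x in lebesgue. x \<in> \<Omega> \<longrightarrow> (\<forall>t. \<bar>f x t\<bar> \<le> c0 * (1 + \<bar>b t\<bar>))"
    using assms(5) unfolding H0_def by blast
  interpret B0: nfun B b by unfold_locales (rule NB)
  obtain ppB where ppB: "\<And>t. t > 0 \<Longrightarrow> t * b t / B t \<le> ppB" using gB unfolding growth_condition_def by blast
  have ppB': "t * b t \<le> ppB * B t" if "t > 0" for t
    using ppB[OF that] B0.A_pos[of t] that by (simp add: pos_divide_le_eq)
  interpret B: nfun_growth B b ppB by unfold_locales (rule ppB')
  have emb: "integrable lebesgue (\<lambda>x. indicator \<Omega> x * B (u x))" if u: "u \<in> W s G" for u :: "'a \<Rightarrow> real"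
  proof (rule integrableI_nonneg)
    show "(\<lambda>x. indicator \<Omega> x * B (u x)) \<in> borel_measurable lebesgue"
      by (intro borel_measurable_times borel_measurable_indicator \<Omega>s measurable_compose[OF W_measurable[OF u] B0.A_measurable])
    have "(\<integral>\<^sup>+ x. ennreal (indicator \<Omega> x * B (u x)) \<partial>lebesgue) = (\<integral>\<^sup>+ x. ennreal (B (u x)) * indicator \<Omega> x \<partial>lebesgue)"
      by (intro nn_integral_cong) (auto split: split_indicator)
    then show "(\<integral>\<^sup>+ x. ennreal (indicator \<Omega> x * B (u x)) \<partial>lebesgue) < \<infinity>"
      using sobolev_embedding[OF refl u NB small \<Omega>s \<Omega>f] by simp
  qed simp
  \<comment> \<open>The locale asks for continuity and the growth bound at every point, whereas they
    hold almost everywhere. The exceptional points go into a null set \<open>N\<close>, and the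
    nonlinearity is set to 0 off \<open>\<Omega> - N\<close>.\<close>
  define good where "good x \<longleftrightarrow> (x \<in> \<Omega> \<longrightarrow> continuous_on UNIV (f x) \<and> (\<forall>t. \<bar>f x t\<bar> \<le> c0 * (1 + \<bar>b t\<bar>)))" for x
  have ae: "AE x in lebesgue. good x"
  proof -
    have "AE x in lebesgue. x \<in> \<Omega> \<longrightarrow> continuous_on UNIV (f x)" using car by (simp add: caratheodory_def)
    then show ?thesis using fb by eventually_elim (auto simp: good_def)
  qed
  have "\<exists>N\<in>null_sets lebesgue. \<forall>x. x \<notin> N \<longrightarrow> good x"
  proof (rule AE_E3[OF ae])
    fix N assume N: "\<And>x. x \<in> space lebesgue - N \<Longrightarrow> good x" "N \<in> null_sets lebesgue"
    show ?thesis by (rule bexI[OF _ N(2)]) (use N(1) in auto)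
  qed
  then obtain N where Nn: "N \<in> null_sets lebesgue" and N: "\<forall>x. x \<notin> N \<longrightarrow> good x" by (elim bexE)
  define \<Omega>0 where "\<Omega>0 = \<Omega> - N"
  have \<Omega>0s: "\<Omega>0 \<in> sets lebesgue" unfolding \<Omega>0_def using Nn by (intro sets.Diff \<Omega>s) auto
  have fc: "continuous_on UNIV (f x)" and fle: "\<bar>f x t\<bar> \<le> c0 * (1 + \<bar>b t\<bar>)" if "x \<in> \<Omega>0" for x t
    using N[THEN spec, of x] that by (auto simp: \<Omega>0_def good_def)
  have AE0: "AE x in lebesgue. x \<in> \<Omega> \<longrightarrow> x \<in> \<Omega>0"
    using AE_not_in[OF Nn] by eventually_elim (auto simp: \<Omega>0_def)
  define cl where "cl x t = min (max t (u_lo x)) (u_up x)" for x t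
  define f1 where "f1 x t = (if x \<in> \<Omega>0 then f x t else 0)" for x t
  define k where "k x t = f1 x (cl x t)" for x t
  define M where "M x = max \<bar>u_lo x\<bar> \<bar>u_up x\<bar>" for x
  \<comment> \<open>Clipped values are bounded by \<open>M x\<close> in absolute value and
    \<open>b\<close> is monotone, so this bounds the truncated nonlinearity for all
    \<open>t\<close>.\<close>
  define h where "h x = indicator \<Omega> x * (c0 * (1 + b (M x)))" for x
  have f1m: "(\<lambda>x. f1 x t) \<in> borel_measurable lebesgue" for t
  proof -
    have "(\<lambda>x. f x t) \<in> borel_measurable (lebesgue_on \<Omega>)" using car by (simp add: caratheodory_def)
    then have "(\<lambda>x. indicator \<Omega> x *\<^sub>R f x t) \<in> borel_measurable lebesgue"
      by (subst (asm) borel_measurable_restrict_space_iff) (use \<Omega>s in auto)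
    then have "(\<lambda>x. indicator \<Omega>0 x * (indicator \<Omega> x *\<^sub>R f x t)) \<in> borel_measurable lebesgue"
      by (intro borel_measurable_times borel_measurable_indicator \<Omega>0s)
    moreover have "(\<lambda>x. indicator \<Omega>0 x * (indicator \<Omega> x *\<^sub>R f x t)) = (\<lambda>x. f1 x t)"
      by (rule ext) (auto simp: f1_def \<Omega>0_def split: split_indicator)
    ultimately show ?thesis by simp
  qed
  have f1c: "continuous_on UNIV (f1 x)" for x
    using fc[of x] unfolding f1_def[abs_def] by (cases "x \<in> \<Omega>0") auto
  have clm: "(\<lambda>x. cl x t) \<in> borel_measurable lebesgue" for t
    unfolding cl_def by (intro borel_measurable_min borel_measurable_max borel_measurable_const W_measurable lo up)
  have kM: "\<bar>k x t\<bar> \<le> h x" for x t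
  proof (cases "x \<in> \<Omega>0")
    case True
    have "\<bar>cl x t\<bar> \<le> M x" by (auto simp: cl_def M_def min_def max_def abs_if)
    then have "\<bar>b (cl x t)\<bar> \<le> b (M x)" unfolding B0.a_abs by (rule B0.a_mono)
    then have "c0 * (1 + \<bar>b (cl x t)\<bar>) \<le> c0 * (1 + b (M x))" using c0 by simp
    then show ?thesis using fle[OF True, of "cl x t"] True by (simp add: k_def f1_def h_def \<Omega>0_def)
  next
    case False
    have "0 \<le> b (M x)" by (rule B0.a_nonneg) (simp add: M_def)
    then show ?thesis using False c0 by (simp add: k_def f1_def h_def)
  qed
  have Mm: "M \<in> borel_measurable lebesgue"
    unfolding M_def by (intro borel_measurable_max borel_measurable_abs W_measurable lo up)
  have hm: "h \<in> borel_measurable lebesgue"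
    unfolding h_def by (intro borel_measurable_times borel_measurable_add borel_measurable_const borel_measurable_indicator \<Omega>s
        measurable_compose[OF Mm B0.a_measurable])
  \<comment> \<open>\<open>B.abs_growth\<close> reduces \<open>b (M x) * \<bar>v x\<bar>\<close> to
    values of \<open>B\<close>, which \<open>emb\<close> controls. The hypotheses on
    \<open>v\<close> are spelled out so that the constant 1, which is not in \<open>W\<close>, is
    covered as well; this gives \<open>h1\<close>.\<close>
  have h_gen: "integrable lebesgue (\<lambda>x. h x * \<bar>v x\<bar>)"
    if v: "v \<in> borel_measurable lebesgue" "integrable lebesgue (\<lambda>x. indicator \<Omega> x * \<bar>v x\<bar>)"
      "integrable lebesgue (\<lambda>x. indicator \<Omega> x * B (v x))" for v
  proof (rule Bochner_Integration.integrable_bound)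
    let ?R = "\<lambda>x. c0 * (indicator \<Omega> x * \<bar>v x\<bar> + (ppB * (indicator \<Omega> x * B (u_lo x) + indicator \<Omega> x * B (u_up x)) + ppB * (indicator \<Omega> x * B (v x))))"
    show "integrable lebesgue ?R"
      by (intro integrable_mult_right Bochner_Integration.integrable_add v emb lo up)
    show "(\<lambda>x. h x * \<bar>v x\<bar>) \<in> borel_measurable lebesgue" by (intro borel_measurable_times hm borel_measurable_abs v)
    show "AE x in lebesgue. norm (h x * \<bar>v x\<bar>) \<le> norm (?R x)"
    proof (rule AE_I2)
      fix x
      show "norm (h x * \<bar>v x\<bar>) \<le> norm (?R x)"
      proof (cases "x \<in> \<Omega>")
        case True
        have "\<bar>M x\<bar> = M x" by (simp add: M_def)
        then have "b (M x) * \<bar>v x\<bar> \<le> ppB * B (M x) + ppB * B (v x)" using B.abs_growth[of "M x" "v x"] by simp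
        moreover have "ppB * B (M x) \<le> ppB * (B (u_lo x) + B (u_up x))"
        proof (rule mult_left_mono)
          show "B (M x) \<le> B (u_lo x) + B (u_up x)" by (auto simp: M_def max_def)
          show "0 \<le> ppB" using B.pp_ge1 by simp
        qed
        ultimately have "\<bar>v x\<bar> + b (M x) * \<bar>v x\<bar> \<le> \<bar>v x\<bar> + (ppB * (B (u_lo x) + B (u_up x)) + ppB * B (v x))" by linarith
        then have "c0 * (\<bar>v x\<bar> + b (M x) * \<bar>v x\<bar>) \<le> c0 * (\<bar>v x\<bar> + (ppB * (B (u_lo x) + B (u_up x)) + ppB * B (v x)))"
          using c0 by (intro mult_left_mono) auto
        then have "h x * \<bar>v x\<bar> \<le> ?R x" using True by (simp add: h_def algebra_simps)
        moreover have "0 \<le> h x * \<bar>v x\<bar>" using order.trans[OF abs_ge_zero kM[of x 0]] by simp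
        ultimately show ?thesis by (simp only: real_norm_def)
      qed (simp add: h_def)
    qed
  qed
  have ind: "integrable lebesgue (\<lambda>x. indicator \<Omega> x * (c::real))" for c
    using \<Omega>s \<Omega>f by (intro integrable_mult_left integrable_real_indicator)
  have h_int: "integrable lebesgue (\<lambda>x. h x * \<bar>v x\<bar>)" if v: "v \<in> W s G" for v
  proof (rule h_gen[OF W_measurable[OF v] _ emb[OF v]])
    show "integrable lebesgue (\<lambda>x. indicator \<Omega> x * \<bar>v x\<bar>)"
    proof (rule Bochner_Integration.integrable_bound)
      show "integrable lebesgue (\<lambda>x. indicator \<Omega> x * 1 + G (v x) / G 1)"
        by (intro Bochner_Integration.integrable_add ind integrable_divide W_integrable v)
      show "(\<lambda>x. indicator \<Omega> x * \<bar>v x\<bar>) \<in> borel_measurable lebesgue"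
        by (intro borel_measurable_times borel_measurable_indicator \<Omega>s borel_measurable_abs W_measurable v)
      show "AE x in lebesgue. norm (indicator \<Omega> x * \<bar>v x\<bar>) \<le> norm (indicator \<Omega> x * 1 + G (v x) / G 1)"
      proof (rule AE_I2)
        fix x
        show "norm (indicator \<Omega> x * \<bar>v x\<bar>) \<le> norm (indicator \<Omega> x * 1 + G (v x) / G 1)"
          using linear_le[of "v x"] by (cases "x \<in> \<Omega>") (simp_all add: order.trans[OF _ abs_ge_self])
      qed
    qed
  qed
  have h1: "integrable lebesgue h"
    using h_gen[of "\<lambda>x. 1"] ind[of 1] ind[of "B 1"] by simp
  interpret T: truncated_problem G g pp s \<Omega> u_lo u_up h k
  proof unfold_locales
    show "(\<lambda>x. k x t) \<in> borel_measurable lebesgue" for t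
      unfolding k_def by (rule caratheodory_compose[OF f1m f1c clm])
    show "continuous_on UNIV (k x)" for x
    proof -
      have "continuous_on UNIV (\<lambda>t. cl x t)" unfolding cl_def by (intro continuous_intros)
      from continuous_on_compose2[OF f1c this] show ?thesis by (simp add: k_def[abs_def])
    qed
    show "k x t = k x (u_up x)" if "u_up x \<le> t" for x t using that by (simp add: k_def cl_def)
    show "k x t = k x (u_lo x)" if "u_lo x \<le> u_up x" "t \<le> u_lo x" for x t using that by (simp add: k_def cl_def max_def)
  qed (rule \<Omega>s \<Omega>f lo up kM h_int; assumption?)+
  have k0: "k x t = 0" if "x \<notin> \<Omega>" for x t using that by (simp add: k_def f1_def \<Omega>0_def)
  \<comment> \<open>Between the barriers clipping is the identity, and outside
    \<open>\<Omega>\<close> both integrands vanish.\<close>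
  have rhs_eq: "rhs \<Omega> f u v = (\<integral>x. k x (u x) * v x \<partial>lebesgue)"
    if u: "u \<in> borel_measurable lebesgue" "AE x in lebesgue. x \<in> \<Omega> \<longrightarrow> u_lo x \<le> u x \<and> u x \<le> u_up x"
      and v: "v \<in> borel_measurable lebesgue" for u v
  proof -
    have m: "(\<lambda>x. k x (u x) * v x) \<in> borel_measurable lebesgue" by (rule borel_measurable_times[OF T.k_comp[OF u(1)] v])
    have ae: "AE x in lebesgue. k x (u x) * v x = indicator \<Omega> x *\<^sub>R (f x (u x) * v x)"
      using u(2) AE0
    proof eventually_elim
      case (elim x)
      show ?case
      proof (cases "x \<in> \<Omega>")
        case True
        then have "cl x (u x) = u x" using elim by (simp add: cl_def)
        then show ?thesis using elim True by (simp add: k_def f1_def)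
      qed (simp add: k0)
    qed
    show ?thesis unfolding rhs_def set_lebesgue_integral_def
      by (rule integral_cong_AE[OF m borel_measurable_AE[OF m ae] ae, symmetric])
  qed
  have E_W: "v \<in> W s G" if "v \<in> E s G \<Omega>" for v using that by (simp add: E_def)
  have Ep_W: "v \<in> W s G" if "v \<in> E_plus s G \<Omega>" for v using that by (simp add: E_plus_def E_def)
  \<comment> \<open>Outside \<open>\<Omega>\<close> one has \<open>u_lo \<le> 0 \<le> u_up\<close>
    and \<open>z = 0\<close>, so the parts cut off vanish there. They are nonnegative and in
    \<open>W\<close>, and \<open>test_passage\<close> makes them admissible in the two
    inequalities.\<close>
  have J_min_clip: "T.J (\<lambda>x. max (min (z x) (u_up x)) (u_lo x)) \<le> T.J z"
    if z: "z \<in> W s G" "AE x in lebesgue. x \<notin> \<Omega> \<longrightarrow> z x = 0" for z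
  proof (rule T.J_clip[OF z(1) le k0])
    fix w assume w: "w \<in> W s G" "\<And>x. w x = max (z x - u_up x) 0"
    have "0 \<le> 1 * (frac_g_laplacian s g u_up w - (\<integral>x. k x (u_up x) * w x \<partial>lebesgue))"
    proof (rule test_passage[OF dom up T.k_comp[OF W_measurable[OF up]] kM h1 h_int])
      fix v assume v: "v \<in> E_plus s G \<Omega>"
      have "rhs \<Omega> f u_up v = (\<integral>x. k x (u_up x) * v x \<partial>lebesgue)"
        by (rule rhs_eq[OF W_measurable[OF up] _ W_measurable[OF Ep_W[OF v]]]) (use le in \<open>auto elim: eventually_mono\<close>)
      then show "0 \<le> 1 * (frac_g_laplacian s g u_up v - (\<integral>x. k x (u_up x) * v x \<partial>lebesgue))"
        using up_super[OF v] by simp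
    next
      show "AE x in lebesgue. x \<notin> \<Omega> \<longrightarrow> w x = 0" using z(2) up_out by eventually_elim (auto simp: w(2))
    qed (use w in auto)
    then show "0 \<le> frac_g_laplacian s g u_up w - (\<integral>x. k x (u_up x) * w x \<partial>lebesgue)" by simp
  next
    fix w assume w: "w \<in> W s G" "\<And>x. w x = max (u_lo x - min (z x) (u_up x)) 0"
    have "0 \<le> - 1 * (frac_g_laplacian s g u_lo w - (\<integral>x. k x (u_lo x) * w x \<partial>lebesgue))"
    proof (rule test_passage[OF dom lo T.k_comp[OF W_measurable[OF lo]] kM h1 h_int])
      fix v assume v: "v \<in> E_plus s G \<Omega>"
      have "rhs \<Omega> f u_lo v = (\<integral>x. k x (u_lo x) * v x \<partial>lebesgue)"
        by (rule rhs_eq[OF W_measurable[OF lo] _ W_measurable[OF Ep_W[OF v]]]) (use le in \<open>auto elim: eventually_mono\<close>)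
      then show "0 \<le> - 1 * (frac_g_laplacian s g u_lo v - (\<integral>x. k x (u_lo x) * v x \<partial>lebesgue))"
        using lo_sub[OF v] by simp
    next
      show "AE x in lebesgue. x \<notin> \<Omega> \<longrightarrow> w x = 0" using z(2) up_out lo_out by eventually_elim (auto simp: w(2))
    qed (use w in auto)
    then show "frac_g_laplacian s g u_lo w - (\<integral>x. k x (u_lo x) * w x \<partial>lebesgue) \<le> 0" by simp
  qed
  have clip_K: "(\<lambda>x. max (min (z x) (u_up x)) (u_lo x)) \<in> T.K"
    if z: "z \<in> W s G" "AE x in lebesgue. x \<notin> \<Omega> \<longrightarrow> z x = 0" for z
  proof -
    have "AE x in lebesgue. (x \<notin> \<Omega> \<longrightarrow> max (min (z x) (u_up x)) (u_lo x) = 0) \<and>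
       (u_lo x \<le> max (min (z x) (u_up x)) (u_lo x) \<and> max (min (z x) (u_up x)) (u_lo x) \<le> u_up x)"
      using z(2) up_out lo_out le
    proof eventually_elim
      case (elim x)
      then show ?case by (cases "x \<in> \<Omega>") auto
    qed
    then show ?thesis unfolding T.K_def W0_def
      using W_max[OF W_min[OF z(1) up] lo] by (auto elim: eventually_mono)
  qed
  \<comment> \<open>Clipping the zero function yields a competitor.\<close>
  have "T.K \<noteq> {}" using clip_K[OF W_zero] by auto
  then obtain u where uK: "u \<in> T.K" and umin: "\<And>z. z \<in> T.K \<Longrightarrow> T.J u \<le> T.J z" using T.K_minimizer by blast
  have uW: "u \<in> W s G" and uz: "AE x in lebesgue. x \<notin> \<Omega> \<longrightarrow> u x = 0" and ub: "AE x in lebesgue. u_lo x \<le> u x \<and> u x \<le> u_up x"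
    using uK by (auto simp: T.K_def W0_def)
  have J_le: "T.J u \<le> T.J z" if "z \<in> W s G" "AE x in lebesgue. x \<notin> \<Omega> \<longrightarrow> z x = 0" for z
    using umin[OF clip_K[OF that]] J_min_clip[OF that] by linarith
  have ineq: "0 \<le> frac_g_laplacian s g u v - (\<integral>x. k x (u x) * v x \<partial>lebesgue)"
    if v: "v \<in> W s G" "AE x in lebesgue. x \<notin> \<Omega> \<longrightarrow> v x = 0" for v
  proof (rule T.euler_lagrange_ineq[OF uW v(1)])
    fix e :: real assume "0 < e"
    have "AE x in lebesgue. x \<notin> \<Omega> \<longrightarrow> u x + e * v x = 0" using uz v(2) by eventually_elim auto
    then show "T.J u \<le> T.J (\<lambda>x. u x + e * v x)" by (rule J_le[OF W_add[OF uW W_cmult[OF v(1)]]])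
  qed
  have "weak_solution s G g \<Omega> f u"
    unfolding weak_solution_def
  proof (intro conjI ballI)
    show "u \<in> W0 s G \<Omega>" using uK by (simp add: T.K_def)
    fix v assume v: "v \<in> E s G \<Omega>"
    note vW = E_W[OF v] and vz = E_zero_outside[OF \<Omega>s \<Omega>f v]
    \<comment> \<open>Both \<open>v\<close> and \<open>- v\<close> are admissible in
      \<open>ineq\<close>, which turns the inequality into the equation.\<close>
    have mz: "AE x in lebesgue. x \<notin> \<Omega> \<longrightarrow> - v x = 0" using vz by eventually_elim simp
    have "rhs \<Omega> f u v = (\<integral>x. k x (u x) * v x \<partial>lebesgue)"
      by (rule rhs_eq[OF W_measurable[OF uW] _ W_measurable[OF vW]]) (use ub in \<open>auto elim: eventually_mono\<close>)
    moreover have "0 \<le> - frac_g_laplacian s g u v + (\<integral>x. k x (u x) * v x \<partial>lebesgue)"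
      using ineq[OF W_minus[OF vW] mz] by (simp add: flap_minus)
    ultimately show "frac_g_laplacian s g u v = rhs \<Omega> f u v" using ineq[OF vW vz] by linarith
  qed
  then show ?thesis using ub unfolding solution_set_def by blast
qed

end
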